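(* Let $X$ be a compact connected Riemann surface, $D\subset X$ a finite subset, $f:Y\to X$ a nonconstant holomorphic map from a compact connected Riemann surface $Y$, and $B=f^{-1}(D)_{\rm red}\subset Y$. Let $(E_*,\theta)$ be a parabolic Higgs bundle and $(E'_*,\nabla)$ a parabolic connection on $(X,D)$ induced by the same tame harmonic bundle $(\mathcal E,\mathcal D_\theta,\mathcal D_\nabla,K)$ on $(X,D)$. Then the pullback $(f^*\mathcal E,f^*\mathcal D_\theta,f^*\mathcal D_\nabla,f^*K)$ is a tame harmonic bundle on $(Y,B)$ giving a correspondence between the pullbacks $f^*(E_*,\theta)$ and $f^*(E'_*,\nabla)$; that is, the parabolic Higgs bundle and the parabolic connection on $(Y,B)$ induced by it are $f^*(E_*,\theta)$ and $f^*(E'_*,\nabla)$, respectively.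
   Context: **Parabolic bundles.** Let $X$ be a compact connected Riemann surface and $D=\{x_1,\dots,x_\ell\}\subset X$ a finite subset (also viewed as a reduced divisor). A parabolic vector bundle $E_*=(E,\{E_i^j\},\{\alpha_i^j\})$ on $(X,D)$ is a holomorphic vector bundle $E$ with, for each $i$, a filtration $E_{x_i}=E_i^1\supsetneq\cdots\supsetneq E_i^{n_i}\supsetneq E_i^{n_i+1}=0$ of the fiber and real weights $0\le\alpha_i^1<\cdots<\alpha_i^{n_i}<1$ ($\alpha_i^j$ is the weight of $E_i^j$). The direct sum $V_*\oplus W_*$ has underlying bundle $V\oplus W$, weights at a point the union of the weights, and its subspace of weight $\lambda$ is $V^{\ge\lambda}\oplus W^{\ge\lambda}$, where $V^{\ge\lambda}$ is the largest member of the filtration of weight $\ge\lambda$ (zero if none). A Higgs field on $E_*$ is an $\mathcal O_X$-linear $\theta:E\to E\otimes K_X(D)$ ($K_X(D)=K_X\otimes\mathcal O_X(D)$) whose value at each $x_i$ preserves every $E_i^j$; $(E_*,\theta)$ is a parabolic Higgs bundle. A parabolic connection is a pair $(E_*,\nabla)$ with $\nabla:E\to E\otimes K_X(D)$ a logarithmic connection whose residue at each $x_i$ preserves every $E_i^j$. **Pullback.** Let $f:Y\to X$ be a nonconstant holomorphic map of compact connected Riemann surfaces and $B=f^{-1}(D)_{\rm red}$. For $y\in Y$ let $m_y\ge1$ be the multiplicity of $f$ at $y$. If $E_*$ is a parabolic line bundle with weight $\alpha_i$ at $x_i$, then $f^*E_*$ is the parabolic line bundle on $(Y,B)$ with underlying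 line bundle $f^*E\otimes\mathcal O_Y\big(\sum_i\sum_{y\in f^{-1}(x_i)}\lfloor m_y\alpha_i\rfloor y\big)$ and weight $m_y\alpha_i-\lfloor m_y\alpha_i\rfloor$ at $y\in f^{-1}(x_i)$ (same definition over open subsets). In general, cover $X$ by open sets $U_j$ on which $E_*$ is a direct sum of parabolic line bundles, take the direct sum of their pullbacks over $f^{-1}(U_j)$, and glue using the identity of $f^*E$ over overlaps; $f^*E_*$ is a parabolic bundle on $(Y,B)$ whose underlying bundle restricts to $f^*E$ on $Y\setminus B$. The pullback $f^*(E_*,\theta)$ (resp. $f^*(E_*,\nabla)$) is $f^*E_*$ with the unique extension to it (as Higgs field, resp. parabolic connection, with poles along $B$) of $(f^*\theta)|_{Y\setminus B}$ (resp. $(f^*\nabla)|_{Y\setminus B}$). **Tame harmonic bundles.** A harmonic bundle on $U=X\setminus D$ is a quadruple $(\mathcal E,\mathcal D_\theta,\mathcal D_\nabla,K)$: a $\mathcal C^\infty$ complex vector bundle $\mathcal E$ on $U$, differential operators $\mathcal D_\theta,\mathcal D_\nabla$ from $\mathcal E$ to $\mathcal E$-valued $\mathcal C^\infty$ 1-forms, and a Hermitian metric $K$ on $\mathcal E$ such that: (1) $\mathcal D_\theta=\overline\partial_\theta+\theta$ with $\overline\partial_\theta$ (type $(0,1)$) a holomorphic structure and $\theta$ (type $(1,0)$) a holomorphic Higgs field on $(\mathcal E,\overline\partial_\theta)$; (2) $\mathcal D_\nabla=\overline\partial_\nabla+\nabla$ with $\overline\partial_\nabla$ (type $(0,1)$)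 a holomorphic structure and $\nabla$ (type $(1,0)$) a holomorphic connection on $(\mathcal E,\overline\partial_\nabla)$; (3) $\overline\partial_\nabla=\overline\partial_\theta+\overline\theta$ and $\nabla=\partial_\theta+\theta$, where $(\partial_\theta u,v)_K+(u,\overline\partial_\theta v)_K=\partial(u,v)_K$ and $(u,\theta v)_K=(\overline\theta u,v)_K$; (4) $\mathcal D_\theta^2=\mathcal D_\nabla^2=0$. It is tame (a tame harmonic bundle on $(X,D)$) if the singularities of $\theta$ at points of $D$ are at most logarithmic, i.e. the coefficients of the characteristic polynomial of $\theta$ extend to holomorphic sections of the powers $K_X(D)^{\otimes i}$. The pullback by $f$ of a harmonic bundle on $X\setminus D$ is the usual pullback of bundle, operators and metric along $f|_{Y\setminus B}:Y\setminus B\to X\setminus D$. **Induced parabolic objects.** Given a tame harmonic bundle, for $\star\in\{\theta,\nabla\}$, $x_i\in D$ and $\alpha\in\mathbb R$ let $E_{\star,i}^\alpha$ be the sheaf that agrees with $(\mathcal E,\overline\partial_\star)$ away from $x_i$ and whose stalk at $x_i$ consists of the holomorphic sections $e$ of $(\mathcal E,\overline\partial_\star)$ on punctured neighborhoods of $x_i$ with $|e|_K\le Cr^{\alpha-\varepsilon}$ for every $\varepsilon>0$ ($C$ may depend on $\varepsilon$; $r$ the radial distance from $x_i$). By Simpson these are locally free and form a decreasing left-continuous filtration with $E_{\star,i}^{\alpha+1}=E_{\star,i}^\alpha(-x_i)$. Let $E_\star$ be obtained by gluing the $E_{\star,i}^0$ over all $i$; its parabolic structure at $x_i$ has as weights those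 $\alpha\in[0,1)$ with $E_{\star,i}^{\alpha}\ne E_{\star,i}^{\alpha+\varepsilon}$ for all $\varepsilon>0$, the subspace of weight $\alpha$ being the image of $E_{\star,i}^\alpha$ in the fiber $(E_\star)_{x_i}$. Then $\theta$ extends to a Higgs field on the parabolic bundle $E_{\theta,*}$ and $\nabla$ to a parabolic connection on $E_{\nabla,*}$; these are the parabolic Higgs bundle and parabolic connection induced by the tame harmonic bundle. *)

theory Defs
  imports
    "HOL-Complex_Analysis.Complex_Analysis"
    "HOL-Computational_Algebra.Polynomial"
begin

section \<open>Riemann surfaces\<close>

text \<open>The points of a Riemann surface are the elements of a Hausdorff type; its complex structure
  is a holomorphic atlas (not assumed maximal) of charts \<open>(U, z)\<close>, where \<open>z\<close> is only meaningful
  on \<open>U\<close>.\<close>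

type_synonym 'x chart = "'x set \<times> ('x \<Rightarrow> complex)"

definition chart_inv :: "'x chart \<Rightarrow> complex \<Rightarrow> 'x" where
  "chart_inv c = inv_into (fst c) (snd c)"

definition riemann_surface :: "('x::t2_space) chart set \<Rightarrow> bool" where
  "riemann_surface X \<longleftrightarrow>
     (\<Union>c\<in>X. fst c) = UNIV \<and>
     (\<forall>c\<in>X. open (fst c) \<and> open (snd c ` fst c) \<and>
        homeomorphism (fst c) (snd c ` fst c) (snd c) (chart_inv c)) \<and>
     (\<forall>c\<in>X. \<forall>c'\<in>X. (snd c' \<circ> chart_inv c) holomorphic_on snd c ` (fst c \<inter> fst c'))"

definition compact_connected_riemann_surface :: "('x::t2_space) chart set \<Rightarrow> bool" where
  "compact_connected_riemann_surface X \<longleftrightarrow>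
     riemann_surface X \<and> compact (UNIV :: 'x set) \<and> connected (UNIV :: 'x set)"

definition holomorphic_map ::
  "('y::t2_space) chart set \<Rightarrow> ('x::t2_space) chart set \<Rightarrow> ('y \<Rightarrow> 'x) \<Rightarrow> bool" where
  "holomorphic_map Y X f \<longleftrightarrow>
     continuous_on UNIV f \<and>
     (\<forall>d\<in>Y. \<forall>c\<in>X. (snd c \<circ> f \<circ> chart_inv d) holomorphic_on snd d ` (fst d \<inter> f -` fst c))"

definition multiplicity_at ::
  "('y::t2_space) chart set \<Rightarrow> ('x::t2_space) chart set \<Rightarrow> ('y \<Rightarrow> 'x) \<Rightarrow> 'y \<Rightarrow> nat" where
  "multiplicity_at Y X f y =
     (THE m. \<forall>d\<in>Y. \<forall>c\<in>X. y \<in> fst d \<longrightarrow> f y \<in> fst c \<longrightarrow>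
        zorder (\<lambda>w. snd c (f (chart_inv d w)) - snd c (f y)) (snd d y) = int m)"


section \<open>Functions and their derivatives\<close>

primrec Ck_on :: "nat \<Rightarrow> (complex \<Rightarrow> complex) \<Rightarrow> complex set \<Rightarrow> bool" where
  "Ck_on 0 g S \<longleftrightarrow> continuous_on S g"
| "Ck_on (Suc k) g S \<longleftrightarrow>
     (\<forall>z\<in>S. g differentiable (at z)) \<and> (\<forall>v. Ck_on k (\<lambda>z. frechet_derivative g (at z) v) S)"

definition holomorphic_fun :: "('x::t2_space) chart set \<Rightarrow> 'x set \<Rightarrow> ('x \<Rightarrow> complex) \<Rightarrow> bool" where
  "holomorphic_fun X V g \<longleftrightarrow>
     open V \<and> (\<forall>c\<in>X. (g \<circ> chart_inv c) holomorphic_on snd c ` (fst c \<inter> V))"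

definition smooth_fun :: "('x::t2_space) chart set \<Rightarrow> 'x set \<Rightarrow> ('x \<Rightarrow> complex) \<Rightarrow> bool" where
  "smooth_fun X V g \<longleftrightarrow>
     open V \<and> (\<forall>c\<in>X. \<forall>k. Ck_on k (g \<circ> chart_inv c) (snd c ` (fst c \<inter> V)))"

text \<open>The coefficients of \<open>\<partial>g = g\<^sub>z dz\<close> and of the antiholomorphic part \<open>g\<^sub>\<bar>z d\<bar>z\<close>
  of \<open>dg\<close> in a chart.\<close>

definition d_z :: "'x chart \<Rightarrow> ('x \<Rightarrow> complex) \<Rightarrow> 'x \<Rightarrow> complex" where
  "d_z c g p = (let L = frechet_derivative (g \<circ> chart_inv c) (at (snd c p))
     in (L 1 - \<i> * L \<i>) / 2)"

definition d_zbar :: "'x chart \<Rightarrow> ('x \<Rightarrow> complex) \<Rightarrow> 'x \<Rightarrow> complex" where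
  "d_zbar c g p = (let L = frechet_derivative (g \<circ> chart_inv c) (at (snd c p))
     in (L 1 + \<i> * L \<i>) / 2)"

definition chart_jacobian :: "'y chart \<Rightarrow> 'x chart \<Rightarrow> ('y \<Rightarrow> 'x) \<Rightarrow> 'y \<Rightarrow> complex" where
  "chart_jacobian d c f q = deriv (snd c \<circ> f \<circ> chart_inv d) (snd d q)"


section \<open>Vector bundles\<close>

text \<open>A rank \<open>n\<close> bundle over an open subset \<open>W\<close> of a surface: every fibre is a copy of the vector
  space \<open>\<complex>\<^sup>n\<close>, and the bundle structure is carried by local trivialisations \<open>(U, T)\<close>, where \<open>T p\<close>
  is the linear isomorphism from the fibre at \<open>p \<in> U\<close> to the standard \<open>\<complex>\<^sup>n\<close>. Identifying each fibre
  with \<open>\<complex>\<^sup>n\<close> is a pointwise choice without any continuity in \<open>p\<close>; so this is an arbitrary, in general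
  nontrivial, bundle. The predicate \<open>R\<close> is the regularity (holomorphic or \<open>C\<^sup>\<infinity>\<close>) of functions.
  Sections are total functions, considered only on an open set.\<close>

type_synonym ('x, 'n) trivialisations = "('x set \<times> ('x \<Rightarrow> complex^'n^'n)) set"
type_synonym ('x, 'n) sect = "'x \<Rightarrow> complex^'n"

definition vector_bundle ::
  "('x set \<Rightarrow> ('x \<Rightarrow> complex) \<Rightarrow> bool) \<Rightarrow> ('x::t2_space) set \<Rightarrow> ('x, 'n::finite) trivialisations \<Rightarrow> bool"
where
  "vector_bundle R W E \<longleftrightarrow>
     (\<Union>\<tau>\<in>E. fst \<tau>) = W \<and>
     (\<forall>\<tau>\<in>E. open (fst \<tau>) \<and> (\<forall>p\<in>fst \<tau>. invertible (snd \<tau> p))) \<and>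
     (\<forall>\<tau>\<in>E. \<forall>\<tau>'\<in>E. \<forall>i j.
        R (fst \<tau> \<inter> fst \<tau>') (\<lambda>p. (snd \<tau>' p ** matrix_inv (snd \<tau> p)) $ i $ j))"

definition regular_section ::
  "('x set \<Rightarrow> ('x \<Rightarrow> complex) \<Rightarrow> bool) \<Rightarrow> ('x, 'n::finite) trivialisations
     \<Rightarrow> ('x::t2_space) set \<Rightarrow> ('x, 'n) sect \<Rightarrow> bool" where
  "regular_section R E V s \<longleftrightarrow>
     open V \<and> V \<subseteq> (\<Union>\<tau>\<in>E. fst \<tau>) \<and>
     (\<forall>\<tau>\<in>E. \<forall>i. R (fst \<tau> \<inter> V) (\<lambda>p. (snd \<tau> p *v s p) $ i))"

abbreviation "hol_section X \<equiv> regular_section (holomorphic_fun X)"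
abbreviation "smooth_section X \<equiv> regular_section (smooth_fun X)"

definition hol_frame ::
  "('x::t2_space) chart set \<Rightarrow> ('x, 'n::finite) trivialisations \<Rightarrow> 'x set \<Rightarrow> ('n \<Rightarrow> ('x, 'n) sect) \<Rightarrow> bool"
where
  "hol_frame X E V e \<longleftrightarrow>
     (\<forall>j. hol_section X E V (e j)) \<and>
     (\<forall>p\<in>V. bij (\<lambda>a :: complex^'n. \<Sum>j\<in>UNIV. (a $ j) *s e j p))"

definition pullback_bundle :: "('y \<Rightarrow> 'x) \<Rightarrow> ('x, 'n) trivialisations \<Rightarrow> ('y, 'n) trivialisations" where
  "pullback_bundle f E = (\<lambda>\<tau>. (f -` fst \<tau>, snd \<tau> \<circ> f)) ` E"


section \<open>Parabolic bundles\<close>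

text \<open>The parabolic structure at \<open>x\<close> is the list
  \<open>[(\<alpha>\<^sup>1, E\<^sup>1), \<dots>, (\<alpha>\<^sup>n, E\<^sup>n)]\<close> of the weights and subspaces; the final term \<open>E\<^sup>n\<^sup>+\<^sup>1 = 0\<close> is omitted.
  Only the values of \<open>flag\<close> at the points of the divisor matter.\<close>

record ('x, 'n) parabolic =
  triv :: "('x, 'n) trivialisations"
  flag :: "'x \<Rightarrow> (real \<times> (complex^'n) set) list"

definition parabolic_bundle ::
  "('x::t2_space) chart set \<Rightarrow> 'x set \<Rightarrow> ('x, 'n::finite) parabolic \<Rightarrow> bool" where
  "parabolic_bundle X D E \<longleftrightarrow>
     vector_bundle (holomorphic_fun X) UNIV (triv E) \<and>
     (\<forall>x\<in>D. flag E x \<noteq> [] \<and> snd (hd (flag E x)) = UNIV \<and>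
        sorted_wrt (\<lambda>(\<alpha>, F) (\<beta>, G). \<alpha> < \<beta> \<and> G \<subset> F) (flag E x) \<and>
        (\<forall>(\<alpha>, F) \<in> set (flag E x). 0 \<le> \<alpha> \<and> \<alpha> < 1 \<and> vec.subspace F \<and> F \<noteq> {0}))"

text \<open>\<open>V\<^sup>\<ge>\<^sup>\<lambda>\<close>: the subspaces form a chain, so the union is the largest one.\<close>

definition weight_ge :: "(real \<times> (complex^'n) set) list \<Rightarrow> real \<Rightarrow> (complex^'n) set" where
  "weight_ge L l = {0} \<union> \<Union>{F. \<exists>\<alpha>\<ge>l. (\<alpha>, F) \<in> set L}"

text \<open>Near \<open>x\<close>, the frame \<open>e\<close> displays the parabolic bundle as the direct sum of the parabolic line
  bundles generated by \<open>e j\<close>, of weight \<open>a j\<close> at \<open>x\<close>.\<close>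

definition parabolic_splitting ::
  "('x::t2_space) chart set \<Rightarrow> 'x set \<Rightarrow> ('x, 'n::finite) parabolic \<Rightarrow> 'x
     \<Rightarrow> 'x set \<Rightarrow> ('n \<Rightarrow> ('x, 'n) sect) \<Rightarrow> ('n \<Rightarrow> real) \<Rightarrow> bool" where
  "parabolic_splitting X D E x V e a \<longleftrightarrow>
     V \<inter> D = {x} \<and> hol_frame X (triv E) V e \<and>
     fst ` set (flag E x) = range a \<and>
     (\<forall>l. weight_ge (flag E x) l = vec.span {e j x | j. a j \<ge> l})"


section \<open>Parabolic Higgs fields and parabolic connections\<close>

text \<open>A section of \<open>E \<otimes> K\<^sub>X(D)\<close> is given by its coefficient \<open>\<omega> c p\<close> in every chart \<open>c = (U, z)\<close>
  at every \<open>p \<in> U\<close>: the coefficient of \<open>dz\<close> if \<open>p \<notin> D\<close>, and that of the generator \<open>dz / (z - z(p))\<close>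
  if \<open>p \<in> D\<close>. In particular the value at a point of \<open>D\<close> is the residue.\<close>

definition log_form ::
  "('x::t2_space) chart set \<Rightarrow> 'x set \<Rightarrow> ('x, 'n::finite) trivialisations \<Rightarrow> 'x set
     \<Rightarrow> ('x chart \<Rightarrow> ('x, 'n) sect) \<Rightarrow> bool" where
  "log_form X D E V \<omega> \<longleftrightarrow>
     open V \<and>
     (\<forall>c\<in>X. \<forall>c'\<in>X. \<forall>p \<in> V \<inter> fst c \<inter> fst c'.
        \<omega> c p = (if p \<in> D then 1 else chart_jacobian c c' id p) *s \<omega> c' p) \<and>
     (\<forall>c\<in>X. hol_section X E (V \<inter> fst c - D) (\<omega> c)) \<and>
     (\<forall>c\<in>X. \<forall>x \<in> V \<inter> fst c \<inter> D. \<exists>N. x \<in> N \<and> N \<subseteq> V \<inter> fst c \<and> N \<inter> D = {x} \<and>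
        hol_section X E N (\<lambda>p. if p = x then \<omega> c x else (snd c p - snd c x) *s \<omega> c p))"

text \<open>A Higgs field is a bundle map \<open>E \<rightarrow> E \<otimes> K\<^sub>X(D)\<close>, with coefficients as for sections.\<close>

type_synonym ('x, 'n) higgs = "'x chart \<Rightarrow> 'x \<Rightarrow> complex^'n^'n"

definition parabolic_higgs_bundle ::
  "('x::t2_space) chart set \<Rightarrow> 'x set \<Rightarrow> ('x, 'n::finite) parabolic \<Rightarrow> ('x, 'n) higgs \<Rightarrow> bool" where
  "parabolic_higgs_bundle X D E \<theta> \<longleftrightarrow>
     parabolic_bundle X D E \<and>
     (\<forall>V s. hol_section X (triv E) V s \<longrightarrow> log_form X D (triv E) V (\<lambda>c p. \<theta> c p *v s p)) \<and>
     (\<forall>c\<in>X. \<forall>x \<in> D \<inter> fst c. \<forall>(\<alpha>, F) \<in> set (flag E x). \<forall>v\<in>F. \<theta> c x *v v \<in> F)"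

text \<open>A connection is an operator on local sections. Since sections are total functions, being
  a morphism of sheaves means that the value at \<open>p\<close> depends only on the germ at \<open>p\<close>.
  In the Leibniz rule, \<open>dg\<close> as a section of \<open>K\<^sub>X(D)\<close> vanishes at the points of \<open>D\<close>.\<close>

type_synonym ('x, 'n) connection = "('x, 'n) sect \<Rightarrow> 'x chart \<Rightarrow> ('x, 'n) sect"

definition log_connection ::
  "('x::t2_space) chart set \<Rightarrow> 'x set \<Rightarrow> ('x, 'n::finite) trivialisations \<Rightarrow> ('x, 'n) connection \<Rightarrow> bool"
where
  "log_connection X D E nabla \<longleftrightarrow>
     (\<forall>V s. hol_section X E V s \<longrightarrow> log_form X D E V (nabla s)) \<and>
     (\<forall>V s t. hol_section X E V s \<longrightarrow> hol_section X E V t \<longrightarrow> (\<forall>p\<in>V. s p = t p) \<longrightarrow>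
        (\<forall>c\<in>X. \<forall>p \<in> V \<inter> fst c. nabla s c p = nabla t c p)) \<and>
     (\<forall>V s t. hol_section X E V s \<longrightarrow> hol_section X E V t \<longrightarrow>
        (\<forall>c\<in>X. \<forall>p \<in> V \<inter> fst c. nabla (\<lambda>q. s q + t q) c p = nabla s c p + nabla t c p)) \<and>
     (\<forall>V g s. holomorphic_fun X V g \<longrightarrow> hol_section X E V s \<longrightarrow>
        (\<forall>c\<in>X. \<forall>p \<in> V \<inter> fst c.
           nabla (\<lambda>q. g q *s s q) c p =
             g p *s nabla s c p + (if p \<in> D then 0 else d_z c g p) *s s p))"

definition parabolic_connection ::
  "('x::t2_space) chart set \<Rightarrow> 'x set \<Rightarrow> ('x, 'n::finite) parabolic \<Rightarrow> ('x, 'n) connection \<Rightarrow> bool" where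
  "parabolic_connection X D E nabla \<longleftrightarrow>
     parabolic_bundle X D E \<and> log_connection X D (triv E) nabla \<and>
     (\<forall>V s. hol_section X (triv E) V s \<longrightarrow>
        (\<forall>c\<in>X. \<forall>x \<in> V \<inter> fst c \<inter> D. \<forall>(\<alpha>, F) \<in> set (flag E x). s x \<in> F \<longrightarrow> nabla s c x \<in> F))"


section \<open>Pullbacks of parabolic objects\<close>

text \<open>As the pullback is obtained by gluing, it is described as a relation; it is determined up to
  the unique isomorphism that is the identity over the complement of \<open>B = f\<^sup>-\<^sup>1(D)\<close>. If \<open>e j\<close>
  generates a parabolic line bundle of weight \<open>a j\<close> at \<open>f y\<close>, then, with \<open>k = \<lfloor>m\<^sub>y a\<^sub>j\<rfloor>\<close> and a local
  coordinate \<open>w\<close> centred at \<open>y\<close>, its pullback tensored by \<open>\<O>\<^sub>Y(k y)\<close> is generated by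
  \<open>w\<^sup>-\<^sup>k f\<^sup>*e\<^sub>j\<close>.\<close>

definition is_pullback_parabolic ::
  "('y::t2_space) chart set \<Rightarrow> ('x::t2_space) chart set \<Rightarrow> 'x set \<Rightarrow> ('y \<Rightarrow> 'x)
     \<Rightarrow> ('x, 'n::finite) parabolic \<Rightarrow> ('y, 'n) parabolic \<Rightarrow> bool" where
  "is_pullback_parabolic Y X D f E F \<longleftrightarrow>
     parabolic_bundle Y (f -` D) F \<and>
     (\<forall>V s. V \<inter> f -` D = {} \<longrightarrow>
        hol_section Y (triv F) V s = hol_section Y (pullback_bundle f (triv E)) V s) \<and>
     (\<forall>y \<in> f -` D. \<exists>U e a V b. \<exists>d\<in>Y.
        parabolic_splitting X D E (f y) U e a \<and>
        y \<in> V \<and> V \<subseteq> f -` U \<inter> fst d \<and>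
        parabolic_splitting Y (f -` D) F y V b (\<lambda>j. frac (real (multiplicity_at Y X f y) * a j)) \<and>
        (\<forall>j. \<forall>q \<in> V - {y}.
           b j q = (snd d q - snd d y) powi (- \<lfloor>real (multiplicity_at Y X f y) * a j\<rfloor>) *s e j (f q)))"

definition is_pullback_higgs ::
  "('y::t2_space) chart set \<Rightarrow> ('x::t2_space) chart set \<Rightarrow> 'x set \<Rightarrow> ('y \<Rightarrow> 'x)
     \<Rightarrow> ('x, 'n::finite) parabolic \<Rightarrow> ('x, 'n) higgs
     \<Rightarrow> ('y, 'n) parabolic \<Rightarrow> ('y, 'n) higgs \<Rightarrow> bool" where
  "is_pullback_higgs Y X D f E \<theta> F \<phi> \<longleftrightarrow>
     is_pullback_parabolic Y X D f E F \<and> parabolic_higgs_bundle Y (f -` D) F \<phi> \<and>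
     (\<forall>d\<in>Y. \<forall>c\<in>X. \<forall>q \<in> fst d \<inter> f -` fst c - f -` D. \<forall>v.
        \<phi> d q *v v = chart_jacobian d c f q *s (\<theta> c (f q) *v v))"

text \<open>Away from \<open>B\<close>, the pullback connection is the one with \<open>f\<^sup>*\<nabla> (f\<^sup>*s) = f\<^sup>*(\<nabla>s)\<close>.\<close>

definition is_pullback_connection ::
  "('y::t2_space) chart set \<Rightarrow> ('x::t2_space) chart set \<Rightarrow> 'x set \<Rightarrow> ('y \<Rightarrow> 'x)
     \<Rightarrow> ('x, 'n::finite) parabolic \<Rightarrow> ('x, 'n) connection
     \<Rightarrow> ('y, 'n) parabolic \<Rightarrow> ('y, 'n) connection \<Rightarrow> bool" where
  "is_pullback_connection Y X D f E nabla F nabla' \<longleftrightarrow>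
     is_pullback_parabolic Y X D f E F \<and> parabolic_connection Y (f -` D) F nabla' \<and>
     (\<forall>V s. V \<inter> D = {} \<longrightarrow> hol_section X (triv E) V s \<longrightarrow>
        (\<forall>d\<in>Y. \<forall>c\<in>X. \<forall>q \<in> fst d \<inter> f -` (V \<inter> fst c).
           nabla' (\<lambda>q. s (f q)) d q = chart_jacobian d c f q *s nabla s c (f q)))"


section \<open>Harmonic bundles\<close>

text \<open>The value of a 1-form \<open>\<omega>\<close> in a chart is the pair of its coefficients of \<open>dz\<close> and \<open>d\<bar>z\<close>.\<close>

type_synonym ('x, 'n) form1 = "'x chart \<Rightarrow> 'x \<Rightarrow> (complex^'n) \<times> (complex^'n)"
type_synonym ('x, 'n) diffop = "('x, 'n) sect \<Rightarrow> ('x, 'n) form1"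
type_synonym 'x derivation = "'x chart \<Rightarrow> ('x \<Rightarrow> complex) \<Rightarrow> 'x \<Rightarrow> complex \<times> complex"

definition derivation_dbar :: "'x derivation" where
  "derivation_dbar c g p = (0, d_zbar c g p)"

definition derivation_d :: "'x derivation" where
  "derivation_d c g p = (d_z c g p, d_zbar c g p)"

text \<open>Operators from \<open>\<E>\<close> to \<open>\<E>\<close>-valued \<open>C\<^sup>\<infinity>\<close> 1-forms with Leibniz rule
  \<open>A (g s) = g A s + \<sigma> g \<otimes> s\<close>. For \<open>\<sigma> = derivation_dbar\<close> this says that the \<open>(1,0)\<close> part is
  linear over functions (an endomorphism-valued form) and that the \<open>(0,1)\<close> part is a
  holomorphic structure (integrability is automatic in complex dimension one). For
  \<open>\<sigma> = derivation_d\<close> the \<open>(1,0)\<close> part is instead a \<open>(1,0)\<close>-connection.\<close>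

definition diff_operator ::
  "'x derivation \<Rightarrow> ('x::t2_space) chart set \<Rightarrow> ('x, 'n::finite) trivialisations \<Rightarrow> ('x, 'n) diffop \<Rightarrow> bool"
where
  "diff_operator \<sigma> X E A \<longleftrightarrow>
     (\<forall>V s. smooth_section X E V s \<longrightarrow>
        (\<forall>c\<in>X. smooth_section X E (V \<inter> fst c) (\<lambda>p. fst (A s c p)) \<and>
                smooth_section X E (V \<inter> fst c) (\<lambda>p. snd (A s c p))) \<and>
        (\<forall>c\<in>X. \<forall>c'\<in>X. \<forall>p \<in> V \<inter> fst c \<inter> fst c'.
           A s c p = (chart_jacobian c c' id p *s fst (A s c' p),
                      cnj (chart_jacobian c c' id p) *s snd (A s c' p)))) \<and>
     (\<forall>V s t. smooth_section X E V s \<longrightarrow> smooth_section X E V t \<longrightarrow> (\<forall>p\<in>V. s p = t p) \<longrightarrow>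
        (\<forall>c\<in>X. \<forall>p \<in> V \<inter> fst c. A s c p = A t c p)) \<and>
     (\<forall>V s t. smooth_section X E V s \<longrightarrow> smooth_section X E V t \<longrightarrow>
        (\<forall>c\<in>X. \<forall>p \<in> V \<inter> fst c. A (\<lambda>q. s q + t q) c p = A s c p + A t c p)) \<and>
     (\<forall>V g s. smooth_fun X V g \<longrightarrow> smooth_section X E V s \<longrightarrow>
        (\<forall>c\<in>X. \<forall>p \<in> V \<inter> fst c.
           A (\<lambda>q. g q *s s q) c p =
             (g p *s fst (A s c p) + fst (\<sigma> c g p) *s s p,
              g p *s snd (A s c p) + snd (\<sigma> c g p) *s s p)))"

text \<open>Sections that are holomorphic for the \<open>(0,1)\<close> part of \<open>A\<close>.\<close>

definition dbar_hol ::
  "('x::t2_space) chart set \<Rightarrow> ('x, 'n::finite) trivialisations \<Rightarrow> ('x, 'n) diffop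
     \<Rightarrow> 'x set \<Rightarrow> ('x, 'n) sect \<Rightarrow> bool" where
  "dbar_hol X E A V s \<longleftrightarrow>
     smooth_section X E V s \<and> (\<forall>c\<in>X. \<forall>p \<in> V \<inter> fst c. snd (A s c p) = 0)"

text \<open>The coefficient of \<open>dz \<and> d\<bar>z\<close> in \<open>A\<^sup>2 s\<close>, where \<open>A\<close> is extended to 1-forms by
  \<open>A (u dz + v d\<bar>z) = A u \<and> dz + A v \<and> d\<bar>z\<close>.\<close>

definition curvature :: "('x, 'n) diffop \<Rightarrow> ('x, 'n::finite) sect \<Rightarrow> 'x chart \<Rightarrow> ('x, 'n) sect" where
  "curvature A s c p =
     fst (A (\<lambda>q. snd (A s c q)) c p) - snd (A (\<lambda>q. fst (A s c q)) c p)"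

definition hermitian_metric ::
  "('x::t2_space) chart set \<Rightarrow> ('x, 'n::finite) trivialisations
     \<Rightarrow> ('x \<Rightarrow> complex^'n \<Rightarrow> complex^'n \<Rightarrow> complex) \<Rightarrow> bool" where
  "hermitian_metric X E K \<longleftrightarrow>
     (\<forall>p \<in> (\<Union>\<tau>\<in>E. fst \<tau>).
        (\<forall>u v w. K p (u + v) w = K p u w + K p v w) \<and>
        (\<forall>a u v. K p (a *s u) v = a * K p u v) \<and>
        (\<forall>u v. K p v u = cnj (K p u v)) \<and>
        (\<forall>u. u \<noteq> 0 \<longrightarrow> Re (K p u u) > 0)) \<and>
     (\<forall>V u v. smooth_section X E V u \<longrightarrow> smooth_section X E V v \<longrightarrow>
        smooth_fun X V (\<lambda>p. K p (u p) (v p)))"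

record ('x, 'n) harmonic =
  vbundle :: "('x, 'n) trivialisations"
  D_theta :: "('x, 'n) diffop"
  D_nabla :: "('x, 'n) diffop"
  metric :: "'x \<Rightarrow> complex^'n \<Rightarrow> complex^'n \<Rightarrow> complex"

text \<open>The operators \<open>P\<close> and \<open>Q\<close> below are \<open>\<partial>\<^sub>\<theta>\<close> (coefficient of \<open>dz\<close>) and the adjoint of \<open>\<theta>\<close>
  (coefficient of \<open>d\<bar>z\<close>). As the metric is conjugate linear in its second argument,
  \<open>(u, v d\<bar>z)\<^sub>K = (u, v)\<^sub>K dz\<close>.\<close>

definition harmonic_bundle ::
  "('x::t2_space) chart set \<Rightarrow> 'x set \<Rightarrow> ('x, 'n::finite) harmonic \<Rightarrow> bool" where
  "harmonic_bundle X W H \<longleftrightarrow>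
     vector_bundle (smooth_fun X) W (vbundle H) \<and>
     hermitian_metric X (vbundle H) (metric H) \<and>
     diff_operator derivation_dbar X (vbundle H) (D_theta H) \<and>
     (\<forall>V s. dbar_hol X (vbundle H) (D_theta H) V s \<longrightarrow>
        (\<forall>c\<in>X. dbar_hol X (vbundle H) (D_theta H) (V \<inter> fst c) (\<lambda>p. fst (D_theta H s c p)))) \<and>
     diff_operator derivation_d X (vbundle H) (D_nabla H) \<and>
     (\<forall>V s. dbar_hol X (vbundle H) (D_nabla H) V s \<longrightarrow>
        (\<forall>c\<in>X. dbar_hol X (vbundle H) (D_nabla H) (V \<inter> fst c) (\<lambda>p. fst (D_nabla H s c p)))) \<and>
     (\<exists>P Q :: ('x, 'n) sect \<Rightarrow> 'x chart \<Rightarrow> ('x, 'n) sect.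
        \<forall>V u v. smooth_section X (vbundle H) V u \<longrightarrow> smooth_section X (vbundle H) V v \<longrightarrow>
          (\<forall>c\<in>X. \<forall>p \<in> V \<inter> fst c.
             metric H p (P u c p) (v p) + metric H p (u p) (snd (D_theta H v c p))
               = d_z c (\<lambda>q. metric H q (u q) (v q)) p \<and>
             metric H p (u p) (fst (D_theta H v c p)) = metric H p (Q u c p) (v p) \<and>
             snd (D_nabla H u c p) = snd (D_theta H u c p) + Q u c p \<and>
             fst (D_nabla H u c p) = P u c p + fst (D_theta H u c p))) \<and>
     (\<forall>V s. smooth_section X (vbundle H) V s \<longrightarrow>
        (\<forall>c\<in>X. \<forall>p \<in> V \<inter> fst c.
           curvature (D_theta H) s c p = 0 \<and> curvature (D_nabla H) s c p = 0))"

text \<open>The coefficient matrix of the Higgs field \<open>\<theta>\<close>, the \<open>(1,0)\<close> part of \<open>\<D>\<^sub>\<theta>\<close>.\<close>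

definition higgs_matrix ::
  "('x::t2_space) chart set \<Rightarrow> ('x, 'n::finite) harmonic \<Rightarrow> ('x, 'n) higgs" where
  "higgs_matrix X H c p =
     (THE M. \<forall>V s. smooth_section X (vbundle H) V s \<longrightarrow> p \<in> V \<longrightarrow> fst (D_theta H s c p) = M *v s p)"

definition charpoly_matrix :: "complex^'n^'n::finite \<Rightarrow> complex poly" where
  "charpoly_matrix A = det ((\<chi> i j. (if i = j then [:0, 1:] else 0) - [:A $ i $ j:]) :: complex poly^'n^'n)"

definition tame_harmonic_bundle ::
  "('x::t2_space) chart set \<Rightarrow> 'x set \<Rightarrow> ('x, 'n::finite) harmonic \<Rightarrow> bool" where
  "tame_harmonic_bundle X D H \<longleftrightarrow>
     harmonic_bundle X (- D) H \<and>
     (\<forall>x\<in>D. \<forall>c\<in>X. x \<in> fst c \<longrightarrow>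
        (\<forall>i\<in>{1..CARD('n)}. \<exists>N g. x \<in> N \<and> N \<subseteq> fst c \<and> N \<inter> D = {x} \<and> holomorphic_fun X N g \<and>
           (\<forall>p \<in> N - {x}. g p =
              (snd c p - snd c x) ^ i * coeff (charpoly_matrix (higgs_matrix X H c p)) (CARD('n) - i))))"

text \<open>The pullback of an operator: writing \<open>t = \<Sum>\<^sub>j u\<^sub>j f\<^sup>*e\<^sub>j\<close> in the pullback of a local frame,
  \<open>f\<^sup>*A (t) = \<Sum>\<^sub>j \<sigma>(u\<^sub>j) \<otimes> f\<^sup>*e\<^sub>j + u\<^sub>j f\<^sup>*(A e\<^sub>j)\<close>. The Leibniz rule makes this independent of
  the frame and of the chart.\<close>

definition pullback_op ::
  "'y derivation \<Rightarrow> ('x::t2_space) chart set \<Rightarrow> ('y::t2_space \<Rightarrow> 'x)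
     \<Rightarrow> ('x, 'n::finite) trivialisations \<Rightarrow> ('x, 'n) diffop \<Rightarrow> ('y, 'n) diffop" where
  "pullback_op \<sigma> X f E A t d q =
     (let c = (SOME c. c \<in> X \<and> f q \<in> fst c);
          T = snd (SOME \<tau>. \<tau> \<in> E \<and> f q \<in> fst \<tau>);
          e = (\<lambda>j p. matrix_inv (T p) *v axis j 1);
          u = (\<lambda>j q'. (T (f q') *v t q') $ j);
          J = chart_jacobian d c f q
      in (\<Sum>j\<in>UNIV. fst (\<sigma> d (u j) q) *s e j (f q) + (u j q * J) *s fst (A (e j) c (f q)),
          \<Sum>j\<in>UNIV. snd (\<sigma> d (u j) q) *s e j (f q) + (u j q * cnj J) *s snd (A (e j) c (f q))))"

definition pullback_harmonic ::
  "('x::t2_space) chart set \<Rightarrow> ('y::t2_space \<Rightarrow> 'x) \<Rightarrow> ('x, 'n::finite) harmonic \<Rightarrow> ('y, 'n) harmonic"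
where
  "pullback_harmonic X f H =
     \<lparr> vbundle = pullback_bundle f (vbundle H),
       D_theta = pullback_op derivation_dbar X f (vbundle H) (D_theta H),
       D_nabla = pullback_op derivation_d X f (vbundle H) (D_nabla H),
       metric = metric H \<circ> f \<rparr>"


section \<open>Parabolic objects induced by a tame harmonic bundle\<close>

text \<open>The stalk at \<open>x\<close> of the sheaf \<open>E\<^sup>\<alpha>\<close> of sections of growth order at least \<open>\<alpha>\<close>; all
  representatives of a germ are included. The operator \<open>A\<close> is one of \<open>\<D>\<^sub>\<theta>\<close>, \<open>\<D>\<^sub>\<nabla>\<close>.\<close>

definition growth_stalk ::
  "('x::t2_space) chart set \<Rightarrow> 'x set \<Rightarrow> ('x, 'n::finite) harmonic \<Rightarrow> ('x, 'n) diffop \<Rightarrow> 'x \<Rightarrow> real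
     \<Rightarrow> ('x, 'n) sect set" where
  "growth_stalk X D H A x \<alpha> =
     {s. (\<exists>N. open N \<and> N \<inter> D = {x} \<and> dbar_hol X (vbundle H) A (N - {x}) s) \<and>
         (\<forall>c\<in>X. x \<in> fst c \<longrightarrow> (\<forall>\<epsilon>>0. \<exists>C. \<forall>\<^sub>F p in at x.
            sqrt (Re (metric H p (s p) (s p))) \<le> C * cmod (snd c p - snd c x) powr (\<alpha> - \<epsilon>)))}"

definition induced_parabolic ::
  "('x::t2_space) chart set \<Rightarrow> 'x set \<Rightarrow> ('x, 'n::finite) harmonic \<Rightarrow> ('x, 'n) diffop
     \<Rightarrow> ('x, 'n) parabolic \<Rightarrow> bool" where
  "induced_parabolic X D H A E \<longleftrightarrow>
     parabolic_bundle X D E \<and>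
     (\<forall>V s. V \<inter> D = {} \<longrightarrow> hol_section X (triv E) V s = dbar_hol X (vbundle H) A V s) \<and>
     (\<forall>x\<in>D.
        (\<forall>s. s \<in> growth_stalk X D H A x 0 \<longleftrightarrow>
             (\<exists>N v. x \<in> N \<and> hol_section X (triv E) N (s(x := v)))) \<and>
        fst ` set (flag E x) =
          {\<alpha>. 0 \<le> \<alpha> \<and> \<alpha> < 1 \<and> (\<forall>\<epsilon>>0. growth_stalk X D H A x \<alpha> \<noteq> growth_stalk X D H A x (\<alpha> + \<epsilon>))} \<and>
        (\<forall>(\<alpha>, F) \<in> set (flag E x).
           F = {s x | s. s \<in> growth_stalk X D H A x \<alpha> \<and> (\<exists>N. x \<in> N \<and> hol_section X (triv E) N s)}))"

definition induced_higgs ::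
  "('x::t2_space) chart set \<Rightarrow> 'x set \<Rightarrow> ('x, 'n::finite) harmonic
     \<Rightarrow> ('x, 'n) parabolic \<Rightarrow> ('x, 'n) higgs \<Rightarrow> bool" where
  "induced_higgs X D H E \<theta> \<longleftrightarrow>
     parabolic_higgs_bundle X D E \<theta> \<and> induced_parabolic X D H (D_theta H) E \<and>
     (\<forall>c\<in>X. \<forall>p \<in> fst c - D. \<theta> c p = higgs_matrix X H c p)"

definition induced_connection ::
  "('x::t2_space) chart set \<Rightarrow> 'x set \<Rightarrow> ('x, 'n::finite) harmonic
     \<Rightarrow> ('x, 'n) parabolic \<Rightarrow> ('x, 'n) connection \<Rightarrow> bool" where
  "induced_connection X D H E nabla \<longleftrightarrow>
     parabolic_connection X D E nabla \<and> induced_parabolic X D H (D_nabla H) E \<and>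
     (\<forall>V s. V \<inter> D = {} \<longrightarrow> hol_section X (triv E) V s \<longrightarrow>
        (\<forall>c\<in>X. \<forall>p \<in> V \<inter> fst c. nabla s c p = fst (D_nabla H s c p)))"

end

theory Submission
  imports Defs
begin

text \<open>Off the divisors everything is checked in pulled back frames: \<open>f\<close> is holomorphic, so
  \<open>f\<^sup>*\<close> commutes with the \<open>(1,0)\<close> and \<open>(0,1)\<close> parts of derivatives by the chain rule. At
  \<open>y \<in> f\<^sup>-\<^sup>1(x)\<close> of multiplicity \<open>m\<close>, let \<open>e\<close> be a frame adapted to the flag at \<open>x\<close>, with weights
  \<open>a\<^sub>j\<close>. That the parabolic structure is induced by the metric means that \<open>\<Sum>\<^sub>j u\<^sub>j e\<^sub>j\<close> has
  growth order at least \<open>\<gamma>\<close> iff \<open>u\<^sub>j = O(r\<^sup>\<gamma>\<^sup>-\<^sup>a\<^sup>j)\<close> for all \<open>j\<close>. This passes to the frame \<open>f\<^sup>*e\<close>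
  with weights \<open>m a\<^sub>j\<close>, because each isotypic component of a section under the deck group
  \<open>t \<mapsto> \<omega> t\<close>, \<open>\<omega>\<^sup>m = 1\<close>, of \<open>z = t\<^sup>m\<close> is a power of \<open>t\<close> times a section from below. Multiplying
  \<open>f\<^sup>*e\<^sub>j\<close> by \<open>w\<^sup>-\<^sup>k\<^sup>j\<close>, \<open>k\<^sub>j = \<lfloor>m a\<^sub>j\<rfloor>\<close>, gives the pullback bundle. If the residue \<open>R\<close> at
  \<open>x\<close> preserves the flag, then \<open>R\<^sub>i\<^sub>j \<noteq> 0\<close> only if \<open>a\<^sub>i \<ge> a\<^sub>j\<close>, and so the entries
  \<open>w\<^sup>k\<^sup>i\<^sup>-\<^sup>k\<^sup>j f\<^sup>*R\<^sub>i\<^sub>j\<close> extend over \<open>y\<close> and preserve the flag there.\<close>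

section \<open>Calculus of \<open>C\<^sup>k\<close> functions and Wirtinger derivatives\<close>

text \<open>Growth of sections is the only information on the metric: no estimate says that an
  adapted frame is almost orthogonal, so a norm upstairs gives no direct bound on the coefficients
  \<open>u\<^sub>j\<close>. Hence the isotypic components: they descend to X, where such a bound
  follows from the parabolic structure being induced, and they are cheap, because all points of a
  fibre of f carry the same hermitian form and a sum over the fibre costs a constant.

  No d-bar equation is solved: off D the sections of the given parabolic bundle are exactly those
  killed by the (0,1) part of the operator, so its trivialisations supply holomorphic frames of the
  harmonic bundle.

  Negative powers of w are harmless in the residue by a count: weights lie in [0,1), so
  \<open>k\<^sub>j - k\<^sub>i \<le> m - 1\<close>, while an entry of R that vanishes at x pulls
  back to one vanishing to order at least m at y. For the connection the twist also subtracts
  \<open>k\<^sub>j\<close> from the j-th diagonal entry, which respects every flag spanned by frame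
  vectors.\<close>

lemma frechet_derivative_cong_open:
  assumes "open S" "x \<in> S" "\<And>x. x \<in> S \<Longrightarrow> f x = g x"
  shows "frechet_derivative f (at x) = frechet_derivative g (at x)"
proof -
  have "(f has_derivative F) (at x) \<longleftrightarrow> (g has_derivative F) (at x)" for F
    using assms has_derivative_transform_within_open[of f F x UNIV S g]
      has_derivative_transform_within_open[of g F x UNIV S f] by auto
  then show ?thesis by (simp add: frechet_derivative_def)
qed

lemma differentiable_cong_open:
  assumes "open S" "x \<in> S" "\<And>x. x \<in> S \<Longrightarrow> f x = g x"
  shows "f differentiable (at x) \<longleftrightarrow> g differentiable (at x)"
proof -
  have "(f has_derivative F) (at x) \<longleftrightarrow> (g has_derivative F) (at x)" for F
    using assms has_derivative_transform_within_open[of f F x UNIV S g]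
      has_derivative_transform_within_open[of g F x UNIV S f] by auto
  then show ?thesis by (simp add: differentiable_def)
qed

text \<open>Openness of S carries the argument: \<open>Ck_on\<close> uses full derivatives at the
  points of S, and these see a neighbourhood.\<close>

lemma Ck_on_cong:
  assumes "open S" "\<And>z. z \<in> S \<Longrightarrow> f z = g z"
  shows "Ck_on k f S \<longleftrightarrow> Ck_on k g S"
  using assms
proof (induction k arbitrary: f g)
  case 0
  then show ?case by (simp cong: continuous_on_cong)
next
  case (Suc k)
  have "f differentiable (at z) \<longleftrightarrow> g differentiable (at z)" if "z \<in> S" for z
    using differentiable_cong_open[OF \<open>open S\<close> that] Suc.prems by auto
  moreover have "Ck_on k (\<lambda>z. frechet_derivative f (at z) v) S \<longleftrightarrow>
      Ck_on k (\<lambda>z. frechet_derivative g (at z) v) S" for v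
  proof (rule Suc.IH[OF \<open>open S\<close>])
    fix z assume "z \<in> S"
    then show "frechet_derivative f (at z) v = frechet_derivative g (at z) v"
      using frechet_derivative_cong_open[OF \<open>open S\<close> \<open>z \<in> S\<close>, of f g] Suc.prems(2) by simp
  qed
  ultimately show ?case by simp
qed

lemma Ck_on_subset: "Ck_on k f S \<Longrightarrow> T \<subseteq> S \<Longrightarrow> Ck_on k f T"
  by (induction k arbitrary: f) (auto intro: continuous_on_subset)

lemma Ck_on_local:
  assumes "\<And>z. z \<in> S \<Longrightarrow> \<exists>T. open T \<and> z \<in> T \<and> Ck_on k f T"
  shows "Ck_on k f S"
  using assms
proof (induction k arbitrary: f)
  case 0
  then show ?case
    by (auto intro!: continuous_at_imp_continuous_on simp: continuous_on_eq_continuous_at) 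
      (use 0 continuous_on_eq_continuous_at in fastforce)
next
  case (Suc k)
  have "f differentiable (at z)" if "z \<in> S" for z
    using Suc.prems[OF that] by auto
  moreover have "Ck_on k (\<lambda>z. frechet_derivative f (at z) v) S" for v
  proof (rule Suc.IH)
    fix z assume "z \<in> S"
    then obtain T where "open T" "z \<in> T" "Ck_on (Suc k) f T" using Suc.prems by blast
    then show "\<exists>T. open T \<and> z \<in> T \<and> Ck_on k (\<lambda>z. frechet_derivative f (at z) v) T"
      by auto
  qed
  ultimately show ?case by simp
qed

text \<open>The Leibniz rule and the chain rule leave some factors undifferentiated, so the
  inductions for products and compositions have to lower the order.\<close>

lemma Ck_on_Suc_imp: "Ck_on (Suc k) f S \<Longrightarrow> Ck_on k f S"
proof (induction k arbitrary: f)
  case 0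
  then show ?case
    by (simp add: continuous_at_imp_continuous_on differentiable_imp_continuous_within)
next
  case (Suc k)
  have "Ck_on (Suc k) (\<lambda>z. frechet_derivative f (at z) v) S" for v
    using Suc.prems by (simp only: Ck_on.simps(2)[of "Suc k"])
  then have "Ck_on k (\<lambda>z. frechet_derivative f (at z) v) S" for v
    by (rule Suc.IH)
  moreover have "\<forall>z\<in>S. f differentiable (at z)"
    using Suc.prems by (simp only: Ck_on.simps(2)[of "Suc k"]) blast
  ultimately show ?case by (simp only: Ck_on.simps(2)) simp
qed

lemma Ck_on_const [simp]: "Ck_on k (\<lambda>z. a) S"
  by (induction k arbitrary: a) auto

text \<open>Trades \<open>frechet_derivative\<close>, which is only a choice of a derivative, for
  one given in closed form.\<close>

lemma Ck_on_SucI: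
  assumes "open S" "\<And>z. z \<in> S \<Longrightarrow> (f has_derivative f' z) (at z)"
    "\<And>v. Ck_on k (\<lambda>z. f' z v) S"
  shows "Ck_on (Suc k) f S"
proof -
  have "frechet_derivative f (at z) v = f' z v" if "z \<in> S" for z v
    using frechet_derivative_at[OF assms(2)[OF that]] by simp
  then have "Ck_on k (\<lambda>z. frechet_derivative f (at z) v) S" for v
    using assms(3)[of v] Ck_on_cong[OF assms(1), of "\<lambda>z. frechet_derivative f (at z) v"] by simp
  then show ?thesis using assms(2) by (auto simp: differentiable_def)
qed

lemma Ck_on_SucD:
  assumes "Ck_on (Suc k) f S" "z \<in> S"
  shows "(f has_derivative frechet_derivative f (at z)) (at z)"
  using assms frechet_derivative_works by auto

lemma Ck_on_linear:
  assumes "open S" "bounded_linear L" "Ck_on k f S"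
  shows "Ck_on k (\<lambda>z. L (f z)) S"
  using assms(3)
proof (induction k arbitrary: f)
  case 0
  then show ?case
    using assms(2) by (simp add: bounded_linear.continuous_on)
next
  case (Suc k)
  have "((\<lambda>z. L (f z)) has_derivative (\<lambda>v. L (frechet_derivative f (at z) v))) (at z)" if "z \<in> S" for z
    using bounded_linear.has_derivative[OF assms(2) Ck_on_SucD[OF Suc.prems that]] by simp
  then show ?case using Suc assms(1)
    by (intro Ck_on_SucI[where f' = "\<lambda>z v. L (frechet_derivative f (at z) v)"]) auto
qed

lemma Ck_on_add:
  assumes "open S" "Ck_on k f S" "Ck_on k g S"
  shows "Ck_on k (\<lambda>z. f z + g z) S"
  using assms(2,3)
proof (induction k arbitrary: f g)
  case 0
  then show ?case by (simp add: continuous_on_add)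
next
  case (Suc k)
  show ?case
    by (rule Ck_on_SucI[OF assms(1) has_derivative_add[OF Ck_on_SucD[OF Suc.prems(1)] Ck_on_SucD[OF Suc.prems(2)]]])
      (use Suc in auto)
qed

lemma Ck_on_mult:
  assumes "open S" "Ck_on k f S" "Ck_on k g S"
  shows "Ck_on k (\<lambda>z. f z * g z) S"
  using assms(2,3)
proof (induction k arbitrary: f g)
  case 0
  then show ?case by (simp add: continuous_on_mult)
next
  case (Suc k)
  show ?case
    by (rule Ck_on_SucI[OF assms(1) has_derivative_mult[OF Ck_on_SucD[OF Suc.prems(1)] Ck_on_SucD[OF Suc.prems(2)]]])
      (use Suc Ck_on_Suc_imp[OF Suc.prems(1)] Ck_on_Suc_imp[OF Suc.prems(2)] assms(1) in
        \<open>auto intro!: Ck_on_add\<close>)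
qed

text \<open>\<open>Ck_on\<close> tests derivatives on fixed vectors only. In the chain rule the
  vector moves with the point; expanding it in the real basis 1, \<i> brings it back to two fixed
  ones.\<close>

lemma real_linear_complex:
  assumes "linear (L :: complex \<Rightarrow> complex)"
  shows "L v = of_real (Re v) * L 1 + of_real (Im v) * L \<i>"
proof -
  have "v = Re v *\<^sub>R 1 + Im v *\<^sub>R \<i>" by (simp add: complex_eq_iff)
  then have "L v = L (Re v *\<^sub>R 1 + Im v *\<^sub>R \<i>)" by (rule arg_cong)
  also have "\<dots> = Re v *\<^sub>R L 1 + Im v *\<^sub>R L \<i>"
    by (simp only: linear_add[OF assms] linear_cmul[OF assms])
  finally show ?thesis by (simp add: scaleR_conv_of_real)
qed

lemma bounded_linear_complex_of_Re: "bounded_linear (\<lambda>z. complex_of_real (Re z))"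
  by (rule bounded_linear_compose[OF bounded_linear_of_real bounded_linear_Re])

lemma bounded_linear_complex_of_Im: "bounded_linear (\<lambda>z. complex_of_real (Im z))"
  by (rule bounded_linear_compose[OF bounded_linear_of_real bounded_linear_Im])

lemma Ck_on_compose:
  assumes "open S" "open T" "Ck_on k g S" "Ck_on k h T" "g ` S \<subseteq> T"
  shows "Ck_on k (\<lambda>z. h (g z)) S"
  using assms(3,4)
proof (induction k arbitrary: h)
  case 0
  then show ?case using assms(5) by (auto intro: continuous_on_compose2)
next
  case (Suc k)
  let ?g = "\<lambda>z. frechet_derivative g (at z)" and ?h = "\<lambda>z. frechet_derivative h (at z)"
  let ?D = "\<lambda>z v. of_real (Re (?g z v)) * ?h (g z) 1 + of_real (Im (?g z v)) * ?h (g z) \<i>"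
  have "((\<lambda>z. h (g z)) has_derivative ?D z) (at z)" if "z \<in> S" for z
  proof -
    have hd: "(h has_derivative ?h (g z)) (at (g z))"
      using Ck_on_SucD[OF Suc.prems(2)] that assms(5) by blast
    have "((\<lambda>z. h (g z)) has_derivative (\<lambda>v. ?h (g z) (?g z v))) (at z)"
      using diff_chain_at[OF Ck_on_SucD[OF Suc.prems(1) that] hd] by (simp add: o_def)
    moreover have "?h (g z) (?g z v) = ?D z v" for v
      using real_linear_complex[OF has_derivative_linear[OF hd], of "?g z v"] by simp
    ultimately show ?thesis by (simp only:)
  qed
  moreover have "Ck_on k (\<lambda>z. ?D z v) S" for v
  proof -
    have 1: "Ck_on k (\<lambda>z. ?h (g z) w) S" for w
      by (rule Suc.IH[OF Ck_on_Suc_imp[OF Suc.prems(1)]]) (use Suc.prems in auto)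
    have 2: "Ck_on k (\<lambda>z. of_real (Re (?g z v))) S" "Ck_on k (\<lambda>z. of_real (Im (?g z v))) S"
      using Suc.prems(1) Ck_on_linear[OF assms(1) bounded_linear_complex_of_Re]
        Ck_on_linear[OF assms(1) bounded_linear_complex_of_Im] by auto
    show ?thesis
      by (intro Ck_on_add Ck_on_mult 1 2 assms(1))
  qed
  ultimately show ?case by (rule Ck_on_SucI[OF assms(1)])
qed

lemma Ck_on_holomorphic:
  assumes "open S" "f holomorphic_on S"
  shows "Ck_on k f S"
  using assms(2)
proof (induction k arbitrary: f)
  case 0
  then show ?case by (simp add: holomorphic_on_imp_continuous_on)
next
  case (Suc k)
  show ?case
  proof (rule Ck_on_SucI[OF assms(1)])
    show "(f has_derivative (\<lambda>v. deriv f z * v)) (at z)" if "z \<in> S" for z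
      using holomorphic_derivI[OF Suc.prems assms(1) that]
      by (simp add: has_field_derivative_def)
    show "Ck_on k (\<lambda>z. deriv f z * v) S" for v
      by (intro Ck_on_mult Suc.IH holomorphic_deriv Suc.prems assms Ck_on_const)
  qed
qed

lemma Ck_on_frechet: "Ck_on (Suc k) f S \<Longrightarrow> Ck_on k (\<lambda>z. frechet_derivative f (at z) v) S"
  by simp

section \<open>Wirtinger derivatives in the plane\<close>

definition wz :: "(complex \<Rightarrow> complex) \<Rightarrow> complex \<Rightarrow> complex" where
  "wz g z = (frechet_derivative g (at z) 1 - \<i> * frechet_derivative g (at z) \<i>) / 2"

definition wzbar :: "(complex \<Rightarrow> complex) \<Rightarrow> complex \<Rightarrow> complex" where
  "wzbar g z = (frechet_derivative g (at z) 1 + \<i> * frechet_derivative g (at z) \<i>) / 2"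

lemma wz_cong_open:
  assumes "open S" "x \<in> S" "\<And>x. x \<in> S \<Longrightarrow> f x = g x"
  shows "wz f x = wz g x" "wzbar f x = wzbar g x"
  by (simp_all add: wz_def wzbar_def frechet_derivative_cong_open[OF assms])

lemma has_derivative_wirtinger:
  assumes "g differentiable (at z)"
  shows "(g has_derivative (\<lambda>v. wz g z * v + wzbar g z * cnj v)) (at z)"
proof -
  let ?L = "frechet_derivative g (at z)"
  have L: "(g has_derivative ?L) (at z)" using assms frechet_derivative_works by blast
  have "?L v = wz g z * v + wzbar g z * cnj v" for v
  proof -
    have "?L v = of_real (Re v) * ?L 1 + of_real (Im v) * ?L \<i>"
      using real_linear_complex[OF has_derivative_linear[OF L], of v] .
    also have "\<dots> = wz g z * (of_real (Re v) + \<i> * of_real (Im v))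
        + wzbar g z * (of_real (Re v) - \<i> * of_real (Im v))"
      unfolding wz_def wzbar_def by (simp add: algebra_simps add_divide_distrib diff_divide_distrib)
    also have "of_real (Re v) + \<i> * of_real (Im v) = v"
      by (simp add: complex_eq_iff)
    also have "of_real (Re v) - \<i> * of_real (Im v) = cnj v"
      by (simp add: complex_eq_iff)
    finally show ?thesis .
  qed
  then have "?L = (\<lambda>v. wz g z * v + wzbar g z * cnj v)" by blast
  then show ?thesis by (rule has_derivative_eq_rhs[OF L])
qed

text \<open>The real-linear maps v and \<open>cnj v\<close> are independent over the complex
  numbers. The calculus rules below all exhibit the derivative as a combination of these two and
  read off the coefficients here.\<close>

lemma wirtinger_eqI:
  assumes "(g has_derivative (\<lambda>v. a * v + b * cnj v)) (at z)"
  shows "wz g z = a" "wzbar g z = b"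
proof -
  have "frechet_derivative g (at z) = (\<lambda>v. a * v + b * cnj v)"
    using frechet_derivative_at[OF assms] by simp
  then show "wz g z = a" "wzbar g z = b"
    by (simp_all add: wz_def wzbar_def algebra_simps)
qed

lemma wz_add:
  assumes "f differentiable (at z)" "g differentiable (at z)"
  shows "wz (\<lambda>z. f z + g z) z = wz f z + wz g z"
    "wzbar (\<lambda>z. f z + g z) z = wzbar f z + wzbar g z"
proof -
  have "((\<lambda>z. f z + g z) has_derivative
      (\<lambda>v. (wz f z + wz g z) * v + (wzbar f z + wzbar g z) * cnj v)) (at z)"
    by (rule has_derivative_eq_rhs[OF has_derivative_add[OF assms[THEN has_derivative_wirtinger]]])
      (simp add: algebra_simps)
  then show "wz (\<lambda>z. f z + g z) z = wz f z + wz g z"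
    "wzbar (\<lambda>z. f z + g z) z = wzbar f z + wzbar g z"
    using wirtinger_eqI by blast+
qed

lemma wz_mult:
  assumes "f differentiable (at z)" "g differentiable (at z)"
  shows "wz (\<lambda>z. f z * g z) z = f z * wz g z + wz f z * g z"
    "wzbar (\<lambda>z. f z * g z) z = f z * wzbar g z + wzbar f z * g z"
proof -
  have "((\<lambda>z. f z * g z) has_derivative
      (\<lambda>v. (f z * wz g z + wz f z * g z) * v + (f z * wzbar g z + wzbar f z * g z) * cnj v)) (at z)"
    by (rule has_derivative_eq_rhs[OF has_derivative_mult[OF assms[THEN has_derivative_wirtinger]]])
      (simp add: algebra_simps)
  then show "wz (\<lambda>z. f z * g z) z = f z * wz g z + wz f z * g z"
    "wzbar (\<lambda>z. f z * g z) z = f z * wzbar g z + wzbar f z * g z"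
    using wirtinger_eqI by blast+
qed

lemma wz_holomorphic:
  assumes "(h has_field_derivative h') (at z)"
  shows "wz h z = h'" "wzbar h z = 0"
  using wirtinger_eqI[of h h' 0 z] assms by (simp_all add: has_field_derivative_def)

lemma wz_compose_holomorphic:
  assumes "(h has_field_derivative h') (at z)" "g differentiable (at (h z))"
  shows "wz (\<lambda>z. g (h z)) z = wz g (h z) * h'"
    "wzbar (\<lambda>z. g (h z)) z = wzbar g (h z) * cnj h'"
proof -
  have "((\<lambda>z. g (h z)) has_derivative (\<lambda>v. wz g (h z) * h' * v + wzbar g (h z) * cnj h' * cnj v)) (at z)"
    using diff_chain_at[OF assms(1)[unfolded has_field_derivative_def] has_derivative_wirtinger[OF assms(2)]]
    by (simp add: o_def algebra_simps)
  then show "wz (\<lambda>z. g (h z)) z = wz g (h z) * h'" "wzbar (\<lambda>z. g (h z)) z = wzbar g (h z) * cnj h'"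
    using wirtinger_eqI by blast+
qed

lemma wz_cnj:
  assumes "g differentiable (at z)"
  shows "wz (\<lambda>z. cnj (g z)) z = cnj (wzbar g z)" "wzbar (\<lambda>z. cnj (g z)) z = cnj (wz g z)"
proof -
  have "((\<lambda>z. cnj (g z)) has_derivative (\<lambda>v. cnj (wzbar g z) * v + cnj (wz g z) * cnj v)) (at z)"
    using bounded_linear.has_derivative[OF bounded_linear_cnj has_derivative_wirtinger[OF assms]]
    by (simp add: algebra_simps)
  then show "wz (\<lambda>z. cnj (g z)) z = cnj (wzbar g z)" "wzbar (\<lambda>z. cnj (g z)) z = cnj (wz g z)"
    using wirtinger_eqI by blast+
qed

lemma holomorphic_on_wzbar:
  assumes "open S" "\<And>z. z \<in> S \<Longrightarrow> g differentiable (at z)" "\<And>z. z \<in> S \<Longrightarrow> wzbar g z = 0"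
  shows "g holomorphic_on S"
proof -
  have "(g has_field_derivative wz g z) (at z)" if "z \<in> S" for z
    using has_derivative_wirtinger[OF assms(2)[OF that]] assms(3)[OF that]
    by (simp add: has_field_derivative_def)
  then show ?thesis
    by (auto simp: holomorphic_on_open[OF assms(1)])
qed

lemma Ck_on_wz:
  assumes "open S" "Ck_on (Suc k) g S"
  shows "Ck_on k (wz g) S" "Ck_on k (wzbar g) S"
proof -
  have "wz g = (\<lambda>z. (1/2) * frechet_derivative g (at z) 1 + (-\<i>/2) * frechet_derivative g (at z) \<i>)"
    "wzbar g = (\<lambda>z. (1/2) * frechet_derivative g (at z) 1 + (\<i>/2) * frechet_derivative g (at z) \<i>)"
    by (auto simp: wz_def wzbar_def fun_eq_iff field_simps)
  then show "Ck_on k (wz g) S" "Ck_on k (wzbar g) S"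
    by (simp_all only:) (intro Ck_on_add Ck_on_mult Ck_on_const Ck_on_frechet assms)+
qed


section \<open>Symmetry of mixed second derivatives\<close>

lemma has_derivative_along_line:
  fixes u :: "complex \<Rightarrow> real"
  assumes "(u has_derivative U) (at (z + of_real s * p))"
  shows "((\<lambda>s. u (z + of_real s * p)) has_real_derivative U p) (at s)"
proof -
  have "((\<lambda>s. z + of_real s * p) has_derivative (\<lambda>h. of_real h * p)) (at s)"
    by (auto intro!: derivative_eq_intros)
  from diff_chain_at[OF this assms]
  have "((\<lambda>s. u (z + of_real s * p)) has_derivative (\<lambda>h. U (of_real h * p))) (at s)"
    by (simp add: o_def)
  moreover have "U (of_real h * p) = U p * h" for h
    using linear_cmul[OF has_derivative_linear[OF assms], of h p]
    by (simp add: scaleR_conv_of_real)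
  ultimately show ?thesis by (simp add: has_field_derivative_def)
qed

text \<open>The mean value theorem, once in direction p and once in direction q. The left-hand side
  is symmetric in p and q, the right-hand side is not; that asymmetry is what gets exploited
  next.\<close>

lemma second_difference:
  fixes u :: "complex \<Rightarrow> real"
  assumes "\<And>w. w \<in> ball z r \<Longrightarrow> (u has_derivative U w) (at w)"
    and "\<And>w. w \<in> ball z r \<Longrightarrow> ((\<lambda>w. U w p) has_derivative V w) (at w)"
    and "norm p = 1" "norm q = 1" "0 < h" "2 * h < r"
  shows "\<exists>\<xi>\<in>ball z r.
    u (z + of_real h * p + of_real h * q) - u (z + of_real h * p) - u (z + of_real h * q) + u z = h\<^sup>2 * V \<xi> q"
proof -
  have in_ball: "z + of_real s * p + of_real t * q \<in> ball z r" if "0 \<le> s" "s \<le> h" "0 \<le> t" "t \<le> h" for s t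
  proof -
    have "norm (of_real s * p + of_real t * q) \<le> s + t"
      using that assms(3,4) norm_triangle_ineq[of "of_real s * p" "of_real t * q"]
      by (simp add: norm_mult)
    then have "norm (of_real s * p + of_real t * q) < r" using that assms(6) by linarith
    moreover have "dist z (z + of_real s * p + of_real t * q) = norm (of_real s * p + of_real t * q)"
      using dist_add_cancel[of z 0 "of_real s * p + of_real t * q"] by (simp add: add.assoc)
    ultimately show ?thesis by simp
  qed
  \<comment> \<open>The increment in direction q, seen as a function of the displacement s along p;
    its total variation over [0,h] is the second difference.\<close>
  let ?\<phi> = "\<lambda>s. u (z + of_real h * q + of_real s * p) - u (z + of_real s * p)"
  have "\<exists>s>0. s < h \<and> ?\<phi> h - ?\<phi> 0 = (h - 0) * (U (z + of_real h * q + of_real s * p) p - U (z + of_real s * p) p)"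
  proof (rule MVT2)
    fix s assume s: "0 \<le> s" "s \<le> h"
    show "(?\<phi> has_real_derivative U (z + of_real h * q + of_real s * p) p - U (z + of_real s * p) p) (at s)"
      using in_ball[of s h] in_ball[of s 0] s assms(5)
      by (intro DERIV_diff has_derivative_along_line assms(1)) (simp_all add: algebra_simps)
  qed (use assms in auto)
  then obtain s where s: "0 < s" "s < h"
    "?\<phi> h - ?\<phi> 0 = h * (U (z + of_real h * q + of_real s * p) p - U (z + of_real s * p) p)"
    by auto
  let ?\<psi> = "\<lambda>t. U (z + of_real s * p + of_real t * q) p"
  have "\<exists>t>0. t < h \<and> ?\<psi> h - ?\<psi> 0 = (h - 0) * V (z + of_real s * p + of_real t * q) q"
  proof (rule MVT2)
    fix t assume t: "0 \<le> t" "t \<le> h"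
    show "(?\<psi> has_real_derivative V (z + of_real s * p + of_real t * q) q) (at t)"
      using in_ball[of s t] s t
      by (intro has_derivative_along_line assms(2)) (simp_all add: algebra_simps)
  qed (use assms in auto)
  then obtain t where t: "0 < t" "t < h" "?\<psi> h - ?\<psi> 0 = h * V (z + of_real s * p + of_real t * q) q"
    by auto
  show ?thesis
    using s t in_ball[of s t]
    by (intro bexI[of _ "z + of_real s * p + of_real t * q"]) (auto simp: algebra_simps power2_eq_square)
qed

text \<open>Evaluating the symmetric second difference in both orders gives equal values of V and W
  at two points as close to z as desired; continuity of the second derivatives moves both points to
  z.\<close>

lemma mixed_second_derivatives_real:
  fixes u :: "complex \<Rightarrow> real"
  assumes "open S" "z \<in> S"
    and u: "\<And>w. w \<in> S \<Longrightarrow> (u has_derivative U w) (at w)"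
    and Up: "\<And>w. w \<in> S \<Longrightarrow> ((\<lambda>w. U w p) has_derivative V w) (at w)"
    and Uq: "\<And>w. w \<in> S \<Longrightarrow> ((\<lambda>w. U w q) has_derivative W w) (at w)"
    and pq: "norm p = 1" "norm q = 1"
    and cont: "continuous_on S (\<lambda>w. V w q)" "continuous_on S (\<lambda>w. W w p)"
  shows "V z q = W z p"
proof (rule ccontr)
  assume ne: "V z q \<noteq> W z p"
  \<comment> \<open>Half of the supposed gap: two errors smaller than e cannot bridge a distance 2
    e.\<close>
  define e where "e = \<bar>V z q - W z p\<bar> / 2"
  have e: "e > 0" using ne by (simp add: e_def)
  have "isCont (\<lambda>w. V w q) z" "isCont (\<lambda>w. W w p) z"
    using cont assms(1,2) continuous_on_eq_continuous_at by blast+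
  then obtain d1 d2 where d: "d1 > 0" "\<And>w. dist w z < d1 \<Longrightarrow> dist (V w q) (V z q) < e"
    "d2 > 0" "\<And>w. dist w z < d2 \<Longrightarrow> dist (W w p) (W z p) < e"
    unfolding continuous_at_eps_delta using e by metis
  obtain r0 where r0: "r0 > 0" "ball z r0 \<subseteq> S" using assms(1,2) open_contains_ball by metis
  define r where "r = min r0 (min d1 d2)"
  have r: "r > 0" "ball z r \<subseteq> S" using r0 d by (auto simp: r_def)
  define h where "h = r / 3"
  have h: "0 < h" "2 * h < r" using r by (auto simp: h_def)
  obtain \<xi> where \<xi>: "\<xi> \<in> ball z r"
    "u (z + of_real h * p + of_real h * q) - u (z + of_real h * p) - u (z + of_real h * q) + u z = h\<^sup>2 * V \<xi> q"
    using second_difference[of z r u U p V q h] u Up pq h r(2) by blast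
  obtain \<eta> where \<eta>: "\<eta> \<in> ball z r"
    "u (z + of_real h * q + of_real h * p) - u (z + of_real h * q) - u (z + of_real h * p) + u z = h\<^sup>2 * W \<eta> p"
    using second_difference[of z r u U q W p h] u Uq pq h r(2) by blast
  have "h\<^sup>2 * V \<xi> q = h\<^sup>2 * W \<eta> p"
    using \<xi>(2) \<eta>(2) by (simp add: algebra_simps)
  then have "V \<xi> q = W \<eta> p" using h by simp
  moreover have "\<bar>V \<xi> q - V z q\<bar> < e" "\<bar>W \<eta> p - W z p\<bar> < e"
    using d(2)[of \<xi>] d(4)[of \<eta>] \<xi>(1) \<eta>(1) by (auto simp: r_def dist_norm norm_minus_commute)
  moreover have "\<bar>V z q - W z p\<bar> \<le> \<bar>V \<xi> q - V z q\<bar> + \<bar>W \<eta> p - W z p\<bar>"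
    using \<open>V \<xi> q = W \<eta> p\<close> by linarith
  moreover have False if "x < e" "y < e" "c \<le> x + y" "e = c / 2" for x y c :: real
    using that by linarith
  ultimately show False using e_def by blast
qed

text \<open>Real and imaginary parts are separated because the mean value theorem speaks of real
  functions.\<close>

lemma mixed_second_derivatives:
  assumes "open S" "Ck_on (Suc (Suc 0)) g S" "z \<in> S"
  shows "frechet_derivative (\<lambda>w. frechet_derivative g (at w) 1) (at z) \<i> =
    frechet_derivative (\<lambda>w. frechet_derivative g (at w) \<i>) (at z) 1"
proof -
  let ?D = "\<lambda>v w. frechet_derivative g (at w) v"
  let ?DD = "\<lambda>v w. frechet_derivative (?D v) (at w)"
  have g: "(g has_derivative (\<lambda>v. ?D v w)) (at w)" if "w \<in> S" for w
    using Ck_on_SucD[OF assms(2) that] .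
  have D: "(?D v has_derivative ?DD v w) (at w)" if "w \<in> S" for v w
    using Ck_on_SucD[OF Ck_on_frechet[OF assms(2)] that] .
  have c: "continuous_on S (\<lambda>w. ?DD v w v')" for v v'
    using Ck_on_frechet[OF Ck_on_frechet[OF assms(2)]] by simp
  have "Re (?DD 1 z \<i>) = Re (?DD \<i> z 1)"
    by (rule mixed_second_derivatives_real[where u = "\<lambda>w. Re (g w)" and U = "\<lambda>w v. Re (?D v w)"
          and V = "\<lambda>w v. Re (?DD 1 w v)" and W = "\<lambda>w v. Re (?DD \<i> w v)" and S = S])
      (use assms g D c in \<open>auto intro: bounded_linear.has_derivative[OF bounded_linear_Re] continuous_on_Re\<close>)
  moreover have "Im (?DD 1 z \<i>) = Im (?DD \<i> z 1)"
    by (rule mixed_second_derivatives_real[where u = "\<lambda>w. Im (g w)" and U = "\<lambda>w v. Im (?D v w)"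
          and V = "\<lambda>w v. Im (?DD 1 w v)" and W = "\<lambda>w v. Im (?DD \<i> w v)" and S = S])
      (use assms g D c in \<open>auto intro: bounded_linear.has_derivative[OF bounded_linear_Im] continuous_on_Im\<close>)
  ultimately show ?thesis by (simp add: complex_eq_iff)
qed

text \<open>The curvature of a pulled back operator contains the commutator of these two
  derivatives, applied to the coefficients of a section.\<close>

lemma wz_wzbar_commute:
  assumes "open S" "Ck_on (Suc (Suc 0)) g S" "z \<in> S"
  shows "wz (wzbar g) z = wzbar (wz g) z"
proof -
  let ?D = "\<lambda>v w. frechet_derivative g (at w) v"
  have D: "(?D v has_derivative frechet_derivative (?D v) (at z)) (at z)" for v
    using Ck_on_SucD[OF Ck_on_frechet[OF assms(2)] assms(3)] .
  have "((\<lambda>w. (?D 1 w - \<i> * ?D \<i> w) / 2) has_derivative (\<lambda>v. (frechet_derivative (?D 1) (at z) v - \<i> * frechet_derivative (?D \<i>) (at z) v) / 2)) (at z)"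
    by (intro bounded_linear.has_derivative[OF bounded_linear_divide] has_derivative_diff
        has_derivative_mult_right D)
  then have wz: "frechet_derivative (wz g) (at z) = (\<lambda>v. (frechet_derivative (?D 1) (at z) v - \<i> * frechet_derivative (?D \<i>) (at z) v) / 2)"
    unfolding wz_def[abs_def] by (rule frechet_derivative_at[symmetric])
  have "((\<lambda>w. (?D 1 w + \<i> * ?D \<i> w) / 2) has_derivative (\<lambda>v. (frechet_derivative (?D 1) (at z) v + \<i> * frechet_derivative (?D \<i>) (at z) v) / 2)) (at z)"
    by (intro bounded_linear.has_derivative[OF bounded_linear_divide] has_derivative_add
        has_derivative_mult_right D)
  then have wzbar: "frechet_derivative (wzbar g) (at z) = (\<lambda>v. (frechet_derivative (?D 1) (at z) v + \<i> * frechet_derivative (?D \<i>) (at z) v) / 2)"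
    unfolding wzbar_def[abs_def] by (rule frechet_derivative_at[symmetric])
  show ?thesis
    unfolding wz_def[of "wzbar g"] wzbar_def[of "wz g"] wz wzbar mixed_second_derivatives[OF assms]
    by (simp add: algebra_simps add_divide_distrib diff_divide_distrib)
qed

section \<open>Regular functions on Riemann surfaces\<close>

text \<open>One interface for holomorphic and for smooth functions on plane domains, so that sheaves
  and bundles are treated once. Composition is only asked with a holomorphic inner map: chart
  changes and f in charts are of that kind.\<close>

locale plane_regularity =
  fixes P :: "(complex \<Rightarrow> complex) \<Rightarrow> complex set \<Rightarrow> bool"
  assumes P_cong: "\<lbrakk>P g S; open S; \<And>z. z \<in> S \<Longrightarrow> g z = h z\<rbrakk> \<Longrightarrow> P h S"
    and P_subset: "\<lbrakk>P g S; T \<subseteq> S\<rbrakk> \<Longrightarrow> P g T"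
    and P_local: "(\<And>z. z \<in> S \<Longrightarrow> \<exists>T. open T \<and> z \<in> T \<and> T \<subseteq> S \<and> P g T) \<Longrightarrow> P g S"
    and P_const: "P (\<lambda>z. a) S"
    and P_add: "\<lbrakk>open S; P g S; P h S\<rbrakk> \<Longrightarrow> P (\<lambda>z. g z + h z) S"
    and P_mult: "\<lbrakk>open S; P g S; P h S\<rbrakk> \<Longrightarrow> P (\<lambda>z. g z * h z) S"
    and P_inverse: "\<lbrakk>open S; P g S; \<And>z. z \<in> S \<Longrightarrow> g z \<noteq> 0\<rbrakk> \<Longrightarrow> P (\<lambda>z. inverse (g z)) S"
    and P_compose: "\<lbrakk>open S; open T; h holomorphic_on S; P g T; h ` S \<subseteq> T\<rbrakk> \<Longrightarrow> P (\<lambda>z. g (h z)) S"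

abbreviation "hol_reg \<equiv> \<lambda>g S. g holomorphic_on (S::complex set)"
abbreviation "smooth_reg \<equiv> \<lambda>g S. \<forall>k. Ck_on k g S"

interpretation hol_reg: plane_regularity hol_reg
proof
  fix g h :: "complex \<Rightarrow> complex" and S :: "complex set" and a :: complex
  show "h holomorphic_on S" if "g holomorphic_on S" "\<And>z. z \<in> S \<Longrightarrow> g z = h z"
    using that holomorphic_transform by blast
  show "g holomorphic_on S" if *: "\<And>z. z \<in> S \<Longrightarrow> \<exists>T. open T \<and> z \<in> T \<and> T \<subseteq> S \<and> g holomorphic_on T"
    unfolding holomorphic_on_def
  proof
    fix z assume "z \<in> S"
    then obtain T where "open T" "z \<in> T" "g holomorphic_on T" using * by blast
    then show "g field_differentiable (at z within S)"
      by (meson field_differentiable_at_within holomorphic_on_imp_differentiable_at)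
  qed
  show "(\<lambda>z. a) holomorphic_on S" by (rule holomorphic_on_const)
  show "(\<lambda>z. g z + h z) holomorphic_on S" if "g holomorphic_on S" "h holomorphic_on S"
    using that by (rule holomorphic_on_add)
  show "(\<lambda>z. g z * h z) holomorphic_on S" if "g holomorphic_on S" "h holomorphic_on S"
    using that by (rule holomorphic_on_mult)
  show "(\<lambda>z. inverse (g z)) holomorphic_on S" if "g holomorphic_on S" "\<And>z. z \<in> S \<Longrightarrow> g z \<noteq> 0"
    using that by (rule holomorphic_on_inverse)
  show "g holomorphic_on T" if "g holomorphic_on S" "T \<subseteq> S" for T
    using that by (rule holomorphic_on_subset)
  show "(\<lambda>z. g (h z)) holomorphic_on S" if "h holomorphic_on S" "g holomorphic_on T" "h ` S \<subseteq> T" for T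
    using holomorphic_on_compose_gen[OF that] by (simp add: o_def)
qed

interpretation smooth_reg: plane_regularity smooth_reg
proof
  fix S g assume a: "\<And>z. z \<in> S \<Longrightarrow> \<exists>T. open T \<and> z \<in> T \<and> T \<subseteq> S \<and> (\<forall>k. Ck_on k g T)"
  show "\<forall>k. Ck_on k g S"
  proof
    fix k show "Ck_on k g S" by (rule Ck_on_local) (use a in blast)
  qed
next
  fix S :: "complex set" and T g h
  assume "open S" "open T" "h holomorphic_on S" "\<forall>k. Ck_on k g T" "h ` S \<subseteq> T"
  then show "\<forall>k. Ck_on k (\<lambda>z. g (h z)) S"
    using Ck_on_compose[OF _ _ Ck_on_holomorphic] by blast
next
  fix S g assume a: "open S" "\<forall>k. Ck_on k g S" "\<And>z. z \<in> S \<Longrightarrow> g z \<noteq> 0"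
  show "\<forall>k. Ck_on k (\<lambda>z. inverse (g z)) S"
  proof
    fix k
    have "inverse holomorphic_on (- {0::complex})" by (auto intro: holomorphic_intros)
    then have "Ck_on k inverse (- {0})" by (intro Ck_on_holomorphic) auto
    then show "Ck_on k (\<lambda>z. inverse (g z)) S"
      by (rule Ck_on_compose[of S "- {0}" k g inverse, rotated 3]) (use a in auto)
  qed
next
  fix g h S assume "\<forall>k. Ck_on k g S" "open S" "\<And>z. z \<in> S \<Longrightarrow> g z = h z"
  then show "\<forall>k. Ck_on k h S" using Ck_on_cong[of S g h] by blast
next
  fix g and S T :: "complex set"
  show "\<forall>k. Ck_on k g S \<Longrightarrow> T \<subseteq> S \<Longrightarrow> \<forall>k. Ck_on k g T" using Ck_on_subset by blast
qed (simp_all add: Ck_on_add Ck_on_mult)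

text \<open>A structure sheaf with exactly the operations that linear algebra over it needs; closure
  under inverses is there for division by the determinant in Cramer's rule.\<close>

locale function_sheaf =
  fixes R :: "('x::t2_space) set \<Rightarrow> ('x \<Rightarrow> complex) \<Rightarrow> bool"
  assumes R_open: "R V g \<Longrightarrow> open V"
    and R_cong: "\<lbrakk>R V g; \<And>p. p \<in> V \<Longrightarrow> g p = h p\<rbrakk> \<Longrightarrow> R V h"
    and R_subset: "\<lbrakk>R V g; open W; W \<subseteq> V\<rbrakk> \<Longrightarrow> R W g"
    and R_local: "(\<And>p. p \<in> V \<Longrightarrow> \<exists>N. p \<in> N \<and> N \<subseteq> V \<and> R N g) \<Longrightarrow> R V g"
    and R_const: "open V \<Longrightarrow> R V (\<lambda>p. a)"
    and R_add: "\<lbrakk>R V g; R V h\<rbrakk> \<Longrightarrow> R V (\<lambda>p. g p + h p)"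
    and R_mult: "\<lbrakk>R V g; R V h\<rbrakk> \<Longrightarrow> R V (\<lambda>p. g p * h p)"
    and R_inverse: "\<lbrakk>R V g; \<And>p. p \<in> V \<Longrightarrow> g p \<noteq> 0\<rbrakk> \<Longrightarrow> R V (\<lambda>p. inverse (g p))"
begin

lemma R_sum: "open V \<Longrightarrow> (\<And>i. i \<in> I \<Longrightarrow> R V (g i)) \<Longrightarrow> R V (\<lambda>p. \<Sum>i\<in>I. g i p)"
  by (induction I rule: infinite_finite_induct) (auto intro: R_const R_add)

lemma R_prod: "open V \<Longrightarrow> (\<And>i. i \<in> I \<Longrightarrow> R V (g i)) \<Longrightarrow> R V (\<lambda>p. \<Prod>i\<in>I. g i p)"
  by (induction I rule: infinite_finite_induct) (auto intro: R_const R_mult)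

lemma R_diff: "\<lbrakk>R V g; R V h\<rbrakk> \<Longrightarrow> R V (\<lambda>p. g p - h p)"
  using R_add[of V g "\<lambda>p. -1 * h p"] R_mult[of V "\<lambda>_. -1" h] R_const[of V "-1"] R_open[of V g] by simp

lemma R_power: "R V g \<Longrightarrow> R V (\<lambda>p. g p ^ k)"
  by (induction k) (auto intro: R_const R_mult R_open)

lemma R_divide: "\<lbrakk>R V g; R V h; \<And>p. p \<in> V \<Longrightarrow> h p \<noteq> 0\<rbrakk> \<Longrightarrow> R V (\<lambda>p. g p / h p)"
  using R_mult[of V g "\<lambda>p. inverse (h p)"] R_inverse[of V h] by (simp add: divide_inverse)

lemma R_power_int: "\<lbrakk>R V g; \<And>p. p \<in> V \<Longrightarrow> g p \<noteq> 0\<rbrakk> \<Longrightarrow> R V (\<lambda>p. g p powi k)"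
  by (cases k rule: int_cases4) (auto simp: power_int_minus intro!: R_inverse R_power)

end

definition surface_reg ::
  "((complex \<Rightarrow> complex) \<Rightarrow> complex set \<Rightarrow> bool) \<Rightarrow> ('x::t2_space) chart set \<Rightarrow> 'x set \<Rightarrow> ('x \<Rightarrow> complex) \<Rightarrow> bool"
where
  "surface_reg P X V g \<longleftrightarrow>
     open V \<and> (\<forall>c\<in>X. P (g \<circ> chart_inv c) (snd c ` (fst c \<inter> V)))"

lemma holomorphic_fun_surface_reg: "holomorphic_fun X = surface_reg hol_reg X"
  by (auto simp: fun_eq_iff holomorphic_fun_def surface_reg_def)

lemma smooth_fun_surface_reg: "smooth_fun X = surface_reg smooth_reg X"
  by (auto simp: fun_eq_iff smooth_fun_def surface_reg_def)

locale surface =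
  fixes X :: "('x::t2_space) chart set"
  assumes riemann: "riemann_surface X"
begin

lemma chart_at: obtains c where "c \<in> X" "p \<in> fst c"
  using riemann unfolding riemann_surface_def by blast

lemma chart_homeo: "c \<in> X \<Longrightarrow> homeomorphism (fst c) (snd c ` fst c) (snd c) (chart_inv c)"
  using riemann unfolding riemann_surface_def by simp

lemma open_chart: "c \<in> X \<Longrightarrow> open (fst c)"
  using riemann unfolding riemann_surface_def by simp

lemma open_chart_image': "c \<in> X \<Longrightarrow> open (snd c ` fst c)"
  using riemann unfolding riemann_surface_def by simp

lemma transition_holomorphic:
  "c \<in> X \<Longrightarrow> c' \<in> X \<Longrightarrow> (snd c' \<circ> chart_inv c) holomorphic_on snd c ` (fst c \<inter> fst c')"
  using riemann unfolding riemann_surface_def by simp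

lemma chart_inv_left [simp]: "c \<in> X \<Longrightarrow> p \<in> fst c \<Longrightarrow> chart_inv c (snd c p) = p"
  using chart_homeo homeomorphism_apply1 by blast

lemma chart_inv_right: "c \<in> X \<Longrightarrow> z \<in> snd c ` fst c \<Longrightarrow> snd c (chart_inv c z) = z"
  using chart_homeo homeomorphism_apply2 by blast

lemma chart_inv_in: "c \<in> X \<Longrightarrow> z \<in> snd c ` (fst c \<inter> V) \<Longrightarrow> chart_inv c z \<in> fst c \<inter> V"
  by auto

lemma chart_inj: "c \<in> X \<Longrightarrow> p \<in> fst c \<Longrightarrow> q \<in> fst c \<Longrightarrow> snd c p = snd c q \<longleftrightarrow> p = q"
  using chart_inv_left by metis

lemma open_chart_image: "c \<in> X \<Longrightarrow> open V \<Longrightarrow> open (snd c ` (fst c \<inter> V))"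
proof -
  assume c: "c \<in> X" and V: "open V"
  have "snd c ` (fst c \<inter> V) = snd c ` fst c \<inter> chart_inv c -` V"
    using c by auto
  moreover have "continuous_on (snd c ` fst c) (chart_inv c)"
    using chart_homeo[OF c] by (simp add: homeomorphism_def)
  ultimately show ?thesis
    using continuous_open_preimage[of "snd c ` fst c" "chart_inv c" V] open_chart_image'[OF c] V by simp
qed

lemma continuous_on_chart: "c \<in> X \<Longrightarrow> continuous_on (fst c) (snd c)"
  using chart_homeo by (simp add: homeomorphism_def)

lemma continuous_on_chart_inv: "c \<in> X \<Longrightarrow> continuous_on (snd c ` fst c) (chart_inv c)"
  using chart_homeo by (simp add: homeomorphism_def)

end

text \<open>The definition quantifies over all charts. Transition maps are holomorphic, so
  \<open>P_compose\<close> carries regularity from one chart at p to the others.\<close>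

lemma (in surface) surface_reg_local:
  assumes P: "plane_regularity P"
    and "\<And>p. p \<in> V \<Longrightarrow> \<exists>c\<in>X. \<exists>N. open N \<and> p \<in> N \<and> N \<subseteq> V \<inter> fst c \<and> P (g \<circ> chart_inv c) (snd c ` N)"
  shows "surface_reg P X V g"
  unfolding surface_reg_def
proof (intro conjI ballI)
  interpret plane_regularity P by fact
  show "open V"
  proof (rule open_subopen[THEN iffD2], rule ballI)
    fix p assume "p \<in> V"
    from assms(2)[OF this] obtain N where "open N" "p \<in> N" "N \<subseteq> V" by auto
    then show "\<exists>T. open T \<and> p \<in> T \<and> T \<subseteq> V" by blast
  qed
  fix c assume c: "c \<in> X"
  show "P (g \<circ> chart_inv c) (snd c ` (fst c \<inter> V))"
  proof (rule P_local)
    fix z assume "z \<in> snd c ` (fst c \<inter> V)"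
    then obtain p where p: "p \<in> fst c" "p \<in> V" "z = snd c p" by blast
    obtain c' N where c': "c' \<in> X" "open N" "p \<in> N" "N \<subseteq> V \<inter> fst c'" "P (g \<circ> chart_inv c') (snd c' ` N)"
      using assms(2)[OF p(2)] by blast
    let ?T = "snd c ` (fst c \<inter> N)"
    have T: "open ?T" using open_chart_image[OF c c'(2)] .
    have "snd c' ` N = snd c' ` (fst c' \<inter> N)"
      using c'(4) by (simp add: Int_absorb1)
    then have T': "open (snd c' ` N)" using open_chart_image[OF c'(1,2)] by simp
    have "P (\<lambda>z. (g \<circ> chart_inv c') ((snd c' \<circ> chart_inv c) z)) ?T"
    proof (rule P_compose[OF T T' _ c'(5)])
      show "snd c' \<circ> chart_inv c holomorphic_on ?T"
        by (rule holomorphic_on_subset[OF transition_holomorphic[OF c c'(1)]]) (use c'(4) in auto)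
      show "(snd c' \<circ> chart_inv c) ` ?T \<subseteq> snd c' ` N"
        using c by auto
    qed
    then have "P (g \<circ> chart_inv c) ?T"
      by (rule P_cong[OF _ T]) (use c c' in auto)
    moreover have "z \<in> ?T" using p c' by blast
    moreover have "?T \<subseteq> snd c ` (fst c \<inter> V)" using c'(4) by blast
    ultimately show "\<exists>T. open T \<and> z \<in> T \<and> T \<subseteq> snd c ` (fst c \<inter> V) \<and> P (g \<circ> chart_inv c) T"
      using T by blast
  qed
qed

lemma (in surface) surface_reg_function_sheaf:
  assumes "plane_regularity P"
  shows "function_sheaf (surface_reg P X)"
proof -
  interpret plane_regularity P by fact
  have sub: "snd c ` (fst c \<inter> W) \<subseteq> snd c ` (fst c \<inter> V)" if "W \<subseteq> V" for c :: "'x chart" and V W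
    using that by blast
  show ?thesis
  proof
    show "surface_reg P X V h" if "surface_reg P X V g" "\<And>p. p \<in> V \<Longrightarrow> g p = h p" for V g h
      unfolding surface_reg_def
    proof (intro conjI ballI)
      show V: "open V" using that(1) by (simp add: surface_reg_def)
      show "P (h \<circ> chart_inv c) (snd c ` (fst c \<inter> V))" if c: "c \<in> X" for c
        by (rule P_cong[of "g \<circ> chart_inv c"])
          (use c V \<open>surface_reg P X V g\<close> open_chart_image \<open>\<And>p. p \<in> V \<Longrightarrow> g p = h p\<close> in \<open>auto simp: surface_reg_def\<close>)
    qed
    show "surface_reg P X W g" if "surface_reg P X V g" "open W" "W \<subseteq> V" for V W g
      unfolding surface_reg_def
    proof (intro conjI ballI)
      show "P (g \<circ> chart_inv c) (snd c ` (fst c \<inter> W))" if "c \<in> X" for c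
        by (rule P_subset[OF _ sub[OF \<open>W \<subseteq> V\<close>]])
          (use \<open>surface_reg P X V g\<close> \<open>c \<in> X\<close> in \<open>simp add: surface_reg_def\<close>)
    qed fact
    show "surface_reg P X V g" if loc: "\<And>p. p \<in> V \<Longrightarrow> \<exists>N. p \<in> N \<and> N \<subseteq> V \<and> surface_reg P X N g" for V g
    proof (rule surface_reg_local[OF assms])
      fix p assume "p \<in> V"
      then obtain N where N: "p \<in> N" "N \<subseteq> V" "surface_reg P X N g" using loc by blast
      obtain c where c: "c \<in> X" "p \<in> fst c" by (rule chart_at)
      show "\<exists>c\<in>X. \<exists>N. open N \<and> p \<in> N \<and> N \<subseteq> V \<inter> fst c \<and> P (g \<circ> chart_inv c) (snd c ` N)"
        using N c open_chart[OF c(1)] by (intro bexI[of _ c] exI[of _ "fst c \<inter> N"]) (auto simp: surface_reg_def)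
    qed
    show "surface_reg P X V (\<lambda>p. g p + h p)" if "surface_reg P X V g" "surface_reg P X V h" for V g h
      using that P_add open_chart_image unfolding surface_reg_def by (simp add: o_def)
    show "surface_reg P X V (\<lambda>p. g p * h p)" if "surface_reg P X V g" "surface_reg P X V h" for V g h
      using that P_mult open_chart_image unfolding surface_reg_def by (simp add: o_def)
    show "surface_reg P X V (\<lambda>p. inverse (g p))" if "surface_reg P X V g" "\<And>p. p \<in> V \<Longrightarrow> g p \<noteq> 0" for V g
      unfolding surface_reg_def
    proof (intro conjI ballI)
      show "open V" using that by (simp add: surface_reg_def)
      show "P ((\<lambda>p. inverse (g p)) \<circ> chart_inv c) (snd c ` (fst c \<inter> V))" if c: "c \<in> X" for c
      proof -
        have "(g \<circ> chart_inv c) z \<noteq> 0" if "z \<in> snd c ` (fst c \<inter> V)" for z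
          using chart_inv_in[OF c that] \<open>\<And>p. p \<in> V \<Longrightarrow> g p \<noteq> 0\<close> by simp
        from P_inverse[OF open_chart_image[OF c \<open>open V\<close>] _ this] show ?thesis
          using \<open>surface_reg P X V g\<close> c by (simp add: surface_reg_def o_def)
      qed
    qed
  qed (auto simp: surface_reg_def o_def P_const)
qed

context surface
begin

sublocale hol: function_sheaf "holomorphic_fun X"
  unfolding holomorphic_fun_surface_reg
  by (rule surface_reg_function_sheaf) unfold_locales

sublocale smooth: function_sheaf "smooth_fun X"
  unfolding smooth_fun_surface_reg
  by (rule surface_reg_function_sheaf) unfold_locales

lemma holomorphic_imp_smooth: "holomorphic_fun X V g \<Longrightarrow> smooth_fun X V g"
  unfolding holomorphic_fun_def smooth_fun_def
  using Ck_on_holomorphic open_chart_image by blast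

lemma smooth_fun_cnj: "smooth_fun X V g \<Longrightarrow> smooth_fun X V (\<lambda>p. cnj (g p))"
  unfolding smooth_fun_def
  using Ck_on_linear[OF open_chart_image bounded_linear_cnj] by (simp add: o_def)

lemma holomorphic_chart: "c \<in> X \<Longrightarrow> holomorphic_fun X (fst c) (snd c)"
  unfolding holomorphic_fun_def using transition_holomorphic open_chart by blast

lemma holomorphic_map_id: "holomorphic_map X X id"
  unfolding holomorphic_map_def using transition_holomorphic by simp

end

lemma holomorphic_map_vimage_open: "holomorphic_map Y X f \<Longrightarrow> open V \<Longrightarrow> open (f -` V)"
  unfolding holomorphic_map_def using open_vimage by blast

locale surface_map = Y: surface Y + X: surface X
  for Y :: "('y::t2_space) chart set" and X :: "('x::t2_space) chart set" +
  fixes f :: "'y \<Rightarrow> 'x"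
  assumes holomorphic_map: "holomorphic_map Y X f"
begin

lemma vimage_open: "open V \<Longrightarrow> open (f -` V)"
  by (rule holomorphic_map_vimage_open[OF holomorphic_map])

lemma surface_reg_pullback:
  assumes P: "plane_regularity P" and g: "surface_reg P X V g"
  shows "surface_reg P Y (f -` V) (\<lambda>q. g (f q))"
proof (rule Y.surface_reg_local[OF P])
  interpret plane_regularity P by fact
  have V: "open V" using g by (simp add: surface_reg_def)
  fix q assume q: "q \<in> f -` V"
  obtain d where d: "d \<in> Y" "q \<in> fst d" by (rule Y.chart_at)
  obtain c where c: "c \<in> X" "f q \<in> fst c" by (rule X.chart_at)
  let ?N = "fst d \<inter> f -` (fst c \<inter> V)"
  have N: "open ?N" 
    by (rule open_Int[OF Y.open_chart[OF d(1)] vimage_open[OF open_Int[OF X.open_chart[OF c(1)] V]]])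
  have T: "open (snd d ` ?N)"
    by (rule Y.open_chart_image[OF d(1) vimage_open[OF open_Int[OF X.open_chart[OF c(1)] V]]])
  have "P (\<lambda>z. (g \<circ> chart_inv c) ((snd c \<circ> f \<circ> chart_inv d) z)) (snd d ` ?N)"
  proof (rule P_compose[where g = "g \<circ> chart_inv c" and h = "snd c \<circ> f \<circ> chart_inv d",
        OF T X.open_chart_image[OF c(1) V]])
    show "snd c \<circ> f \<circ> chart_inv d holomorphic_on snd d ` ?N"
      by (rule holomorphic_on_subset[of _ "snd d ` (fst d \<inter> f -` fst c)"])
        (use holomorphic_map d c in \<open>auto simp: holomorphic_map_def\<close>)
    show "P (g \<circ> chart_inv c) (snd c ` (fst c \<inter> V))"
      using g c by (simp add: surface_reg_def)
    show "(snd c \<circ> f \<circ> chart_inv d) ` snd d ` ?N \<subseteq> snd c ` (fst c \<inter> V)"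
      using d by auto
  qed
  then have "P ((\<lambda>q. g (f q)) \<circ> chart_inv d) (snd d ` ?N)"
    by (rule P_cong[OF _ T]) (use d c in auto)
  then show "\<exists>c\<in>Y. \<exists>N. open N \<and> q \<in> N \<and> N \<subseteq> f -` V \<inter> fst c \<and> P ((\<lambda>q. g (f q)) \<circ> chart_inv c) (snd c ` N)"
    using d c q N by (intro bexI[of _ d] exI[of _ ?N]) auto
qed

lemma holomorphic_fun_pullback: "holomorphic_fun X V g \<Longrightarrow> holomorphic_fun Y (f -` V) (\<lambda>q. g (f q))"
  unfolding holomorphic_fun_surface_reg
  by (rule surface_reg_pullback) unfold_locales

lemma smooth_fun_pullback: "smooth_fun X V g \<Longrightarrow> smooth_fun Y (f -` V) (\<lambda>q. g (f q))"
  unfolding smooth_fun_surface_reg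
  by (rule surface_reg_pullback) unfold_locales

end

subsection \<open>Derivatives in charts\<close>

lemma d_z_wz: "d_z c g p = wz (g \<circ> chart_inv c) (snd c p)"
  and d_zbar_wzbar: "d_zbar c g p = wzbar (g \<circ> chart_inv c) (snd c p)"
  by (simp_all add: d_z_def d_zbar_def wz_def wzbar_def Let_def)

context surface
begin

lemma d_cong:
  assumes "c \<in> X" "open V" "p \<in> V \<inter> fst c" "\<And>q. q \<in> V \<Longrightarrow> g q = h q"
  shows "d_z c g p = d_z c h p" "d_zbar c g p = d_zbar c h p"
proof -
  have "snd c p \<in> snd c ` (fst c \<inter> V)" using assms(3) by blast
  moreover have "(g \<circ> chart_inv c) z = (h \<circ> chart_inv c) z" if "z \<in> snd c ` (fst c \<inter> V)" for z
    using chart_inv_in[OF assms(1) that] assms(4) by simp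
  ultimately show "d_z c g p = d_z c h p" "d_zbar c g p = d_zbar c h p"
    using wz_cong_open[OF open_chart_image[OF assms(1,2)]] unfolding d_z_wz d_zbar_wzbar by blast+
qed

lemma smooth_fun_differentiable:
  assumes "smooth_fun X V g" "c \<in> X" "p \<in> V \<inter> fst c"
  shows "(g \<circ> chart_inv c) differentiable (at (snd c p))"
proof -
  have "Ck_on (Suc 0) (g \<circ> chart_inv c) (snd c ` (fst c \<inter> V))"
    using assms unfolding smooth_fun_def by blast
  then show ?thesis using assms(3) by auto
qed

lemma d_add:
  assumes "smooth_fun X V g" "smooth_fun X V h" "c \<in> X" "p \<in> V \<inter> fst c"
  shows "d_z c (\<lambda>q. g q + h q) p = d_z c g p + d_z c h p"
    "d_zbar c (\<lambda>q. g q + h q) p = d_zbar c g p + d_zbar c h p"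
  using wz_add[OF smooth_fun_differentiable[OF assms(1,3,4)] smooth_fun_differentiable[OF assms(2,3,4)]]
  by (simp_all add: d_z_wz d_zbar_wzbar o_def)

lemma d_mult:
  assumes "smooth_fun X V g" "smooth_fun X V h" "c \<in> X" "p \<in> V \<inter> fst c"
  shows "d_z c (\<lambda>q. g q * h q) p = g p * d_z c h p + d_z c g p * h p"
    "d_zbar c (\<lambda>q. g q * h q) p = g p * d_zbar c h p + d_zbar c g p * h p"
  using wz_mult[OF smooth_fun_differentiable[OF assms(1,3,4)] smooth_fun_differentiable[OF assms(2,3,4)]] assms
  by (simp_all add: d_z_wz d_zbar_wzbar o_def)

lemma d_const [simp]: "d_z c (\<lambda>q. a) p = 0" "d_zbar c (\<lambda>q. a) p = 0"
  by (simp_all add: d_z_def d_zbar_def o_def)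

lemma d_sum:
  assumes "open V" "\<And>i. i \<in> I \<Longrightarrow> smooth_fun X V (g i)" "c \<in> X" "p \<in> V \<inter> fst c"
  shows "d_z c (\<lambda>q. \<Sum>i\<in>I. g i q) p = (\<Sum>i\<in>I. d_z c (g i) p) \<and>
    d_zbar c (\<lambda>q. \<Sum>i\<in>I. g i q) p = (\<Sum>i\<in>I. d_zbar c (g i) p)"
  using assms(2)
proof (induction I rule: infinite_finite_induct)
  case (insert i I)
  have "smooth_fun X V (\<lambda>q. \<Sum>i\<in>I. g i q)"
    using insert by (intro smooth.R_sum assms(1)) auto
  then show ?case using insert d_add[of V "g i" "\<lambda>q. \<Sum>i\<in>I. g i q" c p] assms by simp
qed auto

lemma d_cnj:
  assumes "smooth_fun X V g" "c \<in> X" "p \<in> V \<inter> fst c"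
  shows "d_z c (\<lambda>q. cnj (g q)) p = cnj (d_zbar c g p)" "d_zbar c (\<lambda>q. cnj (g q)) p = cnj (d_z c g p)"
  using wz_cnj[OF smooth_fun_differentiable[OF assms]]
  by (simp_all add: d_z_wz d_zbar_wzbar o_def)

lemma holomorphic_fun_deriv:
  assumes "holomorphic_fun X V g" "c \<in> X" "p \<in> V \<inter> fst c"
  shows "((g \<circ> chart_inv c) has_field_derivative deriv (g \<circ> chart_inv c) (snd c p)) (at (snd c p))"
  using assms open_chart_image[OF assms(2), of V]
  by (intro holomorphic_derivI[of _ "snd c ` (fst c \<inter> V)"]) (auto simp: holomorphic_fun_def)

lemma d_holomorphic:
  assumes "holomorphic_fun X V g" "c \<in> X" "p \<in> V \<inter> fst c"
  shows "d_zbar c g p = 0" "d_z c g p = deriv (g \<circ> chart_inv c) (snd c p)"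
  using wz_holomorphic[OF holomorphic_fun_deriv[OF assms]] by (simp_all add: d_z_wz d_zbar_wzbar)

lemma smooth_fun_d:
  assumes "smooth_fun X V g" "c \<in> X"
  shows "smooth_fun X (V \<inter> fst c) (d_z c g)" "smooth_fun X (V \<inter> fst c) (d_zbar c g)"
proof -
  let ?S = "snd c ` (fst c \<inter> V)" and ?g = "g \<circ> chart_inv c"
  have S: "open ?S" and V: "open V"
    using open_chart_image assms by (auto simp: smooth_fun_def)
  have g: "Ck_on k ?g ?S" for k using assms by (auto simp: smooth_fun_def)
  \<comment> \<open>\<open>d_z c g\<close> refers to the single chart c, so its smoothness is tested
    there and spreads to the other charts by \<open>surface_reg_local\<close>.\<close>
  have *: "smooth_fun X (V \<inter> fst c) h" if "\<And>z. z \<in> ?S \<Longrightarrow> h (chart_inv c z) = w z" "\<And>k. Ck_on k w ?S" for h w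
    unfolding smooth_fun_surface_reg
  proof (rule surface_reg_local)
    show "plane_regularity smooth_reg" by unfold_locales
    fix p assume p: "p \<in> V \<inter> fst c"
    have "Ck_on k (h \<circ> chart_inv c) ?S" for k
      using that(2)[of k] Ck_on_cong[OF S, of "h \<circ> chart_inv c" w k] that(1) by simp
    then show "\<exists>c'\<in>X. \<exists>N. open N \<and> p \<in> N \<and> N \<subseteq> V \<inter> fst c \<inter> fst c' \<and> (\<forall>k. Ck_on k (h \<circ> chart_inv c') (snd c' ` N))"
      using assms(2) p V open_chart[OF assms(2)] by (intro bexI[of _ c] exI[of _ "fst c \<inter> V"]) auto
  qed
  show "smooth_fun X (V \<inter> fst c) (d_z c g)"
    by (rule *[of _ "wz ?g"]) (use Ck_on_wz[OF S g] assms in \<open>auto simp: d_z_wz\<close>)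
  show "smooth_fun X (V \<inter> fst c) (d_zbar c g)"
    by (rule *[of _ "wzbar ?g"]) (use Ck_on_wz[OF S g] assms in \<open>auto simp: d_zbar_wzbar\<close>)
qed

lemma d_z_d_zbar_commute:
  assumes "smooth_fun X V g" "c \<in> X" "p \<in> V \<inter> fst c"
  shows "d_z c (d_zbar c g) p = d_zbar c (d_z c g) p"
proof -
  let ?S = "snd c ` (fst c \<inter> V)" and ?g = "g \<circ> chart_inv c"
  have S: "open ?S" and p: "snd c p \<in> ?S"
    using open_chart_image assms by (auto simp: smooth_fun_def)
  have "wz (d_zbar c g \<circ> chart_inv c) (snd c p) = wz (wzbar ?g) (snd c p)"
    by (rule wz_cong_open[OF S p]) (use assms(2) in \<open>auto simp: d_zbar_wzbar\<close>)
  also have "\<dots> = wzbar (wz ?g) (snd c p)"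
  proof (rule wz_wzbar_commute[OF S _ p])
    show "Ck_on (Suc (Suc 0)) ?g ?S" using assms unfolding smooth_fun_def by blast
  qed
  also have "\<dots> = wzbar (d_z c g \<circ> chart_inv c) (snd c p)"
    by (rule wz_cong_open[OF S p]) (use assms(2) in \<open>auto simp: d_z_wz\<close>)
  finally show ?thesis by (simp add: d_z_wz[of _ "d_zbar c g"] d_zbar_wzbar[of _ "d_z c g"])
qed

text \<open>The Cauchy-Riemann equations. This converts the vanishing of the (0,1) part in
  \<open>dbar_hol\<close> into holomorphy of coefficients.\<close>

lemma holomorphic_fun_iff_d_zbar:
  "holomorphic_fun X V g \<longleftrightarrow> smooth_fun X V g \<and> (\<forall>c\<in>X. \<forall>p\<in>V \<inter> fst c. d_zbar c g p = 0)"
proof (intro iffI conjI ballI)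
  assume *: "smooth_fun X V g \<and> (\<forall>c\<in>X. \<forall>p\<in>V \<inter> fst c. d_zbar c g p = 0)"
  show "holomorphic_fun X V g"
    unfolding holomorphic_fun_def
  proof (intro conjI ballI)
    show V: "open V" using * smooth.R_open by blast
    fix c assume c: "c \<in> X"
    show "g \<circ> chart_inv c holomorphic_on snd c ` (fst c \<inter> V)"
    proof (rule holomorphic_on_wzbar[OF open_chart_image[OF c V]])
      fix z assume "z \<in> snd c ` (fst c \<inter> V)"
      then obtain p where p: "p \<in> V \<inter> fst c" "z = snd c p" by blast
      show "g \<circ> chart_inv c differentiable at z"
        using smooth_fun_differentiable[OF _ c p(1)] * p(2) by blast
      show "wzbar (g \<circ> chart_inv c) z = 0"
        using * c p by (simp add: d_zbar_wzbar[symmetric])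
    qed
  qed
qed (use holomorphic_imp_smooth d_holomorphic in auto)

lemma holomorphic_fun_d_z:
  assumes "holomorphic_fun X V g" "c \<in> X"
  shows "holomorphic_fun X (V \<inter> fst c) (d_z c g)"
  unfolding holomorphic_fun_def
proof (intro conjI ballI)
  show "open (V \<inter> fst c)" using assms open_chart hol.R_open by blast
next
  fix c' assume c': "c' \<in> X"
  have V: "open V" using assms hol.R_open by blast
  have "(\<lambda>z. (deriv (g \<circ> chart_inv c)) ((snd c \<circ> chart_inv c') z)) holomorphic_on snd c' ` (fst c' \<inter> (V \<inter> fst c))"
  proof (rule hol_reg.P_compose[where g = "deriv (g \<circ> chart_inv c)" and h = "snd c \<circ> chart_inv c'"
        and T = "snd c ` (fst c \<inter> V)"])
    show "open (snd c' ` (fst c' \<inter> (V \<inter> fst c)))" "open (snd c ` (fst c \<inter> V))"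
      using open_chart_image c' assms(2) V open_chart by blast+
    show "snd c \<circ> chart_inv c' holomorphic_on snd c' ` (fst c' \<inter> (V \<inter> fst c))"
      by (rule holomorphic_on_subset[OF transition_holomorphic[OF c' assms(2)]]) auto
    show "deriv (g \<circ> chart_inv c) holomorphic_on snd c ` (fst c \<inter> V)"
      using assms open_chart_image[OF assms(2) V] by (intro holomorphic_deriv) (auto simp: holomorphic_fun_def)
    show "(snd c \<circ> chart_inv c') ` snd c' ` (fst c' \<inter> (V \<inter> fst c)) \<subseteq> snd c ` (fst c \<inter> V)"
      using c' by auto
  qed
  then show "d_z c g \<circ> chart_inv c' holomorphic_on snd c' ` (fst c' \<inter> (V \<inter> fst c))"
    by (rule holomorphic_transform) (use c' assms d_holomorphic(2)[OF assms] in auto)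
qed

end

context surface_map
begin

lemma jacobian_d_z:
  assumes "d \<in> Y" "c \<in> X" "q \<in> fst d \<inter> f -` fst c"
  shows "chart_jacobian d c f q = d_z d (\<lambda>q. snd c (f q)) q"
  using Y.d_holomorphic(2)[OF holomorphic_fun_pullback[OF X.holomorphic_chart[OF assms(2)]] assms(1), of q] assms
  by (simp add: chart_jacobian_def o_def)

lemma holomorphic_jacobian:
  assumes "d \<in> Y" "c \<in> X"
  shows "holomorphic_fun Y (fst d \<inter> f -` fst c) (chart_jacobian d c f)"
proof -
  have "holomorphic_fun Y (f -` fst c \<inter> fst d) (d_z d (\<lambda>q. snd c (f q)))"
    by (rule Y.holomorphic_fun_d_z[OF holomorphic_fun_pullback[OF X.holomorphic_chart[OF assms(2)]] assms(1)])
  then have "holomorphic_fun Y (fst d \<inter> f -` fst c) (d_z d (\<lambda>q. snd c (f q)))"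
    by (simp add: Int_commute)
  then show ?thesis by (rule Y.hol.R_cong) (use jacobian_d_z assms in auto)
qed

lemma d_chain:
  assumes "smooth_fun X V g" "d \<in> Y" "c \<in> X" "q \<in> fst d" "f q \<in> fst c" "f q \<in> V"
  shows "d_z d (\<lambda>q. g (f q)) q = chart_jacobian d c f q * d_z c g (f q)"
    "d_zbar d (\<lambda>q. g (f q)) q = cnj (chart_jacobian d c f q) * d_zbar c g (f q)"
proof -
  let ?h = "snd c \<circ> f \<circ> chart_inv d"
  let ?S = "snd d ` (fst d \<inter> f -` (fst c \<inter> V))"
  have S: "open ?S" "snd d q \<in> ?S"
    using assms vimage_open[OF open_Int[OF X.open_chart[OF assms(3)] X.smooth.R_open[OF assms(1)]]]
    by (auto intro!: Y.open_chart_image simp del: vimage_Int)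
  have h: "(?h has_field_derivative chart_jacobian d c f q) (at (snd d q))"
    using Y.holomorphic_fun_deriv[OF holomorphic_fun_pullback[OF X.holomorphic_chart[OF assms(3)]] assms(2), of q] assms
    by (simp add: chart_jacobian_def o_def)
  have g: "(g \<circ> chart_inv c) differentiable (at (?h (snd d q)))"
    using X.smooth_fun_differentiable[OF assms(1,3), of "f q"] assms by simp
  have "wz ((\<lambda>q. g (f q)) \<circ> chart_inv d) (snd d q) = wz (\<lambda>z. (g \<circ> chart_inv c) (?h z)) (snd d q)"
    "wzbar ((\<lambda>q. g (f q)) \<circ> chart_inv d) (snd d q) = wzbar (\<lambda>z. (g \<circ> chart_inv c) (?h z)) (snd d q)"
    by (rule wz_cong_open[OF S]; use assms in auto)+
  then show "d_z d (\<lambda>q. g (f q)) q = chart_jacobian d c f q * d_z c g (f q)"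
    "d_zbar d (\<lambda>q. g (f q)) q = cnj (chart_jacobian d c f q) * d_zbar c g (f q)"
    using wz_compose_holomorphic[OF h g] assms by (simp_all add: d_z_wz d_zbar_wzbar o_def)
qed

end

text \<open>Chart changes are the case f = \<open>id\<close>, so the Jacobians
  \<open>chart_jacobian c c' id\<close> inherit the chain rules proved for a general map.\<close>

sublocale surface \<subseteq> self: surface_map X X id
  by unfold_locales (rule holomorphic_map_id)

context surface_map
begin

text \<open>Together with the next lemma these are the cocycle rules of the Jacobian: this one makes
  pulled back forms transform correctly between charts of Y, the other makes them independent of the
  chart of X.\<close>

lemma jacobian_change_source:
  assumes "d \<in> Y" "d' \<in> Y" "c \<in> X" "q \<in> fst d" "q \<in> fst d'" "f q \<in> fst c"
  shows "chart_jacobian d c f q = chart_jacobian d d' id q * chart_jacobian d' c f q"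
proof -
  have "smooth_fun Y (f -` fst c) (\<lambda>q. snd c (f q))"
    by (intro Y.holomorphic_imp_smooth holomorphic_fun_pullback X.holomorphic_chart assms)
  from Y.self.d_chain(1)[OF this assms(1,2), of q] show ?thesis
    using assms by (simp add: jacobian_d_z)
qed

lemma jacobian_change_target:
  assumes "d \<in> Y" "c \<in> X" "c' \<in> X" "q \<in> fst d" "f q \<in> fst c" "f q \<in> fst c'"
  shows "chart_jacobian d c f q = chart_jacobian d c' f q * chart_jacobian c' c id (f q)"
proof -
  have "smooth_fun X (fst c) (snd c)"
    by (intro X.holomorphic_imp_smooth X.holomorphic_chart assms)
  from d_chain(1)[OF this assms(1,3), of q] show ?thesis
    using assms X.self.jacobian_d_z[of c' c "f q"] by (simp add: jacobian_d_z)
qed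

end

no_notation fps_nth (infixl \<open>$\<close> 75)

section \<open>Bundles over a sheaf of regular functions\<close>

subsection \<open>Matrices and frames\<close>

lemma matrix_inv_right_invertible: "invertible A \<Longrightarrow> A ** matrix_inv A = mat 1"
  and matrix_inv_left_invertible: "invertible A \<Longrightarrow> matrix_inv A ** A = mat 1"
  for A :: "'a::semiring_1^'n^'n"
  unfolding invertible_def matrix_inv_def by (metis (mono_tags, lifting) someI_ex)+

lemma matrix_inv_vec [simp]:
  fixes A :: "'a::semiring_1^'n^'n"
  assumes "invertible A"
  shows "A *v (matrix_inv A *v v) = v" "matrix_inv A *v (A *v v) = v"
  using assms by (simp_all add: matrix_vector_mul_assoc matrix_inv_right_invertible matrix_inv_left_invertible)

lemma invertible_matrix_inv:
  "invertible A \<Longrightarrow> invertible (matrix_inv A)" for A :: "'a::semiring_1^'n^'n"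
  using matrix_inv_right_invertible matrix_inv_left_invertible invertible_def by blast

text \<open>Cramer's rule exhibits the inverse through sums, products and one quotient of entries;
  regularity of inverse matrices then follows from the ring operations of the sheaf.\<close>

lemma matrix_inv_entry_cramer:
  fixes A :: "'a::field^'n^'n"
  assumes "invertible A"
  shows "(matrix_inv A *v b) $ k = det (\<chi> i j. if j = k then b $ i else A $ i $ j) / det A"
proof -
  have "matrix_inv A *v b = (\<chi> k. det (\<chi> i j. if j = k then b $ i else A $ i $ j) / det A)"
    using cramer[of A "matrix_inv A *v b" b] assms by (simp add: invertible_det_nz)
  then show ?thesis by (simp add: vec_eq_iff)
qed

definition comb :: "('n::finite \<Rightarrow> ('x, 'n) sect) \<Rightarrow> ('n \<Rightarrow> 'x \<Rightarrow> complex) \<Rightarrow> ('x, 'n) sect" where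
  "comb e u p = (\<Sum>j\<in>UNIV. u j p *s e j p)"

definition frame_matrix :: "('n::finite \<Rightarrow> ('x, 'n) sect) \<Rightarrow> 'x \<Rightarrow> complex^'n^'n" where
  "frame_matrix e p = (\<chi> i j. e j p $ i)"

definition coords :: "('n::finite \<Rightarrow> ('x, 'n) sect) \<Rightarrow> ('x, 'n) sect \<Rightarrow> 'n \<Rightarrow> 'x \<Rightarrow> complex" where
  "coords e s j p = (matrix_inv (frame_matrix e p) *v s p) $ j"

lemma frame_matrix_vec: "frame_matrix e p *v a = (\<Sum>j\<in>UNIV. (a $ j) *s e j p)"
  by (simp add: frame_matrix_def matrix_vector_mult_def vec_eq_iff mult.commute)

lemma invertible_frame_matrix_iff:
  "invertible (frame_matrix e p) \<longleftrightarrow> bij (\<lambda>a :: complex^'n::finite. \<Sum>j\<in>UNIV. (a $ j) *s e j p)"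
proof -
  have eq: "(\<lambda>a. \<Sum>j\<in>UNIV. (a $ j) *s e j p) = (*v) (frame_matrix e p)"
    by (simp add: fun_eq_iff frame_matrix_vec)
  show ?thesis
  proof
    assume "invertible (frame_matrix e p)"
    then show "bij (\<lambda>a. \<Sum>j\<in>UNIV. (a $ j) *s e j p)"
      unfolding eq by (intro o_bij[of "(*v) (matrix_inv (frame_matrix e p))"]) (auto simp: o_def)
  next
    assume "bij (\<lambda>a. \<Sum>j\<in>UNIV. (a $ j) *s e j p)"
    then have "inj ((*v) (frame_matrix e p))" unfolding eq by (rule bij_is_inj)
    then show "invertible (frame_matrix e p)"
      by (metis invertible_left_inverse matrix_left_invertible_injective)
  qed
qed

lemma matrix_mult_axis [simp]: "(M *v axis j 1) $ i = M $ i $ j" for M :: "'a::comm_semiring_1^'n^'m"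
  by (simp add: matrix_vector_mult_def axis_def if_distrib cong: if_cong)

lemma frame_matrix_axis [simp]: "frame_matrix (\<lambda>j p. M p *v axis j 1) p = M p"
  by (simp add: frame_matrix_def vec_eq_iff)

lemma comb_coords: "invertible (frame_matrix e p) \<Longrightarrow> comb e (coords e s) p = s p"
  using frame_matrix_vec[of e p "matrix_inv (frame_matrix e p) *v s p"]
  by (simp add: comb_def coords_def)

lemma coords_comb:
  assumes "invertible (frame_matrix e p)" "s p = comb e u p"
  shows "coords e s j p = u j p"
proof -
  have "s p = frame_matrix e p *v (\<chi> j. u j p)"
    using assms(2) by (simp add: frame_matrix_vec comb_def)
  then show ?thesis using assms(1) by (simp add: coords_def)
qed

lemma comb_eq_iff:
  assumes "invertible (frame_matrix e p)"
  shows "comb e u p = comb e v p \<longleftrightarrow> (\<forall>j. u j p = v j p)"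
  using coords_comb[OF assms, of "comb e u" u] coords_comb[OF assms, of "comb e u" v]
  by (auto simp: comb_def)

lemma coords_add: "coords e (\<lambda>q. s q + t q) j p = coords e s j p + coords e t j p"
  by (simp add: coords_def matrix_vector_right_distrib)

lemma coords_scale: "coords e (\<lambda>q. g q *s s q) j p = g p * coords e s j p"
  by (simp add: coords_def vector_scalar_commute)

lemma coords_frame: "invertible (frame_matrix e p) \<Longrightarrow> coords e (e k) j p = (if j = k then 1 else 0)"
  by (rule coords_comb[where u = "\<lambda>j p. if j = k then 1 else 0"])
    (auto simp: comb_def if_distrib[of "\<lambda>a. a *s _"] cong: if_cong)

lemma mult_comb: "M *v comb e u p = (\<Sum>j\<in>UNIV. u j p *s (M *v e j p))"
  by (simp add: comb_def vec.sum vec.scale)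

context function_sheaf
begin

lemma R_det: "open V \<Longrightarrow> (\<And>i j. R V (\<lambda>p. M p $ i $ j)) \<Longrightarrow> R V (\<lambda>p. det (M p :: complex^'n^'n))"
  unfolding det_def by (intro R_sum R_mult R_const R_prod) auto

lemma R_matrix_inv_vec:
  fixes M :: "'x \<Rightarrow> complex^'n::finite^'n"
  assumes "open V" "\<And>i j. R V (\<lambda>p. M p $ i $ j)" "\<And>p. p \<in> V \<Longrightarrow> invertible (M p)"
    and "\<And>j. R V (\<lambda>p. s p $ j)"
  shows "R V (\<lambda>p. (matrix_inv (M p) *v s p) $ k)"
proof -
  have "R V (\<lambda>p. det (\<chi> i j. if j = k then s p $ i else M p $ i $ j) / det (M p))"
  proof (intro R_divide R_det assms)
    show "R V (\<lambda>p. (\<chi> i j. if j = k then s p $ i else M p $ i $ j) $ i $ j)" for i j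
      using assms by (cases "j = k") auto
    show "det (M p) \<noteq> 0" if "p \<in> V" for p using assms(3)[OF that] by (simp add: invertible_det_nz)
  qed
  then show ?thesis by (rule R_cong) (simp add: matrix_inv_entry_cramer assms(3))
qed

end

definition regular_frame ::
  "('x set \<Rightarrow> ('x \<Rightarrow> complex) \<Rightarrow> bool) \<Rightarrow> ('x::t2_space, 'n::finite) trivialisations \<Rightarrow> 'x set
     \<Rightarrow> ('n \<Rightarrow> ('x, 'n) sect) \<Rightarrow> bool"
where
  "regular_frame R E V e \<longleftrightarrow>
     open V \<and> (\<forall>j. regular_section R E V (e j)) \<and> (\<forall>p\<in>V. invertible (frame_matrix e p))"

lemma hol_frame_regular_frame: "hol_frame X = regular_frame (holomorphic_fun X)"
  by (auto simp: fun_eq_iff hol_frame_def regular_frame_def invertible_frame_matrix_iff regular_section_def)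

locale sheaf_bundle = function_sheaf R
  for R :: "('x::t2_space) set \<Rightarrow> ('x \<Rightarrow> complex) \<Rightarrow> bool" +
  fixes W :: "'x set" and E :: "('x, 'n::finite) trivialisations"
  assumes is_vector_bundle: "vector_bundle R W E"
begin

lemma triv_cover: "(\<Union>\<tau>\<in>E. fst \<tau>) = W"
  and triv_open: "\<tau> \<in> E \<Longrightarrow> open (fst \<tau>)"
  and triv_invertible: "\<tau> \<in> E \<Longrightarrow> p \<in> fst \<tau> \<Longrightarrow> invertible (snd \<tau> p)"
  and triv_transition: "\<tau> \<in> E \<Longrightarrow> \<tau>' \<in> E \<Longrightarrow>
    R (fst \<tau> \<inter> fst \<tau>') (\<lambda>p. (snd \<tau>' p ** matrix_inv (snd \<tau> p)) $ i $ j)"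
  using is_vector_bundle unfolding vector_bundle_def by simp_all

lemma triv_at: "p \<in> W \<Longrightarrow> \<exists>\<tau>\<in>E. p \<in> fst \<tau>"
  using triv_cover by blast

lemma open_W: "open W"
  using triv_cover triv_open by (metis (no_types, lifting) open_UN)

lemma section_open: "regular_section R E V s \<Longrightarrow> open V"
  and section_dom: "regular_section R E V s \<Longrightarrow> V \<subseteq> W"
  and section_triv: "regular_section R E V s \<Longrightarrow> \<tau> \<in> E \<Longrightarrow> R (fst \<tau> \<inter> V) (\<lambda>p. (snd \<tau> p *v s p) $ i)"
  unfolding regular_section_def triv_cover by simp_all

lemma section_subset:
  assumes "regular_section R E V s" "open N" "N \<subseteq> V"
  shows "regular_section R E N s"
  unfolding regular_section_def triv_cover
proof (intro conjI ballI allI)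
  show "R (fst \<tau> \<inter> N) (\<lambda>p. (snd \<tau> p *v s p) $ i)" if "\<tau> \<in> E" for \<tau> i
    by (rule R_subset[OF section_triv[OF assms(1) that]]) (use assms triv_open[OF that] in auto)
qed (use assms section_dom in auto)

lemma section_cong:
  assumes "regular_section R E V s" "\<And>p. p \<in> V \<Longrightarrow> s p = t p"
  shows "regular_section R E V t"
  unfolding regular_section_def triv_cover
proof (intro conjI ballI allI)
  show "R (fst \<tau> \<inter> V) (\<lambda>p. (snd \<tau> p *v t p) $ i)" if "\<tau> \<in> E" for \<tau> i
    by (rule R_cong[OF section_triv[OF assms(1) that]]) (use assms(2) in auto)
qed (use assms(1) section_open section_dom in auto)

lemma section_local:
  assumes "\<And>p. p \<in> V \<Longrightarrow> \<exists>N. p \<in> N \<and> N \<subseteq> V \<and> regular_section R E N s"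
  shows "regular_section R E V s"
  unfolding regular_section_def triv_cover
proof (intro conjI ballI allI)
  show "open V"
  proof (rule open_subopen[THEN iffD2], rule ballI)
    fix p assume "p \<in> V"
    then show "\<exists>T. open T \<and> p \<in> T \<and> T \<subseteq> V" using assms section_open by blast
  qed
  show "V \<subseteq> W"
  proof
    fix p assume "p \<in> V"
    then show "p \<in> W" using assms section_dom by blast
  qed
  fix \<tau> i assume \<tau>: "\<tau> \<in> E"
  show "R (fst \<tau> \<inter> V) (\<lambda>p. (snd \<tau> p *v s p) $ i)"
  proof (rule R_local)
    fix p assume p: "p \<in> fst \<tau> \<inter> V"
    then obtain N where N: "p \<in> N" "N \<subseteq> V" "regular_section R E N s" using assms by blast
    show "\<exists>N. p \<in> N \<and> N \<subseteq> fst \<tau> \<inter> V \<and> R N (\<lambda>p. (snd \<tau> p *v s p) $ i)"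
      using section_triv[OF N(3) \<tau>] N p by (intro exI[of _ "fst \<tau> \<inter> N"]) auto
  qed
qed

lemma section_add:
  assumes "regular_section R E V s" "regular_section R E V t"
  shows "regular_section R E V (\<lambda>p. s p + t p)"
  using assms by (simp add: regular_section_def matrix_vector_right_distrib R_add)

lemma section_scale:
  assumes "R V g" "regular_section R E V s"
  shows "regular_section R E V (\<lambda>p. g p *s s p)"
  unfolding regular_section_def triv_cover
proof (intro conjI ballI allI)
  show "R (fst \<tau> \<inter> V) (\<lambda>p. (snd \<tau> p *v (g p *s s p)) $ i)" if "\<tau> \<in> E" for \<tau> i
    using R_mult[OF R_subset[OF assms(1), of "fst \<tau> \<inter> V"] section_triv[OF assms(2) that]]
      triv_open[OF that] R_open[OF assms(1)] by (auto simp: vector_scalar_commute)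
qed (use assms section_open section_dom in auto)

lemma section_zero: "open V \<Longrightarrow> V \<subseteq> W \<Longrightarrow> regular_section R E V (\<lambda>p. 0)"
  by (auto simp: regular_section_def triv_cover intro!: R_const triv_open)

lemma section_sum:
  assumes "open V" "V \<subseteq> W" "\<And>i. i \<in> I \<Longrightarrow> regular_section R E V (s i)"
  shows "regular_section R E V (\<lambda>p. \<Sum>i\<in>I. s i p)"
  using assms(3)
  by (induction I rule: infinite_finite_induct) (simp_all add: section_add section_zero[OF assms(1,2)])

lemma section_diff:
  assumes "regular_section R E V s" "regular_section R E V t"
  shows "regular_section R E V (\<lambda>p. s p - t p)"
proof -
  have "regular_section R E V (\<lambda>p. s p + (-1) *s t p)"
    using assms section_open by (intro section_add section_scale R_const) auto
  then show ?thesis by (simp add: vector_sneg_minus1[symmetric])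
qed

lemma section_comb:
  assumes "regular_frame R E V e" "\<And>j. R V (u j)"
  shows "regular_section R E V (comb e u)"
  unfolding comb_def[abs_def]
  using assms section_dom by (intro section_sum section_scale) (auto simp: regular_frame_def)

lemma frame_triv:
  assumes "\<tau> \<in> E"
  shows "regular_frame R E (fst \<tau>) (\<lambda>j p. matrix_inv (snd \<tau> p) *v axis j 1)"
  unfolding regular_frame_def regular_section_def triv_cover
proof (intro conjI ballI allI)
  show "R (fst \<tau>' \<inter> fst \<tau>) (\<lambda>p. (snd \<tau>' p *v (matrix_inv (snd \<tau> p) *v axis j 1)) $ i)" if "\<tau>' \<in> E" for \<tau>' i j
    using triv_transition[OF assms that, of i j]
    by (simp add: matrix_vector_mul_assoc Int_commute)
  show "invertible (frame_matrix (\<lambda>j p. matrix_inv (snd \<tau> p) *v axis j 1) p)" if "p \<in> fst \<tau>" for p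
    using triv_invertible[OF assms that] by (simp add: invertible_matrix_inv)
qed (use assms triv_open[OF assms] triv_cover in auto)

lemma frame_subset: "regular_frame R E V e \<Longrightarrow> open N \<Longrightarrow> N \<subseteq> V \<Longrightarrow> regular_frame R E N e"
  unfolding regular_frame_def using section_subset by blast

lemma frame_at:
  assumes "p \<in> W"
  obtains V e where "regular_frame R E V e" "p \<in> V"
  using triv_at[OF assms] frame_triv by blast

text \<open>In a trivialisation T the coordinates u solve the linear system (T e) u = T s, whose
  matrix and right-hand side are regular by definition; Cramer's rule does the rest.\<close>

lemma R_coords:
  assumes "regular_frame R E V e" "regular_section R E V s"
  shows "R V (coords e s j)"
proof (rule R_local)
  fix p assume p: "p \<in> V"
  then obtain \<tau> where \<tau>: "\<tau> \<in> E" "p \<in> fst \<tau>" using triv_at section_dom[OF assms(2)] by blast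
  let ?N = "fst \<tau> \<inter> V" and ?T = "snd \<tau>"
  let ?M = "\<lambda>p. ?T p ** frame_matrix e p"
  have V: "open V" and inv: "\<And>p. p \<in> V \<Longrightarrow> invertible (frame_matrix e p)"
    and e: "\<And>j. regular_section R E V (e j)"
    using assms(1) by (auto simp: regular_frame_def)
  have "?M p $ i $ k = (?T p *v e k p) $ i" for p i k
    by (simp add: matrix_matrix_mult_def matrix_vector_mult_def frame_matrix_def)
  then have "R ?N (\<lambda>p. (matrix_inv (?M p) *v (?T p *v s p)) $ j)"
    using section_triv[OF assms(2) \<tau>(1)] section_triv[OF e \<tau>(1)] V triv_open[OF \<tau>(1)]
    by (intro R_matrix_inv_vec) (auto intro: invertible_mult triv_invertible[OF \<tau>(1)] inv)
  moreover have "matrix_inv (?M p) *v (?T p *v s p) = matrix_inv (frame_matrix e p) *v s p" if "p \<in> ?N" for p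
  proof -
    have i: "invertible (?M p)" using that by (intro invertible_mult triv_invertible[OF \<tau>(1)] inv) auto
    have "?T p *v s p = ?M p *v (matrix_inv (frame_matrix e p) *v s p)"
      using inv that by (simp add: matrix_vector_mul_assoc[symmetric])
    then show ?thesis using i by simp
  qed
  ultimately have "R ?N (coords e s j)"
    unfolding coords_def[abs_def] using R_cong[of ?N "\<lambda>p. (matrix_inv (?M p) *v (?T p *v s p)) $ j"] by simp
  then show "\<exists>N. p \<in> N \<and> N \<subseteq> V \<and> R N (coords e s j)"
    using p \<tau> by blast
qed

lemma section_iff_coords:
  assumes "regular_frame R E V e"
  shows "regular_section R E V s \<longleftrightarrow> (\<forall>j. R V (coords e s j))"
proof
  assume "\<forall>j. R V (coords e s j)"
  then have "regular_section R E V (comb e (coords e s))" using section_comb[OF assms] by blast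
  then show "regular_section R E V s"
    by (rule section_cong) (use assms in \<open>auto simp: regular_frame_def comb_coords\<close>)
qed (use R_coords assms in blast)

text \<open>Constant coordinates in a local frame. Since every vector of a fibre is the value of a
  section, an endomorphism is determined by its effect on sections.\<close>

lemma section_constant_coords:
  assumes "p \<in> W"
  shows "\<exists>V s. p \<in> V \<and> regular_section R E V s \<and> s p = v"
proof -
  obtain V e where e: "regular_frame R E V e" "p \<in> V" using frame_at[OF assms] .
  let ?u = "\<lambda>j q. (matrix_inv (frame_matrix e p) *v v) $ j"
  have "regular_section R E V (comb e ?u)"
    using e by (intro section_comb R_const) (auto simp: regular_frame_def)
  moreover have "comb e ?u p = v"
    using comb_coords[of e p "\<lambda>_. v"] e by (simp add: regular_frame_def comb_def coords_def)
  ultimately show ?thesis using e(2) by blast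
qed

end

subsection \<open>Pullback of bundles\<close>

locale sheaf_map = RX: function_sheaf RX + RY: function_sheaf RY
  for RX :: "('x::t2_space) set \<Rightarrow> ('x \<Rightarrow> complex) \<Rightarrow> bool"
    and RY :: "('y::t2_space) set \<Rightarrow> ('y \<Rightarrow> complex) \<Rightarrow> bool" +
  fixes f :: "'y \<Rightarrow> 'x"
  assumes sheaf_pullback: "RX V g \<Longrightarrow> RY (f -` V) (\<lambda>q. g (f q))"
    and preimage_open: "open V \<Longrightarrow> open (f -` V)"
begin

lemma vector_bundle_pullback:
  assumes "vector_bundle RX W E"
  shows "vector_bundle RY (f -` W) (pullback_bundle f E)"
proof -
  interpret sheaf_bundle RX W E by unfold_locales fact
  show ?thesis
    unfolding vector_bundle_def pullback_bundle_def
    using triv_cover triv_open triv_invertible preimage_open sheaf_pullback[OF triv_transition]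
    by auto
qed

lemma section_pullback:
  assumes "vector_bundle RX W E" "regular_section RX E V s"
  shows "regular_section RY (pullback_bundle f E) (f -` V) (\<lambda>q. s (f q))"
proof -
  interpret sheaf_bundle RX W E by unfold_locales fact
  show ?thesis
    unfolding regular_section_def pullback_bundle_def
    using section_open[OF assms(2)] section_dom[OF assms(2)] triv_cover preimage_open
      sheaf_pullback[OF section_triv[OF assms(2)]]
    by fastforce
qed

lemma frame_pullback:
  assumes "vector_bundle RX W E" "regular_frame RX E V e"
  shows "regular_frame RY (pullback_bundle f E) (f -` V) (\<lambda>j q. e j (f q))"
  using assms section_pullback[OF assms(1)] preimage_open
  by (auto simp: regular_frame_def frame_matrix_def)

end

context surface_map
begin

sublocale hol_map: sheaf_map "holomorphic_fun X" "holomorphic_fun Y" f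
  by unfold_locales (use holomorphic_fun_pullback vimage_open in auto)

sublocale smooth_map: sheaf_map "smooth_fun X" "smooth_fun Y" f
  by unfold_locales (use smooth_fun_pullback vimage_open in auto)

end

section \<open>Differential operators and their pullbacks\<close>

text \<open>The parameter \<alpha> lets one argument serve both operators: \<alpha> = 0 is the
  Leibniz rule of \<open>D_theta\<close>, \<alpha> = 1 that of \<open>D_nabla\<close>, and nothing
  in the pullback depends on which value it takes.\<close>

definition scaled_derivation :: "complex \<Rightarrow> 'x derivation" where
  "scaled_derivation \<alpha> c g p = (\<alpha> * d_z c g p, d_zbar c g p)"

lemma derivation_dbar_eq: "derivation_dbar = scaled_derivation 0"
  and derivation_d_eq: "derivation_d = scaled_derivation 1"
  by (simp_all add: fun_eq_iff derivation_dbar_def derivation_d_def scaled_derivation_def)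

lemma scaled_derivation_simps [simp]:
  "fst (scaled_derivation \<alpha> c g p) = \<alpha> * d_z c g p" "snd (scaled_derivation \<alpha> c g p) = d_zbar c g p"
  by (simp_all add: scaled_derivation_def)

locale operator = surface X
  for X :: "('x::t2_space) chart set" +
  fixes \<alpha> :: complex and W :: "'x set" and E :: "('x, 'n::finite) trivialisations"
    and A :: "('x, 'n) diffop"
  assumes smooth_bundle: "vector_bundle (smooth_fun X) W E"
    and diff_op: "diff_operator (scaled_derivation \<alpha>) X E A"
begin

sublocale sm: sheaf_bundle "smooth_fun X" W E
  by unfold_locales (rule smooth_bundle)

lemmas diff_op_unfolded = diff_op[unfolded diff_operator_def scaled_derivation_simps]

lemma A_smooth:
  assumes "smooth_section X E V s" "c \<in> X"
  shows "smooth_section X E (V \<inter> fst c) (\<lambda>p. fst (A s c p))"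
    "smooth_section X E (V \<inter> fst c) (\<lambda>p. snd (A s c p))"
  using conjunct1[OF diff_op_unfolded] assms by blast+

lemma A_chart:
  assumes "smooth_section X E V s" "c \<in> X" "c' \<in> X" "p \<in> V" "p \<in> fst c" "p \<in> fst c'"
  shows "fst (A s c p) = chart_jacobian c c' id p *s fst (A s c' p)"
    "snd (A s c p) = cnj (chart_jacobian c c' id p) *s snd (A s c' p)"
proof -
  have "A s c p = (chart_jacobian c c' id p *s fst (A s c' p), cnj (chart_jacobian c c' id p) *s snd (A s c' p))"
    using conjunct1[OF diff_op_unfolded] assms by blast
  then show "fst (A s c p) = chart_jacobian c c' id p *s fst (A s c' p)"
    "snd (A s c p) = cnj (chart_jacobian c c' id p) *s snd (A s c' p)" by simp_all
qed

lemma A_cong: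
  assumes "smooth_section X E V s" "smooth_section X E V t" "\<And>p. p \<in> V \<Longrightarrow> s p = t p" "c \<in> X" "p \<in> V" "p \<in> fst c"
  shows "A s c p = A t c p"
  using conjunct1[OF conjunct2[OF diff_op_unfolded]] assms by blast

lemma A_add:
  assumes "smooth_section X E V s" "smooth_section X E V t" "c \<in> X" "p \<in> V" "p \<in> fst c"
  shows "A (\<lambda>q. s q + t q) c p = A s c p + A t c p"
  using conjunct1[OF conjunct2[OF conjunct2[OF diff_op_unfolded]]] assms by blast

lemma A_scale:
  assumes "smooth_fun X V g" "smooth_section X E V s" "c \<in> X" "p \<in> V" "p \<in> fst c"
  shows "fst (A (\<lambda>q. g q *s s q) c p) = g p *s fst (A s c p) + (\<alpha> * d_z c g p) *s s p"
    "snd (A (\<lambda>q. g q *s s q) c p) = g p *s snd (A s c p) + d_zbar c g p *s s p"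
proof -
  have "A (\<lambda>q. g q *s s q) c p =
    (g p *s fst (A s c p) + (\<alpha> * d_z c g p) *s s p, g p *s snd (A s c p) + d_zbar c g p *s s p)"
    using conjunct2[OF conjunct2[OF conjunct2[OF diff_op_unfolded]]] assms by blast
  then show "fst (A (\<lambda>q. g q *s s q) c p) = g p *s fst (A s c p) + (\<alpha> * d_z c g p) *s s p"
    "snd (A (\<lambda>q. g q *s s q) c p) = g p *s snd (A s c p) + d_zbar c g p *s s p" by simp_all
qed

lemma A_zero:
  assumes "c \<in> X" "p \<in> W" "p \<in> fst c"
  shows "A (\<lambda>q. 0) c p = 0"
proof -
  have "smooth_section X E W (\<lambda>q. 0)" by (rule sm.section_zero) (auto simp: sm.open_W)
  from A_scale[OF smooth.R_const[OF sm.open_W, of 0] this assms(1,2,3)] show ?thesis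
    by (simp add: prod_eq_iff)
qed

lemma A_sum:
  assumes "open V" "V \<subseteq> W" "\<And>i. i \<in> I \<Longrightarrow> smooth_section X E V (s i)" "c \<in> X" "p \<in> V" "p \<in> fst c"
  shows "A (\<lambda>q. \<Sum>i\<in>I. s i q) c p = (\<Sum>i\<in>I. A (s i) c p)"
  using assms(3)
proof (induction I rule: infinite_finite_induct)
  case (insert i I)
  have "smooth_section X E V (\<lambda>q. \<Sum>i\<in>I. s i q)"
    by (rule sm.section_sum[OF assms(1,2)]) (use insert in auto)
  then show ?case using insert A_add[of V "s i" "\<lambda>q. \<Sum>i\<in>I. s i q" c p] assms by simp
qed (use A_zero[OF assms(4) _ assms(6)] assms(2,5) in auto)

lemma A_comb:
  assumes "open V" "\<And>j. smooth_section X E V (e j)" "\<And>j. smooth_fun X V (u j)" "c \<in> X" "p \<in> V" "p \<in> fst c"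
  shows "fst (A (comb e u) c p) = (\<Sum>j\<in>UNIV. (\<alpha> * d_z c (u j) p) *s e j p + u j p *s fst (A (e j) c p))"
    "snd (A (comb e u) c p) = (\<Sum>j\<in>UNIV. d_zbar c (u j) p *s e j p + u j p *s snd (A (e j) c p))"
proof -
  have "A (comb e u) c p = (\<Sum>j\<in>UNIV. A (\<lambda>q. u j q *s e j q) c p)"
    unfolding comb_def[abs_def]
    by (rule A_sum[OF assms(1) sm.section_dom[OF assms(2)] sm.section_scale[OF assms(3,2)] assms(4,5,6)])
  then show "fst (A (comb e u) c p) = (\<Sum>j\<in>UNIV. (\<alpha> * d_z c (u j) p) *s e j p + u j p *s fst (A (e j) c p))"
    "snd (A (comb e u) c p) = (\<Sum>j\<in>UNIV. d_zbar c (u j) p *s e j p + u j p *s snd (A (e j) c p))"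
    using A_scale[OF assms(3) assms(2) assms(4,5,6)] by (simp_all add: fst_sum snd_sum add.commute)
qed

end

text \<open>The algebra behind independence of the frame. The derivative of the transition matrix g
  enters once through the new coefficients and once through A applied to the old frame, and the two
  occurrences agree. J stands for the Jacobian in the (1,0) part and for its conjugate in the (0,1)
  part.\<close>

lemma change_of_frame_identity:
  fixes g :: "'n::finite \<Rightarrow> 'n \<Rightarrow> complex" and e e0 :: "'n \<Rightarrow> complex^'n"
  assumes "\<And>k. du0 k = (\<Sum>j\<in>UNIV. g k j * du j + J * dg k j * u j)"
    and "\<And>k. u0 k = (\<Sum>j\<in>UNIV. g k j * u j)"
    and "\<And>j. e j = (\<Sum>k\<in>UNIV. g k j *s e0 k)"
    and "\<And>j. Ae j = (\<Sum>k\<in>UNIV. dg k j *s e0 k + g k j *s Ae0 k)"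
  shows "(\<Sum>k\<in>UNIV. du0 k *s e0 k + (u0 k * J) *s Ae0 k) = (\<Sum>j\<in>UNIV. du j *s e j + (u j * J) *s Ae j)"
proof -
  have "(\<Sum>j\<in>UNIV. du j *s e j + (u j * J) *s Ae j) =
    (\<Sum>j\<in>UNIV. \<Sum>k\<in>UNIV. (g k j * du j + J * dg k j * u j) *s e0 k + (g k j * u j * J) *s Ae0 k)"
    unfolding assms(3,4)
    by (simp add: vec_eq_iff sum_distrib_left sum.distrib[symmetric] algebra_simps)
  also have "\<dots> = (\<Sum>k\<in>UNIV. \<Sum>j\<in>UNIV. (g k j * du j + J * dg k j * u j) *s e0 k + (g k j * u j * J) *s Ae0 k)"
    by (rule sum.swap)
  also have "\<dots> = (\<Sum>k\<in>UNIV. du0 k *s e0 k + (u0 k * J) *s Ae0 k)"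
    unfolding assms(1,2)
    by (simp add: vec_eq_iff sum_distrib_left sum_distrib_right sum.distrib algebra_simps)
  finally show ?thesis by simp
qed

lemma matrix_inv_matrix_inv:
  fixes A :: "'a::field^'n^'n"
  assumes "invertible A"
  shows "matrix_inv (matrix_inv A) = A"
proof -
  have "matrix_inv (matrix_inv A) = matrix_inv (matrix_inv A) ** (matrix_inv A ** A)"
    by (simp add: matrix_inv_left_invertible[OF assms])
  also have "\<dots> = (matrix_inv (matrix_inv A) ** matrix_inv A) ** A"
    by (simp only: matrix_mul_assoc)
  finally show ?thesis
    by (simp add: matrix_inv_left_invertible[OF invertible_matrix_inv[OF assms]])
qed

lemma pullback_op_scaled_derivation:
  "pullback_op (scaled_derivation \<alpha>) X f E A t d q =
     (let c = (SOME c. c \<in> X \<and> f q \<in> fst c);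
          T = snd (SOME \<tau>. \<tau> \<in> E \<and> f q \<in> fst \<tau>);
          e = (\<lambda>j p. matrix_inv (T p) *v axis j 1);
          u = (\<lambda>j q'. (T (f q') *v t q') $ j);
          J = chart_jacobian d c f q
      in (\<Sum>j\<in>UNIV. (\<alpha> * d_z d (u j) q) *s e j (f q) + (u j q * J) *s fst (A (e j) c (f q)),
          \<Sum>j\<in>UNIV. d_zbar d (u j) q *s e j (f q) + (u j q * cnj J) *s snd (A (e j) c (f q))))"
  by (simp add: pullback_op_def scaled_derivation_def)

locale pullback_operator = surface_map Y X f + operator X \<alpha> W E A
  for Y :: "('y::t2_space) chart set" and X :: "('x::t2_space) chart set" and f :: "'y \<Rightarrow> 'x"
    and \<alpha> :: complex and W :: "'x set" and E :: "('x, 'n::finite) trivialisations" and A :: "('x, 'n) diffop"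
begin

abbreviation "PE \<equiv> pullback_bundle f E"
abbreviation "PA \<equiv> pullback_op (scaled_derivation \<alpha>) X f E A"

lemma pullback_smooth_bundle: "vector_bundle (smooth_fun Y) (f -` W) PE"
  by (rule smooth_map.vector_bundle_pullback[OF smooth_bundle])

sublocale psm: sheaf_bundle "smooth_fun Y" "f -` W" PE
  by unfold_locales (rule pullback_smooth_bundle)

text \<open>\<open>pullback_op\<close> picks some chart and some trivialisation. Here both are
  replaced by an arbitrary chart and frame, and the expansion of t is required only near q, so that
  the formula sees only the germ of t at q.\<close>

lemma PA_frame:
  assumes e: "regular_frame (smooth_fun X) E U e" and c: "c \<in> X" "f q \<in> fst c" "f q \<in> U"
    and d: "d \<in> Y" "q \<in> fst d" and u: "\<And>j. smooth_fun Y N (u j)" and q: "q \<in> N"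
    and t: "\<And>q'. q' \<in> N \<Longrightarrow> f q' \<in> U \<Longrightarrow> t q' = comb (\<lambda>j q. e j (f q)) u q'"
  shows "fst (PA t d q) = (\<Sum>j\<in>UNIV. (\<alpha> * d_z d (u j) q) *s e j (f q) +
      (u j q * chart_jacobian d c f q) *s fst (A (e j) c (f q)))"
    and "snd (PA t d q) = (\<Sum>j\<in>UNIV. d_zbar d (u j) q *s e j (f q) +
      (u j q * cnj (chart_jacobian d c f q)) *s snd (A (e j) c (f q)))"
proof -
  define c0 where "c0 = (SOME c. c \<in> X \<and> f q \<in> fst c)"
  define \<tau> where "\<tau> = (SOME \<tau>. \<tau> \<in> E \<and> f q \<in> fst \<tau>)"
  have "c0 \<in> X \<and> f q \<in> fst c0"
    unfolding c0_def by (rule someI[of _ c]) (use c in simp)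
  then have c0: "c0 \<in> X" "f q \<in> fst c0" by auto
  have eU: "\<And>j. smooth_section X E U (e j)" "open U" and invU: "\<And>p. p \<in> U \<Longrightarrow> invertible (frame_matrix e p)"
    using e by (auto simp: regular_frame_def)
  have "f q \<in> W" using sm.section_dom[OF eU(1)] c by blast
  then obtain \<tau>' where "\<tau>' \<in> E" "f q \<in> fst \<tau>'" using sm.triv_at by blast
  then have "\<tau> \<in> E \<and> f q \<in> fst \<tau>"
    unfolding \<tau>_def by (intro someI[of "\<lambda>\<tau>. \<tau> \<in> E \<and> f q \<in> fst \<tau>" \<tau>'] conjI)
  then have \<tau>: "\<tau> \<in> E" "f q \<in> fst \<tau>" by auto
  let ?T = "snd \<tau>"
  define e0 where "e0 = (\<lambda>j p. matrix_inv (?T p) *v axis j 1)"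
  define u0 where "u0 = (\<lambda>j q'. (?T (f q') *v t q') $ j)"
  define g where "g = (\<lambda>k j. coords e0 (e j) k)"
  have e0: "regular_frame (smooth_fun X) E (fst \<tau>) e0"
    unfolding e0_def by (rule sm.frame_triv[OF \<tau>(1)])
  let ?U = "U \<inter> fst \<tau>"
  have U: "open ?U" using eU(2) sm.triv_open[OF \<tau>(1)] by blast
  have e0': "regular_frame (smooth_fun X) E ?U e0" using sm.frame_subset[OF e0 U] by blast
  have e': "smooth_section X E ?U (e j)" for j using sm.section_subset[OF eU(1) U] by blast
  have g: "smooth_fun X ?U (g k j)" for k j
    unfolding g_def by (rule sm.R_coords[OF e0' e'])
  have inv0: "invertible (frame_matrix e0 p)" if "p \<in> fst \<tau>" for p
    using e0 that by (auto simp: regular_frame_def)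
  have ee0: "e j p = comb e0 (\<lambda>k. g k j) p" if "p \<in> ?U" for j p
    unfolding g_def using comb_coords[OF inv0, of p "e j"] that by simp
  \<comment> \<open>The coefficients of t in \<open>pullback_op\<close> are computed with T; the
    transition coefficients have to be expressed through T as well before the two can be
    compared.\<close>
  have gT: "g k j p = (?T p *v e j p) $ k" if "p \<in> ?U" for k j p
  proof -
    have "frame_matrix e0 p = matrix_inv (?T p)" by (simp add: e0_def)
    then show ?thesis
      using sm.triv_invertible[OF \<tau>(1)] that by (simp add: g_def coords_def matrix_inv_matrix_inv)
  qed
  have N: "open N" using u[of undefined] Y.smooth.R_open by blast
  let ?N = "N \<inter> f -` ?U"
  have N': "open ?N" "q \<in> ?N" using N vimage_open[OF U] c \<tau> q by auto
  have u0: "u0 k q' = (\<Sum>j\<in>UNIV. g k j (f q') * u j q')" if "q' \<in> ?N" for k q'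
    using that by (simp add: u0_def t mult_comb gT mult.commute)
  have smooth_gf: "smooth_fun Y ?N (\<lambda>q. g k j (f q))" for k j
    by (rule Y.smooth.R_subset[OF smooth_fun_pullback[OF g] N'(1)]) auto
  have smooth_u: "smooth_fun Y ?N (u j)" for j
    by (rule Y.smooth.R_subset[OF u N'(1)]) auto
  let ?J = "chart_jacobian d c f q" and ?K = "chart_jacobian d c0 f q"
  have du0: "d_z d (u0 k) q = (\<Sum>j\<in>UNIV. g k j (f q) * d_z d (u j) q + ?J * d_z c (g k j) (f q) * u j q)"
    "d_zbar d (u0 k) q = (\<Sum>j\<in>UNIV. g k j (f q) * d_zbar d (u j) q + cnj ?J * d_zbar c (g k j) (f q) * u j q)" for k
  proof -
    have q': "q \<in> ?N \<inter> fst d" using N' d by blast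
    have fq: "f q \<in> ?U" using N' by blast
    show "d_z d (u0 k) q = (\<Sum>j\<in>UNIV. g k j (f q) * d_z d (u j) q + ?J * d_z c (g k j) (f q) * u j q)"
      "d_zbar d (u0 k) q = (\<Sum>j\<in>UNIV. g k j (f q) * d_zbar d (u j) q + cnj ?J * d_zbar c (g k j) (f q) * u j q)"
      using Y.d_cong[OF d(1) N'(1) q', of "u0 k" "\<lambda>q'. \<Sum>j\<in>UNIV. g k j (f q') * u j q'", OF u0]
        Y.d_sum[OF N'(1) _ d(1) q', of UNIV "\<lambda>j q'. g k j (f q') * u j q'", OF Y.smooth.R_mult[OF smooth_gf smooth_u]]
        Y.d_mult[OF smooth_gf smooth_u d(1) q'] d_chain[OF g d(1) c(1) d(2) c(2) fq]
      by simp_all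
  qed
  have fq: "f q \<in> ?U" using N' by blast
  have A_e: "fst (A (e j) c (f q)) = (\<Sum>k\<in>UNIV. (\<alpha> * d_z c (g k j) (f q)) *s e0 k (f q) + g k j (f q) *s fst (A (e0 k) c (f q)))"
    "snd (A (e j) c (f q)) = (\<Sum>k\<in>UNIV. d_zbar c (g k j) (f q) *s e0 k (f q) + g k j (f q) *s snd (A (e0 k) c (f q)))" for j
  proof -
    have s: "smooth_section X E ?U (comb e0 (\<lambda>k. g k j))"
      by (rule sm.section_comb[OF e0' g])
    have s0: "smooth_section X E ?U (e0 k)" for k using e0' by (simp add: regular_frame_def)
    show "fst (A (e j) c (f q)) = (\<Sum>k\<in>UNIV. (\<alpha> * d_z c (g k j) (f q)) *s e0 k (f q) + g k j (f q) *s fst (A (e0 k) c (f q)))"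
      "snd (A (e j) c (f q)) = (\<Sum>k\<in>UNIV. d_zbar c (g k j) (f q) *s e0 k (f q) + g k j (f q) *s snd (A (e0 k) c (f q)))"
      using A_cong[OF e' s ee0 c(1) fq c(2)] A_comb[OF U s0 g c(1) fq c(2)] by simp_all
  qed
  have s0: "smooth_section X E (fst \<tau>) (e0 k)" for k using e0 by (simp add: regular_frame_def)
  have J: "?J = ?K * chart_jacobian c0 c id (f q)"
    by (rule jacobian_change_target[OF d(1) c(1) c0(1) d(2) c(2) c0(2)])
  \<comment> \<open>The chosen chart is traded for c: the Jacobian that A picks up under the change
    of chart is the one by which the two Jacobians of f differ.\<close>
  have A_e0: "(a * ?K) *s fst (A (e0 k) c0 (f q)) = (a * ?J) *s fst (A (e0 k) c (f q))"
    "(a * cnj ?K) *s snd (A (e0 k) c0 (f q)) = (a * cnj ?J) *s snd (A (e0 k) c (f q))" for a k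
    using A_chart[OF s0 c0(1) c(1) \<tau>(2) c0(2) c(2), of k] unfolding J by simp_all
  have ef: "e j (f q) = (\<Sum>k\<in>UNIV. g k j (f q) *s e0 k (f q))" for j
    using ee0[OF fq] by (simp add: comb_def)
  have "fst (PA t d q) = (\<Sum>k\<in>UNIV. (\<alpha> * d_z d (u0 k) q) *s e0 k (f q) + (u0 k q * ?J) *s fst (A (e0 k) c (f q)))"
    unfolding pullback_op_scaled_derivation Let_def c0_def[symmetric] \<tau>_def[symmetric] fst_conv
    using A_e0(1) by (simp add: e0_def u0_def)
  also have "\<dots> = (\<Sum>j\<in>UNIV. (\<alpha> * d_z d (u j) q) *s e j (f q) + (u j q * ?J) *s fst (A (e j) c (f q)))"
    by (rule change_of_frame_identity[where g = "\<lambda>k j. g k j (f q)" and dg = "\<lambda>k j. \<alpha> * d_z c (g k j) (f q)"])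
      (simp_all add: du0 u0[OF N'(2)] ef A_e sum_distrib_left algebra_simps)
  finally show "fst (PA t d q) = (\<Sum>j\<in>UNIV. (\<alpha> * d_z d (u j) q) *s e j (f q) + (u j q * ?J) *s fst (A (e j) c (f q)))" .
  have "snd (PA t d q) = (\<Sum>k\<in>UNIV. d_zbar d (u0 k) q *s e0 k (f q) + (u0 k q * cnj ?J) *s snd (A (e0 k) c (f q)))"
    unfolding pullback_op_scaled_derivation Let_def c0_def[symmetric] \<tau>_def[symmetric] snd_conv
    using A_e0(2) by (simp add: e0_def u0_def)
  also have "\<dots> = (\<Sum>j\<in>UNIV. d_zbar d (u j) q *s e j (f q) + (u j q * cnj ?J) *s snd (A (e j) c (f q)))"
    by (rule change_of_frame_identity[where g = "\<lambda>k j. g k j (f q)" and dg = "\<lambda>k j. d_zbar c (g k j) (f q)"])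
      (simp_all add: du0 u0[OF N'(2)] ef A_e)
  finally show "snd (PA t d q) = (\<Sum>j\<in>UNIV. d_zbar d (u j) q *s e j (f q) + (u j q * cnj ?J) *s snd (A (e j) c (f q)))" .
qed

text \<open>The coordinates of a pulled back section are pulled back functions, and the chain rule
  takes the same Jacobian out of their derivatives that \<open>PA_frame\<close> attaches to A. This
  is the property by which pullbacks are recognised later.\<close>

lemma PA_pullback_section:
  assumes s: "smooth_section X E V s" and c: "c \<in> X" "f q \<in> fst c" "f q \<in> V" and d: "d \<in> Y" "q \<in> fst d"
  shows "fst (PA (\<lambda>q. s (f q)) d q) = chart_jacobian d c f q *s fst (A s c (f q))"
    and "snd (PA (\<lambda>q. s (f q)) d q) = cnj (chart_jacobian d c f q) *s snd (A s c (f q))"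
proof -
  have "f q \<in> W" using sm.section_dom[OF s] c by blast
  then obtain U0 e where e0: "regular_frame (smooth_fun X) E U0 e" "f q \<in> U0" by (rule sm.frame_at)
  let ?U = "U0 \<inter> V"
  have U: "open ?U" using e0 sm.section_open[OF s] by (auto simp: regular_frame_def)
  have e: "regular_frame (smooth_fun X) E ?U e" by (rule sm.frame_subset[OF e0(1) U]) auto
  have s': "smooth_section X E ?U s" by (rule sm.section_subset[OF s U]) auto
  have eU: "smooth_section X E ?U (e j)" for j using e by (simp add: regular_frame_def)
  have inv: "invertible (frame_matrix e p)" if "p \<in> ?U" for p using e that by (auto simp: regular_frame_def)
  let ?u = "coords e s"
  have u: "smooth_fun X ?U (?u j)" for j by (rule sm.R_coords[OF e s'])
  have fq: "f q \<in> ?U" using c e0 by blast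
  have uf: "smooth_fun Y (f -` ?U) (\<lambda>q. ?u j (f q))" for j by (rule smooth_fun_pullback[OF u])
  have t: "s (f q') = comb (\<lambda>j q. e j (f q)) (\<lambda>j q. ?u j (f q)) q'" if "f q' \<in> ?U" for q'
    using comb_coords[OF inv[OF that], of s] by (simp add: comb_def)
  have As: "A s c (f q) = A (comb e ?u) c (f q)"
    by (rule A_cong[OF s' sm.section_comb[OF e u] _ c(1) fq c(2)]) (simp add: comb_coords[OF inv])
  have dc: "d_z d (\<lambda>q. ?u j (f q)) q = chart_jacobian d c f q * d_z c (?u j) (f q)"
    "d_zbar d (\<lambda>q. ?u j (f q)) q = cnj (chart_jacobian d c f q) * d_zbar c (?u j) (f q)" for j
    using d_chain[OF u d(1) c(1) d(2) c(2) fq] by simp_all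
  have PAs: "fst (PA (\<lambda>q. s (f q)) d q) = (\<Sum>j\<in>UNIV. (\<alpha> * d_z d (\<lambda>q. ?u j (f q)) q) *s e j (f q) +
      (?u j (f q) * chart_jacobian d c f q) *s fst (A (e j) c (f q)))"
    "snd (PA (\<lambda>q. s (f q)) d q) = (\<Sum>j\<in>UNIV. d_zbar d (\<lambda>q. ?u j (f q)) q *s e j (f q) +
      (?u j (f q) * cnj (chart_jacobian d c f q)) *s snd (A (e j) c (f q)))"
    using fq by (intro PA_frame[OF e c(1,2) fq d uf _ t]; simp)+
  show "fst (PA (\<lambda>q. s (f q)) d q) = chart_jacobian d c f q *s fst (A s c (f q))"
    unfolding PAs As A_comb[OF U eU u c(1) fq c(2)] dc
    by (simp add: vec_eq_iff sum_distrib_left algebra_simps)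
  show "snd (PA (\<lambda>q. s (f q)) d q) = cnj (chart_jacobian d c f q) *s snd (A s c (f q))"
    unfolding PAs As A_comb[OF U eU u c(1) fq c(2)] dc
    by (simp add: vec_eq_iff sum_distrib_left algebra_simps)
qed

abbreviation "pcoords e \<equiv> coords (\<lambda>j q. e j (f q))"

lemma pullback_frame_matrix: "frame_matrix (\<lambda>j q. e j (f q)) q = frame_matrix e (f q)"
  by (simp add: frame_matrix_def)

lemma smooth_pcoords:
  assumes e: "regular_frame (smooth_fun X) E U e" and t: "smooth_section Y PE V t"
  shows "smooth_fun Y (V \<inter> f -` U) (pcoords e t j)"
proof -
  have "open (V \<inter> f -` U)"
    using psm.section_open[OF t] e vimage_open by (auto simp: regular_frame_def)
  then show ?thesis
    by (intro psm.R_coords psm.frame_subset[OF smooth_map.frame_pullback[OF smooth_bundle e]]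
        psm.section_subset[OF t]) auto
qed

text \<open>The second section \<open>t'\<close>, which is merely equal to t on V, is there for the
  locality axiom of \<open>diff_operator\<close>.\<close>

lemma PA_coords:
  assumes e: "regular_frame (smooth_fun X) E U e" and c: "c \<in> X" "f q \<in> fst c" "f q \<in> U"
    and d: "d \<in> Y" "q \<in> fst d" and t: "smooth_section Y PE V t" "q \<in> V" and t': "\<And>q. q \<in> V \<Longrightarrow> t' q = t q"
  shows "fst (PA t' d q) = (\<Sum>j\<in>UNIV. (\<alpha> * d_z d (pcoords e t j) q) *s e j (f q) +
      (pcoords e t j q * chart_jacobian d c f q) *s fst (A (e j) c (f q)))"
    and "snd (PA t' d q) = (\<Sum>j\<in>UNIV. d_zbar d (pcoords e t j) q *s e j (f q) +
      (pcoords e t j q * cnj (chart_jacobian d c f q)) *s snd (A (e j) c (f q)))"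
proof -
  have "t' q' = comb (\<lambda>j q. e j (f q)) (pcoords e t) q'" if "q' \<in> V \<inter> f -` U" "f q' \<in> U" for q'
    using e that t' by (simp add: comb_coords pullback_frame_matrix regular_frame_def)
  with c(3) t(2) show "fst (PA t' d q) = (\<Sum>j\<in>UNIV. (\<alpha> * d_z d (pcoords e t j) q) *s e j (f q) +
      (pcoords e t j q * chart_jacobian d c f q) *s fst (A (e j) c (f q)))"
    "snd (PA t' d q) = (\<Sum>j\<in>UNIV. d_zbar d (pcoords e t j) q *s e j (f q) +
      (pcoords e t j q * cnj (chart_jacobian d c f q)) *s snd (A (e j) c (f q)))"
    by (intro PA_frame[OF e c d smooth_pcoords[OF e t(1)]]; simp)+
qed

text \<open>Every axiom is read off at one point, in a frame near its image: a section enters the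
  formula of \<open>PA_coords\<close> only through its coordinates and their first derivatives
  there.\<close>

lemma diff_operator_pullback: "diff_operator (scaled_derivation \<alpha>) Y PE PA"
proof -
  have frames: "\<exists>c U e. c \<in> X \<and> f q \<in> fst c \<and> regular_frame (smooth_fun X) E U e \<and> f q \<in> U"
    if s: "smooth_section Y PE V s" and q: "q \<in> V" for V s q
  proof -
    have "f q \<in> W" using psm.section_dom[OF s] q by blast
    then obtain U e where "regular_frame (smooth_fun X) E U e" "f q \<in> U" by (rule sm.frame_at)
    moreover obtain c where "c \<in> X" "f q \<in> fst c" by (rule X.chart_at)
    ultimately show ?thesis by blast
  qed
  have smooth: "smooth_section Y PE (V \<inter> fst d) (\<lambda>p. fst (PA s d p)) \<and>
      smooth_section Y PE (V \<inter> fst d) (\<lambda>p. snd (PA s d p))"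
    if s: "smooth_section Y PE V s" and d: "d \<in> Y" for V s d
  proof -
    have "\<exists>N. q \<in> N \<and> N \<subseteq> V \<inter> fst d \<and> smooth_section Y PE N (\<lambda>p. fst (PA s d p)) \<and>
        smooth_section Y PE N (\<lambda>p. snd (PA s d p))" if q: "q \<in> V \<inter> fst d" for q
    proof -
      obtain c U e where c: "c \<in> X" "f q \<in> fst c" and e: "regular_frame (smooth_fun X) E U e" "f q \<in> U"
        using frames[OF s, of q] q by auto
      let ?U = "U \<inter> fst c"
      let ?N = "V \<inter> fst d \<inter> f -` ?U"
      have U: "open ?U" using e X.open_chart[OF c(1)] by (auto simp: regular_frame_def)
      have N: "open ?N" using psm.section_open[OF s] Y.open_chart[OF d] vimage_open[OF U] by blast
      have sub: "smooth_section Y PE ?N h" if "smooth_section Y PE M h" "?N \<subseteq> M" for M h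
        using psm.section_subset[OF that(1) N that(2)] .
      have subf: "smooth_fun Y ?N h" if "smooth_fun Y M h" "?N \<subseteq> M" for M h
        using Y.smooth.R_subset[OF that(1) N that(2)] .
      have eU: "smooth_section X E U (e j)" for j using e by (simp add: regular_frame_def)
      have 1: "smooth_section Y PE ?N (\<lambda>q. e j (f q))" for j
        by (rule sub[OF smooth_map.section_pullback[OF smooth_bundle eU]]) auto
      have 2: "smooth_section Y PE ?N (\<lambda>q. fst (A (e j) c (f q)))"
         "smooth_section Y PE ?N (\<lambda>q. snd (A (e j) c (f q)))" for j
        by (rule sub[OF smooth_map.section_pullback[OF smooth_bundle A_smooth(1)[OF eU c(1)]]], blast)
          (rule sub[OF smooth_map.section_pullback[OF smooth_bundle A_smooth(2)[OF eU c(1)]]], blast)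
      have u: "smooth_fun Y (V \<inter> f -` U) (pcoords e s j)" for j
        by (rule smooth_pcoords[OF e(1) s])
      have 3: "smooth_fun Y ?N (pcoords e s j)" "smooth_fun Y ?N (d_z d (pcoords e s j))"
        "smooth_fun Y ?N (d_zbar d (pcoords e s j))" for j
        by (rule subf[OF u], blast) (rule subf[OF Y.smooth_fun_d(1)[OF u d]], blast,
            rule subf[OF Y.smooth_fun_d(2)[OF u d]], blast)
      have 4: "smooth_fun Y ?N (chart_jacobian d c f)"
        by (rule subf[OF Y.holomorphic_imp_smooth[OF holomorphic_jacobian[OF d c(1)]]]) auto
      have dom: "?N \<subseteq> f -` W" using psm.section_dom[OF s] by blast
      have "smooth_section Y PE ?N (\<lambda>q. \<Sum>j\<in>UNIV. (\<alpha> * d_z d (pcoords e s j) q) *s e j (f q) +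
          (pcoords e s j q * chart_jacobian d c f q) *s fst (A (e j) c (f q)))"
        by (intro psm.section_sum psm.section_add psm.section_scale Y.smooth.R_mult Y.smooth.R_const 1 2 3 4 N dom)
      then have F: "smooth_section Y PE ?N (\<lambda>p. fst (PA s d p))"
        by (rule psm.section_cong) (use c in \<open>simp add: PA_coords(1)[OF e(1) c(1) _ _ d _ s]\<close>)
      have "smooth_section Y PE ?N (\<lambda>q. \<Sum>j\<in>UNIV. d_zbar d (pcoords e s j) q *s e j (f q) +
          (pcoords e s j q * cnj (chart_jacobian d c f q)) *s snd (A (e j) c (f q)))"
        by (intro psm.section_sum psm.section_add psm.section_scale Y.smooth.R_mult Y.smooth.R_const
            Y.smooth_fun_cnj 1 2 3 4 N dom)
      then have S: "smooth_section Y PE ?N (\<lambda>p. snd (PA s d p))"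
        by (rule psm.section_cong) (use c in \<open>simp add: PA_coords(2)[OF e(1) c(1) _ _ d _ s]\<close>)
      show ?thesis using F S q c e(2) by (intro exI[of _ ?N]) auto
    qed
    then show ?thesis
      using psm.section_local[of "V \<inter> fst d" "\<lambda>p. fst (PA s d p)"]
        psm.section_local[of "V \<inter> fst d" "\<lambda>p. snd (PA s d p)"] by meson
  qed
  have chart: "PA s d q = (chart_jacobian d d' id q *s fst (PA s d' q), cnj (chart_jacobian d d' id q) *s snd (PA s d' q))"
    if s: "smooth_section Y PE V s" and d: "d \<in> Y" "d' \<in> Y" and q: "q \<in> V \<inter> fst d \<inter> fst d'" for V s d d' q
  proof -
    obtain c U e where c: "c \<in> X" "f q \<in> fst c" and e: "regular_frame (smooth_fun X) E U e" "f q \<in> U"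
      using frames[OF s, of q] q by auto
    have q': "q \<in> fst d" "q \<in> fst d'" "q \<in> V" using q by auto
    note PA1 = PA_coords[OF e(1) c e(2) d(1) q'(1) s q'(3) refl]
    note PA2 = PA_coords[OF e(1) c e(2) d(2) q'(2) s q'(3) refl]
    have du: "d_z d (pcoords e s j) q = chart_jacobian d d' id q * d_z d' (pcoords e s j) q"
      "d_zbar d (pcoords e s j) q = cnj (chart_jacobian d d' id q) * d_zbar d' (pcoords e s j) q" for j
      using Y.self.d_chain[OF smooth_pcoords[OF e(1) s] d q'(1)] q' e(2) by simp_all
    have J: "chart_jacobian d c f q = chart_jacobian d d' id q * chart_jacobian d' c f q"
      by (rule jacobian_change_source[OF d c(1) q'(1,2) c(2)])
    show ?thesis
      unfolding prod_eq_iff fst_conv snd_conv PA1 PA2 du J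
      by (simp add: vec_eq_iff sum_distrib_left algebra_simps)
  qed
  have cong: "PA s d q = PA t d q"
    if s: "smooth_section Y PE V s" and t: "smooth_section Y PE V t" and st: "\<forall>p\<in>V. s p = t p"
      and d: "d \<in> Y" "q \<in> V \<inter> fst d" for V s t d q
  proof -
    obtain c U e where c: "c \<in> X" "f q \<in> fst c" and e: "regular_frame (smooth_fun X) E U e" "f q \<in> U"
      using frames[OF s, of q] d by auto
    have q': "q \<in> fst d" "q \<in> V" using d by auto
    note PA1 = PA_coords[OF e(1) c e(2) d(1) q'(1) s q'(2)]
    show ?thesis
      unfolding prod_eq_iff by (simp add: PA1[OF refl] PA1[of t] st)
  qed
  have add: "PA (\<lambda>q. s q + t q) d q = PA s d q + PA t d q"
    if s: "smooth_section Y PE V s" and t: "smooth_section Y PE V t"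
      and d: "d \<in> Y" "q \<in> V \<inter> fst d" for V s t d q
  proof -
    obtain c U e where c: "c \<in> X" "f q \<in> fst c" and e: "regular_frame (smooth_fun X) E U e" "f q \<in> U"
      using frames[OF s, of q] d by auto
    have q': "q \<in> fst d" "q \<in> V" using d by auto
    have qU: "q \<in> (V \<inter> f -` U) \<inter> fst d" using q' e by auto
    have st: "pcoords e (\<lambda>q. s q + t q) j = (\<lambda>q. pcoords e s j q + pcoords e t j q)" for j
      by (simp add: fun_eq_iff coords_add)
    note P = PA_coords[OF e(1) c e(2) d(1) q'(1) _ q'(2) refl]
    show ?thesis
      unfolding prod_eq_iff fst_add snd_add P[OF s] P[OF t] P[OF psm.section_add[OF s t]] st
        Y.d_add[OF smooth_pcoords[OF e(1) s] smooth_pcoords[OF e(1) t] d(1) qU]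
      by (simp add: sum.distrib[symmetric] vec_eq_iff algebra_simps)
  qed
  have scale: "PA (\<lambda>q. g q *s s q) d q = (g q *s fst (PA s d q) + (\<alpha> * d_z d g q) *s s q,
       g q *s snd (PA s d q) + d_zbar d g q *s s q)"
    if g: "smooth_fun Y V g" and s: "smooth_section Y PE V s"
      and d: "d \<in> Y" "q \<in> V \<inter> fst d" for V g s d q
  proof -
    obtain c U e where c: "c \<in> X" "f q \<in> fst c" and e: "regular_frame (smooth_fun X) E U e" "f q \<in> U"
      using frames[OF s, of q] d by auto
    have q': "q \<in> fst d" "q \<in> V" using d by auto
    have qU: "q \<in> (V \<inter> f -` U) \<inter> fst d" using q' e by auto
    have gs: "pcoords e (\<lambda>q. g q *s s q) j = (\<lambda>q. g q * pcoords e s j q)" for j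
      by (simp add: fun_eq_iff coords_scale)
    have g': "smooth_fun Y (V \<inter> f -` U) g"
      using g Y.smooth.R_open[OF g] e(1) vimage_open by (auto intro!: Y.smooth.R_subset[OF g] simp: regular_frame_def)
    have sq: "s q = (\<Sum>j\<in>UNIV. pcoords e s j q *s e j (f q))"
      using comb_coords[of "\<lambda>j q. e j (f q)" q s] e by (simp add: comb_def pullback_frame_matrix regular_frame_def)
    note P = PA_coords[OF e(1) c e(2) d(1) q'(1) _ q'(2) refl]
    have split_scale: "(\<Sum>j\<in>UNIV. (k * (g q * du j + dg * u j)) *s ej j + (g q * u j * J) *s Ae j) =
        g q *s (\<Sum>j\<in>UNIV. (k * du j) *s ej j + (u j * J) *s Ae j) + (k * dg) *s (\<Sum>j\<in>UNIV. u j *s ej j)"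
      for k dg J :: complex and du u :: "'n \<Rightarrow> complex" and ej Ae :: "'n \<Rightarrow> complex^'n"
      by (simp add: vec_eq_iff sum_distrib_left sum.distrib[symmetric] algebra_simps)
    have "fst (PA (\<lambda>q. g q *s s q) d q) = g q *s fst (PA s d q) + (\<alpha> * d_z d g q) *s s q"
      unfolding P[OF s] P[OF psm.section_scale[OF g s]] gs Y.d_mult[OF g' smooth_pcoords[OF e(1) s] d(1) qU]
      unfolding sq by (rule split_scale)
    moreover have "snd (PA (\<lambda>q. g q *s s q) d q) = g q *s snd (PA s d q) + d_zbar d g q *s s q"
      unfolding P[OF s] P[OF psm.section_scale[OF g s]] gs Y.d_mult[OF g' smooth_pcoords[OF e(1) s] d(1) qU]
      unfolding sq using split_scale[of 1] by simp
    ultimately show ?thesis by (simp add: prod_eq_iff)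
  qed
  show ?thesis
    unfolding diff_operator_def scaled_derivation_simps
    by (intro conjI allI impI ballI; (rule conjunct1[OF smooth] conjunct2[OF smooth] chart cong add scale; assumption))
qed

end

sublocale pullback_operator \<subseteq> pop: operator Y \<alpha> "f -` W" "pullback_bundle f E"
    "pullback_op (scaled_derivation \<alpha>) X f E A"
  by unfold_locales (rule pullback_smooth_bundle, rule diff_operator_pullback)

section \<open>Local structure of holomorphic functions and maps\<close>

definition rad :: "'x chart \<Rightarrow> 'x \<Rightarrow> 'x \<Rightarrow> real" where
  "rad c x p = cmod (snd c p - snd c x)"

context surface
begin

lemma filterlim_chart:
  assumes "c \<in> X" "x \<in> fst c"
  shows "filterlim (snd c) (at (snd c x)) (at x)"
  unfolding filterlim_at
proof
  have "\<forall>p\<in>fst c. p \<noteq> x \<longrightarrow> snd c p \<in> UNIV \<and> snd c p \<noteq> snd c x"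
    using chart_inj[OF assms(1)] assms(2) by simp
  then show "\<forall>\<^sub>F p in at x. snd c p \<in> UNIV \<and> snd c p \<noteq> snd c x"
    using open_chart[OF assms(1)] assms(2) unfolding eventually_at_topological by blast
  show "(snd c \<longlongrightarrow> snd c x) (at x)"
    using continuous_on_chart[OF assms(1)] open_chart[OF assms(1)] assms(2)
    by (simp add: continuous_on_eq_continuous_at isCont_def)
qed

lemma filterlim_chart_inv:
  assumes "c \<in> X" "x \<in> fst c"
  shows "filterlim (chart_inv c) (at x) (at (snd c x))"
  unfolding filterlim_at
proof
  have "chart_inv c z \<noteq> x" if "z \<in> snd c ` fst c" "z \<noteq> snd c x" for z
    using that assms by auto
  then show "\<forall>\<^sub>F z in at (snd c x). chart_inv c z \<in> UNIV \<and> chart_inv c z \<noteq> x"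
    using open_chart_image'[OF assms(1)] assms(2) unfolding eventually_at_topological
    by (intro exI[of _ "snd c ` fst c"]) auto
  have "isCont (chart_inv c) (snd c x)"
    using continuous_on_chart_inv[OF assms(1)] open_chart_image'[OF assms(1)] assms(2)
    by (simp add: continuous_on_eq_continuous_at)
  then show "(chart_inv c \<longlongrightarrow> x) (at (snd c x))"
    using assms by (simp add: isCont_def)
qed

lemma eventually_in_open: "open V \<Longrightarrow> x \<in> V \<Longrightarrow> \<forall>\<^sub>F p in at x. p \<in> V - {x}"
  unfolding eventually_at_topological by blast

text \<open>Points of a surface are not isolated; without this, limits at a puncture would not be
  unique.\<close>

lemma at_neq_bot: "at (x :: 'x) \<noteq> bot"
proof
  assume bot: "at x = bot"
  obtain c where c: "c \<in> X" "x \<in> fst c" by (rule chart_at)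
  have "filterlim (chart_inv c) bot (at (snd c x))"
    using filterlim_chart_inv[OF c] bot by simp
  then show False by (simp add: filterlim_def filtermap_bot_iff bot_unique)
qed

lemma holomorphic_on_chart_iff:
  assumes "c \<in> X" "open V" "V \<subseteq> fst c"
  shows "holomorphic_fun X V g \<longleftrightarrow> (g \<circ> chart_inv c) holomorphic_on snd c ` V"
proof
  assume "holomorphic_fun X V g"
  then show "(g \<circ> chart_inv c) holomorphic_on snd c ` V"
    using assms by (auto simp: holomorphic_fun_def Int_absorb1)
next
  assume g: "(g \<circ> chart_inv c) holomorphic_on snd c ` V"
  show "holomorphic_fun X V g"
    unfolding holomorphic_fun_surface_reg
  proof (rule surface_reg_local)
    show "plane_regularity hol_reg" by unfold_locales
    fix p assume "p \<in> V"
    then show "\<exists>c\<in>X. \<exists>N. open N \<and> p \<in> N \<and> N \<subseteq> V \<inter> fst c \<and> (g \<circ> chart_inv c) holomorphic_on snd c ` N"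
      using g assms by (intro bexI[of _ c] exI[of _ V]) auto
  qed
qed

lemma holomorphic_compose_chart:
  assumes "c \<in> X" "open V" "V \<subseteq> fst c" "h holomorphic_on T" "snd c ` V \<subseteq> T"
  shows "holomorphic_fun X V (\<lambda>p. h (snd c p))"
  unfolding holomorphic_on_chart_iff[OF assms(1-3)]
  by (rule holomorphic_transform[OF holomorphic_on_subset[OF assms(4,5)]]) (use assms(1,3) in auto)

lemma open_chart_vimage:
  assumes "c \<in> X" "open S"
  shows "open (fst c \<inter> snd c -` S)"
  using continuous_open_preimage[OF continuous_on_chart[OF assms(1)] open_chart[OF assms(1)] assms(2)] .

lemma smooth_isCont:
  assumes "smooth_fun X V g" "p \<in> V"
  shows "isCont g p"
proof -
  obtain c where c: "c \<in> X" "p \<in> fst c" by (rule chart_at)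
  have "isCont (g \<circ> chart_inv c) (snd c p)"
    using smooth_fun_differentiable[OF assms(1) c(1), of p] assms(2) c(2)
    by (simp add: differentiable_imp_continuous_within)
  then have "((\<lambda>z. g (chart_inv c z)) \<longlongrightarrow> g p) (at (snd c p))"
    using c by (simp add: isCont_def o_def)
  from filterlim_compose[OF this filterlim_chart[OF c]]
  have "((\<lambda>q. g (chart_inv c (snd c q))) \<longlongrightarrow> g p) (at p)" .
  moreover have "\<forall>\<^sub>F q in at p. g (chart_inv c (snd c q)) = g q"
    using eventually_in_open[OF open_chart[OF c(1)] c(2)]
    by (rule eventually_mono) (use c in auto)
  ultimately show ?thesis unfolding isCont_def by (rule Lim_transform_eventually)
qed

lemmas holomorphic_isCont = smooth_isCont[OF holomorphic_imp_smooth]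

lemma removable_singularity:
  assumes V: "open V" "x \<in> V" and g: "holomorphic_fun X (V - {x}) g"
    and c: "c \<in> X" "x \<in> fst c" and lim: "((\<lambda>p. (snd c p - snd c x) * g p) \<longlongrightarrow> 0) (at x)"
  shows "\<exists>v. holomorphic_fun X V (g(x := v))"
proof -
  let ?V = "V \<inter> fst c" and ?z = "snd c x"
  let ?S = "snd c ` (fst c \<inter> V)"
  have S: "open ?S" "?z \<in> interior ?S"
    using open_chart_image[OF c(1) V(1)] c V by (auto simp: interior_open)
  have "?S - {?z} = snd c ` (fst c \<inter> (V - {x}))"
    using chart_inj[OF c(1)] c(2) by auto
  then have g': "(g \<circ> chart_inv c) holomorphic_on ?S - {?z}"
    using g c by (simp add: holomorphic_fun_def)
  have "((\<lambda>z. (snd c (chart_inv c z) - ?z) * g (chart_inv c z)) \<longlongrightarrow> 0) (at ?z)"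
    by (rule filterlim_compose[OF lim filterlim_chart_inv[OF c]])
  moreover have "\<forall>\<^sub>F z in at ?z. (snd c (chart_inv c z) - ?z) * g (chart_inv c z) = (z - ?z) * (g \<circ> chart_inv c) z"
    unfolding eventually_at_topological
    by (intro exI[of _ ?S]) (use S c V chart_inv_right[OF c(1)] in auto)
  ultimately have "((\<lambda>z. (z - ?z) * (g \<circ> chart_inv c) z) \<longlongrightarrow> 0) (at ?z)"
    by (rule Lim_transform_eventually)
  then obtain h where h: "h holomorphic_on ?S" "\<forall>z\<in>?S - {?z}. h z = (g \<circ> chart_inv c) z"
    using holomorphic_on_extend_lim[OF g' S(2)] by blast
  have "holomorphic_fun X ?V (\<lambda>p. h (snd c p))"
    by (rule holomorphic_compose_chart[OF c(1) _ _ h(1)]) (use V open_chart[OF c(1)] in auto)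
  then have 1: "holomorphic_fun X ?V (g(x := h ?z))"
  proof (rule hol.R_cong)
    fix p assume "p \<in> ?V"
    then show "h (snd c p) = (g(x := h ?z)) p"
      using h(2) chart_inj[OF c(1)] c by auto
  qed
  have 2: "holomorphic_fun X (V - {x}) (g(x := h ?z))"
    by (rule hol.R_cong[OF g]) auto
  have "holomorphic_fun X V (g(x := h ?z))"
  proof (rule hol.R_local)
    fix p assume "p \<in> V"
    then show "\<exists>N. p \<in> N \<and> N \<subseteq> V \<and> holomorphic_fun X N (g(x := h ?z))"
      using 1 2 c(2) by (cases "p = x") (auto intro: exI[of _ ?V] exI[of _ "V - {x}"])
  qed
  then show ?thesis by blast
qed

text \<open>The quotient by the coordinate has a removable singularity, since multiplied by the
  coordinate it tends to g(x) = 0.\<close>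

lemma divide_coordinate:
  assumes g: "holomorphic_fun X V g" and c: "c \<in> X" "V \<subseteq> fst c" and x: "x \<in> V" "g x = 0"
  obtains h where "holomorphic_fun X V h" "\<forall>p\<in>V. g p = (snd c p - snd c x) * h p"
proof -
  have V: "open V" using hol.R_open[OF g] .
  let ?h = "\<lambda>p. g p / (snd c p - snd c x)"
  have xc: "x \<in> fst c" using x c by blast
  have V': "open (V - {x})" using V by auto
  have ne: "snd c p \<noteq> snd c x" if "p \<in> V - {x}" for p
    using chart_inj[OF c(1) _ xc] that c(2) by auto
  have 1: "holomorphic_fun X (V - {x}) ?h"
    by (intro hol.R_divide hol.R_diff hol.R_const hol.R_subset[OF g V'] hol.R_subset[OF holomorphic_chart[OF c(1)] V'] V')
      (use c ne in auto)
  have "(g \<longlongrightarrow> 0) (at x)"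
    using holomorphic_isCont[OF g x(1)] x(2) by (simp add: isCont_def)
  moreover have "\<forall>\<^sub>F p in at x. g p = (snd c p - snd c x) * ?h p"
    using eventually_in_open[OF V x(1)] by (rule eventually_mono) (use ne in auto)
  ultimately have "((\<lambda>p. (snd c p - snd c x) * ?h p) \<longlongrightarrow> 0) (at x)"
    by (rule Lim_transform_eventually)
  then obtain v where "holomorphic_fun X V (?h(x := v))"
    using removable_singularity[OF V x(1) 1 c(1) xc] by blast
  then show ?thesis
    by (rule that) (use ne x in auto)
qed

lemma jacobian_self: "c \<in> X \<Longrightarrow> x \<in> fst c \<Longrightarrow> chart_jacobian c c id x = 1"
proof -
  assume c: "c \<in> X" "x \<in> fst c"
  have "deriv (snd c \<circ> id \<circ> chart_inv c) (snd c x) = deriv (\<lambda>z. z) (snd c x)"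
    by (rule deriv_cong_ev)
      (use c open_chart_image'[OF c(1)] chart_inv_right[OF c(1)] in
        \<open>auto simp: eventually_nhds intro!: exI[of _ "snd c ` fst c"]\<close>)
  then show ?thesis by (simp add: chart_jacobian_def)
qed

lemma jacobian_nonzero:
  assumes "c \<in> X" "c' \<in> X" "x \<in> fst c" "x \<in> fst c'"
  shows "chart_jacobian c c' id x \<noteq> 0"
  using self.jacobian_change_source[of c c' c x] assms jacobian_self[of c x] by auto

lemma chart_ratio_limit:
  assumes "c \<in> X" "c' \<in> X" "x \<in> fst c" "x \<in> fst c'"
  shows "((\<lambda>p. (snd c' p - snd c' x) / (snd c p - snd c x)) \<longlongrightarrow> chart_jacobian c c' id x) (at x)"
proof -
  have "((snd c' \<circ> chart_inv c) has_field_derivative chart_jacobian c c' id x) (at (snd c x))"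
    using holomorphic_fun_deriv[OF holomorphic_chart[OF assms(2)] assms(1), of x] assms
    by (simp add: chart_jacobian_def)
  then have "((\<lambda>z. (snd c' (chart_inv c z) - snd c' x) / (z - snd c x)) \<longlongrightarrow> chart_jacobian c c' id x) (at (snd c x))"
    using assms by (simp add: has_field_derivative_iff)
  from filterlim_compose[OF this filterlim_chart[OF assms(1,3)]]
  have "((\<lambda>p. (snd c' (chart_inv c (snd c p)) - snd c' x) / (snd c p - snd c x)) \<longlongrightarrow> chart_jacobian c c' id x) (at x)" .
  moreover have "\<forall>\<^sub>F p in at x. (snd c' (chart_inv c (snd c p)) - snd c' x) / (snd c p - snd c x) =
      (snd c' p - snd c' x) / (snd c p - snd c x)"
    using eventually_in_open[OF open_chart[OF assms(1)] assms(3)]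
    by (rule eventually_mono) (use assms in auto)
  ultimately show ?thesis by (rule Lim_transform_eventually)
qed

text \<open>The quotient of two coordinates centred at x tends to the Jacobian of the chart change,
  which is not 0. Growth orders are therefore independent of the chart.\<close>

lemma rad_bigtheta:
  assumes "c \<in> X" "c' \<in> X" "x \<in> fst c" "x \<in> fst c'"
  shows "rad c' x \<in> \<Theta>[at x](rad c x)"
  using tendsto_norm[OF chart_ratio_limit[OF assms]] jacobian_nonzero[OF assms]
  by (intro bigthetaI_tendsto_norm[where c = "norm (chart_jacobian c c' id x)"])
    (auto simp: rad_def norm_divide)

lemma rad_powr_bigtheta:
  assumes "c \<in> X" "c' \<in> X" "x \<in> fst c" "x \<in> fst c'"
  shows "(\<lambda>p. rad c' x p powr \<gamma>) \<in> \<Theta>[at x](\<lambda>p. rad c x p powr \<gamma>)"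
  using bigtheta_powr[OF rad_bigtheta[OF assms], of \<gamma>] by (simp add: rad_def)

lemma rad_tendsto_0:
  assumes "c \<in> X" "x \<in> fst c"
  shows "(rad c x \<longlongrightarrow> 0) (at x)" "\<forall>\<^sub>F p in at x. 0 < rad c x p" "\<forall>\<^sub>F p in at x. rad c x p < 1"
proof -
  have *: "(snd c \<longlongrightarrow> snd c x) (at x)" "\<forall>\<^sub>F p in at x. snd c p \<noteq> snd c x"
    using filterlim_chart[OF assms] by (auto simp: filterlim_at)
  have "((\<lambda>p. cmod (snd c p - snd c x)) \<longlongrightarrow> cmod (snd c x - snd c x)) (at x)"
    by (intro tendsto_intros *)
  then show 1: "(rad c x \<longlongrightarrow> 0) (at x)" by (simp add: rad_def[abs_def])
  show "\<forall>\<^sub>F p in at x. 0 < rad c x p"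
    using *(2) by (rule eventually_mono) (simp add: rad_def)
  show "\<forall>\<^sub>F p in at x. rad c x p < 1"
    using order_tendstoD(2)[OF 1, of 1] by simp
qed

lemma rad_powr_mono:
  assumes "c \<in> X" "x \<in> fst c" "\<gamma> \<le> \<delta>"
  shows "(\<lambda>p. rad c x p powr \<delta>) \<in> O[at x](\<lambda>p. rad c x p powr \<gamma>)"
proof (rule bigoI[where c = 1])
  show "\<forall>\<^sub>F p in at x. norm (rad c x p powr \<delta>) \<le> 1 * norm (rad c x p powr \<gamma>)"
    using rad_tendsto_0(2,3)[OF assms(1,2)]
    by eventually_elim (use assms(3) in \<open>auto intro: powr_mono'\<close>)
qed

lemma holomorphic_bigo_1:
  assumes "holomorphic_fun X V g" "x \<in> V" "c \<in> X" "x \<in> fst c"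
  shows "(\<lambda>p. cmod (g p)) \<in> O[at x](\<lambda>p. rad c x p powr 0)"
proof -
  have "(g \<longlongrightarrow> g x) (at x)" using holomorphic_isCont[OF assms(1,2)] by (simp add: isCont_def)
  then have "(\<lambda>p. cmod (g p)) \<in> O[at x](\<lambda>_. 1 :: real)"
    using tendsto_norm[of g "g x" "at x"] by (intro bigoI_tendsto_norm[where c = "norm (g x)"]) auto
  also have "(\<lambda>_. 1 :: real) \<in> O[at x](\<lambda>p. rad c x p powr 0)"
    by (rule bigoI[where c = 1]) (use rad_tendsto_0(2)[OF assms(3,4)] in \<open>auto elim: eventually_mono\<close>)
  finally show ?thesis .
qed

end

section \<open>Ramification of a nonconstant map\<close>

locale branched_map = surface_map Y X f
  for Y :: "('y::t2_space) chart set" and X :: "('x::t2_space) chart set" and f :: "'y \<Rightarrow> 'x" +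
  assumes connected_source: "connected (UNIV :: 'y set)"
    and nonconstant: "\<not> f constant_on UNIV"
begin

lemma vimage_chart_open:
  assumes "d \<in> Y" "c \<in> X"
  shows "open (fst d \<inter> f -` fst c)"
  using Y.open_chart[OF assms(1)] vimage_open[OF X.open_chart[OF assms(2)]] by blast

lemma chart_expression_holomorphic:
  assumes "d \<in> Y" "c \<in> X"
  shows "(\<lambda>w. snd c (f (chart_inv d w))) holomorphic_on snd d ` (fst d \<inter> f -` fst c)"
  using holomorphic_map assms by (simp add: holomorphic_map_def o_def)

text \<open>The set A of points near which f is constant is open by definition. Its complement is
  open by analytic continuation over coordinate discs, so connectedness leaves only A =
  \<open>UNIV\<close>, and a locally constant map on a connected surface is constant.\<close>

lemma locally_nonconstant:
  assumes "open N" "y \<in> N"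
  shows "\<exists>q\<in>N. f q \<noteq> f y"
proof (rule ccontr)
  assume neg: "\<not> ?thesis"
  define A where "A = {y. \<exists>N. open N \<and> y \<in> N \<and> (\<forall>q\<in>N. f q = f y)}"
  have yA: "y \<in> A" using neg assms unfolding A_def by blast
  have openA: "open A"
    unfolding open_subopen[of A]
  proof
    fix y assume "y \<in> A"
    then obtain N where N: "open N" "y \<in> N" "\<forall>q\<in>N. f q = f y" unfolding A_def by blast
    have "q \<in> A" if q: "q \<in> N" for q
    proof -
      have "\<forall>q'\<in>N. f q' = f q" using N(3) q by simp
      then show ?thesis unfolding A_def using N(1) q by blast
    qed
    then show "\<exists>T. open T \<and> y \<in> T \<and> T \<subseteq> A" using N by blast
  qed
  have "open (- A)"
    unfolding open_subopen[of "- A"]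
  proof
    fix y assume y: "y \<in> - A"
    obtain d where d: "d \<in> Y" "y \<in> fst d" by (rule Y.chart_at)
    obtain c where c: "c \<in> X" "f y \<in> fst c" by (rule X.chart_at)
    let ?S = "snd d ` (fst d \<inter> f -` fst c)" and ?h = "\<lambda>w. snd c (f (chart_inv d w))"
    have S: "open ?S" by (rule Y.open_chart_image[OF d(1) vimage_open[OF X.open_chart[OF c(1)]]])
    then obtain r where r: "r > 0" "ball (snd d y) r \<subseteq> ?S"
      using d c open_contains_ball[of ?S] by blast
    let ?B = "ball (snd d y) r"
    have hB: "?h holomorphic_on ?B"
      by (rule holomorphic_on_subset[OF chart_expression_holomorphic[OF d(1) c(1)] r(2)])
    let ?N = "fst d \<inter> snd d -` ?B"
    have N: "open ?N" "y \<in> ?N" using Y.open_chart_vimage[OF d(1)] d r by auto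
    have NS: "f q \<in> fst c" if "q \<in> ?N" for q
    proof -
      have "snd d q \<in> ?S" using that r by blast
      then obtain q' where "q' \<in> fst d" "f q' \<in> fst c" "snd d q = snd d q'" by blast
      then show ?thesis using Y.chart_inj[OF d(1)] that by auto
    qed
    have "q \<notin> A" if q: "q \<in> ?N" for q
    proof
      assume "q \<in> A"
      then obtain M where M: "open M" "q \<in> M" "\<forall>q'\<in>M. f q' = f q" unfolding A_def by blast
      let ?T = "snd d ` (fst d \<inter> (M \<inter> ?N))"
      have T: "open ?T" by (rule Y.open_chart_image[OF d(1) open_Int[OF M(1) N(1)]])
      have hT: "?h w = snd c (f q)" if "w \<in> ?T" for w using that M(3) d by auto
      have ne: "?T \<noteq> {}" and sub: "?T \<subseteq> ?B" using q M(2) by blast+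
      have const: "?h w = snd c (f q)" if "w \<in> ?B" for w
        by (rule analytic_continuation_open[OF T open_ball ne connected_ball sub hB holomorphic_on_const hT that])
      have eq: "f q' = f q" if "q' \<in> ?N" for q'
      proof -
        have "snd c (f q') = snd c (f q)" using const[of "snd d q'"] that d by auto
        then show ?thesis using X.chart_inj[OF c(1)] NS[OF that] NS[OF q] by simp
      qed
      have "y \<in> A" unfolding A_def 
      proof (intro CollectI exI[of _ ?N] conjI)
        show "\<forall>q'\<in>?N. f q' = f y" using eq N(2) by metis
      qed (use N in blast)+
      then show False using y by simp
    qed
    then show "\<exists>T. open T \<and> y \<in> T \<and> T \<subseteq> - A" using N by blast
  qed
  then have "A = UNIV"
    using connected_source[unfolded connected_clopen, rule_format, of A] openA yA
    by (auto simp: closed_def)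
  \<comment> \<open>With f locally constant, every condition on the value of f is open, hence also
    closed.\<close>
  have op: "open {q. P (f q)}" for P
    unfolding open_subopen[of "{q. P (f q)}"]
  proof
    fix q assume q: "q \<in> {q. P (f q)}"
    have "q \<in> A" using \<open>A = UNIV\<close> by simp
    then obtain N where N: "open N" "q \<in> N" "\<forall>q'\<in>N. f q' = f q" unfolding A_def by blast
    have "z \<in> {q. P (f q)}" if "z \<in> N" for z
    proof -
      have "f z = f q" using N(3) that by (rule bspec)
      then show ?thesis using q by (simp only: mem_Collect_eq)
    qed
    then show "\<exists>T. open T \<and> q \<in> T \<and> T \<subseteq> {q. P (f q)}" using N(1,2) by blast
  qed
  have "closed {q. f q = f y}"
    using op[of "\<lambda>v. v \<noteq> f y"] by (simp add: closed_def Collect_neg_eq)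
  then have "{q. f q = f y} = UNIV"
    using connected_source[unfolded connected_clopen, rule_format, of "{q. f q = f y}"]
      op[of "\<lambda>v. v = f y"] by auto
  then have "f constant_on UNIV" by (auto simp: constant_on_def)
  then show False using nonconstant by simp
qed

text \<open>Read in charts, f minus its value at y vanishes at y but not identically, hence has a
  zero of finite order with a cofactor that is nonzero near y.\<close>

lemma local_form_charts:
  assumes d: "d \<in> Y" "y \<in> fst d" and c: "c \<in> X" "f y \<in> fst c"
  shows "\<exists>m\<ge>1. \<exists>N g. open N \<and> y \<in> N \<and> N \<subseteq> fst d \<inter> f -` fst c \<and> holomorphic_fun Y N g \<and>
    (\<forall>q\<in>N. g q \<noteq> 0 \<and> snd c (f q) - snd c (f y) = g q * (snd d q - snd d y) ^ m) \<and>
    zorder (\<lambda>w. snd c (f (chart_inv d w)) - snd c (f y)) (snd d y) = int m"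
proof -
  let ?S = "snd d ` (fst d \<inter> f -` fst c)" and ?z = "snd d y"
  let ?F = "\<lambda>w. snd c (f (chart_inv d w)) - snd c (f y)"
  have S: "open ?S" by (rule Y.open_chart_image[OF d(1) vimage_open[OF X.open_chart[OF c(1)]]])
  then obtain r where r: "r > 0" "ball ?z r \<subseteq> ?S"
    using d c open_contains_ball[of ?S] by blast
  let ?B = "ball ?z r"
  have F: "?F holomorphic_on ?B"
    by (intro holomorphic_intros holomorphic_on_subset[OF chart_expression_holomorphic[OF d(1) c(1)] r(2)])
  have N: "open (fst d \<inter> snd d -` ?B)" by (rule Y.open_chart_vimage[OF d(1)]) simp
  then obtain q where q: "q \<in> fst d" "snd d q \<in> ?B" "f q \<noteq> f y"
    using locally_nonconstant[OF N, of y] d r by auto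
  have "f q \<in> fst c"
  proof -
    have "snd d q \<in> ?S" using q r by blast
    then obtain q' where "q' \<in> fst d" "f q' \<in> fst c" "snd d q = snd d q'" by blast
    then show ?thesis using Y.chart_inj[OF d(1)] q by auto
  qed
  then have "?F (snd d q) \<noteq> 0" using q X.chart_inj[OF c(1)] c d by simp
  then have ex: "\<exists>w\<in>?B. ?F w \<noteq> 0" using q by blast
  define n where "n = zorder ?F ?z"
  define g where "g = zor_poly ?F ?z"
  have "?F ?z = 0" using d by simp
  with zorder_exist_zero[OF F open_ball connected_ball _ ex, of ?z] r(1)
  obtain \<rho> where \<rho>: "n > 0" "\<rho> > 0" "cball ?z \<rho> \<subseteq> ?B" "g holomorphic_on cball ?z \<rho>"
    "\<forall>w\<in>cball ?z \<rho>. ?F w = g w * (w - ?z) ^ nat n \<and> g w \<noteq> 0"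
    unfolding n_def g_def by auto
  let ?N = "fst d \<inter> f -` fst c \<inter> (fst d \<inter> snd d -` ball ?z \<rho>)"
  have No: "open ?N"
    by (intro open_Int[OF vimage_chart_open[OF d(1) c(1)] Y.open_chart_vimage[OF d(1)]]) simp
  have "holomorphic_fun Y ?N (\<lambda>q. g (snd d q))"
    by (rule Y.holomorphic_compose_chart[OF d(1) No _ \<rho>(4)]) auto
  moreover have "\<forall>q\<in>?N. g (snd d q) \<noteq> 0 \<and> snd c (f q) - snd c (f y) = g (snd d q) * (snd d q - snd d y) ^ nat n"
  proof
    fix q assume q: "q \<in> ?N"
    then have "snd d q \<in> cball ?z \<rho>" "chart_inv d (snd d q) = q" using d(1) by auto
    then show "g (snd d q) \<noteq> 0 \<and> snd c (f q) - snd c (f y) = g (snd d q) * (snd d q - snd d y) ^ nat n"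
      using \<rho>(5) by metis
  qed
  moreover have "1 \<le> nat n" "zorder ?F ?z = int (nat n)" using \<rho>(1) by (auto simp: n_def)
  moreover have "y \<in> ?N" using d c \<rho>(2) by auto
  ultimately show ?thesis using No by blast
qed

text \<open>Growth bounds live on the punctured filter. They can be composed with f because nearby
  points other than y do not hit f y.\<close>

lemma filterlim_at_image: "filterlim f (at (f y)) (at y)"
  unfolding filterlim_at
proof
  obtain d where d: "d \<in> Y" "y \<in> fst d" by (rule Y.chart_at)
  obtain c where c: "c \<in> X" "f y \<in> fst c" by (rule X.chart_at)
  obtain m N g where m: "m \<ge> 1" and N: "open N" "y \<in> N" "N \<subseteq> fst d \<inter> f -` fst c"
    "\<forall>q\<in>N. g q \<noteq> 0 \<and> snd c (f q) - snd c (f y) = g q * (snd d q - snd d y) ^ m"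
    using local_form_charts[OF d c] by metis
  have ne: "f q \<in> UNIV \<and> f q \<noteq> f y" if "q \<in> N - {y}" for q
  proof -
    have "snd d q \<noteq> snd d y" using Y.chart_inj[OF d(1) _ d(2), of q] that N(3) by auto
    then have "snd c (f q) - snd c (f y) \<noteq> 0" using N(4) that by auto
    then show ?thesis by auto
  qed
  show "\<forall>\<^sub>F q in at y. f q \<in> UNIV \<and> f q \<noteq> f y"
    by (rule eventually_mono[OF Y.eventually_in_open[OF N(1,2)] ne])
  show "(f \<longlongrightarrow> f y) (at y)"
    using holomorphic_map unfolding holomorphic_map_def
    by (simp add: continuous_on_eq_continuous_at isCont_def)
qed

lemma power_ratio_limit:
  fixes m m' :: nat
  assumes F: "F \<noteq> bot" and w: "filterlim w (at 0) F" and lim: "((\<lambda>q. w q ^ m' / w q ^ m) \<longlongrightarrow> (L::complex)) F" "L \<noteq> 0"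
  shows "m = m'"
proof (rule ccontr)
  assume "m \<noteq> m'"
  have w0: "(w \<longlongrightarrow> 0) F" "\<forall>\<^sub>F q in F. w q \<noteq> 0" using w by (auto simp: filterlim_at)
  show False
  proof (cases "m < m'")
    case True
    have "((\<lambda>q. w q ^ (m' - m)) \<longlongrightarrow> 0) F"
      using tendsto_power[OF w0(1), of "m' - m"] True by (simp add: zero_power)
    moreover have "\<forall>\<^sub>F q in F. w q ^ (m' - m) = w q ^ m' / w q ^ m"
      using w0(2) by (rule eventually_mono) (use True in \<open>simp add: power_diff\<close>)
    ultimately have "((\<lambda>q. w q ^ m' / w q ^ m) \<longlongrightarrow> 0) F"
      by (rule Lim_transform_eventually)
    then show False using tendsto_unique[OF F lim(1)] lim(2) by auto
  next
    case False
    then have lt: "m' < m" using \<open>m \<noteq> m'\<close> by simp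
    have "((\<lambda>q. w q ^ (m - m')) \<longlongrightarrow> 0) F"
      using tendsto_power[OF w0(1), of "m - m'"] lt by (simp add: zero_power)
    from tendsto_mult[OF this lim(1)]
    have "((\<lambda>q. w q ^ (m - m') * (w q ^ m' / w q ^ m)) \<longlongrightarrow> 0) F" by simp
    moreover have "\<forall>\<^sub>F q in F. w q ^ (m - m') * (w q ^ m' / w q ^ m) = 1"
      using w0(2) by (rule eventually_mono) (use lt in \<open>simp add: power_diff\<close>)
    ultimately have "((\<lambda>q. 1 :: complex) \<longlongrightarrow> 0) F"
      by (rule Lim_transform_eventually)
    then show False using F by (simp add: tendsto_const_iff)
  qed
qed

lemma filterlim_coordinate:
  assumes "d \<in> Y" "y \<in> fst d"
  shows "filterlim (\<lambda>q. snd d q - snd d y) (at 0) (at y)"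
proof -
  have "(snd d \<longlongrightarrow> snd d y) (at y)" "\<forall>\<^sub>F q in at y. snd d q \<noteq> snd d y"
    using Y.filterlim_chart[OF assms] by (auto simp: filterlim_at)
  then show ?thesis by (auto simp: filterlim_at LIM_zero_iff elim: eventually_mono)
qed

text \<open>If both descriptions hold, the quotient of the powers m' and m of one coordinate has a
  nonzero limit, which forces m = m'. This is what makes the \<open>THE\<close> in
  \<open>multiplicity_at\<close> meaningful across all charts.\<close>

lemma order_unique:
  assumes d: "d \<in> Y" "y \<in> fst d" "d' \<in> Y" "y \<in> fst d'" and c: "c \<in> X" "f y \<in> fst c" "c' \<in> X" "f y \<in> fst c'"
    and N: "open N" "y \<in> N" "holomorphic_fun Y N g" "\<And>q. q \<in> N \<Longrightarrow> g q \<noteq> 0 \<and> snd c (f q) - snd c (f y) = g q * (snd d q - snd d y) ^ m"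
    and N': "open N'" "y \<in> N'" "holomorphic_fun Y N' g'" "\<And>q. q \<in> N' \<Longrightarrow> g' q \<noteq> 0 \<and> snd c' (f q) - snd c' (f y) = g' q * (snd d' q - snd d' y) ^ m'"
  shows "m = m'"
proof (rule power_ratio_limit[OF Y.at_neq_bot filterlim_coordinate[OF d(1,2)]])
  let ?w = "\<lambda>q. snd d q - snd d y" and ?w' = "\<lambda>q. snd d' q - snd d' y"
  \<comment> \<open>The limit collects the change of chart on X, the ratio of the cofactors, and the
    m'-th power of the change of coordinate on Y.\<close>
  let ?L = "chart_jacobian c c' id (f y) * g y / g' y * (chart_jacobian d' d id y) ^ m'"
  have "((\<lambda>q. (snd c' (f q) - snd c' (f y)) / (snd c (f q) - snd c (f y)) * g q / g' q * (?w q / ?w' q) ^ m') \<longlongrightarrow> ?L) (at y)"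
  proof (intro tendsto_intros)
    show "((\<lambda>q. (snd c' (f q) - snd c' (f y)) / (snd c (f q) - snd c (f y))) \<longlongrightarrow> chart_jacobian c c' id (f y)) (at y)"
      by (rule filterlim_compose[OF X.chart_ratio_limit[OF c(1,3,2,4)] filterlim_at_image])
    show "(g \<longlongrightarrow> g y) (at y)" "(g' \<longlongrightarrow> g' y) (at y)"
      using Y.holomorphic_isCont[OF N(3,2)] Y.holomorphic_isCont[OF N'(3,2)] by (auto simp: isCont_def)
    show "((\<lambda>q. ?w q / ?w' q) \<longlongrightarrow> chart_jacobian d' d id y) (at y)"
      by (rule Y.chart_ratio_limit[OF d(3,1,4,2)])
    show "g' y \<noteq> 0" using N' by blast
  qed
  moreover have "\<forall>\<^sub>F q in at y. (snd c' (f q) - snd c' (f y)) / (snd c (f q) - snd c (f y)) * g q / g' q * (?w q / ?w' q) ^ m'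
      = ?w q ^ m' / ?w q ^ m"
  proof -
    have ev: "\<forall>\<^sub>F q in at y. q \<in> N - {y}" "\<forall>\<^sub>F q in at y. q \<in> N' - {y}"
      "\<forall>\<^sub>F q in at y. ?w q \<noteq> 0" "\<forall>\<^sub>F q in at y. ?w' q \<noteq> 0"
      using Y.eventually_in_open[OF N(1,2)] Y.eventually_in_open[OF N'(1,2)]
        filterlim_coordinate[OF d(1,2)] filterlim_coordinate[OF d(3,4)] by (simp_all add: filterlim_at)
    then show ?thesis
    proof eventually_elim
      case (elim q)
      then show ?case using N(4)[of q] N'(4)[of q] by (simp add: power_divide)
    qed
  qed
  ultimately show "((\<lambda>q. ?w q ^ m' / ?w q ^ m) \<longlongrightarrow> ?L) (at y)"
    by (rule Lim_transform_eventually)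
  show "?L \<noteq> 0"
    using X.jacobian_nonzero[OF c(1,3,2,4)] Y.jacobian_nonzero[OF d(3,1,4,2)] N(2,4) N'(2,4) by simp
qed

abbreviation "ramification y \<equiv> multiplicity_at Y X f y"

lemma local_form:
  assumes d: "d \<in> Y" "y \<in> fst d" and c: "c \<in> X" "f y \<in> fst c"
  obtains N g where "open N" "y \<in> N" "N \<subseteq> fst d \<inter> f -` fst c" "holomorphic_fun Y N g"
    "\<forall>q\<in>N. g q \<noteq> 0" "\<forall>q\<in>N. snd c (f q) - snd c (f y) = g q * (snd d q - snd d y) ^ ramification y"
    "ramification y \<ge> 1"
proof -
  obtain m N g where m: "m \<ge> 1" and N: "open N" "y \<in> N" "N \<subseteq> fst d \<inter> f -` fst c" "holomorphic_fun Y N g"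
    "\<And>q. q \<in> N \<Longrightarrow> g q \<noteq> 0 \<and> snd c (f q) - snd c (f y) = g q * (snd d q - snd d y) ^ m"
    "zorder (\<lambda>w. snd c (f (chart_inv d w)) - snd c (f y)) (snd d y) = int m"
    using local_form_charts[OF d c] by metis
  have "ramification y = m"
    unfolding multiplicity_at_def
  proof (rule the_equality)
    show "\<forall>d\<in>Y. \<forall>c\<in>X. y \<in> fst d \<longrightarrow> f y \<in> fst c \<longrightarrow>
        zorder (\<lambda>w. snd c (f (chart_inv d w)) - snd c (f y)) (snd d y) = int m"
    proof (intro ballI impI)
      fix d' c' assume d': "d' \<in> Y" "y \<in> fst d'" and c': "c' \<in> X" "f y \<in> fst c'"
      obtain m' N' g' where N': "open N'" "y \<in> N'" "holomorphic_fun Y N' g'"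
        "\<And>q. q \<in> N' \<Longrightarrow> g' q \<noteq> 0 \<and> snd c' (f q) - snd c' (f y) = g' q * (snd d' q - snd d' y) ^ m'"
        "zorder (\<lambda>w. snd c' (f (chart_inv d' w)) - snd c' (f y)) (snd d' y) = int m'"
        using local_form_charts[OF d' c'] by metis
      have "m = m'" by (rule order_unique[OF d d' c c' N(1,2,4,5) N'(1-4)])
      then show "zorder (\<lambda>w. snd c' (f (chart_inv d' w)) - snd c' (f y)) (snd d' y) = int m"
        using N'(5) by simp
    qed
    fix k assume "\<forall>d\<in>Y. \<forall>c\<in>X. y \<in> fst d \<longrightarrow> f y \<in> fst c \<longrightarrow>
        zorder (\<lambda>w. snd c (f (chart_inv d w)) - snd c (f y)) (snd d y) = int k"
    then have "int k = int m" using d c N(6) by metis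
    then show "k = m" by simp
  qed
  with N m show ?thesis by (intro that[of N g]) auto
qed

lemma ramification_pos: "ramification y \<ge> 1"
proof -
  obtain d where d: "d \<in> Y" "y \<in> fst d" by (rule Y.chart_at)
  obtain c where c: "c \<in> X" "f y \<in> fst c" by (rule X.chart_at)
  show ?thesis by (rule local_form[OF d c])
qed

text \<open>In the local form the modulus of the coordinate on X is that of the coordinate on Y to
  the power m, times a cofactor with nonzero limit. Here the factor m in the weights of the pullback
  originates.\<close>

lemma rad_pullback:
  assumes d: "d \<in> Y" "y \<in> fst d" and c: "c \<in> X" "f y \<in> fst c"
  shows "(\<lambda>q. rad c (f y) (f q) powr \<gamma>) \<in> \<Theta>[at y](\<lambda>q. rad d y q powr (real (ramification y) * \<gamma>))"
proof -
  obtain N g where N: "open N" "y \<in> N" "N \<subseteq> fst d \<inter> f -` fst c" "holomorphic_fun Y N g"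
    "\<forall>q\<in>N. g q \<noteq> 0" "\<forall>q\<in>N. snd c (f q) - snd c (f y) = g q * (snd d q - snd d y) ^ ramification y"
    "ramification y \<ge> 1"
    by (rule local_form[OF d c])
  have "(g \<longlongrightarrow> g y) (at y)" using Y.holomorphic_isCont[OF N(4,2)] by (simp add: isCont_def)
  then have "((\<lambda>q. cmod (g q)) \<longlongrightarrow> cmod (g y)) (at y)" by (rule tendsto_norm)
  moreover have "\<forall>\<^sub>F q in at y. cmod (g q) = norm (rad c (f y) (f q) / (rad d y q ^ ramification y))"
    using Y.eventually_in_open[OF N(1,2)] Y.rad_tendsto_0(2)[OF d]
  proof eventually_elim
    case (elim q)
    then show ?case using N(6) by (simp add: rad_def norm_mult norm_power)
  qed
  ultimately have "((\<lambda>q. norm (rad c (f y) (f q) / (rad d y q ^ ramification y))) \<longlongrightarrow> cmod (g y)) (at y)"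
    by (rule Lim_transform_eventually)
  then have "(\<lambda>q. rad c (f y) (f q)) \<in> \<Theta>[at y](\<lambda>q. rad d y q ^ ramification y)"
    using N(2,5) by (intro bigthetaI_tendsto_norm[where c = "cmod (g y)"]) auto
  from bigtheta_powr[OF this, of \<gamma>]
  have "(\<lambda>q. rad c (f y) (f q) powr \<gamma>) \<in> \<Theta>[at y](\<lambda>q. (rad d y q ^ ramification y) powr \<gamma>)"
    by (simp add: rad_def)
  also have "(\<lambda>q. (rad d y q ^ ramification y) powr \<gamma>) \<in> \<Theta>[at y](\<lambda>q. rad d y q powr (real (ramification y) * \<gamma>))"
    by (rule bigthetaI_cong, rule eventually_mono[OF Y.rad_tendsto_0(2)[OF d]])
      (simp add: powr_powr powr_realpow[symmetric])
  finally show ?thesis .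
qed

text \<open>With z the coordinate on X centred at f y and w that on Y centred at y, this is the
  pullback of dz/z written as \<kappa> dw/w. Differentiating z f = g w^m logarithmically gives
  \<kappa> = w g'/g + m; the neighbourhood is shrunk until \<kappa> has no zero and y is the only
  preimage of f y.\<close>

lemma log_derivative:
  assumes d: "d \<in> Y" "y \<in> fst d" and c: "c \<in> X" "f y \<in> fst c"
  obtains N \<kappa> where "open N" "y \<in> N" "N \<subseteq> fst d \<inter> f -` fst c" "holomorphic_fun Y N \<kappa>" "\<kappa> y = of_nat (ramification y)"
    "\<forall>q\<in>N. \<kappa> q \<noteq> 0" "\<forall>q\<in>N - {y}. f q \<noteq> f y"
    "\<forall>q\<in>N. (snd d q - snd d y) * chart_jacobian d c f q = \<kappa> q * (snd c (f q) - snd c (f y))"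
proof -
  obtain N g where N: "open N" "y \<in> N" "N \<subseteq> fst d \<inter> f -` fst c" "holomorphic_fun Y N g"
    "\<forall>q\<in>N. g q \<noteq> 0" "\<forall>q\<in>N. snd c (f q) - snd c (f y) = g q * (snd d q - snd d y) ^ ramification y"
    "ramification y \<ge> 1"
    by (rule local_form[OF d c])
  let ?w = "\<lambda>q. snd d q - snd d y" and ?m = "ramification y"
  have Nd: "N \<inter> fst d = N" using N(3) by blast
  have w: "holomorphic_fun Y N ?w"
    by (intro Y.hol.R_diff Y.hol.R_const N(1) Y.hol.R_subset[OF Y.holomorphic_chart[OF d(1)]]) (use N(3) in auto)
  have dg: "holomorphic_fun Y N (d_z d g)" using Y.holomorphic_fun_d_z[OF N(4) d(1)] Nd by simp
  define \<kappa> where "\<kappa> = (\<lambda>q. ?w q * d_z d g q / g q + of_nat ?m)"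
  have \<kappa>: "holomorphic_fun Y N \<kappa>"
    unfolding \<kappa>_def by (intro Y.hol.R_add Y.hol.R_divide Y.hol.R_mult w dg N(1,4) Y.hol.R_const) (use N(5) in auto)
  \<comment> \<open>Multiplied by the coordinate, the derivative of a power contains no exponent k -
    1, so k = 0 needs no separate treatment.\<close>
  have dwk: "d_z d (\<lambda>q. ?w q ^ k) q * ?w q = of_nat k * ?w q ^ k" if "q \<in> N" for q k
  proof (induction k)
    case (Suc k)
    have q: "q \<in> N \<inter> fst d" using that N(3) by blast
    have dw: "d_z d ?w q = 1"
    proof -
      have "d_z d ?w q = d_z d (\<lambda>q. snd d q + (- snd d y)) q" by simp
      also have "\<dots> = d_z d (snd d) q + 0"
        using Y.d_add(1)[OF Y.holomorphic_imp_smooth[OF Y.holomorphic_chart[OF d(1)]] Y.smooth.R_const[OF Y.open_chart[OF d(1)]] d(1), of q "- snd d y"] q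
        by simp
      also have "\<dots> = 1"
        using Y.self.jacobian_d_z[OF d(1) d(1), of q] Y.jacobian_self[OF d(1), of q] q by simp
      finally show ?thesis .
    qed
    have "d_z d (\<lambda>q. ?w q * ?w q ^ k) q = ?w q * d_z d (\<lambda>q. ?w q ^ k) q + ?w q ^ k"
      using Y.d_mult(1)[OF Y.holomorphic_imp_smooth[OF w] Y.holomorphic_imp_smooth[OF Y.hol.R_power[OF w]] d(1) q, of k] dw
      by simp
    then show ?case using Suc by (simp add: algebra_simps)
  qed simp
  have eq: "?w q * chart_jacobian d c f q = \<kappa> q * (snd c (f q) - snd c (f y))" if q: "q \<in> N" for q
  proof -
    have q': "q \<in> N \<inter> fst d" "q \<in> fst d \<inter> f -` fst c" using q N(3) by blast+
    have "chart_jacobian d c f q = d_z d (\<lambda>q. snd c (f q)) q"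
      by (rule jacobian_d_z[OF d(1) c(1) q'(2)])
    also have "\<dots> = d_z d (\<lambda>q. g q * ?w q ^ ?m + snd c (f y)) q"
      by (rule Y.d_cong[OF d(1) N(1) q'(1)]) (use N(6) in \<open>simp add: algebra_simps\<close>)
    also have "\<dots> = g q * d_z d (\<lambda>q. ?w q ^ ?m) q + d_z d g q * ?w q ^ ?m"
    proof -
      have s: "smooth_fun Y N g" "smooth_fun Y N (\<lambda>q. ?w q ^ ?m)" "smooth_fun Y N (\<lambda>q. snd c (f y))"
        using N w by (auto intro!: Y.holomorphic_imp_smooth Y.hol.R_power Y.hol.R_const)
      show ?thesis
        using Y.d_add(1)[OF Y.smooth.R_mult[OF s(1,2)] s(3) d(1) q'(1)] Y.d_mult(1)[OF s(1,2) d(1) q'(1)] by simp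
    qed
    finally have J: "chart_jacobian d c f q = g q * d_z d (\<lambda>q. ?w q ^ ?m) q + d_z d g q * ?w q ^ ?m" .
    have "?w q * chart_jacobian d c f q = g q * (d_z d (\<lambda>q. ?w q ^ ?m) q * ?w q) + ?w q * d_z d g q * ?w q ^ ?m"
      unfolding J by (simp add: algebra_simps)
    also have "\<dots> = \<kappa> q * (g q * ?w q ^ ?m)"
      unfolding dwk[OF q] \<kappa>_def using N(5) q by (simp add: field_simps)
    finally show ?thesis using N(6) q by simp
  qed
  have \<kappa>y: "\<kappa> y = of_nat ?m" by (simp add: \<kappa>_def)
  have "isCont \<kappa> y" by (rule Y.holomorphic_isCont[OF \<kappa> N(2)])
  then have "\<forall>\<^sub>F q in at y. \<kappa> q \<noteq> 0"
    using tendsto_imp_eventually_ne[of \<kappa> "\<kappa> y" "at y" 0] \<kappa>y N(7) by (simp add: isCont_def)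
  moreover have "\<forall>\<^sub>F q in at y. f q \<noteq> f y"
    using filterlim_at_image[of y] by (simp add: filterlim_at)
  ultimately have "\<forall>\<^sub>F q in at y. \<kappa> q \<noteq> 0 \<and> f q \<noteq> f y" by (rule eventually_conj)
  then obtain M where M: "open M" "y \<in> M" "\<forall>q\<in>M. q \<noteq> y \<longrightarrow> \<kappa> q \<noteq> 0 \<and> f q \<noteq> f y"
    unfolding eventually_at_topological by blast
  show ?thesis
  proof (rule that[of "N \<inter> M" \<kappa>])
    show "holomorphic_fun Y (N \<inter> M) \<kappa>" using \<kappa> N M by (auto intro: Y.hol.R_subset)
    have "\<kappa> q \<noteq> 0" if "q \<in> N \<inter> M" for q using M that \<kappa>y N(7) by (cases "q = y") auto
    then show "\<forall>q\<in>N \<inter> M. \<kappa> q \<noteq> 0" by blast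
  qed (use N M \<kappa>y eq in auto)
qed

end

section \<open>Ramified coordinate changes\<close>

context branched_map
begin

text \<open>A coordinate \<open>t\<close> at \<open>y\<close> in which \<open>f\<close> is \<open>t \<mapsto> t\<^sup>m\<close>: \<open>\<phi>\<close> is the parametrisation and \<open>\<tau>\<close>
  its inverse.\<close>

lemma local_parametrization:
  assumes d: "d \<in> Y" "y \<in> fst d" and c: "c \<in> X" "f y \<in> fst c" and M: "open M" "y \<in> M"
  obtains \<rho> \<phi> \<tau> where "\<rho> > 0" "\<phi> 0 = y" "\<phi> ` ball 0 \<rho> \<subseteq> M \<inter> fst d \<inter> f -` fst c"
    "(\<lambda>t. snd d (\<phi> t)) holomorphic_on ball 0 \<rho>" "inj_on \<phi> (ball 0 \<rho>)"
    "\<forall>t\<in>ball 0 \<rho>. snd c (f (\<phi> t)) = snd c (f y) + t ^ ramification y"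
    "filterlim \<phi> (at y) (at 0)" "filterlim \<tau> (at 0) (at y)" "\<forall>\<^sub>F q in at y. \<phi> (\<tau> q) = q"
    "(\<lambda>t. rad d y (\<phi> t)) \<in> \<Theta>[at 0](\<lambda>t. cmod t)" "(\<lambda>q. cmod (\<tau> q)) \<in> \<Theta>[at y](rad d y)"
proof -
  obtain N0 g where N0: "open N0" "y \<in> N0" "N0 \<subseteq> fst d \<inter> f -` fst c" "holomorphic_fun Y N0 g"
    "\<forall>q\<in>N0. g q \<noteq> 0" "\<forall>q\<in>N0. snd c (f q) - snd c (f y) = g q * (snd d q - snd d y) ^ ramification y"
    "ramification y \<ge> 1"
    by (rule local_form[OF d c])
  define N where "N = N0 \<inter> M"
  have N: "open N" "y \<in> N" "N \<subseteq> M \<inter> fst d \<inter> f -` fst c" "holomorphic_fun Y N g"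
    "\<forall>q\<in>N. g q \<noteq> 0" "\<forall>q\<in>N. snd c (f q) - snd c (f y) = g q * (snd d q - snd d y) ^ ramification y"
    using N0 M by (auto simp: N_def intro: Y.hol.R_subset)
  let ?m = "ramification y" and ?z = "snd d y"
  define S where "S = snd d ` N"
  define G where "G = (\<lambda>w. g (chart_inv d w))"
  have SN: "fst d \<inter> N = N" using N(3) by blast
  have S: "open S" "?z \<in> S" using Y.open_chart_image[OF d(1) N(1)] N(2) SN by (auto simp: S_def)
  have G: "G holomorphic_on S"
    using N(4) d(1) SN unfolding holomorphic_fun_def S_def G_def by (auto simp: o_def)
  have Sinv: "chart_inv d w \<in> N" "snd d (chart_inv d w) = w" if "w \<in> S" for w
    using that N(3) d(1) unfolding S_def by auto
  have Gz: "G ?z \<noteq> 0" "G ?z = g y" using N(2,5) d by (auto simp: G_def)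
  \<comment> \<open>The normalised cofactor will be kept at distance less than 1 from 1, away from
    the branch cut of \<open>Ln\<close>, so that it has a holomorphic m-th root.\<close>
  have "isCont (\<lambda>w. G w / G ?z) ?z"
    using holomorphic_on_imp_continuous_on[OF G] S Gz
    by (auto intro!: continuous_intros simp: continuous_on_eq_continuous_at)
  then obtain \<delta> where \<delta>: "\<delta> > 0" "\<And>w. dist w ?z < \<delta> \<Longrightarrow> dist (G w / G ?z) 1 < 1"
    unfolding continuous_at_eps_delta using Gz(1) by (metis divide_self zero_less_one)
  obtain r0 where r0: "r0 > 0" "ball ?z r0 \<subseteq> S" using S open_contains_ball by blast
  define r where "r = min r0 \<delta>"
  have r: "r > 0" "ball ?z r \<subseteq> S" using r0 \<delta> by (auto simp: r_def)
  have re: "G w / G ?z \<notin> \<real>\<^sub>\<le>\<^sub>0" if "w \<in> ball ?z r" for w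
  proof
    assume "G w / G ?z \<in> \<real>\<^sub>\<le>\<^sub>0"
    then have "Re (G w / G ?z) \<le> 0" by (auto simp: complex_nonpos_Reals_iff)
    moreover have "dist (G w / G ?z) 1 < 1" using \<delta>(2)[of w] that by (simp add: r_def dist_commute)
    moreover have "\<bar>Re (G w / G ?z - 1)\<bar> \<le> cmod (G w / G ?z - 1)" by (rule abs_Re_le_cmod)
    ultimately show False by (simp add: dist_norm)
  qed
  \<comment> \<open>An m-th root of the cofactor G: the constant G(z) and the quotient by it receive
    separate roots, because only the quotient is known to avoid the cut.\<close>
  define k where "k = (\<lambda>w. exp (Ln (G ?z) / of_nat ?m) * exp (Ln (G w / G ?z) / of_nat ?m))"
  have k_hol: "k holomorphic_on ball ?z r"
    unfolding k_def using re Gz(1) N0(7)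
    by (intro holomorphic_intros holomorphic_on_subset[OF G r(2)]) auto
  have km: "k w ^ ?m = G w" if "w \<in> ball ?z r" for w
  proof -
    have "G w \<noteq> 0" using Sinv[of w] that r(2) N(5) by (auto simp: G_def)
    have e: "exp (Ln a / of_nat ?m) ^ ?m = a" if "a \<noteq> 0" for a
      using that N0(7) by (simp add: exp_of_nat_mult[symmetric])
    show ?thesis
      unfolding k_def power_mult_distrib using e[of "G ?z"] e[of "G w / G ?z"] Gz(1) \<open>G w \<noteq> 0\<close> by simp
  qed
  have k0: "k w \<noteq> 0" for w by (simp add: k_def)
  \<comment> \<open>The coordinate in which f becomes a pure power: its m-th power is (w - z)^m
    G(w). Its derivative at the centre is k there, hence nonzero, and T can be inverted
    nearby.\<close>
  define T where "T = (\<lambda>w. (w - ?z) * k w)"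
  have T: "T holomorphic_on ball ?z r" unfolding T_def by (intro holomorphic_intros k_hol)
  have "(k has_field_derivative deriv k ?z) (at ?z)"
    using holomorphic_derivI[OF k_hol open_ball] r(1) by simp
  then have "(T has_field_derivative k ?z) (at ?z)"
    unfolding T_def by (auto intro!: derivative_eq_intros)
  then have dT: "deriv T ?z \<noteq> 0" using k0 DERIV_imp_deriv by metis
  obtain r' where r': "r' > 0" "ball ?z r' \<subseteq> ball ?z r" "open (T ` ball ?z r')" "inj_on T (ball ?z r')"
    by (rule has_complex_derivative_locally_invertible[OF T _ open_ball dT]) (use r in auto)
  have "T holomorphic_on ball ?z r'" by (rule holomorphic_on_subset[OF T r'(2)])
  then obtain \<psi> where \<psi>: "\<psi> holomorphic_on (T ` ball ?z r')" "\<forall>w\<in>ball ?z r'. \<psi> (T w) = w"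
    using holomorphic_has_inverse[OF _ open_ball r'(4)] by metis
  have Tz: "T ?z = 0" by (simp add: T_def)
  then have "0 \<in> T ` ball ?z r'" using r'(1) by force
  then obtain \<rho> where \<rho>: "\<rho> > 0" "ball 0 \<rho> \<subseteq> T ` ball ?z r'"
    using r'(3) open_contains_ball by blast
  have \<psi>_in: "\<psi> t \<in> ball ?z r'" "T (\<psi> t) = t" if "t \<in> ball 0 \<rho>" for t
    using \<rho>(2) \<psi>(2) that by auto
  have \<psi>_hol: "\<psi> holomorphic_on ball 0 \<rho>" by (rule holomorphic_on_subset[OF \<psi>(1) \<rho>(2)])
  have \<psi>0: "\<psi> 0 = ?z" using \<psi>(2) Tz r'(1) by (metis centre_in_ball)
  define \<phi> where "\<phi> = (\<lambda>t. chart_inv d (\<psi> t))"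
  \<comment> \<open>A total function, meaningful only near y; for this reason the inverse relation
    with \<phi> is claimed eventually and not on a set.\<close>
  define \<tau> where "\<tau> = (\<lambda>q. T (snd d q))"
  have \<phi>_in: "\<phi> t \<in> N" "snd d (\<phi> t) = \<psi> t" if "t \<in> ball 0 \<rho>" for t
    using Sinv[of "\<psi> t"] \<psi>_in(1)[OF that] r'(2) r(2) unfolding \<phi>_def by blast+
  have ctr: "\<psi> \<midarrow>0\<rightarrow> ?z" "k \<midarrow>?z\<rightarrow> k ?z" "T \<midarrow>?z\<rightarrow> 0"
  proof -
    have "isCont \<psi> 0" "isCont k ?z" "isCont T ?z"
      using holomorphic_on_imp_continuous_on[OF \<psi>_hol] holomorphic_on_imp_continuous_on[OF k_hol]
        holomorphic_on_imp_continuous_on[OF T] \<rho>(1) r(1)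
      by (auto simp: continuous_on_eq_continuous_at)
    then show "\<psi> \<midarrow>0\<rightarrow> ?z" "k \<midarrow>?z\<rightarrow> k ?z" "T \<midarrow>?z\<rightarrow> 0"
      unfolding isCont_def by (simp_all only: \<psi>0 Tz)
  qed
  have ball0: "\<forall>\<^sub>F t in at 0. t \<in> ball 0 \<rho> - {0::complex}"
    unfolding eventually_at_topological using \<rho>(1) by (intro exI[of _ "ball 0 \<rho>"]) auto
  have ball1: "\<forall>\<^sub>F w in at ?z. w \<in> ball ?z r' - {?z}"
    unfolding eventually_at_topological using r'(1) by (intro exI[of _ "ball ?z r'"]) auto
  have \<psi>_ne: "\<psi> t \<noteq> ?z" if "t \<in> ball 0 \<rho> - {0}" for t using \<psi>_in(2)[of t] that Tz by auto
  have fl\<psi>: "filterlim \<psi> (at ?z) (at 0)"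
    unfolding filterlim_at using ctr(1) eventually_mono[OF ball0 \<psi>_ne] by simp
  have flT: "filterlim T (at 0) (at ?z)"
    unfolding filterlim_at
  proof
    show "\<forall>\<^sub>F w in at ?z. T w \<in> UNIV \<and> T w \<noteq> 0"
      using ball1 by (rule eventually_mono) (simp add: T_def k0)
  qed (rule ctr(3))
  have fl\<phi>: "filterlim \<phi> (at y) (at 0)"
    unfolding \<phi>_def by (rule filterlim_compose[OF Y.filterlim_chart_inv[OF d] fl\<psi>])
  have fl\<tau>: "filterlim \<tau> (at 0) (at y)"
    unfolding \<tau>_def by (rule filterlim_compose[OF flT Y.filterlim_chart[OF d]])
  have near: "\<forall>\<^sub>F q in at y. snd d q \<in> ball ?z r' - {?z} \<and> q \<in> N - {y}"
    using filterlim_iff[THEN iffD1, rule_format, OF Y.filterlim_chart[OF d] ball1]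
      Y.eventually_in_open[OF N(1,2)] by (rule eventually_conj)
  have \<tau>rad: "(\<lambda>q. cmod (\<tau> q)) \<in> \<Theta>[at y](rad d y)"
  proof (rule bigthetaI_tendsto_norm[where c = "cmod (k ?z)"])
    have "((\<lambda>q. k (snd d q)) \<longlongrightarrow> k ?z) (at y)"
      by (rule filterlim_compose[OF ctr(2) Y.filterlim_chart[OF d]])
    then have "((\<lambda>q. cmod (k (snd d q))) \<longlongrightarrow> cmod (k ?z)) (at y)" by (rule tendsto_norm)
    moreover have "\<forall>\<^sub>F q in at y. cmod (k (snd d q)) = norm (cmod (\<tau> q) / rad d y q)"
      using near by (rule eventually_mono) (simp add: \<tau>_def T_def rad_def norm_mult)
    ultimately show "((\<lambda>q. norm (cmod (\<tau> q) / rad d y q)) \<longlongrightarrow> cmod (k ?z)) (at y)"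
      by (rule Lim_transform_eventually)
  qed (simp add: k0)
  have "(\<lambda>t. cmod (\<tau> (\<phi> t))) \<in> \<Theta>[at 0](\<lambda>t. rad d y (\<phi> t))"
    by (rule landau_theta.compose[OF \<tau>rad fl\<phi>])
  also have "(\<lambda>t. cmod (\<tau> (\<phi> t))) \<in> \<Theta>[at 0](\<lambda>t. rad d y (\<phi> t)) \<longleftrightarrow>
      (\<lambda>t. cmod t) \<in> \<Theta>[at 0](\<lambda>t. rad d y (\<phi> t))"
    by (rule landau_theta.in_cong, rule eventually_mono[OF ball0]) (simp add: \<tau>_def \<phi>_in \<psi>_in)
  finally have \<phi>rad: "(\<lambda>t. rad d y (\<phi> t)) \<in> \<Theta>[at 0](\<lambda>t. cmod t)"
    by (simp add: bigtheta_sym)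
  show ?thesis
  proof (rule that[of \<rho> \<phi> \<tau>])
    show "\<phi> ` ball 0 \<rho> \<subseteq> M \<inter> fst d \<inter> f -` fst c" using \<phi>_in(1) N(3) by blast
    show "\<phi> 0 = y" using \<psi>0 d by (simp add: \<phi>_def)
    show "(\<lambda>t. snd d (\<phi> t)) holomorphic_on ball 0 \<rho>"
      by (rule holomorphic_transform[OF \<psi>_hol]) (simp add: \<phi>_in)
    show "inj_on \<phi> (ball 0 \<rho>)" by (rule inj_onI) (metis \<phi>_in(2) \<psi>_in(2))
    show "\<forall>t\<in>ball 0 \<rho>. snd c (f (\<phi> t)) = snd c (f y) + t ^ ?m"
    proof
      fix t assume t: "t \<in> ball (0::complex) \<rho>"
      have "snd c (f (\<phi> t)) - snd c (f y) = g (\<phi> t) * (\<psi> t - ?z) ^ ?m"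
        using N(6) \<phi>_in[OF t] by simp
      also have "g (\<phi> t) = k (\<psi> t) ^ ?m"
        using km[of "\<psi> t"] \<psi>_in(1)[OF t] r'(2) by (auto simp: G_def \<phi>_def)
      also have "k (\<psi> t) ^ ?m * (\<psi> t - ?z) ^ ?m = T (\<psi> t) ^ ?m"
        by (simp add: T_def power_mult_distrib mult.commute)
      finally show "snd c (f (\<phi> t)) = snd c (f y) + t ^ ?m" using \<psi>_in(2)[OF t] by (simp add: algebra_simps)
    qed
    show "\<forall>\<^sub>F q in at y. \<phi> (\<tau> q) = q"
      using near
    proof (rule eventually_mono)
      fix q assume q: "snd d q \<in> ball ?z r' - {?z} \<and> q \<in> N - {y}"
      then have "\<psi> (T (snd d q)) = snd d q" using \<psi>(2) by blast
      then show "\<phi> (\<tau> q) = q" using q N(3) d(1) by (auto simp: \<phi>_def \<tau>_def)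
    qed
  qed (use \<rho>(1) fl\<phi> fl\<tau> \<phi>rad \<tau>rad in auto)
qed

end

subsection \<open>Isotypic components\<close>

text \<open>Up to the factor m, the component of u of character \<open>\<omega>\<^sup>k\<close>
  under multiplication by roots of unity, divided by \<open>t\<^sup>k\<close> so that it depends on
  z = \<open>t\<^sup>m\<close> alone. Summing over the whole fibre avoids choosing a root of
  z.\<close>

definition isotypic :: "nat \<Rightarrow> nat \<Rightarrow> (complex \<Rightarrow> complex) \<Rightarrow> complex \<Rightarrow> complex" where
  "isotypic m k u z = (\<Sum>t | t ^ m = z. u t / t ^ k)"

lemma isotypic_root:
  assumes "m > 0" "t ^ m = z" "z \<noteq> 0"
  shows "isotypic m k u z = (\<Sum>\<omega> | \<omega> ^ m = 1. u (t * \<omega>) / (t * \<omega>) ^ k)"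
proof -
  have "t \<noteq> 0" using assms by auto
  then have "bij_betw (\<lambda>\<omega>. t * \<omega>) {\<omega>. \<omega> ^ m = 1} {t. t ^ m = z}"
    using assms by (intro bij_betw_byWitness[where f' = "\<lambda>w. w / t"])
      (auto simp: power_mult_distrib power_divide)
  then show ?thesis
    unfolding isotypic_def by (rule sum.reindex_bij_betw[symmetric])
qed

text \<open>Near a point other than 0 there is a holomorphic branch r of the m-th root; the fibre is
  then r times the roots of unity, and the component is a finite sum of holomorphic
  functions.\<close>

lemma isotypic_holomorphic:
  assumes m: "m > 0" and \<rho>: "\<rho> > 0" and u: "u holomorphic_on ball 0 \<rho> - {0}"
  shows "isotypic m k u holomorphic_on ball 0 (\<rho> ^ m) - {0}"
proof (rule hol_reg.P_local)
  fix z0 :: complex assume z0: "z0 \<in> ball 0 (\<rho> ^ m) - {0}"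
  let ?T = "ball z0 (cmod z0) \<inter> ball 0 (\<rho> ^ m)"
  define t0 where "t0 = exp (Ln z0 / of_nat m)"
  have t0: "t0 ^ m = z0" using z0 m by (simp add: t0_def exp_of_nat_mult[symmetric])
  \<comment> \<open>The branch is normalised at \<open>z0\<close>: on the disc around
    \<open>z0\<close> that avoids 0 the quotient z / \<open>z0\<close> stays off the cut of
    \<open>Ln\<close>.\<close>
  define r where "r = (\<lambda>z. t0 * exp (Ln (z / z0) / of_nat m))"
  have T0: "z \<noteq> 0" if "z \<in> ?T" for z using that by auto
  have re: "z / z0 \<notin> \<real>\<^sub>\<le>\<^sub>0" if "z \<in> ?T" for z
  proof
    assume "z / z0 \<in> \<real>\<^sub>\<le>\<^sub>0"
    then have "Re (z / z0) \<le> 0" by (auto simp: complex_nonpos_Reals_iff)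
    moreover have "cmod (z / z0 - 1) < 1"
    proof -
      have "z / z0 - 1 = (z - z0) / z0" using z0 by (simp add: field_simps)
      then show ?thesis using that z0 by (simp add: norm_divide dist_norm norm_minus_commute)
    qed
    moreover have "\<bar>Re (z / z0 - 1)\<bar> \<le> cmod (z / z0 - 1)" by (rule abs_Re_le_cmod)
    ultimately show False by simp
  qed
  have r: "r holomorphic_on ?T"
    unfolding r_def using re m z0 by (intro holomorphic_intros) auto
  have rm: "r z ^ m = z" if "z \<in> ?T" for z
    using T0[OF that] z0 m t0 by (simp add: r_def power_mult_distrib exp_of_nat_mult[symmetric])
  have in_ball: "r z * \<omega> \<in> ball 0 \<rho> - {0}" if "z \<in> ?T" "\<omega> ^ m = 1" for z \<omega>
  proof -
    have "(r z * \<omega>) ^ m = z" using rm[OF that(1)] that(2) by (simp add: power_mult_distrib)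
    then have "cmod (r z * \<omega>) ^ m = cmod z" by (simp add: norm_power[symmetric])
    also have "\<dots> < \<rho> ^ m" using that(1) by simp
    finally have "cmod (r z * \<omega>) < \<rho>" using \<rho> by (simp add: power_less_imp_less_base)
    moreover have "r z * \<omega> \<noteq> 0"
      using \<open>(r z * \<omega>) ^ m = z\<close> T0[OF that(1)] m by (metis power_0_left not_gr_zero)
    ultimately show ?thesis by simp
  qed
  have "(\<lambda>z. \<Sum>\<omega> | \<omega> ^ m = 1. u (r z * \<omega>) / (r z * \<omega>) ^ k) holomorphic_on ?T"
  proof (intro holomorphic_on_sum holomorphic_on_divide holomorphic_on_power)
    fix \<omega> :: complex assume \<omega>: "\<omega> \<in> {\<omega>. \<omega> ^ m = 1}"
    show rw: "(\<lambda>z. r z * \<omega>) holomorphic_on ?T" by (intro holomorphic_intros r)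
    show "(\<lambda>z. u (r z * \<omega>)) holomorphic_on ?T"
      by (rule holomorphic_on_compose_gen[OF rw u, unfolded o_def]) (use in_ball \<omega> in auto)
    show "(r z * \<omega>) ^ k \<noteq> 0" if "z \<in> ?T" for z using in_ball[OF that, of \<omega>] \<omega> by simp
  qed
  then have "isotypic m k u holomorphic_on ?T"
    by (rule holomorphic_transform) (use isotypic_root[OF m rm T0] in simp)
  moreover have "z0 \<in> ?T" "?T \<subseteq> ball 0 (\<rho> ^ m) - {0}" using z0 by auto
  ultimately show "\<exists>T. open T \<and> z0 \<in> T \<and> T \<subseteq> ball 0 (\<rho> ^ m) - {0} \<and> isotypic m k u holomorphic_on T"
    by (intro exI[of _ ?T]) auto
qed

text \<open>Orthogonality of characters: the sum of the powers of \<open>inverse \<omega>\<close>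
  below m vanishes unless \<omega> = 1, so only u(t) itself survives.\<close>

lemma sum_isotypic:
  assumes m: "m > 0" and t: "t \<noteq> 0"
  shows "(\<Sum>k<m. t ^ k * isotypic m k u (t ^ m)) = of_nat m * u t"
proof -
  have fin: "finite {\<omega> :: complex. \<omega> ^ m = 1}" using m by (rule finite_nth_roots)
  have "(\<Sum>k<m. t ^ k * isotypic m k u (t ^ m)) = (\<Sum>k<m. \<Sum>\<omega> | \<omega> ^ m = 1. u (t * \<omega>) * inverse \<omega> ^ k)"
    using t by (simp add: isotypic_root[OF m refl] sum_distrib_left power_mult_distrib field_simps)
  also have "\<dots> = (\<Sum>\<omega> | \<omega> ^ m = 1. u (t * \<omega>) * (\<Sum>k<m. inverse \<omega> ^ k))"
    by (subst sum.swap) (simp add: sum_distrib_left)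
  also have "\<dots> = (\<Sum>\<omega> :: complex | \<omega> ^ m = 1. if \<omega> = 1 then of_nat m * u t else 0)"
  proof (rule sum.cong[OF refl])
    fix \<omega> :: complex assume w: "\<omega> \<in> {\<omega>. \<omega> ^ m = 1}"
    show "u (t * \<omega>) * (\<Sum>k<m. inverse \<omega> ^ k) = (if \<omega> = 1 then of_nat m * u t else 0)"
    proof (cases "\<omega> = 1")
      case False
      then have "inverse \<omega> \<noteq> 1" by simp
      have "inverse \<omega> ^ m = 1" using w by (simp add: power_inverse)
      then have "(\<Sum>k<m. inverse \<omega> ^ k) = 0"
        using geometric_sum[OF \<open>inverse \<omega> \<noteq> 1\<close>, of m] by simp
      then show ?thesis using False by simp
    qed simp
  qed
  also have "\<dots> = of_nat m * u t" using fin by simp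
  finally show ?thesis .
qed

lemma norm_eq_root_powr:
  fixes t :: complex
  assumes "t ^ m = z" "m > 0"
  shows "cmod t = cmod z powr (1 / real m)"
proof (cases "t = 0")
  case True
  then show ?thesis using assms by auto
next
  case False
  then have "cmod z = cmod t powr real m"
    using assms by (simp add: norm_power[symmetric] powr_realpow)
  then show ?thesis using assms False by (simp add: powr_powr)
qed

section \<open>Growth filtrations\<close>

definition hermitian_form :: "((complex^'n) \<Rightarrow> (complex^'n) \<Rightarrow> complex) \<Rightarrow> bool" where
  "hermitian_form h \<longleftrightarrow>
     (\<forall>u v w. h (u + v) w = h u w + h v w) \<and> (\<forall>a u v. h (a *s u) v = a * h u v) \<and>
     (\<forall>u v. h v u = cnj (h u v)) \<and> (\<forall>u. u \<noteq> 0 \<longrightarrow> Re (h u u) > 0)"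

definition hnorm :: "((complex^'n) \<Rightarrow> (complex^'n) \<Rightarrow> complex) \<Rightarrow> complex^'n \<Rightarrow> real" where
  "hnorm h v = sqrt (Re (h v v))"

lemma hermitian_form_cnj: "hermitian_form h \<Longrightarrow> h v u = cnj (h u v)"
  unfolding hermitian_form_def by blast

lemma hermitian_form_simps:
  assumes "hermitian_form h"
  shows "h (u + v) w = h u w + h v w" "h (a *s u) v = a * h u v"
    "h w (u + v) = h w u + h w v" "h v (a *s u) = cnj a * h v u" "h 0 v = 0" "h v 0 = 0"
    "Re (h v v) \<ge> 0"
proof -
  have add: "h (u + v) w = h u w + h v w" and scale: "h (a *s u) v = a * h u v" for u v w a
    using assms unfolding hermitian_form_def by blast+
  note cnj = hermitian_form_cnj[OF assms]
  show "h (u + v) w = h u w + h v w" "h (a *s u) v = a * h u v" by (fact add scale)+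
  show "h w (u + v) = h w u + h w v"
    unfolding cnj[of w "u + v"] cnj[of w u] cnj[of w v] by (simp add: add)
  show "h v (a *s u) = cnj a * h v u"
    unfolding cnj[of v "a *s u"] cnj[of v u] by (simp add: scale)
  have 0: "h 0 v = 0" for v using scale[of 0 0 v] by simp
  show "h 0 v = 0" by (fact 0)
  show "h v 0 = 0" unfolding cnj[of v 0] by (simp add: 0)
  show "Re (h v v) \<ge> 0"
  proof (cases "v = 0")
    case False
    then have "Re (h v v) > 0" using assms unfolding hermitian_form_def by blast
    then show ?thesis by simp
  qed (simp add: 0)
qed

lemma hermitian_form_sum:
  assumes "hermitian_form h"
  shows "h (\<Sum>i\<in>I. a i *s x i) v = (\<Sum>i\<in>I. a i * h (x i) v)"
    "h v (\<Sum>i\<in>I. a i *s x i) = (\<Sum>i\<in>I. cnj (a i) * h v (x i))"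
  by (induction I rule: infinite_finite_induct) (simp_all add: hermitian_form_simps[OF assms])

lemma hnorm_nonneg [simp]: "hermitian_form h \<Longrightarrow> 0 \<le> hnorm h v"
  by (simp add: hnorm_def hermitian_form_simps)

lemma hnorm_zero [simp]: "hermitian_form h \<Longrightarrow> hnorm h 0 = 0"
  by (simp add: hnorm_def hermitian_form_simps)

lemma hnorm_scale:
  assumes "hermitian_form h"
  shows "hnorm h (a *s v) = cmod a * hnorm h v"
proof -
  have "h (a *s v) (a *s v) = of_real ((cmod a)\<^sup>2) * h v v"
    using hermitian_form_simps(2,4)[OF assms] by (simp add: complex_norm_square mult.assoc del: of_real_power)
  then show ?thesis by (simp add: hnorm_def real_sqrt_mult)
qed

text \<open>The parallelogram law gives a triangle inequality up to a constant, which is all that growth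
  orders need.\<close>

lemma hnorm_add_le:
  assumes "hermitian_form h"
  shows "hnorm h (u + v) \<le> 2 * (hnorm h u + hnorm h v)"
proof -
  define w where "w = (-1) *s v"
  have "h u w = - h u v" "h w u = - h v u" "h w w = h v v"
    unfolding w_def hermitian_form_simps(2,4)[OF assms] by simp_all
  then have "Re (h (u + v) (u + v)) + Re (h (u + w) (u + w)) = 2 * Re (h u u) + 2 * Re (h v v)"
    by (simp add: hermitian_form_simps(1,3)[OF assms])
  moreover have "0 \<le> Re (h (u + w) (u + w))" by (rule hermitian_form_simps(7)[OF assms])
  ultimately have "Re (h (u + v) (u + v)) \<le> 2 * Re (h u u) + 2 * Re (h v v)" by linarith
  also have "\<dots> = 2 * (hnorm h u)\<^sup>2 + 2 * (hnorm h v)\<^sup>2"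
    by (simp add: hnorm_def hermitian_form_simps(7)[OF assms])
  also have "\<dots> \<le> (2 * (hnorm h u + hnorm h v))\<^sup>2"
    using hnorm_nonneg[OF assms, of u] hnorm_nonneg[OF assms, of v]
    by (simp add: power2_eq_square algebra_simps)
  finally have "sqrt (Re (h (u + v) (u + v))) \<le> sqrt ((2 * (hnorm h u + hnorm h v))\<^sup>2)"
    by (rule real_sqrt_le_mono)
  then show ?thesis using hnorm_nonneg[OF assms, of u] hnorm_nonneg[OF assms, of v]
    unfolding hnorm_def[of h "u + v"] by (simp only: real_sqrt_abs) simp
qed

text \<open>The factor 2 of \<open>hnorm_add_le\<close> is paid once per summand. In the
  applications the number of summands is the rank or the multiplicity, so a growth order does not
  notice it.\<close>

lemma hnorm_sum_le:
  assumes "hermitian_form h" "finite I"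
  shows "hnorm h (\<Sum>i\<in>I. x i) \<le> 2 ^ card I * (\<Sum>i\<in>I. hnorm h (x i))"
  using assms(2)
proof (induction I rule: finite_induct)
  case (insert i I)
  let ?S = "\<Sum>i\<in>I. hnorm h (x i)"
  have S: "0 \<le> ?S" by (rule sum_nonneg) (simp add: assms(1))
  have "hnorm h (x i + (\<Sum>i\<in>I. x i)) \<le> 2 * (hnorm h (x i) + hnorm h (\<Sum>i\<in>I. x i))"
    by (rule hnorm_add_le[OF assms(1)])
  also have "\<dots> \<le> 2 * (2 ^ card I * hnorm h (x i) + 2 ^ card I * ?S)"
    using insert.IH mult_right_mono[of 1 "2 ^ card I :: real" "hnorm h (x i)"] assms(1) by simp
  finally show ?case using insert by (simp add: algebra_simps)
qed (simp add: assms(1))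

lemma (in surface) rad_powr_mult:
  assumes "(f :: 'x \<Rightarrow> real) \<in> O[at x](\<lambda>p. rad c x p powr \<alpha>)" "g \<in> O[at x](\<lambda>p. rad c x p powr \<beta>)"
  shows "(\<lambda>p. f p * g p) \<in> O[at x](\<lambda>p. rad c x p powr (\<alpha> + \<beta>))"
  using landau_o.big.mult[OF assms] by (simp add: powr_add)

lemma rad_nonneg [simp]: "0 \<le> rad c x p"
  by (simp add: rad_def)

section \<open>Growth orders of holomorphic functions at a puncture\<close>

context surface
begin

lemma coordinate_powi_bigtheta:
  assumes "c \<in> X" "x \<in> fst c"
  shows "(\<lambda>p. cmod ((snd c p - snd c x) powi k)) \<in> \<Theta>[at x](\<lambda>p. rad c x p powr of_int k)"
  by (rule bigthetaI_cong, rule eventually_mono[OF rad_tendsto_0(2)[OF assms]])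
    (simp add: rad_def norm_power_int powr_real_of_int')

lemma one_not_bigo_rad:
  assumes "c \<in> X" "x \<in> fst c" "\<epsilon> > 0"
  shows "(\<lambda>p. 1 :: real) \<notin> O[at x](\<lambda>p. rad c x p powr \<epsilon>)"
proof
  assume "(\<lambda>p. 1 :: real) \<in> O[at x](\<lambda>p. rad c x p powr \<epsilon>)"
  then obtain C where C: "C > 0" "\<forall>\<^sub>F p in at x. norm (1 :: real) \<le> C * norm (rad c x p powr \<epsilon>)"
    by (rule landau_o.bigE)
  have "((\<lambda>p. rad c x p powr \<epsilon>) \<longlongrightarrow> 0) (at x)"
    using rad_tendsto_0(1)[OF assms(1,2)] assms(3)
    by (intro tendsto_zero_powrI[where b = \<epsilon>]) auto
  then have "\<forall>\<^sub>F p in at x. rad c x p powr \<epsilon> < 1 / C"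
    using C(1) by (intro order_tendstoD(2)) auto
  with C(2) have "\<forall>\<^sub>F p in at x. False"
    by eventually_elim (use C(1) in \<open>simp add: field_simps\<close>)
  then show False using at_neq_bot by (simp add: eventually_False)
qed

text \<open>An order above -1 is strictly better than a simple pole: the coordinate times g still
  tends to 0, and Riemann's theorem applies.\<close>

lemma bigo_rad_extends:
  assumes N: "open N" "x \<in> N" and c: "c \<in> X" "x \<in> fst c" and g: "holomorphic_fun X (N - {x}) g"
    and bnd: "(\<lambda>p. cmod (g p)) \<in> O[at x](\<lambda>p. rad c x p powr \<kappa>)" "\<kappa> > -1"
  shows "\<exists>v. holomorphic_fun X N (g(x := v))"
proof (rule removable_singularity[OF N g c])
  have "(\<lambda>p. rad c x p powr 1 * cmod (g p)) \<in> O[at x](\<lambda>p. rad c x p powr (1 + \<kappa>))"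
    by (rule rad_powr_mult[OF _ bnd(1)]) simp
  then obtain C where C: "C > 0"
    "\<forall>\<^sub>F p in at x. norm (rad c x p powr 1 * cmod (g p)) \<le> C * norm (rad c x p powr (1 + \<kappa>))"
    by (rule landau_o.bigE)
  have "((\<lambda>p. C * rad c x p powr (1 + \<kappa>)) \<longlongrightarrow> C * 0) (at x)"
    using rad_tendsto_0(1)[OF c] bnd(2)
    by (intro tendsto_mult tendsto_const tendsto_zero_powrI[where b = "1 + \<kappa>"]) auto
  then have lim: "((\<lambda>p. C * rad c x p powr (1 + \<kappa>)) \<longlongrightarrow> 0) (at x)" by simp
  show "((\<lambda>p. (snd c p - snd c x) * g p) \<longlongrightarrow> 0) (at x)"
  proof (rule tendsto_norm_zero_cancel, rule tendsto_sandwich[OF _ _ tendsto_const lim])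
    show "\<forall>\<^sub>F p in at x. norm ((snd c p - snd c x) * g p) \<le> C * rad c x p powr (1 + \<kappa>)"
      using C(2) by (rule eventually_mono) (auto simp: norm_mult rad_def)
  qed simp
qed

lemma bigo_rad_vanishes:
  assumes N: "x \<in> N" and c: "c \<in> X" "x \<in> fst c" and g: "holomorphic_fun X N g"
    and bnd: "(\<lambda>p. cmod (g p)) \<in> O[at x](\<lambda>p. rad c x p powr \<kappa>)" "\<kappa> > 0"
  shows "g x = 0"
proof (rule ccontr)
  assume nz: "g x \<noteq> 0"
  have "isCont g x" by (rule holomorphic_isCont[OF g N])
  then have "((\<lambda>p. 1 / g p) \<longlongrightarrow> 1 / g x) (at x)"
    using nz by (intro tendsto_intros) (auto simp: isCont_def)
  then have "((\<lambda>p. norm (1 / cmod (g p))) \<longlongrightarrow> cmod (1 / g x)) (at x)"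
    using tendsto_norm by (fastforce simp: norm_divide)
  moreover have "\<forall>\<^sub>F p in at x. cmod (g p) \<noteq> 0"
    using tendsto_imp_eventually_ne[of g "g x" "at x" 0] \<open>isCont g x\<close> nz by (simp add: isCont_def)
  ultimately have "(\<lambda>p. 1 :: real) \<in> O[at x](\<lambda>p. cmod (g p))"
    by (rule bigoI_tendsto_norm)
  also note bnd(1)
  finally show False using one_not_bigo_rad[OF c bnd(2)] by simp
qed

lemma vanishing_bigo_rad:
  assumes N: "x \<in> N" and c: "c \<in> X" "x \<in> fst c" and g: "holomorphic_fun X N g" "g x = 0"
  shows "(\<lambda>p. cmod (g p)) \<in> O[at x](\<lambda>p. rad c x p powr 1)"
proof -
  let ?N = "N \<inter> fst c"
  have N': "open ?N" using hol.R_open[OF g(1)] open_chart[OF c(1)] by blast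
  obtain h where h: "holomorphic_fun X ?N h" "\<forall>p\<in>?N. g p = (snd c p - snd c x) * h p"
    by (rule divide_coordinate[OF hol.R_subset[OF g(1) N' Int_lower1] c(1) Int_lower2 _ g(2)]) (use N c in auto)
  have "(\<lambda>p. rad c x p powr 1 * cmod (h p)) \<in> O[at x](\<lambda>p. rad c x p powr (1 + 0))"
    by (rule rad_powr_mult[OF _ holomorphic_bigo_1[OF h(1) _ c]]) (use N c in auto)
  moreover have "\<forall>\<^sub>F p in at x. rad c x p powr 1 * cmod (h p) = cmod (g p)"
    using eventually_in_open[OF N', of x] N c
    by (auto elim!: eventually_mono simp: h(2) norm_mult rad_def)
  ultimately show ?thesis by (simp add: landau_o.big.in_cong)
qed

text \<open>A function holomorphic on a punctured disc and of finite growth has an integral order,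
  so the exact exponent inside (-1,0] or inside (0,1] is irrelevant. This discreteness is why the
  growth filtration can jump only at the weights, up to integers.\<close>

lemma punctured_bigo_iff:
  assumes N: "open N" "x \<in> N" and c: "c \<in> X" "x \<in> fst c" and g: "holomorphic_fun X (N - {x}) g"
  shows "-1 < \<kappa> \<Longrightarrow> \<kappa> \<le> 0 \<Longrightarrow> (\<lambda>p. cmod (g p)) \<in> O[at x](\<lambda>p. rad c x p powr \<kappa>) \<longleftrightarrow>
      (\<exists>v. holomorphic_fun X N (g(x := v)))"
    and "0 < \<kappa> \<Longrightarrow> \<kappa> \<le> 1 \<Longrightarrow> (\<lambda>p. cmod (g p)) \<in> O[at x](\<lambda>p. rad c x p powr \<kappa>) \<longleftrightarrow>
      holomorphic_fun X N (g(x := 0))"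
proof -
  have cong: "(\<lambda>p. cmod ((g(x := v)) p)) \<in> O[at x](h) \<longleftrightarrow> (\<lambda>p. cmod (g p)) \<in> O[at x](h)" for v h
    by (rule landau_o.big.in_cong) (auto simp: eventually_at_topological)
  {
    assume \<kappa>: "-1 < \<kappa>" "\<kappa> \<le> 0"
    have "(\<lambda>p. cmod (g p)) \<in> O[at x](\<lambda>p. rad c x p powr \<kappa>)" if "holomorphic_fun X N (g(x := v))" for v
      using landau_o.big_trans[OF holomorphic_bigo_1[OF that N(2) c] rad_powr_mono[OF c \<kappa>(2)]] cong by simp
    then show "(\<lambda>p. cmod (g p)) \<in> O[at x](\<lambda>p. rad c x p powr \<kappa>) \<longleftrightarrow>
      (\<exists>v. holomorphic_fun X N (g(x := v)))"
      using bigo_rad_extends[OF N c g _ \<kappa>(1)] by blast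
  next
    assume \<kappa>: "0 < \<kappa>" "\<kappa> \<le> 1"
    show "(\<lambda>p. cmod (g p)) \<in> O[at x](\<lambda>p. rad c x p powr \<kappa>) \<longleftrightarrow> holomorphic_fun X N (g(x := 0))"
    proof
      assume "holomorphic_fun X N (g(x := 0))"
      from landau_o.big_trans[OF vanishing_bigo_rad[OF N(2) c this] rad_powr_mono[OF c \<kappa>(2)]]
      show "(\<lambda>p. cmod (g p)) \<in> O[at x](\<lambda>p. rad c x p powr \<kappa>)" using cong by simp
    next
      assume b: "(\<lambda>p. cmod (g p)) \<in> O[at x](\<lambda>p. rad c x p powr \<kappa>)"
      then obtain v where v: "holomorphic_fun X N (g(x := v))"
        using bigo_rad_extends[OF N c g, of \<kappa>] \<kappa> by auto
      have "(g(x := v)) x = 0"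
        by (rule bigo_rad_vanishes[OF N(2) c v _ \<kappa>(1)]) (use b cong in blast)
      then show "holomorphic_fun X N (g(x := 0))" using v by simp
    qed
  }
qed

end

text \<open>The stalks of \<^const>\<open>growth_stalk\<close> only depend on the holomorphic bundle and the metric.\<close>

definition growth_sections ::
  "('x::t2_space) chart set \<Rightarrow> 'x set \<Rightarrow> ('x, 'n::finite) trivialisations
     \<Rightarrow> ('x \<Rightarrow> complex^'n \<Rightarrow> complex^'n \<Rightarrow> complex) \<Rightarrow> 'x \<Rightarrow> real \<Rightarrow> ('x, 'n) sect set" where
  "growth_sections X D T K x \<alpha> =
     {s. (\<exists>N. open N \<and> N \<inter> D = {x} \<and> hol_section X T (N - {x}) s) \<and>
         (\<forall>c\<in>X. x \<in> fst c \<longrightarrow> (\<forall>\<epsilon>>0. \<exists>C. \<forall>\<^sub>F p in at x.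
            sqrt (Re (K p (s p) (s p))) \<le> C * cmod (snd c p - snd c x) powr (\<alpha> - \<epsilon>)))}"

text \<open>The part of \<open>induced_parabolic\<close> that concerns one point, with the
  filtration as a parameter; it can then be stated for filtrations that no longer mention an
  operator.\<close>

definition induced_at ::
  "('x::t2_space) chart set \<Rightarrow> 'x set \<Rightarrow> ('x, 'n::finite) parabolic \<Rightarrow> 'x \<Rightarrow> (real \<Rightarrow> ('x, 'n) sect set) \<Rightarrow> bool"
where
  "induced_at X D E x G \<longleftrightarrow>
     (\<forall>s. s \<in> G 0 \<longleftrightarrow> (\<exists>N v. x \<in> N \<and> hol_section X (triv E) N (s(x := v)))) \<and>
     fst ` set (flag E x) = {\<alpha>. 0 \<le> \<alpha> \<and> \<alpha> < 1 \<and> (\<forall>\<epsilon>>0. G \<alpha> \<noteq> G (\<alpha> + \<epsilon>))} \<and>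
     (\<forall>(\<alpha>, F) \<in> set (flag E x). F = {s x | s. s \<in> G \<alpha> \<and> (\<exists>N. x \<in> N \<and> hol_section X (triv E) N s)})"

text \<open>For the filtration, e acts like an orthogonal frame with norms r to the power
  \<open>a\<^sub>j\<close>. The exponent \<gamma> is any real number and the coefficients may be
  singular at x. The filtration allows a loss \<epsilon> while the coefficients have none: their
  orders are integers, so a bound with every positive loss is a bound without loss.\<close>

definition frame_growth ::
  "('x::t2_space) chart set \<Rightarrow> 'x \<Rightarrow> (real \<Rightarrow> ('x, 'n::finite) sect set) \<Rightarrow> 'x set
     \<Rightarrow> ('n \<Rightarrow> ('x, 'n) sect) \<Rightarrow> ('n \<Rightarrow> real) \<Rightarrow> bool" where
  "frame_growth X x G U e a \<longleftrightarrow>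
     (\<forall>\<gamma> N g. open N \<longrightarrow> x \<in> N \<longrightarrow> N \<subseteq> U \<longrightarrow> (\<forall>j. holomorphic_fun X (N - {x}) (g j)) \<longrightarrow>
        (comb e g \<in> G \<gamma> \<longleftrightarrow>
          (\<forall>c\<in>X. x \<in> fst c \<longrightarrow> (\<forall>j. (\<lambda>p. cmod (g j p)) \<in> O[at x](\<lambda>p. rad c x p powr (\<gamma> - a j))))))"

section \<open>The growth filtration at a point of the divisor\<close>

locale metric_at = surface X
  for X :: "('x::t2_space) chart set" +
  fixes D :: "'x set" and E :: "('x, 'n::finite) parabolic"
    and K :: "'x \<Rightarrow> complex^'n \<Rightarrow> complex^'n \<Rightarrow> complex" and x :: 'x
  assumes parabolic: "parabolic_bundle X D E"
    and herm: "p \<notin> D \<Longrightarrow> hermitian_form (K p)"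
    and x_D: "x \<in> D" and isolated: "\<exists>N. open N \<and> N \<inter> D = {x}"
begin

sublocale hb: sheaf_bundle "holomorphic_fun X" UNIV "triv E"
  using parabolic unfolding parabolic_bundle_def by unfold_locales blast

abbreviation "G \<equiv> growth_sections X D (triv E) K x"

definition snorm :: "('x, 'n) sect \<Rightarrow> 'x \<Rightarrow> real" where
  "snorm s p = hnorm (K p) (s p)"

text \<open>Growth orders agree in all charts, so one is fixed; this allows the filtration to be
  written with Landau symbols instead of a quantifier over charts.\<close>

definition cx :: "'x chart" where "cx = (SOME c. c \<in> X \<and> x \<in> fst c)"

lemma cx: "cx \<in> X" "x \<in> fst cx"
proof -
  obtain c where "c \<in> X" "x \<in> fst c" by (rule chart_at)
  then have "cx \<in> X \<and> x \<in> fst cx" 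
    unfolding cx_def by (intro someI[of "\<lambda>c. c \<in> X \<and> x \<in> fst c" c] conjI)
  then show "cx \<in> X" "x \<in> fst cx" by auto
qed

abbreviation "rx \<equiv> rad cx x"
abbreviation "zx \<equiv> \<lambda>p. snd cx p - snd cx x"

lemma eventually_herm: "\<forall>\<^sub>F p in at x. hermitian_form (K p)"
proof -
  obtain N where N: "open N" "N \<inter> D = {x}" using isolated by blast
  then have "x \<in> N" by blast
  show ?thesis
    by (rule eventually_mono[OF eventually_in_open[OF N(1) \<open>x \<in> N\<close>]]) (rule herm, use N in blast)
qed

lemma G_iff:
  "s \<in> G \<alpha> \<longleftrightarrow> (\<exists>N. open N \<and> N \<inter> D = {x} \<and> hol_section X (triv E) (N - {x}) s) \<and>
     (\<forall>\<epsilon>>0. snorm s \<in> O[at x](\<lambda>p. rx p powr (\<alpha> - \<epsilon>)))"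
proof -
  have bnd: "(\<exists>C. \<forall>\<^sub>F p in at x. sqrt (Re (K p (s p) (s p))) \<le> C * cmod (snd c p - snd c x) powr (\<alpha> - \<epsilon>)) \<longleftrightarrow>
      snorm s \<in> O[at x](\<lambda>p. rx p powr (\<alpha> - \<epsilon>))" (is "?L \<longleftrightarrow> ?R") if c: "c \<in> X" "x \<in> fst c" for c \<epsilon>
  proof -
    have "?L \<longleftrightarrow> snorm s \<in> O[at x](\<lambda>p. rad c x p powr (\<alpha> - \<epsilon>))"
    proof
      assume ?L
      then obtain C where C: "\<forall>\<^sub>F p in at x. sqrt (Re (K p (s p) (s p))) \<le> C * cmod (snd c p - snd c x) powr (\<alpha> - \<epsilon>)" by blast
      have "\<forall>\<^sub>F p in at x. norm (snorm s p) \<le> C * norm (rad c x p powr (\<alpha> - \<epsilon>))"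
        using C eventually_herm
        by eventually_elim (simp add: snorm_def rad_def hnorm_def hermitian_form_simps)
      then show "snorm s \<in> O[at x](\<lambda>p. rad c x p powr (\<alpha> - \<epsilon>))" by (rule bigoI)
    next
      assume "snorm s \<in> O[at x](\<lambda>p. rad c x p powr (\<alpha> - \<epsilon>))"
      then obtain C where C: "\<forall>\<^sub>F p in at x. norm (snorm s p) \<le> C * norm (rad c x p powr (\<alpha> - \<epsilon>))"
        by (rule landau_o.bigE)
      show ?L
      proof (rule exI[of _ C], rule eventually_mono[OF C])
        fix p assume "norm (snorm s p) \<le> C * norm (rad c x p powr (\<alpha> - \<epsilon>))"
        then show "sqrt (Re (K p (s p) (s p))) \<le> C * cmod (snd c p - snd c x) powr (\<alpha> - \<epsilon>)"
          using abs_ge_self[of "snorm s p"] by (simp add: snorm_def hnorm_def rad_def)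
      qed
    qed
    also have "\<dots> \<longleftrightarrow> ?R"
      using landau_o.big.cong_bigtheta[OF rad_powr_bigtheta[OF c(1) cx(1) c(2) cx(2)]] by blast
    finally show ?thesis .
  qed
  show ?thesis
    unfolding growth_sections_def mem_Collect_eq
  proof (rule conj_cong[OF refl], intro iffI allI impI ballI)
    fix \<epsilon> :: real assume *: "\<forall>c\<in>X. x \<in> fst c \<longrightarrow> (\<forall>\<epsilon>>0. \<exists>C. \<forall>\<^sub>F p in at x.
            sqrt (Re (K p (s p) (s p))) \<le> C * cmod (snd c p - snd c x) powr (\<alpha> - \<epsilon>))" and e: "0 < \<epsilon>"
    show "snorm s \<in> O[at x](\<lambda>p. rx p powr (\<alpha> - \<epsilon>))"
      using *[rule_format, OF cx e] bnd[OF cx] by blast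
  next
    fix c \<epsilon> assume *: "\<forall>\<epsilon>>0. snorm s \<in> O[at x](\<lambda>p. rx p powr (\<alpha> - \<epsilon>))"
      and c: "c \<in> X" "x \<in> fst c" and e: "(0::real) < \<epsilon>"
    show "\<exists>C. \<forall>\<^sub>F p in at x. sqrt (Re (K p (s p) (s p))) \<le> C * cmod (snd c p - snd c x) powr (\<alpha> - \<epsilon>)"
      using *[rule_format, OF e] bnd[OF c] by blast
  qed
qed

lemma G_mono: "\<alpha> \<le> \<beta> \<Longrightarrow> G \<beta> \<subseteq> G \<alpha>"
proof
  fix s assume le: "\<alpha> \<le> \<beta>" and s: "s \<in> G \<beta>"
  have "snorm s \<in> O[at x](\<lambda>p. rx p powr (\<alpha> - \<epsilon>))" if "\<epsilon> > 0" for \<epsilon>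
  proof (rule landau_o.big_trans)
    show "snorm s \<in> O[at x](\<lambda>p. rx p powr (\<beta> - \<epsilon>))" using s that unfolding G_iff by blast
  qed (rule rad_powr_mono[OF cx], use le in simp)
  then show "s \<in> G \<alpha>" using s unfolding G_iff by blast
qed

lemma G_left_continuous:
  assumes "\<And>\<beta>. \<beta> < \<alpha> \<Longrightarrow> s \<in> G \<beta>"
  shows "s \<in> G \<alpha>"
  unfolding G_iff
proof (intro conjI allI impI)
  show "\<exists>N. open N \<and> N \<inter> D = {x} \<and> hol_section X (triv E) (N - {x}) s"
    using assms[of "\<alpha> - 1"] unfolding G_iff by simp
  fix \<epsilon> :: real assume e: "\<epsilon> > 0"
  \<comment> \<open>The allowed loss is split: one half moves the index below \<alpha>, the other is
    the loss in the definition of the filtration there.\<close>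
  have "s \<in> G (\<alpha> - \<epsilon> / 2)" by (rule assms) (use e in simp)
  then have "\<forall>\<delta>>0. snorm s \<in> O[at x](\<lambda>p. rx p powr (\<alpha> - \<epsilon> / 2 - \<delta>))"
    unfolding G_iff by blast
  from this[rule_format, of "\<epsilon> / 2"] e show "snorm s \<in> O[at x](\<lambda>p. rx p powr (\<alpha> - \<epsilon>))" by simp
qed

lemma section_near:
  assumes "s \<in> G \<alpha>" "open U" "x \<in> U"
  obtains N where "open N" "x \<in> N" "N \<subseteq> U" "N \<inter> D = {x}" "hol_section X (triv E) (N - {x}) s"
proof -
  obtain N where N: "open N" "N \<inter> D = {x}" "hol_section X (triv E) (N - {x}) s"
    using assms(1) unfolding G_iff by blast
  show ?thesis
    by (rule that[of "N \<inter> U"]) (use N assms x_D in \<open>auto intro: hb.section_subset\<close>)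
qed

lemma G_cong:
  assumes "s \<in> G \<alpha>" "open N" "x \<in> N" "\<And>p. p \<in> N - {x} \<Longrightarrow> s p = t p"
  shows "t \<in> G \<alpha>"
  unfolding G_iff
proof (intro conjI allI impI)
  obtain M where M: "open M" "x \<in> M" "M \<subseteq> N" "M \<inter> D = {x}" "hol_section X (triv E) (M - {x}) s"
    by (rule section_near[OF assms(1-3)])
  have "hol_section X (triv E) (M - {x}) t"
    by (rule hb.section_cong[OF M(5)]) (use assms(4) M(3) in blast)
  then show "\<exists>N. open N \<and> N \<inter> D = {x} \<and> hol_section X (triv E) (N - {x}) t" using M by blast
  fix \<epsilon> :: real assume "\<epsilon> > 0"
  then have "snorm s \<in> O[at x](\<lambda>p. rx p powr (\<alpha> - \<epsilon>))" using assms(1) unfolding G_iff by blast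
  moreover have "\<forall>\<^sub>F p in at x. snorm s p = snorm t p"
    by (rule eventually_mono[OF eventually_in_open[OF assms(2,3)]]) (simp add: snorm_def assms(4))
  ultimately show "snorm t \<in> O[at x](\<lambda>p. rx p powr (\<alpha> - \<epsilon>))"
    using landau_o.big.in_cong by blast
qed

lemma G_cong_iff:
  assumes "open N" "x \<in> N" "\<And>p. p \<in> N - {x} \<Longrightarrow> s p = t p"
  shows "s \<in> G \<alpha> \<longleftrightarrow> t \<in> G \<alpha>"
  using G_cong[OF _ assms(1,2), of s \<alpha> t] G_cong[OF _ assms(1,2), of t \<alpha> s] assms(3) by metis

lemma snorm_add_bigo:
  assumes "snorm s \<in> O[at x](h)" "snorm t \<in> O[at x](h)"
  shows "snorm (\<lambda>p. s p + t p) \<in> O[at x](h)"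
proof -
  have "(\<lambda>p. 2 * (snorm s p + snorm t p)) \<in> O[at x](h)"
    using sum_in_bigo(1)[OF assms] by (simp del: distrib_left_numeral)
  moreover have "\<forall>\<^sub>F p in at x. norm (snorm (\<lambda>p. s p + t p) p) \<le> 1 * norm (2 * (snorm s p + snorm t p))"
    using eventually_herm
  proof eventually_elim
    case (elim p)
    show ?case
      using hnorm_add_le[OF elim, of "s p" "t p"] hnorm_nonneg[OF elim] by (simp add: snorm_def)
  qed
  then have "snorm (\<lambda>p. s p + t p) \<in> O[at x](\<lambda>p. 2 * (snorm s p + snorm t p))" by (rule bigoI)
  ultimately show ?thesis using landau_o.big_trans by blast
qed

lemma snorm_scale_cong:
  "(snorm (\<lambda>p. g p *s s p) \<in> O[at x](h)) \<longleftrightarrow> ((\<lambda>p. cmod (g p) * snorm s p) \<in> O[at x](h))"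
  by (rule landau_o.big.in_cong, rule eventually_mono[OF eventually_herm]) (simp add: snorm_def hnorm_scale)

lemma snorm_comb_bigo:
  assumes "\<And>j. (\<lambda>p. cmod (g j p) * snorm (e j) p) \<in> O[at x](h)"
  shows "snorm (comb e g) \<in> O[at x](h)"
proof -
  have "(\<lambda>p. 2 ^ CARD('n) * (\<Sum>j\<in>UNIV. cmod (g j p) * snorm (e j) p)) \<in> O[at x](h)"
    using big_sum_in_bigo[of UNIV "\<lambda>j p. cmod (g j p) * snorm (e j) p"] assms by simp
  moreover have "\<forall>\<^sub>F p in at x. norm (snorm (comb e g) p) \<le>
      1 * norm (2 ^ CARD('n) * (\<Sum>j\<in>UNIV. cmod (g j p) * snorm (e j) p))"
    using eventually_herm
  proof eventually_elim
    case (elim p)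
    have "0 \<le> (\<Sum>j\<in>UNIV. cmod (g j p) * snorm (e j) p)"
      by (intro sum_nonneg mult_nonneg_nonneg) (simp_all add: snorm_def elim)
    then show ?case
      using hnorm_sum_le[OF elim finite, of "\<lambda>j. g j p *s e j p" UNIV] elim
      by (simp add: snorm_def comb_def hnorm_scale[OF elim])
  qed
  then have "snorm (comb e g) \<in> O[at x](\<lambda>p. 2 ^ CARD('n) * (\<Sum>j\<in>UNIV. cmod (g j p) * snorm (e j) p))" by (rule bigoI)
  ultimately show ?thesis using landau_o.big_trans by blast
qed

lemma G_add:
  assumes "s \<in> G \<alpha>" "t \<in> G \<alpha>"
  shows "(\<lambda>p. s p + t p) \<in> G \<alpha>"
  unfolding G_iff
proof (intro conjI allI impI)
  obtain N where N: "open N" "x \<in> N" "N \<inter> D = {x}" "hol_section X (triv E) (N - {x}) s"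
    by (rule section_near[OF assms(1) open_UNIV UNIV_I])
  obtain M where M: "open M" "x \<in> M" "M \<subseteq> N" "hol_section X (triv E) (M - {x}) t"
    by (rule section_near[OF assms(2) N(1,2)])
  have "hol_section X (triv E) (M - {x}) s"
    by (rule hb.section_subset[OF N(4)]) (use M in auto)
  from hb.section_add[OF this M(4)] show "\<exists>N. open N \<and> N \<inter> D = {x} \<and> hol_section X (triv E) (N - {x}) (\<lambda>p. s p + t p)"
    using M N by blast
  fix \<epsilon> :: real assume e: "\<epsilon> > 0"
  have "snorm s \<in> O[at x](\<lambda>p. rx p powr (\<alpha> - \<epsilon>))" "snorm t \<in> O[at x](\<lambda>p. rx p powr (\<alpha> - \<epsilon>))"
    using assms e unfolding G_iff by blast+
  then show "snorm (\<lambda>p. s p + t p) \<in> O[at x](\<lambda>p. rx p powr (\<alpha> - \<epsilon>))"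
    by (rule snorm_add_bigo)
qed

text \<open>The periodicity of the filtration under multiplication by the coordinate. As k may be
  negative, it reduces every real index to one in [0,1).\<close>

lemma G_coordinate_power:
  assumes "s \<in> G \<alpha>"
  shows "(\<lambda>p. zx p powi k *s s p) \<in> G (\<alpha> + of_int k)"
  unfolding G_iff
proof (intro conjI allI impI)
  obtain N where N: "open N" "x \<in> N" "N \<subseteq> fst cx" "N \<inter> D = {x}" "hol_section X (triv E) (N - {x}) s"
    by (rule section_near[OF assms open_chart[OF cx(1)] cx(2)])
  have N': "open (N - {x})" using N by auto
  have "holomorphic_fun X (N - {x}) (\<lambda>p. zx p powi k)"
    by (intro hol.R_power_int hol.R_diff hol.R_const N' hol.R_subset[OF holomorphic_chart[OF cx(1)] N'])
      (use N chart_inj[OF cx(1) _ cx(2)] in auto)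
  from hb.section_scale[OF this N(5)]
  show "\<exists>N. open N \<and> N \<inter> D = {x} \<and> hol_section X (triv E) (N - {x}) (\<lambda>p. zx p powi k *s s p)"
    using N by blast
  fix \<epsilon> :: real assume "\<epsilon> > 0"
  then have "snorm s \<in> O[at x](\<lambda>p. rx p powr (\<alpha> - \<epsilon>))" using assms unfolding G_iff by blast
  from rad_powr_mult[OF bigthetaD1[OF coordinate_powi_bigtheta[OF cx, of k]] this]
  show "snorm (\<lambda>p. zx p powi k *s s p) \<in> O[at x](\<lambda>p. rx p powr (\<alpha> + of_int k - \<epsilon>))"
    unfolding snorm_scale_cong by (simp add: algebra_simps)
qed

lemma frame_growth_iff:
  "frame_growth X x G U e a \<longleftrightarrow>
     (\<forall>\<gamma> N g. open N \<longrightarrow> x \<in> N \<longrightarrow> N \<subseteq> U \<longrightarrow> (\<forall>j. holomorphic_fun X (N - {x}) (g j)) \<longrightarrow>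
        (comb e g \<in> G \<gamma> \<longleftrightarrow> (\<forall>j. (\<lambda>p. cmod (g j p)) \<in> O[at x](\<lambda>p. rx p powr (\<gamma> - a j)))))"
proof -
  have "(\<forall>c\<in>X. x \<in> fst c \<longrightarrow> (\<forall>j. (\<lambda>p. cmod (g j p)) \<in> O[at x](\<lambda>p. rad c x p powr (\<gamma> - a j)))) \<longleftrightarrow>
      (\<forall>j. (\<lambda>p. cmod (g j p)) \<in> O[at x](\<lambda>p. rx p powr (\<gamma> - a j)))" for g \<gamma>
    using landau_o.big.cong_bigtheta[OF rad_powr_bigtheta[OF _ cx(1) _ cx(2)]] cx by blast
  then show ?thesis unfolding frame_growth_def by simp
qed

end

lemma comb_scale: "comb e (\<lambda>j p. g p * u j p) p = g p *s comb e u p"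
  by (simp add: comb_def vec_eq_iff sum_distrib_left mult.assoc)

lemma comb_cong: "(\<And>j. u j p = v j p) \<Longrightarrow> comb e u p = comb e v p"
  by (simp add: comb_def)

locale split_at = metric_at X D E K x
  for X :: "('x::t2_space) chart set" and D :: "'x set" and E :: "('x, 'n::finite) parabolic"
    and K :: "'x \<Rightarrow> complex^'n \<Rightarrow> complex^'n \<Rightarrow> complex" and x :: 'x +
  fixes U :: "'x set" and e :: "'n \<Rightarrow> ('x, 'n) sect" and a :: "'n \<Rightarrow> real"
  assumes splitting: "parabolic_splitting X D E x U e a"
begin

lemma U_D: "U \<inter> D = {x}" and frameU: "regular_frame (holomorphic_fun X) (triv E) U e"
  and weights_eq: "fst ` set (flag E x) = range a"
  and weight_ge_span: "weight_ge (flag E x) l = vec.span {e j x | j. a j \<ge> l}"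
  using splitting unfolding parabolic_splitting_def hol_frame_regular_frame by blast+

lemma xU: "x \<in> U" using U_D by blast

lemma openU: "open U" and sectionU: "hol_section X (triv E) U (e j)"
  and invU: "p \<in> U \<Longrightarrow> invertible (frame_matrix e p)"
  using frameU by (auto simp: regular_frame_def)

lemma flag_at: obtains F where "(a j, F) \<in> set (flag E x)"
proof -
  have "a j \<in> fst ` set (flag E x)" unfolding weights_eq by blast
  then show ?thesis using that by (metis imageE prod.collapse)
qed

lemma a_bounds: "0 \<le> a j" "a j < 1"
proof -
  have "a j \<in> fst ` set (flag E x)" using weights_eq by blast
  then show "0 \<le> a j" "a j < 1"
    using parabolic x_D unfolding parabolic_bundle_def by fastforce+
qed

text \<open>The subspaces shrink strictly as the weights grow, so among those of weight at least
  \<alpha> the one of weight \<alpha> itself contains the others.\<close>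

lemma weight_ge_flag:
  assumes "(\<alpha>, F) \<in> set (flag E x)"
  shows "weight_ge (flag E x) \<alpha> = F"
proof -
  let ?L = "flag E x"
  have sorted: "sorted_wrt (\<lambda>(\<alpha>, F) (\<beta>, G). \<alpha> < \<beta> \<and> G \<subset> F) ?L"
    and sub: "\<And>\<alpha> F. (\<alpha>, F) \<in> set ?L \<Longrightarrow> vec.subspace F"
    using parabolic x_D unfolding parabolic_bundle_def by auto
  obtain i where i: "i < length ?L" "?L ! i = (\<alpha>, F)" using assms by (auto simp: in_set_conv_nth)
  have "H \<subseteq> F" if H: "(\<beta>, H) \<in> set ?L" "\<beta> \<ge> \<alpha>" for \<beta> H
  proof -
    obtain j where j: "j < length ?L" "?L ! j = (\<beta>, H)" using H by (auto simp: in_set_conv_nth)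
    consider "i < j" | "i = j" | "j < i" by linarith
    then show ?thesis
    proof cases
      case 1
      then show ?thesis using sorted_wrt_nth_less[OF sorted 1 j(1)] i j by auto
    next
      case 3
      then show ?thesis using sorted_wrt_nth_less[OF sorted 3 i(1)] i j H(2) by auto
    qed (use i j in auto)
  qed
  moreover have "0 \<in> F" using sub[OF assms] by (rule vec.subspace_0)
  ultimately show ?thesis using assms unfolding weight_ge_def by blast
qed

text \<open>Since the e j x form a basis, lying in a coordinate subspace is the vanishing of the
  remaining coordinates; membership in a flag is checked in this way from here on.\<close>

lemma span_coords:
  "v \<in> vec.span {e j x | j. P j} \<longleftrightarrow> (\<forall>i. \<not> P i \<longrightarrow> coords e (\<lambda>_. v) i x = 0)"
proof
  let ?S = "{v. \<forall>i. \<not> P i \<longrightarrow> coords e (\<lambda>_. v) i x = 0}"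
  have "vec.subspace ?S"
    by (auto simp: vec.subspace_def coords_add[of e "\<lambda>_. _" "\<lambda>_. _"] coords_scale[of e "\<lambda>_. _" "\<lambda>_. _"])
      (simp add: coords_def)
  moreover have "{e j x | j. P j} \<subseteq> ?S"
  proof clarify
    fix j i assume "P j" "\<not> P i"
    then show "coords e (\<lambda>_. e j x) i x = 0"
      using coords_frame[OF invU[OF xU], of j i] by (auto simp: coords_def)
  qed
  ultimately have "vec.span {e j x | j. P j} \<subseteq> ?S" by (intro vec.span_minimal)
  then show "v \<in> vec.span {e j x | j. P j} \<Longrightarrow> \<forall>i. \<not> P i \<longrightarrow> coords e (\<lambda>_. v) i x = 0" by blast
next
  assume *: "\<forall>i. \<not> P i \<longrightarrow> coords e (\<lambda>_. v) i x = 0"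
  have "coords e (\<lambda>_. v) j x *s e j x \<in> vec.span {e j x | j. P j}" for j
    using * by (cases "P j") (auto intro: vec.span_scale vec.span_base vec.span_zero)
  then have "(\<Sum>j\<in>UNIV. coords e (\<lambda>_. v) j x *s e j x) \<in> vec.span {e j x | j. P j}"
    by (intro vec.span_sum)
  then show "v \<in> vec.span {e j x | j. P j}"
    using comb_coords[OF invU[OF xU], of "\<lambda>_. v"] by (simp add: comb_def)
qed

lemma section_U: "open N \<Longrightarrow> N \<subseteq> U \<Longrightarrow> (\<And>j. holomorphic_fun X N (g j)) \<Longrightarrow> hol_section X (triv E) N (comb e g)"
  by (rule hb.section_comb[OF hb.frame_subset[OF frameU]])

lemma coords_U: "hol_section X (triv E) N s \<Longrightarrow> N \<subseteq> U \<Longrightarrow> holomorphic_fun X N (coords e s j)"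
  using hb.R_coords[OF hb.frame_subset[OF frameU]] hb.section_open by blast

lemma punctured_section:
  assumes "open N" "x \<in> N" "N \<subseteq> U" "\<And>j. holomorphic_fun X (N - {x}) (g j)"
  shows "\<exists>N. open N \<and> N \<inter> D = {x} \<and> hol_section X (triv E) (N - {x}) (comb e g)"
proof (intro exI[of _ N] conjI)
  show "N \<inter> D = {x}" using assms U_D x_D by blast
  show "hol_section X (triv E) (N - {x}) (comb e g)"
    by (rule section_U) (use assms in auto)
qed (rule assms)

lemma comb_in_G:
  assumes e: "\<And>j. e j \<in> G (a j)" and N: "open N" "x \<in> N" "N \<subseteq> U" "\<And>j. holomorphic_fun X (N - {x}) (g j)"
    and g: "\<And>j. (\<lambda>p. cmod (g j p)) \<in> O[at x](\<lambda>p. rx p powr (\<gamma> - a j))"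
  shows "comb e g \<in> G \<gamma>"
  unfolding G_iff
proof (intro conjI allI impI)
  show "\<exists>N. open N \<and> N \<inter> D = {x} \<and> hol_section X (triv E) (N - {x}) (comb e g)"
    by (rule punctured_section[OF N])
  fix \<epsilon> :: real assume eps: "\<epsilon> > 0"
  show "snorm (comb e g) \<in> O[at x](\<lambda>p. rx p powr (\<gamma> - \<epsilon>))"
  proof (rule snorm_comb_bigo)
    fix j
    have "snorm (e j) \<in> O[at x](\<lambda>p. rx p powr (a j - \<epsilon>))" using e[of j] eps unfolding G_iff by blast
    from rad_powr_mult[OF g[of j] this]
    show "(\<lambda>p. cmod (g j p) * snorm (e j) p) \<in> O[at x](\<lambda>p. rx p powr (\<gamma> - \<epsilon>))" by simp
  qed
qed

lemma comb_delta: "comb e (\<lambda>j p. if j = k then 1 else 0) = e k"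
  by (simp add: fun_eq_iff comb_def if_distrib[of "\<lambda>a. a *s _"] cong: if_cong)

text \<open>Apply the criterion to the coefficients 0 and 1: the constant 1 is bounded by a power of
  the radius exactly when the exponent is not positive. So each frame vector has growth order
  exactly its weight.\<close>

lemma frame_growth_frame:
  assumes "frame_growth X x G U e a"
  shows "e k \<in> G \<gamma> \<longleftrightarrow> \<gamma> \<le> a k"
proof -
  let ?g = "\<lambda>j p. if j = k then 1 else (0::complex)"
  have "e k \<in> G \<gamma> \<longleftrightarrow> (\<forall>j. (\<lambda>p. cmod (?g j p)) \<in> O[at x](\<lambda>p. rx p powr (\<gamma> - a j)))"
  proof -
    have "open (U - {x})" using openU by auto
    then have hol: "\<forall>j. holomorphic_fun X (U - {x}) (?g j)" using hol.R_const by blast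
    show ?thesis
      using assms[unfolded frame_growth_iff, THEN spec[of _ \<gamma>], THEN spec[of _ U], THEN spec[of _ ?g]]
        openU xU hol unfolding comb_delta by blast
  qed
  also have "\<dots> \<longleftrightarrow> (\<lambda>p. 1 :: real) \<in> O[at x](\<lambda>p. rx p powr (\<gamma> - a k))"
  proof
    assume "\<forall>j. (\<lambda>p. cmod (?g j p)) \<in> O[at x](\<lambda>p. rx p powr (\<gamma> - a j))"
    from this[rule_format, of k] show "(\<lambda>p. 1 :: real) \<in> O[at x](\<lambda>p. rx p powr (\<gamma> - a k))" by simp
  next
    assume 1: "(\<lambda>p. 1 :: real) \<in> O[at x](\<lambda>p. rx p powr (\<gamma> - a k))"
    show "\<forall>j. (\<lambda>p. cmod (?g j p)) \<in> O[at x](\<lambda>p. rx p powr (\<gamma> - a j))"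
    proof
      fix j show "(\<lambda>p. cmod (?g j p)) \<in> O[at x](\<lambda>p. rx p powr (\<gamma> - a j))"
        using 1 by (cases "j = k") auto
    qed
  qed
  also have "\<dots> \<longleftrightarrow> \<gamma> \<le> a k"
  proof
    assume "(\<lambda>p. 1 :: real) \<in> O[at x](\<lambda>p. rx p powr (\<gamma> - a k))"
    then show "\<gamma> \<le> a k" using one_not_bigo_rad[OF cx, of "\<gamma> - a k"] by (cases "\<gamma> \<le> a k") auto
  next
    assume "\<gamma> \<le> a k"
    have "(\<lambda>p. 1 :: real) \<in> O[at x](\<lambda>p. rx p powr 0)"
      using holomorphic_bigo_1[OF hol.R_const[OF openU, of 1] xU cx] by simp
    also have "(\<lambda>p. rx p powr 0) \<in> O[at x](\<lambda>p. rx p powr (\<gamma> - a k))"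
      by (rule rad_powr_mono[OF cx]) (use \<open>\<gamma> \<le> a k\<close> in simp)
    finally show "(\<lambda>p. 1 :: real) \<in> O[at x](\<lambda>p. rx p powr (\<gamma> - a k))" .
  qed
  finally show ?thesis .
qed

subsection \<open>From the induced structure to growth in an adapted frame\<close>

text \<open>Let b be the supremum of the indices up to \<delta> to which membership in G \<gamma>
  propagates. By left continuity it propagates to b itself; if b < \<delta>, then b is not a weight,
  the filtration is constant on an interval to the right of b, and b was not the supremum. The bound
  \<delta> \<le> 1 reflects that weights describe the jumps in [0,1) only.\<close>

lemma no_jump:
  assumes jumps: "fst ` set (flag E x) = {\<alpha>. 0 \<le> \<alpha> \<and> \<alpha> < 1 \<and> (\<forall>\<epsilon>>0. G \<alpha> \<noteq> G (\<alpha> + \<epsilon>))}"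
    and bounds: "0 \<le> \<gamma>" "\<gamma> \<le> \<delta>" "\<delta> \<le> 1" and none: "\<And>j. a j < \<gamma> \<or> \<delta> \<le> a j"
  shows "G \<gamma> \<subseteq> G \<delta>"
proof -
  let ?S = "{\<beta>. \<gamma> \<le> \<beta> \<and> \<beta> \<le> \<delta> \<and> G \<gamma> \<subseteq> G \<beta>}"
  define b where "b = Sup ?S"
  have ne: "\<gamma> \<in> ?S" using bounds by blast
  have bdd: "bdd_above ?S" by (rule bdd_aboveI[of _ \<delta>]) simp
  have b: "\<gamma> \<le> b" "b \<le> \<delta>"
  proof -
    show "\<gamma> \<le> b" unfolding b_def by (rule cSup_upper[OF ne bdd])
    show "b \<le> \<delta>" unfolding b_def by (rule cSup_least) (use ne in blast)+
  qed
  have Gb: "G \<gamma> \<subseteq> G b"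
  proof
    fix s assume s: "s \<in> G \<gamma>"
    show "s \<in> G b"
    proof (rule G_left_continuous)
      fix \<beta> assume "\<beta> < b"
      then have "\<exists>\<beta>'\<in>?S. \<beta> < \<beta>'"
        unfolding b_def by (rule less_cSupE) (use ne in blast)+
      then obtain \<beta>' where \<beta>': "G \<gamma> \<subseteq> G \<beta>'" "\<beta> < \<beta>'" by blast
      then show "s \<in> G \<beta>" using s G_mono[of \<beta> \<beta>'] by (meson less_imp_le subsetD)
    qed
  qed
  show ?thesis
  proof (cases "b = \<delta>")
    case False
    then have lt: "b < \<delta>" using b by simp
    have "b \<notin> range a" using none b(1) lt by (metis leD less_le_trans rangeE)
    then have "b \<notin> fst ` set (flag E x)" using weights_eq by simp
    then obtain \<epsilon> where \<epsilon>: "\<epsilon> > 0" "G b = G (b + \<epsilon>)"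
      using jumps b bounds lt by auto
    define b' where "b' = min (b + \<epsilon>) \<delta>"
    have "G \<gamma> \<subseteq> G b'" using Gb \<epsilon>(2) G_mono[of b' "b + \<epsilon>"] by (auto simp: b'_def)
    then have "b' \<in> ?S" using b \<epsilon>(1) bounds by (auto simp: b'_def)
    then have "b' \<le> b" unfolding b_def by (rule cSup_upper[OF _ bdd])
    then show ?thesis using \<epsilon>(1) lt by (simp add: b'_def)
  qed (use Gb in simp)
qed

text \<open>The flag only prescribes values at x: some section s of order \<open>a\<^sub>j\<close>
  agrees with e j there. Their difference vanishes at x, so it is the coordinate times a holomorphic
  section, hence of order at least 1, and 1 exceeds every weight.\<close>

lemma induced_frame_in_G:
  assumes ind: "induced_at X D E x G"
  shows "e j \<in> G (a j)"
proof -
  note ind' = ind[unfolded induced_at_def]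
  obtain F where F: "(a j, F) \<in> set (flag E x)" by (rule flag_at)
  have "e j x \<in> weight_ge (flag E x) (a j)"
    unfolding weight_ge_span by (rule vec.span_base) blast
  then have "e j x \<in> F" unfolding weight_ge_flag[OF F] .
  moreover have "F = {s x | s. s \<in> G (a j) \<and> (\<exists>N. x \<in> N \<and> hol_section X (triv E) N s)}"
    using bspec[OF conjunct2[OF conjunct2[OF ind']] F] by (simp only: prod.case)
  ultimately have "e j x \<in> {s x | s. s \<in> G (a j) \<and> (\<exists>N. x \<in> N \<and> hol_section X (triv E) N s)}" by (simp only:)
  then obtain s N where s': "e j x = s x" "s \<in> G (a j)" "x \<in> N" "hol_section X (triv E) N s"
    unfolding mem_Collect_eq by (elim exE conjE)
  note s = s'(1)[symmetric] s'(2-4)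
  let ?N = "N \<inter> U \<inter> fst cx"
  have N: "open ?N" "x \<in> ?N"
    using hb.section_open[OF s(4)] openU open_chart[OF cx(1)] s(3) xU cx(2) by auto
  have sub: "hol_section X (triv E) ?N t" if "hol_section X (triv E) M t" "?N \<subseteq> M" for t M
    by (rule hb.section_subset[OF that(1) N(1) that(2)])
  have t: "hol_section X (triv E) ?N (\<lambda>p. e j p - s p)"
    by (intro hb.section_diff sub[OF sectionU] sub[OF s(4)]) auto
  define h where "h = coords e (\<lambda>p. e j p - s p)"
  have h: "holomorphic_fun X ?N (h i)" "h i x = 0" for i
  proof -
    show "holomorphic_fun X ?N (h i)" unfolding h_def by (rule coords_U[OF t]) auto
    show "h i x = 0" using s(1) by (simp add: h_def coords_def)
  qed
  have "\<exists>k. holomorphic_fun X ?N k \<and> (\<forall>p\<in>?N. h i p = zx p * k p)" for i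
    by (rule divide_coordinate[OF h(1)[of i] cx(1) _ N(2) h(2)]) blast+
  then obtain k where k: "\<And>i. holomorphic_fun X ?N (k i)" "\<And>i p. p \<in> ?N \<Longrightarrow> h i p = zx p * k i p" by metis
  have "hol_section X (triv E) ?N (comb e k)" by (rule section_U[OF N(1) _ k(1)]) auto
  then have "comb e k \<in> G 0"
    using conjunct1[OF ind'] N(2) by (metis fun_upd_triv)
  then have "(\<lambda>p. zx p powi 1 *s comb e k p) \<in> G (0 + of_int 1)" by (rule G_coordinate_power)
  then have "(\<lambda>p. zx p *s comb e k p) \<in> G 1" by simp
  then have "(\<lambda>p. zx p *s comb e k p) \<in> G (a j)" using G_mono[of "a j" 1] a_bounds(2)[of j] by auto
  from G_add[OF s(2) this] show "e j \<in> G (a j)"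
  proof (rule G_cong[OF _ N])
    fix p assume p: "p \<in> ?N - {x}"
    have "e j p - s p = comb e h p"
      unfolding h_def using comb_coords[of e p "\<lambda>p. e j p - s p"] invU p by simp
    also have "\<dots> = comb e (\<lambda>j p. zx p * k j p) p" by (rule comb_cong, rule k(2)) (use p in blast)
    also have "\<dots> = zx p *s comb e k p" by (rule comb_scale)
    finally show "s p + zx p *s comb e k p = e j p" by (metis add.commute diff_add_cancel)
  qed
qed

text \<open>One half is an upper bound for the norm of a sum. The other has to recover bounds on
  coefficients from a bound on the section, and this is done without the metric: after a shift of
  the index into [0,1) the section extends across x, and the position of its value in the flag shows
  which coefficients vanish.\<close>

lemma induced_frame_growth:
  assumes ind: "induced_at X D E x G"
  shows "frame_growth X x G U e a"
  unfolding frame_growth_iff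
proof (intro allI impI iffI)
  fix \<gamma> :: real and N and g :: "'n \<Rightarrow> 'x \<Rightarrow> complex"
  assume N: "open N" "x \<in> N" "N \<subseteq> U" and g: "\<forall>j. holomorphic_fun X (N - {x}) (g j)"
  show "comb e g \<in> G \<gamma>" if "\<forall>j. (\<lambda>p. cmod (g j p)) \<in> O[at x](\<lambda>p. rx p powr (\<gamma> - a j))"
    by (rule comb_in_G[OF induced_frame_in_G[OF ind] N]) (use g that in auto)
  fix j :: 'n assume s: "comb e g \<in> G \<gamma>"
  note ind' = ind[unfolded induced_at_def]
  note G0 = conjunct1[OF ind', rule_format] and jumps = conjunct1[OF conjunct2[OF ind']]
  \<comment> \<open>Integer part of the index, removed by a power of the coordinate; the rest
    \<open>\<gamma>0\<close> lies where the parabolic structure describes the filtration.\<close>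
  define n where "n = \<lfloor>\<gamma>\<rfloor>"
  define \<gamma>0 where "\<gamma>0 = \<gamma> - of_int n"
  have \<gamma>0: "0 \<le> \<gamma>0" "\<gamma>0 < 1" unfolding \<gamma>0_def n_def by linarith+
  define s' where "s' = (\<lambda>p. zx p powi (-n) *s comb e g p)"
  have s': "s' \<in> G \<gamma>0"
    using G_coordinate_power[OF s, of "-n"] unfolding s'_def \<gamma>0_def by simp
  have "s' \<in> G 0" using s' G_mono[of 0 \<gamma>0] \<gamma>0(1) by blast
  then obtain M v where M: "x \<in> M" "hol_section X (triv E) M (s'(x := v))" using G0 by blast
  let ?N = "N \<inter> M \<inter> fst cx"
  have N': "open ?N" "x \<in> ?N" using N M(1) hb.section_open[OF M(2)] open_chart[OF cx(1)] cx(2) by auto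
  have sec: "hol_section X (triv E) ?N (s'(x := v))" by (rule hb.section_subset[OF M(2) N'(1)]) auto
  define k where "k = coords e (s'(x := v))"
  have k: "holomorphic_fun X ?N (k i)" for i unfolding k_def by (rule coords_U[OF sec]) (use N in auto)
  have zx_ne: "zx p \<noteq> 0" if "p \<in> ?N - {x}" for p
    using chart_inj[OF cx(1) _ cx(2), of p] that by auto
  have kg: "k i p = zx p powi (-n) * g i p" if p: "p \<in> ?N - {x}" for i p
  proof -
    have "invertible (frame_matrix e p)" using invU N p by blast
    then have "k i p = (\<lambda>i p. zx p powi (-n) * g i p) i p"
      unfolding k_def by (rule coords_comb) (use p in \<open>simp add: s'_def comb_scale\<close>)
    then show ?thesis .
  qed
  \<comment> \<open>Coefficients of weight below \<open>\<gamma>0\<close> have to gain one order.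
    They do so by vanishing at x, and the flag is what forces this.\<close>
  have vanish: "k i x = 0" if i: "a i < \<gamma>0" for i
  proof (cases "\<exists>j. \<gamma>0 \<le> a j")
    case True
    \<comment> \<open>The next weight from \<open>\<gamma>0\<close> on. No jump lies between, so the
      extended section is in G \<alpha> and its value lies in the subspace of weight \<alpha>, which
      is spanned by frame vectors of weight at least \<alpha>, hence greater than a i.\<close>
    define \<alpha> where "\<alpha> = Min {\<alpha> \<in> range a. \<gamma>0 \<le> \<alpha>}"
    have fin: "finite {\<alpha> \<in> range a. \<gamma>0 \<le> \<alpha>}" by simp
    have \<alpha>: "\<alpha> \<in> range a" "\<gamma>0 \<le> \<alpha>" using Min_in[OF fin] True unfolding \<alpha>_def by auto
    have le: "\<alpha> \<le> a j" if "\<gamma>0 \<le> a j" for j unfolding \<alpha>_def by (rule Min_le[OF fin]) (use that in auto)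
    have "\<alpha> \<le> 1" using \<alpha>(1) a_bounds(2) by (auto simp: less_imp_le)
    have "G \<gamma>0 \<subseteq> G \<alpha>"
      by (rule no_jump[OF jumps \<gamma>0(1) \<alpha>(2) \<open>\<alpha> \<le> 1\<close>]) (use le in \<open>meson not_le\<close>)
    then have "s'(x := v) \<in> G \<alpha>"
      using G_cong[of s' \<alpha> UNIV "s'(x := v)"] s' by auto
    moreover obtain F where F: "(\<alpha>, F) \<in> set (flag E x)" using \<alpha>(1) flag_at by blast
    moreover have "F = {s x | s. s \<in> G \<alpha> \<and> (\<exists>N. x \<in> N \<and> hol_section X (triv E) N s)}"
      using bspec[OF conjunct2[OF conjunct2[OF ind']] F] by (simp only: prod.case)
    ultimately have "(s'(x := v)) x \<in> F" using M by blast
    then have "v \<in> vec.span {e j x | j. a j \<ge> \<alpha>}"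
      unfolding weight_ge_span[symmetric] weight_ge_flag[OF F] by simp
    then have "coords e (\<lambda>_. v) i x = 0" using i \<alpha>(2) unfolding span_coords by simp
    then show ?thesis by (simp add: k_def coords_def)
  next
    case False
    \<comment> \<open>With every weight below \<open>\<gamma>0\<close> the filtration does not jump
      before 1. The section divided by the coordinate still extends, so all coefficients vanish at
      x.\<close>
    have "G \<gamma>0 \<subseteq> G 1"
      by (rule no_jump[OF jumps \<gamma>0(1)]) (use False \<gamma>0 in \<open>auto simp: not_le\<close>)
    then have "(\<lambda>p. zx p powi (-1) *s s' p) \<in> G (1 + of_int (-1))"
      using G_coordinate_power s' by blast
    then obtain M' v' where M': "x \<in> M'" "hol_section X (triv E) M' ((\<lambda>p. zx p powi (-1) *s s' p)(x := v'))"
      using G0 by auto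
    let ?t = "(\<lambda>p. zx p powi (-1) *s s' p)(x := v')"
    let ?M = "?N \<inter> M'"
    have M'': "open ?M" "x \<in> ?M" using N' M' hb.section_open[OF M'(2)] by auto
    have t: "hol_section X (triv E) ?M ?t" by (rule hb.section_subset[OF M'(2) M''(1)]) auto
    have l: "holomorphic_fun X ?M (coords e ?t i)" by (rule coords_U[OF t]) (use N in auto)
    have kl: "k i p = zx p * coords e ?t i p" if p: "p \<in> ?M - {x}" for p
    proof -
      have "coords e ?t i p = coords e (\<lambda>p. zx p powi (-1) *s s' p) i p" using p by (simp add: coords_def)
      also have "\<dots> = zx p powi (-1) * k i p" using p by (simp add: coords_scale) (simp add: k_def coords_def)
      finally show ?thesis using zx_ne[of p] p by (simp add: power_int_minus)
    qed
    have "(\<lambda>p. zx p * coords e ?t i p) \<midarrow>x\<rightarrow> zx x * coords e ?t i x"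
      using holomorphic_isCont[OF l M''(2)] holomorphic_isCont[OF holomorphic_chart[OF cx(1)] cx(2)]
      by (intro tendsto_intros) (auto simp: isCont_def)
    moreover have "\<forall>\<^sub>F p in at x. zx p * coords e ?t i p = k i p"
      by (rule eventually_mono[OF eventually_in_open[OF M'']]) (simp add: kl)
    ultimately have "k i \<midarrow>x\<rightarrow> zx x * coords e ?t i x" by (rule Lim_transform_eventually)
    moreover have "k i \<midarrow>x\<rightarrow> k i x" using holomorphic_isCont[OF k N'(2)] by (simp add: isCont_def)
    ultimately have "k i x = zx x * coords e ?t i x" using tendsto_unique[OF at_neq_bot] by blast
    then show ?thesis by simp
  qed
  \<comment> \<open>The required exponent is below or equal to 1 for a vanishing coefficient and not
    positive for the others, so the orders 1 and 0 of holomorphic functions suffice.\<close>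
  have "(\<lambda>p. cmod (k j p)) \<in> O[at x](\<lambda>p. rx p powr (\<gamma>0 - a j))"
  proof (cases "a j < \<gamma>0")
    case True
    from vanishing_bigo_rad[OF N'(2) cx k vanish[OF True]]
    have "(\<lambda>p. cmod (k j p)) \<in> O[at x](\<lambda>p. rx p powr 1)" .
    also have "(\<lambda>p. rx p powr 1) \<in> O[at x](\<lambda>p. rx p powr (\<gamma>0 - a j))"
      using rad_powr_mono[OF cx, of "\<gamma>0 - a j" 1] \<gamma>0 a_bounds(1)[of j] by simp
    finally show ?thesis .
  next
    case False
    from holomorphic_bigo_1[OF k N'(2) cx]
    have "(\<lambda>p. cmod (k j p)) \<in> O[at x](\<lambda>p. rx p powr 0)" .
    also have "(\<lambda>p. rx p powr 0) \<in> O[at x](\<lambda>p. rx p powr (\<gamma>0 - a j))"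
      using rad_powr_mono[OF cx, of "\<gamma>0 - a j" 0] False by simp
    finally show ?thesis .
  qed
  from rad_powr_mult[OF bigthetaD1[OF coordinate_powi_bigtheta[OF cx, of n]] this]
  have "(\<lambda>p. cmod (zx p powi n) * cmod (k j p)) \<in> O[at x](\<lambda>p. rx p powr (\<gamma> - a j))"
    by (simp add: \<gamma>0_def)
  moreover have "\<forall>\<^sub>F p in at x. cmod (zx p powi n) * cmod (k j p) = cmod (g j p)"
  proof (rule eventually_mono[OF eventually_in_open[OF N']])
    fix p assume p: "p \<in> ?N - {x}"
    have "zx p powi n * k j p = g j p" unfolding kg[OF p] using zx_ne[OF p] by (simp add: power_int_minus)
    then show "cmod (zx p powi n) * cmod (k j p) = cmod (g j p)" unfolding norm_mult[symmetric] by (rule arg_cong)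
  qed
  ultimately show "(\<lambda>p. cmod (g j p)) \<in> O[at x](\<lambda>p. rx p powr (\<gamma> - a j))"
    by (rule landau_o.big.in_cong[THEN iffD1, rotated])
qed

subsection \<open>From growth in an adapted frame to the induced structure\<close>

text \<open>All three parts of \<open>induced_at\<close> become statements on coefficients: index 0
  means removable singularities because weights are below 1, jumps are located by the discreteness
  of orders, and the flag is the vanishing of coordinates at x.\<close>

lemma frame_growth_induced:
  assumes fg: "frame_growth X x G U e a"
  shows "induced_at X D E x G"
proof -
  have near: "\<exists>N. open N \<and> x \<in> N \<and> N \<subseteq> U \<and> (\<forall>j. holomorphic_fun X (N - {x}) (coords e s j)) \<and>
      (\<forall>\<gamma>. s \<in> G \<gamma> \<longleftrightarrow> (\<forall>j. (\<lambda>p. cmod (coords e s j p)) \<in> O[at x](\<lambda>p. rx p powr (\<gamma> - a j))))"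
    if s: "s \<in> G \<beta>" for s \<beta>
  proof -
    obtain N where N: "open N" "x \<in> N" "N \<subseteq> U" "N \<inter> D = {x}" "hol_section X (triv E) (N - {x}) s"
      by (rule section_near[OF s openU xU])
    have c: "holomorphic_fun X (N - {x}) (coords e s j)" for j by (rule coords_U[OF N(5)]) (use N in auto)
    have "s \<in> G \<gamma> \<longleftrightarrow> comb e (coords e s) \<in> G \<gamma>" for \<gamma>
    proof (rule G_cong_iff[OF N(1,2)])
      fix p assume "p \<in> N - {x}"
      then have "p \<in> U" using N(3) by blast
      then show "s p = comb e (coords e s) p" by (simp add: comb_coords invU)
    qed
    moreover have "comb e (coords e s) \<in> G \<gamma> \<longleftrightarrow>
        (\<forall>j. (\<lambda>p. cmod (coords e s j p)) \<in> O[at x](\<lambda>p. rx p powr (\<gamma> - a j)))" for \<gamma>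
      by (rule fg[unfolded frame_growth_iff, rule_format, OF N(1-3) c])
    ultimately show ?thesis using N c by blast
  qed
  have near_section: "s \<in> G \<gamma> \<longleftrightarrow> (\<forall>j. (\<lambda>p. cmod (coords e s j p)) \<in> O[at x](\<lambda>p. rx p powr (\<gamma> - a j)))"
    if s: "hol_section X (triv E) N s" "x \<in> N" for s N \<gamma>
  proof -
    let ?N = "N \<inter> U"
    have N: "open ?N" "x \<in> ?N" using hb.section_open[OF s(1)] openU s(2) xU by auto
    have s': "hol_section X (triv E) ?N s" by (rule hb.section_subset[OF s(1) N(1)]) auto
    have c: "holomorphic_fun X (?N - {x}) (coords e s j)" for j
      by (rule hol.R_subset[OF coords_U[OF s']]) (use N in auto)
    have "s \<in> G \<gamma> \<longleftrightarrow> comb e (coords e s) \<in> G \<gamma>"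
    proof (rule G_cong_iff[OF N])
      fix p assume "p \<in> ?N - {x}"
      then have "p \<in> U" by blast
      then show "s p = comb e (coords e s) p" by (simp add: comb_coords invU)
    qed
    also have "\<dots> \<longleftrightarrow> (\<forall>j. (\<lambda>p. cmod (coords e s j p)) \<in> O[at x](\<lambda>p. rx p powr (\<gamma> - a j)))"
      by (rule fg[unfolded frame_growth_iff, rule_format, OF N Int_lower2 c])
    finally show ?thesis .
  qed
  have "\<And>s. s \<in> G 0 \<longleftrightarrow> (\<exists>N v. x \<in> N \<and> hol_section X (triv E) N (s(x := v)))"
  proof
    fix s assume s: "s \<in> G 0"
    obtain N where N: "open N" "x \<in> N" "N \<subseteq> U" "\<forall>j. holomorphic_fun X (N - {x}) (coords e s j)"
      "\<forall>j. (\<lambda>p. cmod (coords e s j p)) \<in> O[at x](\<lambda>p. rx p powr (0 - a j))"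
      using near[OF s] s by blast
    \<comment> \<open>The exponent - a j is greater than -1.\<close>
    have "\<exists>v. holomorphic_fun X N ((coords e s j)(x := v))" for j
      by (rule bigo_rad_extends[OF N(1,2) cx N(4)[rule_format] N(5)[rule_format]]) (use a_bounds(2)[of j] in simp)
    then obtain v where v: "\<And>j. holomorphic_fun X N ((coords e s j)(x := v j))" by metis
    let ?u = "\<lambda>j. (coords e s j)(x := v j)"
    have "hol_section X (triv E) N (comb e ?u)" by (rule section_U[OF N(1,3) v])
    then have "hol_section X (triv E) N (s(x := comb e ?u x))"
    proof (rule hb.section_cong)
      fix p assume p: "p \<in> N"
      show "comb e ?u p = (s(x := comb e ?u x)) p"
      proof (cases "p = x")
        case False
        have "comb e ?u p = comb e (coords e s) p" using False by (simp add: comb_def)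
        then show ?thesis using comb_coords[OF invU, of p s] p N(3) False by auto
      qed simp
    qed
    then show "\<exists>N v. x \<in> N \<and> hol_section X (triv E) N (s(x := v))" using N(2) by blast
  next
    fix s assume "\<exists>N v. x \<in> N \<and> hol_section X (triv E) N (s(x := v))"
    then obtain N v where N: "x \<in> N" "hol_section X (triv E) N (s(x := v))" by blast
    have "s(x := v) \<in> G 0"
      unfolding near_section[OF N(2,1)]
    proof
      fix j
      have "open (N \<inter> U)" using hb.section_open[OF N(2)] openU by blast
      then have "holomorphic_fun X (N \<inter> U) (coords e (s(x := v)) j)"
        by (intro coords_U hb.section_subset[OF N(2)]) auto
      then have "(\<lambda>p. cmod (coords e (s(x := v)) j p)) \<in> O[at x](\<lambda>p. rx p powr 0)"
        by (rule holomorphic_bigo_1) (use N xU cx in auto)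
      also have "(\<lambda>p. rx p powr 0) \<in> O[at x](\<lambda>p. rx p powr (0 - a j))"
        by (rule rad_powr_mono[OF cx]) (use a_bounds(1) in simp)
      finally show "(\<lambda>p. cmod (coords e (s(x := v)) j p)) \<in> O[at x](\<lambda>p. rx p powr (0 - a j))" .
    qed
    then show "s \<in> G 0" by (rule G_cong[OF _ open_UNIV]) auto
  qed
  moreover have "fst ` set (flag E x) = {\<alpha>. 0 \<le> \<alpha> \<and> \<alpha> < 1 \<and> (\<forall>\<epsilon>>0. G \<alpha> \<noteq> G (\<alpha> + \<epsilon>))}"
    unfolding weights_eq
  proof (intro equalityI subsetI)
    fix \<alpha> assume "\<alpha> \<in> range a"
    then obtain j where j: "\<alpha> = a j" by blast
    have "e j \<in> G \<alpha>" "e j \<notin> G (\<alpha> + \<epsilon>)" if "\<epsilon> > 0" for \<epsilon>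
      using that by (simp_all add: frame_growth_frame[OF fg] j)
    then show "\<alpha> \<in> {\<alpha>. 0 \<le> \<alpha> \<and> \<alpha> < 1 \<and> (\<forall>\<epsilon>>0. G \<alpha> \<noteq> G (\<alpha> + \<epsilon>))}" using a_bounds j by blast
  next
    fix \<alpha> assume "\<alpha> \<in> {\<alpha>. 0 \<le> \<alpha> \<and> \<alpha> < 1 \<and> (\<forall>\<epsilon>>0. G \<alpha> \<noteq> G (\<alpha> + \<epsilon>))}"
    then have \<alpha>: "0 \<le> \<alpha>" "\<alpha> < 1" and jump: "\<forall>\<epsilon>>0. G \<alpha> \<noteq> G (\<alpha> + \<epsilon>)"
      unfolding mem_Collect_eq by blast+
    show "\<alpha> \<in> range a"
    proof (rule ccontr)
      assume notin: "\<alpha> \<notin> range a"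
      \<comment> \<open>The weights beyond \<alpha>; 1 is the default when there is none, which is
        admissible because the same discreteness argument reaches up to 1.\<close>
      define B where "B = insert 1 {b \<in> range a. b > \<alpha>}"
      have B: "finite B" "B \<noteq> {}" "\<And>b. b \<in> B \<Longrightarrow> b > \<alpha>" using \<alpha>(2) by (auto simp: B_def)
      define \<beta> where "\<beta> = Min B"
      have \<beta>: "\<alpha> < \<beta>" "\<beta> \<le> 1" "\<And>j. \<alpha> < a j \<Longrightarrow> \<beta> \<le> a j"
      proof -
        show "\<alpha> < \<beta>" unfolding \<beta>_def by (rule B(3)[OF Min_in[OF B(1,2)]])
        show "\<beta> \<le> 1" unfolding \<beta>_def by (rule Min_le[OF B(1)]) (simp add: B_def)
        show "\<beta> \<le> a j" if "\<alpha> < a j" for j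
          unfolding \<beta>_def by (rule Min_le[OF B(1)]) (use that in \<open>simp add: B_def\<close>)
      qed
      have "G \<alpha> \<subseteq> G \<beta>"
      proof
        fix s assume s: "s \<in> G \<alpha>"
        obtain N where N: "open N" "x \<in> N" "\<forall>j. holomorphic_fun X (N - {x}) (coords e s j)"
          "\<And>\<gamma>. s \<in> G \<gamma> \<longleftrightarrow> (\<forall>j. (\<lambda>p. cmod (coords e s j p)) \<in> O[at x](\<lambda>p. rx p powr (\<gamma> - a j)))"
          using near[OF s] by (elim exE conjE) (rule that, auto)
        show "s \<in> G \<beta>"
          unfolding N(4)
        proof
          fix j
          have s': "(\<lambda>p. cmod (coords e s j p)) \<in> O[at x](\<lambda>p. rx p powr (\<alpha> - a j))" using s N(4) by blast
          have hol: "holomorphic_fun X (N - {x}) (coords e s j)" using N(3) by blast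
          note iff = punctured_bigo_iff[OF N(1,2) cx hol]
          \<comment> \<open>The exponents \<alpha> - a j and \<beta> - a j lie in the same one of
            the intervals (-1,0] and (0,1], so both bounds amount to the same condition: extension
            across x or vanishing at x.\<close>
          show "(\<lambda>p. cmod (coords e s j p)) \<in> O[at x](\<lambda>p. rx p powr (\<beta> - a j))"
          proof (cases "\<alpha> < a j")
            case True
            then have "-1 < \<alpha> - a j" "\<alpha> - a j \<le> 0" "-1 < \<beta> - a j" "\<beta> - a j \<le> 0"
              using \<alpha> a_bounds[of j] \<beta> by auto
            then show ?thesis using iff(1) s' by blast
          next
            case False
            then have "a j < \<alpha>" using notin by (metis linorder_cases rangeI)
            then have "0 < \<alpha> - a j" "\<alpha> - a j \<le> 1" "0 < \<beta> - a j" "\<beta> - a j \<le> 1"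
              using \<alpha> a_bounds[of j] \<beta>(1,2) by auto
            then show ?thesis using iff(2) s' by blast
          qed
        qed
      qed
      moreover have "G \<beta> \<subseteq> G \<alpha>" by (rule G_mono) (use \<beta>(1) in simp)
      ultimately have "G \<alpha> = G (\<alpha> + (\<beta> - \<alpha>))" by simp
      moreover have "0 < \<beta> - \<alpha>" using \<beta>(1) by simp
      ultimately show False using jump by blast
    qed
  qed
  moreover have "F = {s x | s. s \<in> G \<alpha> \<and> (\<exists>N. x \<in> N \<and> hol_section X (triv E) N s)}"
    if F: "(\<alpha>, F) \<in> set (flag E x)" for \<alpha> F
  proof -
    have Fs: "F = vec.span {e j x | j. a j \<ge> \<alpha>}"
      unfolding weight_ge_span[symmetric] weight_ge_flag[OF F] ..
    have "\<alpha> \<in> range a" unfolding weights_eq[symmetric] using image_eqI[of \<alpha> fst "(\<alpha>, F)", OF _ F] by simp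
    then have \<alpha>: "0 \<le> \<alpha>" "\<alpha> < 1" using a_bounds by auto
    show ?thesis
    proof (intro equalityI subsetI)
      fix v assume v: "v \<in> F"
      let ?u = "\<lambda>j (p::'x). coords e (\<lambda>_. v) j x"
      have 0: "?u j x = 0" if "\<not> \<alpha> \<le> a j" for j using v that unfolding Fs span_coords by blast
      have sec: "hol_section X (triv E) U (comb e ?u)" by (rule section_U[OF openU order_refl hol.R_const[OF openU]])
      have "comb e ?u \<in> G \<alpha>"
      proof (rule fg[unfolded frame_growth_iff, rule_format, THEN iffD2, OF openU xU order_refl])
        show "holomorphic_fun X (U - {x}) (?u j)" for j by (rule hol.R_const) (use openU in auto)
        have "(\<lambda>p. cmod (?u j p)) \<in> O[at x](\<lambda>p. rx p powr (\<alpha> - a j))" for j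
        proof (cases "\<alpha> \<le> a j")
          case True
          have "(\<lambda>p. cmod (?u j p)) \<in> O[at x](\<lambda>p. rx p powr 0)"
            by (rule holomorphic_bigo_1[OF hol.R_const[OF openU] xU cx])
          also have "(\<lambda>p. rx p powr 0) \<in> O[at x](\<lambda>p. rx p powr (\<alpha> - a j))"
            by (rule rad_powr_mono[OF cx]) (use True in simp)
          finally show ?thesis .
        qed (simp add: 0)
        then show "\<forall>j. (\<lambda>p. cmod (?u j p)) \<in> O[at x](\<lambda>p. rx p powr (\<alpha> - a j))" by blast
      qed
      moreover have "v = comb e ?u x"
        using comb_coords[OF invU[OF xU], of "\<lambda>_. v"] by (simp add: comb_def)
      ultimately show "v \<in> {s x | s. s \<in> G \<alpha> \<and> (\<exists>N. x \<in> N \<and> hol_section X (triv E) N s)}"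
        using sec xU by (intro CollectI exI[of _ "comb e ?u"] conjI exI[of _ U])
    next
      fix v assume "v \<in> {s x | s. s \<in> G \<alpha> \<and> (\<exists>N. x \<in> N \<and> hol_section X (triv E) N s)}"
      then obtain s N where s: "v = s x" "s \<in> G \<alpha>" "x \<in> N" "hol_section X (triv E) N s" by blast
      have "coords e s j x = 0" if j: "\<not> \<alpha> \<le> a j" for j
      proof (rule bigo_rad_vanishes[OF _ cx])
        have "open (N \<inter> U)" using hb.section_open[OF s(4)] openU by blast
        then show "holomorphic_fun X (N \<inter> U) (coords e s j)"
          by (intro coords_U hb.section_subset[OF s(4)]) auto
        show "(\<lambda>p. cmod (coords e s j p)) \<in> O[at x](\<lambda>p. rx p powr (\<alpha> - a j))"
          using near_section[OF s(4,3)] s(2) by blast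
      qed (use j s(3) xU in auto)
      then show "v \<in> F" unfolding Fs span_coords s(1) by (simp add: coords_def)
    qed
  qed
  ultimately show ?thesis
    unfolding induced_at_def
  proof (intro conjI allI ballI, goal_cases)
    case (3 p)
    obtain \<alpha> F where p: "p = (\<alpha>, F)" by (cases p)
    show ?case unfolding p prod.case by (rule 3(3)) (use 3(4) p in simp)
  qed
qed

end

subsection \<open>Growth on the branched cover\<close>

text \<open>For the upper bound, a section \<open>s = \<Sum>\<^sub>j u\<^sub>j f\<^sup>*e\<^sub>j\<close> is split into isotypic components under
  \<open>t \<mapsto> \<omega> t\<close>, \<open>\<omega>\<^sup>m = 1\<close>. As the metric is pulled back, each component satisfies the same growth
  bound; up to a power of \<open>t\<close> it is the pullback of a section downstairs, whose coefficients
  are controlled by the hypothesis.\<close>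

lemma (in branched_map) pullback_frame_growth:
  fixes E :: "('x, 'n::finite) parabolic" and F :: "('y, 'n) parabolic"
  assumes SX: "split_at X D E K (f y) U e a"
    and SY: "split_at Y (f -` D) F (K \<circ> f) y V b (\<lambda>j. frac (real (ramification y) * a j))"
    and d: "d \<in> Y" and V: "V \<subseteq> f -` U \<inter> fst d"
    and b: "\<forall>j. \<forall>q \<in> V - {y}.
      b j q = (snd d q - snd d y) powi (- \<lfloor>real (ramification y) * a j\<rfloor>) *s e j (f q)"
    and growth: "frame_growth X (f y) (growth_sections X D (triv E) K (f y)) U e a"
  shows "frame_growth Y y (growth_sections Y (f -` D) (triv F) (K \<circ> f) y) V b
    (\<lambda>j. frac (real (ramification y) * a j))"
proof -
  interpret SX: split_at X D E K "f y" U e a by (rule SX)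
  interpret SY: split_at Y "f -` D" F "K \<circ> f" y V b "\<lambda>j. frac (real (ramification y) * a j)" by (rule SY)
  let ?m = "ramification y" and ?x = "f y"
  let ?w = "\<lambda>q. snd d q - snd d y"
  define k where "k = (\<lambda>j. \<lfloor>real ?m * a j\<rfloor>)"
  have m: "?m > 0" using ramification_pos[of y] by simp
  have yd: "y \<in> fst d" using SY.xU V by blast
  have w_ne: "?w q \<noteq> 0" if "q \<in> V - {y}" for q
    using Y.chart_inj[OF d _ yd, of q] that V by auto
  have w_powi: "(\<lambda>q. cmod (?w q powi i)) \<in> \<Theta>[at y](\<lambda>q. SY.rx q powr of_int i)" for i
    using Y.coordinate_powi_bigtheta[OF d yd, of i] Y.rad_powr_bigtheta[OF SY.cx(1) d SY.cx(2) yd, of "of_int i"]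
    by (rule landau_theta.trans)
  have pullback_norm: "SY.snorm (\<lambda>q. s (f q)) q = SX.snorm s (f q)" for s q
    by (simp add: SY.snorm_def SX.snorm_def)
  show ?thesis
    unfolding SY.frame_growth_iff
  proof (intro allI impI)
    fix \<beta> :: real and N and v :: "'n \<Rightarrow> 'y \<Rightarrow> complex"
    assume N: "open N" "y \<in> N" "N \<subseteq> V" and v: "\<forall>j. holomorphic_fun Y (N - {y}) (v j)"
    \<comment> \<open>The coefficients of the same section in the pulled back frame, whose weights m
      \<open>a\<^sub>j\<close> are not reduced modulo 1. The powers of the coordinate account
      exactly for the integer parts, so the claim may be proved for u and these unreduced
      weights.\<close>
    define u where "u = (\<lambda>j q. ?w q powi (- k j) * v j q)"
    have N': "open (N - {y})" using N by auto
    have u: "holomorphic_fun Y (N - {y}) (u j)" for j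
      unfolding u_def using w_ne N(3) V v
      by (intro Y.hol.R_mult Y.hol.R_power_int Y.hol.R_diff Y.hol.R_const N'
          Y.hol.R_subset[OF Y.holomorphic_chart[OF d] N']) auto
    have su: "comb b v q = comb (\<lambda>j q. e j (f q)) u q" if "q \<in> N - {y}" for q
      using that N(3) b by (simp add: comb_def u_def k_def vec_eq_iff sum_distrib_left subset_iff mult.commute mult.left_commute)
    have vu: "(\<lambda>q. cmod (v j q)) \<in> O[at y](\<lambda>q. SY.rx q powr (\<beta> - frac (real ?m * a j))) \<longleftrightarrow>
        (\<lambda>q. cmod (u j q)) \<in> O[at y](\<lambda>q. SY.rx q powr (\<beta> - real ?m * a j))" for j
    proof
      assume "(\<lambda>q. cmod (v j q)) \<in> O[at y](\<lambda>q. SY.rx q powr (\<beta> - frac (real ?m * a j)))"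
      from Y.rad_powr_mult[OF bigthetaD1[OF w_powi] this, of "- k j"]
      show "(\<lambda>q. cmod (u j q)) \<in> O[at y](\<lambda>q. SY.rx q powr (\<beta> - real ?m * a j))"
        by (simp add: u_def norm_mult frac_def k_def algebra_simps)
    next
      assume "(\<lambda>q. cmod (u j q)) \<in> O[at y](\<lambda>q. SY.rx q powr (\<beta> - real ?m * a j))"
      from Y.rad_powr_mult[OF bigthetaD1[OF w_powi] this, of "k j"]
      have "(\<lambda>q. cmod (?w q powi k j) * cmod (u j q)) \<in> O[at y](\<lambda>q. SY.rx q powr (\<beta> - frac (real ?m * a j)))"
        by (simp add: frac_def k_def algebra_simps)
      moreover have "\<forall>\<^sub>F q in at y. cmod (?w q powi k j) * cmod (u j q) = cmod (v j q)"
      proof (rule eventually_mono[OF Y.eventually_in_open[OF N(1,2)]])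
        fix q assume "q \<in> N - {y}"
        then have "?w q powi k j * u j q = v j q"
          using w_ne[of q] N(3) by (auto simp: u_def power_int_minus)
        then show "cmod (?w q powi k j) * cmod (u j q) = cmod (v j q)"
          unfolding norm_mult[symmetric] by (rule arg_cong)
      qed
      ultimately show "(\<lambda>q. cmod (v j q)) \<in> O[at y](\<lambda>q. SY.rx q powr (\<beta> - frac (real ?m * a j)))"
        by (rule landau_o.big.in_cong[THEN iffD1, rotated])
    qed
    show "comb b v \<in> SY.G \<beta> \<longleftrightarrow> (\<forall>j. (\<lambda>q. cmod (v j q)) \<in> O[at y](\<lambda>q. SY.rx q powr (\<beta> - frac (real ?m * a j))))"
      unfolding vu
    proof
      assume bound: "\<forall>j. (\<lambda>q. cmod (u j q)) \<in> O[at y](\<lambda>q. SY.rx q powr (\<beta> - real ?m * a j))"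
      show "comb b v \<in> SY.G \<beta>"
        unfolding SY.G_iff
      proof (intro conjI allI impI)
        show "\<exists>N. open N \<and> N \<inter> f -` D = {y} \<and> hol_section Y (triv F) (N - {y}) (comb b v)"
          by (rule SY.punctured_section[OF N]) (use v in blast)
        fix \<epsilon> :: real assume eps: "\<epsilon> > 0"
        have "SY.snorm (comb (\<lambda>j q. e j (f q)) u) \<in> O[at y](\<lambda>q. SY.rx q powr (\<beta> - \<epsilon>))"
        proof (rule SY.snorm_comb_bigo)
          fix j
          have "e j \<in> SX.G (a j)" using SX.frame_growth_frame[OF growth] by simp
          then have "\<forall>\<epsilon>>0. SX.snorm (e j) \<in> O[at ?x](\<lambda>p. SX.rx p powr (a j - \<epsilon>))"
            unfolding SX.G_iff by blast
          \<comment> \<open>A loss of \<epsilon>/m on X becomes a loss of \<epsilon> on Y, since the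
            radius pulls back to the power m.\<close>
          from this[rule_format, of "\<epsilon> / real ?m"]
          have "SX.snorm (e j) \<in> O[at ?x](\<lambda>p. SX.rx p powr (a j - \<epsilon> / real ?m))" using eps m by simp
          from landau_o.big.compose[OF this filterlim_at_image]
          have "(\<lambda>q. SX.snorm (e j) (f q)) \<in> O[at y](\<lambda>q. SX.rx (f q) powr (a j - \<epsilon> / real ?m))" .
          also have "(\<lambda>q. SX.rx (f q) powr (a j - \<epsilon> / real ?m)) \<in>
              \<Theta>[at y](\<lambda>q. SY.rx q powr (real ?m * (a j - \<epsilon> / real ?m)))"
            by (rule rad_pullback[OF SY.cx SX.cx])
          finally have "(\<lambda>q. SX.snorm (e j) (f q)) \<in> O[at y](\<lambda>q. SY.rx q powr (real ?m * a j - \<epsilon>))"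
            using m by (simp add: right_diff_distrib)
          from Y.rad_powr_mult[OF bound[rule_format, of j] this]
          show "(\<lambda>q. cmod (u j q) * SY.snorm (\<lambda>q. e j (f q)) q) \<in> O[at y](\<lambda>q. SY.rx q powr (\<beta> - \<epsilon>))"
            unfolding pullback_norm by simp
        qed
        moreover have "\<forall>\<^sub>F q in at y. SY.snorm (comb (\<lambda>j q. e j (f q)) u) q = SY.snorm (comb b v) q"
          by (rule eventually_mono[OF Y.eventually_in_open[OF N(1,2)]]) (simp add: SY.snorm_def su)
        ultimately show "SY.snorm (comb b v) \<in> O[at y](\<lambda>q. SY.rx q powr (\<beta> - \<epsilon>))"
          by (rule landau_o.big.in_cong[THEN iffD1, rotated])
      qed
    next
      assume s: "comb b v \<in> SY.G \<beta>"
      obtain \<rho> \<phi> \<tau> where \<rho>: "\<rho> > 0" and \<phi>0: "\<phi> 0 = y"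
        and \<phi>_in: "\<phi> ` ball 0 \<rho> \<subseteq> N \<inter> fst SY.cx \<inter> f -` fst SX.cx"
        and \<phi>_hol: "(\<lambda>t. snd SY.cx (\<phi> t)) holomorphic_on ball 0 \<rho>" and \<phi>_inj: "inj_on \<phi> (ball 0 \<rho>)"
        and \<phi>_pow: "\<forall>t\<in>ball 0 \<rho>. snd SX.cx (f (\<phi> t)) = snd SX.cx ?x + t ^ ?m"
        and lim: "filterlim \<phi> (at y) (at 0)" "filterlim \<tau> (at 0) (at y)" "\<forall>\<^sub>F q in at y. \<phi> (\<tau> q) = q"
        and \<phi>_rad: "(\<lambda>t. SY.rx (\<phi> t)) \<in> \<Theta>[at 0](\<lambda>t. cmod t)" and \<tau>_rad: "(\<lambda>q. cmod (\<tau> q)) \<in> \<Theta>[at y](SY.rx)"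
        by (rule local_parametrization[OF SY.cx SX.cx N(1,2)])
      have \<phi>N: "\<phi> t \<in> N - {y}" if "t \<in> ball 0 \<rho> - {0}" for t
      proof -
        have "\<phi> t \<noteq> \<phi> 0" using inj_onD[OF \<phi>_inj, of t 0] that \<rho> by auto
        then show ?thesis using \<phi>_in \<phi>0 that by auto
      qed
      have u\<phi>: "(\<lambda>t. u j (\<phi> t)) holomorphic_on ball 0 \<rho> - {0}" for j
      proof -
        let ?S = "snd SY.cx ` (fst SY.cx \<inter> (N - {y}))"
        have "(u j \<circ> chart_inv SY.cx) holomorphic_on ?S"
          using u[of j] SY.cx(1) by (simp add: holomorphic_fun_def)
        moreover have "(\<lambda>t. snd SY.cx (\<phi> t)) ` (ball 0 \<rho> - {0}) \<subseteq> ?S"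
          using \<phi>N \<phi>_in by blast
        ultimately have "((u j \<circ> chart_inv SY.cx) \<circ> (\<lambda>t. snd SY.cx (\<phi> t))) holomorphic_on ball 0 \<rho> - {0}"
          by (intro holomorphic_on_compose_gen[OF holomorphic_on_subset[OF \<phi>_hol]]) auto
        then show ?thesis
        proof (rule holomorphic_transform)
          fix t :: complex assume "t \<in> ball 0 \<rho> - {0}"
          then have "\<phi> t \<in> fst SY.cx" using \<phi>_in by blast
          then show "((u j \<circ> chart_inv SY.cx) \<circ> (\<lambda>t. snd SY.cx (\<phi> t))) t = u j (\<phi> t)"
            using SY.cx(1) by simp
        qed
      qed
      \<comment> \<open>Coefficients on X of the isotypic components: t to the power i times the
        pullback of \<open>comb e (G i)\<close> is m times the i-th component of the given section.
        The frame is pulled back and therefore invariant, so only its coefficients are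
        decomposed.\<close>
      define g where "g = (\<lambda>k j. isotypic ?m k (\<lambda>t. u j (\<phi> t)))"
      define G where "G = (\<lambda>k j p. g k j (snd SX.cx p - snd SX.cx ?x))"
      let ?NX = "U \<inter> (fst SX.cx \<inter> snd SX.cx -` ball (snd SX.cx ?x) (\<rho> ^ ?m))"
      have NX: "open ?NX" "?x \<in> ?NX" "?NX \<subseteq> U"
        using SX.openU X.open_chart_vimage[OF SX.cx(1)] SX.xU SX.cx(2) \<rho> by auto
      have NX': "open (?NX - {?x})" using NX(1) by auto
      have G_hol: "holomorphic_fun X (?NX - {?x}) (G i j)" for i j
      proof -
        have "g i j holomorphic_on ball 0 (\<rho> ^ ?m) - {0}"
          unfolding g_def by (rule isotypic_holomorphic[OF m \<rho> u\<phi>])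
        then have "(\<lambda>z. g i j (z - snd SX.cx ?x)) holomorphic_on ball (snd SX.cx ?x) (\<rho> ^ ?m) - {snd SX.cx ?x}"
          by (intro holomorphic_on_compose_gen[of "\<lambda>z. z - snd SX.cx ?x" _ "g i j", unfolded o_def])
            (auto intro!: holomorphic_intros simp: dist_norm norm_minus_commute)
        then show ?thesis
          unfolding G_def using X.chart_inj[OF SX.cx(1) _ SX.cx(2)]
          by (intro X.holomorphic_compose_chart[OF SX.cx(1) NX']) auto
      qed
      \<comment> \<open>Order \<beta> in t, lowered by i through the division by the i-th power of
        t, and divided by m because the coordinate on X is the m-th power of t.\<close>
      have G_growth: "comb e (G i) \<in> SX.G ((\<beta> - real i) / real ?m)" for i
        unfolding SX.G_iff
      proof (intro conjI allI impI)
        show "\<exists>N. open N \<and> N \<inter> D = {?x} \<and> hol_section X (triv E) (N - {?x}) (comb e (G i))"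
          by (rule SX.punctured_section[OF NX G_hol])
        fix \<epsilon> :: real assume eps: "\<epsilon> > 0"
        \<comment> \<open>The loss \<epsilon> is measured on X; on Y it is m \<epsilon>.\<close>
        define \<kappa> where "\<kappa> = \<beta> - real ?m * \<epsilon>"
        have "SY.snorm (comb b v) \<in> O[at y](\<lambda>q. SY.rx q powr \<kappa>)"
          using s eps m unfolding SY.G_iff \<kappa>_def by simp
        from landau_o.big.compose[OF this lim(1)]
        have "(\<lambda>t. SY.snorm (comb b v) (\<phi> t)) \<in> O[at 0](\<lambda>t. SY.rx (\<phi> t) powr \<kappa>)" .
        also have "(\<lambda>t. SY.rx (\<phi> t) powr \<kappa>) \<in> \<Theta>[at 0](\<lambda>t. cmod t powr \<kappa>)"
          using bigtheta_powr[OF \<phi>_rad, of \<kappa>] by simp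
        finally obtain C where C: "C > 0"
          "\<forall>\<^sub>F t in at 0. norm (SY.snorm (comb b v) (\<phi> t)) \<le> C * norm (cmod t powr \<kappa>)"
          by (rule landau_o.bigE)
        then obtain \<delta>0 where \<delta>0: "\<delta>0 > 0"
          "\<And>t. t \<noteq> 0 \<Longrightarrow> cmod t < \<delta>0 \<Longrightarrow> norm (SY.snorm (comb b v) (\<phi> t)) \<le> C * norm (cmod t powr \<kappa>)"
          unfolding eventually_at by auto
        define \<delta> where "\<delta> = min \<delta>0 \<rho>"
        have \<delta>: "\<delta> > 0" "\<delta> \<le> \<rho>" using \<delta>0(1) \<rho> by (auto simp: \<delta>_def)
        have sb: "SY.snorm (comb b v) (\<phi> t) \<le> C * cmod t powr \<kappa>" if "t \<noteq> 0" "cmod t < \<delta>" for t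
          using \<delta>0(2)[of t] that by (simp add: \<delta>_def)
        let ?M = "U \<inter> (fst SX.cx \<inter> snd SX.cx -` ball (snd SX.cx ?x) (\<delta> ^ ?m))"
        have M: "open ?M" "?x \<in> ?M"
          using SX.openU X.open_chart_vimage[OF SX.cx(1)] SX.xU SX.cx(2) \<delta> by auto
        have "\<forall>\<^sub>F p in at ?x. norm (SX.snorm (comb e (G i)) p) \<le>
            (2 ^ ?m * real ?m * C) * norm (SX.rx p powr ((\<beta> - real i) / real ?m - \<epsilon>))"
          using X.eventually_in_open[OF M] SX.eventually_herm
        proof eventually_elim
          case (elim p)
          define z where "z = snd SX.cx p - snd SX.cx ?x"
          have z: "z \<noteq> 0" using X.chart_inj[OF SX.cx(1) _ SX.cx(2), of p] elim(1) by (auto simp: z_def)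
          have zn: "cmod z < \<delta> ^ ?m" using elim(1) by (simp add: z_def dist_norm norm_minus_commute)
          \<comment> \<open>The fibre over p in the coordinate t: m points, all in the disc where
            the growth bound holds. They share the hermitian form K p, so the bounds at these points
            add up to one for the component at p.\<close>
          let ?R = "{t. t ^ ?m = z}"
          have R: "finite ?R" "card ?R = ?m" using card_nth_roots[OF z m] finite_nth_roots[OF m] by auto
          have t: "t \<noteq> 0" "cmod t < \<delta>" "t \<in> ball 0 \<rho> - {0}" "f (\<phi> t) = p" if "t \<in> ?R" for t
          proof -
            have tm: "t ^ ?m = z" using that by simp
            show t0: "t \<noteq> 0" using tm z m by auto
            have "cmod t ^ ?m < \<delta> ^ ?m" using zn tm by (simp add: norm_power[symmetric])
            then show t\<delta>: "cmod t < \<delta>" using \<delta>(1) by (simp add: power_less_imp_less_base)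
            then show tb: "t \<in> ball 0 \<rho> - {0}" using t0 \<delta>(2) by simp
            have "snd SX.cx (f (\<phi> t)) = snd SX.cx p" using \<phi>_pow tb tm by (simp add: z_def)
            moreover have "f (\<phi> t) \<in> fst SX.cx" using \<phi>_in tb by blast
            ultimately show "f (\<phi> t) = p" using X.chart_inj[OF SX.cx(1)] elim(1) by simp
          qed
          have st: "comb b v (\<phi> t) = (\<Sum>j\<in>UNIV. u j (\<phi> t) *s e j p)" if "t \<in> ?R" for t
            using su[OF \<phi>N[OF t(3)[OF that]]] t(4)[OF that] by (simp add: comb_def)
          have "comb e (G i) p = (\<Sum>j\<in>UNIV. \<Sum>t\<in>?R. (u j (\<phi> t) / t ^ i) *s e j p)"
            unfolding comb_def G_def g_def isotypic_def z_def[symmetric] by (simp add: vec.scale_sum_left)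
          also have "\<dots> = (\<Sum>t\<in>?R. \<Sum>j\<in>UNIV. (u j (\<phi> t) / t ^ i) *s e j p)" by (rule sum.swap)
          also have "\<dots> = (\<Sum>t\<in>?R. (1 / t ^ i) *s comb b v (\<phi> t))"
            by (rule sum.cong[OF refl]) (simp add: st vec.scale_sum_right)
          finally have "SX.snorm (comb e (G i)) p = hnorm (K p) (\<Sum>t\<in>?R. (1 / t ^ i) *s comb b v (\<phi> t))"
            by (simp add: SX.snorm_def)
          also have "\<dots> \<le> 2 ^ card ?R * (\<Sum>t\<in>?R. hnorm (K p) ((1 / t ^ i) *s comb b v (\<phi> t)))"
            by (rule hnorm_sum_le[OF elim(2) R(1)])
          also have "\<dots> \<le> 2 ^ card ?R * (\<Sum>t\<in>?R. C * cmod z powr ((\<beta> - real i) / real ?m - \<epsilon>))"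
          proof (intro mult_left_mono sum_mono)
            fix t' assume t': "t' \<in> ?R"
            have tn: "cmod t' = cmod z powr (1 / real ?m)" by (rule norm_eq_root_powr) (use t' m in auto)
            have "hnorm (K p) ((1 / t' ^ i) *s comb b v (\<phi> t')) = (1 / cmod t' ^ i) * SY.snorm (comb b v) (\<phi> t')"
              using t(4)[OF t'] by (simp add: hnorm_scale[OF elim(2)] SY.snorm_def norm_divide norm_power)
            also have "\<dots> \<le> (1 / cmod t' ^ i) * (C * cmod t' powr \<kappa>)"
              by (intro mult_left_mono sb t[OF t']) simp
            also have "\<dots> = C * cmod t' powr (\<kappa> - real i)"
              using t(1)[OF t'] by (simp add: powr_diff powr_realpow)
            also have "\<dots> = C * cmod z powr ((\<beta> - real i) / real ?m - \<epsilon>)"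
              using m unfolding tn powr_powr \<kappa>_def by (simp add: field_simps)
            finally show "hnorm (K p) ((1 / t' ^ i) *s comb b v (\<phi> t')) \<le> C * cmod z powr ((\<beta> - real i) / real ?m - \<epsilon>)" .
          qed simp
          finally show ?case
            using R(2) hnorm_nonneg[OF elim(2)] by (simp add: SX.snorm_def rad_def z_def)
        qed
        then show "SX.snorm (comb e (G i)) \<in> O[at ?x](\<lambda>p. SX.rx p powr ((\<beta> - real i) / real ?m - \<epsilon>))"
          by (rule bigoI)
      qed
      \<comment> \<open>The only place where a bound on a section yields bounds on its coefficients;
        it is the hypothesis on X, applied to a section that lives there.\<close>
      have G_bigo: "(\<lambda>p. cmod (G i j p)) \<in> O[at ?x](\<lambda>p. SX.rx p powr ((\<beta> - real i) / real ?m - a j))" for i j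
        using SX.frame_growth_iff[THEN iffD1, OF growth, rule_format, OF NX G_hol, THEN iffD1, OF G_growth] by blast
      have ball0: "\<forall>\<^sub>F t in at 0. t \<in> ball 0 \<rho> - {0::complex}"
        unfolding eventually_at_topological using \<rho> by (intro exI[of _ "ball 0 \<rho>"]) auto
      \<comment> \<open>The index i cancels: i + m ((\<beta> - i)/m - a j) = \<beta> - m a j, so all
        components obey the same bound, and with them their sum.\<close>
      have part: "(\<lambda>t. cmod (t ^ i * g i j (t ^ ?m))) \<in> O[at 0](\<lambda>t. cmod t powr (\<beta> - real ?m * a j))" for i j
      proof -
        let ?\<kappa> = "(\<beta> - real i) / real ?m - a j"
        have "(\<lambda>t. cmod (G i j (f (\<phi> t)))) \<in> O[at 0](\<lambda>t. SX.rx (f (\<phi> t)) powr ?\<kappa>)"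
          by (rule landau_o.big.compose[OF G_bigo filterlim_compose[OF filterlim_at_image lim(1)]])
        then obtain C where C: "C > 0"
          "\<forall>\<^sub>F t in at 0. norm (cmod (G i j (f (\<phi> t)))) \<le> C * norm (SX.rx (f (\<phi> t)) powr ?\<kappa>)"
          by (rule landau_o.bigE)
        show ?thesis
        proof (rule bigoI[of _ C])
          show "\<forall>\<^sub>F t in at 0. norm (cmod (t ^ i * g i j (t ^ ?m))) \<le> C * norm (cmod t powr (\<beta> - real ?m * a j))"
            using C(2) ball0
          proof eventually_elim
            case (elim t)
            have z: "snd SX.cx (f (\<phi> t)) - snd SX.cx ?x = t ^ ?m" using \<phi>_pow elim(2) by simp
            have t0: "cmod t > 0" using elim(2) by simp
            have le: "cmod (g i j (t ^ ?m)) \<le> C * cmod (t ^ ?m) powr ?\<kappa>"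
              using elim(1) by (simp add: G_def rad_def z)
            have "cmod (t ^ ?m) powr ?\<kappa> = cmod t powr (real ?m * ?\<kappa>)"
              using t0 by (simp add: norm_power powr_realpow[symmetric] powr_powr)
            also have "real ?m * ?\<kappa> = \<beta> - real ?m * a j - real i" using m by (simp add: field_simps)
            finally have "cmod t ^ i * cmod (g i j (t ^ ?m)) \<le> cmod t ^ i * (C * cmod t powr (\<beta> - real ?m * a j - real i))"
              using le by (intro mult_left_mono) simp_all
            also have "\<dots> = C * cmod t powr (\<beta> - real ?m * a j)"
              using t0 by (simp add: powr_diff powr_realpow)
            finally show ?case by (simp add: norm_mult norm_power)
          qed
        qed
      qed
      show "\<forall>j. (\<lambda>q. cmod (u j q)) \<in> O[at y](\<lambda>q. SY.rx q powr (\<beta> - real ?m * a j))"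
      proof
        fix j
        have "(\<lambda>t. \<Sum>i<?m. cmod (t ^ i * g i j (t ^ ?m))) \<in> O[at 0](\<lambda>t. cmod t powr (\<beta> - real ?m * a j))"
          by (rule big_sum_in_bigo) (rule part)
        moreover have "\<forall>\<^sub>F t in at 0. norm (cmod (u j (\<phi> t))) \<le> 1 * norm (\<Sum>i<?m. cmod (t ^ i * g i j (t ^ ?m)))"
          using ball0
        proof eventually_elim
          case (elim t)
          have "of_nat ?m * u j (\<phi> t) = (\<Sum>i<?m. t ^ i * g i j (t ^ ?m))"
            unfolding g_def by (rule sum_isotypic[OF m, symmetric]) (use elim in simp)
          then have "real ?m * cmod (u j (\<phi> t)) = cmod (\<Sum>i<?m. t ^ i * g i j (t ^ ?m))"
            by (metis norm_mult norm_of_nat)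
          also have "\<dots> \<le> (\<Sum>i<?m. cmod (t ^ i * g i j (t ^ ?m)))" by (rule norm_sum)
          finally have le: "real ?m * cmod (u j (\<phi> t)) \<le> (\<Sum>i<?m. cmod (t ^ i * g i j (t ^ ?m)))" .
          have "1 * cmod (u j (\<phi> t)) \<le> real ?m * cmod (u j (\<phi> t))"
            by (rule mult_right_mono) (use m in simp_all)
          with le show ?case by simp
        qed
        then have "(\<lambda>t. cmod (u j (\<phi> t))) \<in> O[at 0](\<lambda>t. \<Sum>i<?m. cmod (t ^ i * g i j (t ^ ?m)))" by (rule bigoI)
        ultimately have "(\<lambda>t. cmod (u j (\<phi> t))) \<in> O[at 0](\<lambda>t. cmod t powr (\<beta> - real ?m * a j))"
          using landau_o.big_trans by blast
        from landau_o.big.compose[OF this lim(2)]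
        have "(\<lambda>q. cmod (u j (\<phi> (\<tau> q)))) \<in> O[at y](\<lambda>q. cmod (\<tau> q) powr (\<beta> - real ?m * a j))" .
        also have "(\<lambda>q. cmod (\<tau> q) powr (\<beta> - real ?m * a j)) \<in> \<Theta>[at y](\<lambda>q. SY.rx q powr (\<beta> - real ?m * a j))"
          using bigtheta_powr[OF \<tau>_rad, of "\<beta> - real ?m * a j"] by simp
        finally have "(\<lambda>q. cmod (u j (\<phi> (\<tau> q)))) \<in> O[at y](\<lambda>q. SY.rx q powr (\<beta> - real ?m * a j))" .
        moreover have "\<forall>\<^sub>F q in at y. cmod (u j (\<phi> (\<tau> q))) = cmod (u j q)"
          using lim(3) by (rule eventually_mono) simp
        ultimately show "(\<lambda>q. cmod (u j q)) \<in> O[at y](\<lambda>q. SY.rx q powr (\<beta> - real ?m * a j))"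
          by (rule landau_o.big.in_cong[THEN iffD1, rotated])
      qed
    qed
  qed
qed

section \<open>Pullback of harmonic bundles\<close>

context operator
begin

lemma dbar_hol_smooth: "dbar_hol X E A V s \<Longrightarrow> smooth_section X E V s"
  and dbar_hol_zero: "dbar_hol X E A V s \<Longrightarrow> c \<in> X \<Longrightarrow> p \<in> V \<Longrightarrow> p \<in> fst c \<Longrightarrow> snd (A s c p) = 0"
  by (simp_all add: dbar_hol_def)

lemma dbar_hol_subset: "dbar_hol X E A V s \<Longrightarrow> open N \<Longrightarrow> N \<subseteq> V \<Longrightarrow> dbar_hol X E A N s"
  unfolding dbar_hol_def using sm.section_subset by blast

lemma dbar_hol_local:
  assumes "\<And>p. p \<in> V \<Longrightarrow> \<exists>N. p \<in> N \<and> N \<subseteq> V \<and> dbar_hol X E A N s"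
  shows "dbar_hol X E A V s"
  unfolding dbar_hol_def
proof (intro conjI ballI)
  show "smooth_section X E V s"
  proof (rule sm.section_local)
    fix p assume "p \<in> V"
    from assms[OF this] show "\<exists>N. p \<in> N \<and> N \<subseteq> V \<and> smooth_section X E N s"
      using dbar_hol_smooth by blast
  qed
  fix c p assume c: "c \<in> X" "p \<in> V \<inter> fst c"
  then obtain N where "p \<in> N" "dbar_hol X E A N s" using assms[of p] by blast
  then show "snd (A s c p) = 0" using dbar_hol_zero c by blast
qed

text \<open>In a frame of sections killed by the (0,1) part, that part acts on coordinates as d-bar,
  so the Cauchy-Riemann criterion applies to each coordinate.\<close>

lemma dbar_hol_coords:
  assumes e: "regular_frame (smooth_fun X) E U e" "\<And>j. dbar_hol X E A U (e j)" and V: "open V" "V \<subseteq> U"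
  shows "dbar_hol X E A V s \<longleftrightarrow> (\<forall>j. holomorphic_fun X V (coords e s j))"
proof -
  have eV: "regular_frame (smooth_fun X) E V e" by (rule sm.frame_subset[OF e(1) V])
  then have sV: "smooth_section X E V (e j)" and inv: "p \<in> V \<Longrightarrow> invertible (frame_matrix e p)" for j p
    by (auto simp: regular_frame_def)
  have snd_A: "snd (A s c p) = comb e (\<lambda>j. d_zbar c (coords e s j)) p"
    if u: "\<And>j. smooth_fun X V (coords e s j)" and c: "c \<in> X" "p \<in> V" "p \<in> fst c" for c p
  proof -
    have t: "smooth_section X E V (comb e (coords e s))" by (rule sm.section_comb[OF eV u])
    have "smooth_section X E V s" using sm.section_iff_coords[OF eV] u by blast
    then have "A s c p = A (comb e (coords e s)) c p"
      by (rule A_cong[OF _ t _ c]) (simp add: comb_coords[OF inv])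
    then show ?thesis
      using A_comb(2)[OF V(1) sV u c] dbar_hol_zero[OF e(2) c(1)] c V by (auto simp: comb_def)
  qed
  show ?thesis
  proof
    assume s: "dbar_hol X E A V s"
    have u: "smooth_fun X V (coords e s j)" for j by (rule sm.R_coords[OF eV dbar_hol_smooth[OF s]])
    have "d_zbar c (coords e s j) p = 0" if c: "c \<in> X" "p \<in> V" "p \<in> fst c" for c p j
    proof -
      have "comb e (\<lambda>j. d_zbar c (coords e s j)) p = comb e (\<lambda>j p. 0) p"
        using snd_A[OF u c] dbar_hol_zero[OF s c] by (simp add: comb_def)
      then show ?thesis 
        using comb_eq_iff[OF inv[OF c(2)], of "\<lambda>j. d_zbar c (coords e s j)" "\<lambda>j p. 0"] by simp
    qed
    then show "\<forall>j. holomorphic_fun X V (coords e s j)"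
      using u holomorphic_fun_iff_d_zbar by blast
  next
    assume h: "\<forall>j. holomorphic_fun X V (coords e s j)"
    then have u: "smooth_fun X V (coords e s j)" for j using holomorphic_imp_smooth by blast
    show "dbar_hol X E A V s"
      unfolding dbar_hol_def
    proof (intro conjI ballI)
      show "smooth_section X E V s" using sm.section_iff_coords[OF eV] u by blast
      fix c p assume c: "c \<in> X" "p \<in> V \<inter> fst c"
      have "d_zbar c (coords e s j) p = 0" for j
        using h holomorphic_fun_iff_d_zbar c by blast
      then show "snd (A s c p) = 0" using snd_A[OF u c(1)] c(2) by (simp add: comb_def)
    qed
  qed
qed

definition local_hol_frames :: bool where
  "local_hol_frames \<longleftrightarrow> (\<forall>p\<in>W. \<exists>U e. p \<in> U \<and> regular_frame (smooth_fun X) E U e \<and> (\<forall>j. dbar_hol X E A U (e j)))"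

definition flat :: bool where
  "flat \<longleftrightarrow> (\<forall>V s. smooth_section X E V s \<longrightarrow> (\<forall>c\<in>X. \<forall>p \<in> V \<inter> fst c. curvature A s c p = 0))"

definition preserves_dbar_hol :: bool where
  "preserves_dbar_hol \<longleftrightarrow> (\<forall>V s. dbar_hol X E A V s \<longrightarrow> (\<forall>c\<in>X. dbar_hol X E A (V \<inter> fst c) (\<lambda>p. fst (A s c p))))"

text \<open>If the (0,1) part of A s vanishes, the first term of the curvature vanishes with it, and
  what remains is the (0,1) part of A applied to the (1,0) part of A s.\<close>

lemma flat_preserves_dbar_hol:
  assumes flat
  shows preserves_dbar_hol
  unfolding preserves_dbar_hol_def
proof (intro allI impI ballI)
  fix V s c assume s: "dbar_hol X E A V s" and c: "c \<in> X"
  note s' = dbar_hol_smooth[OF s]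
  note fs = A_smooth(1)[OF s' c]
  have Vc: "open (V \<inter> fst c)" "V \<inter> fst c \<subseteq> W" using sm.section_open[OF fs] sm.section_dom[OF fs] by auto
  show "dbar_hol X E A (V \<inter> fst c) (\<lambda>p. fst (A s c p))"
    unfolding dbar_hol_def
  proof (intro conjI ballI)
    show "smooth_section X E (V \<inter> fst c) (\<lambda>p. fst (A s c p))" by (rule fs)
    fix c' p assume c': "c' \<in> X" "p \<in> V \<inter> fst c \<inter> fst c'"
    have "A (\<lambda>q. snd (A s c q)) c p = A (\<lambda>q. 0) c p"
      by (rule A_cong[OF A_smooth(2)[OF s' c] sm.section_zero[OF Vc] _ c])
        (use dbar_hol_zero[OF s c] c' in auto)
    moreover have "p \<in> W" using c' Vc by blast
    ultimately have "A (\<lambda>q. snd (A s c q)) c p = 0" using A_zero[OF c, of p] c' by simp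
    moreover have "curvature A s c p = 0" using assms s' c c' unfolding flat_def by blast
    ultimately have "snd (A (\<lambda>q. fst (A s c q)) c p) = 0" by (simp add: curvature_def)
    then show "snd (A (\<lambda>q. fst (A s c q)) c' p) = 0"
      using A_chart(2)[OF fs c'(1) c, of p] c' by simp
  qed
qed

end

context pullback_operator
begin

lemma dbar_hol_pullback:
  assumes "dbar_hol X E A V s"
  shows "dbar_hol Y PE PA (f -` V) (\<lambda>q. s (f q))"
  unfolding dbar_hol_def
proof (intro conjI ballI)
  note s = dbar_hol_smooth[OF assms]
  show "smooth_section Y PE (f -` V) (\<lambda>q. s (f q))"
    by (rule smooth_map.section_pullback[OF smooth_bundle s])
  fix d q assume d: "d \<in> Y" "q \<in> f -` V \<inter> fst d"
  obtain c where c: "c \<in> X" "f q \<in> fst c" by (rule X.chart_at)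
  show "snd (PA (\<lambda>q. s (f q)) d q) = 0"
    using PA_pullback_section(2)[OF s c _ d(1)] d dbar_hol_zero[OF assms c(1) _ c(2)] by simp
qed

text \<open>In a pulled back holomorphic frame the curvature consists of \<alpha> times the
  commutator of the two derivatives on the coefficients, which is 0, and of terms in the coefficient
  forms \<theta>. The latter cancel because \<theta> and the Jacobian are holomorphic; for \<theta>
  this is what \<open>preserves_dbar_hol\<close> supplies.\<close>

lemma flat_pullback:
  assumes frames: local_hol_frames and pres: preserves_dbar_hol
  shows pop.flat
  unfolding pop.flat_def
proof (intro allI impI ballI)
  fix V t d q assume t: "smooth_section Y PE V t" and d: "d \<in> Y" "q \<in> V \<inter> fst d"
  obtain c where c: "c \<in> X" "f q \<in> fst c" by (rule X.chart_at)
  have "f q \<in> W" using psm.section_dom[OF t] d by blast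
  then obtain U e where U: "f q \<in> U" and e: "regular_frame (smooth_fun X) E U e" "\<And>j. dbar_hol X E A U (e j)"
    using frames unfolding local_hol_frames_def by blast
  \<comment> \<open>The images of the frame under the (1,0) part: the Higgs field if \<alpha> = 0,
    the connection form if \<alpha> = 1.\<close>
  define \<theta> where "\<theta> = (\<lambda>j p. fst (A (e j) c p))"
  let ?U = "U \<inter> fst c"
  let ?N = "V \<inter> fst d \<inter> f -` ?U"
  let ?eb = "\<lambda>j q. e j (f q)" and ?tb = "\<lambda>j q. \<theta> j (f q)"
  let ?u = "pcoords e t" and ?J = "chart_jacobian d c f"
  have \<theta>: "dbar_hol X E A ?U (\<theta> j)" for j
    using pres e(2) c(1) unfolding preserves_dbar_hol_def \<theta>_def by blast
  have oU: "open ?U" using e(1) X.open_chart[OF c(1)] by (auto simp: regular_frame_def)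
  have N: "open ?N" "q \<in> ?N" "q \<in> fst d"
    using psm.section_open[OF t] Y.open_chart[OF d(1)] vimage_open[OF oU] U c d by auto
  have sub: "smooth_section Y PE ?N h" if "smooth_section Y PE M h" "?N \<subseteq> M" for M h
    by (rule psm.section_subset[OF that(1) N(1) that(2)])
  have subf: "smooth_fun Y ?N h" if "smooth_fun Y M h" "?N \<subseteq> M" for M h
    by (rule Y.smooth.R_subset[OF that(1) N(1) that(2)])
  have Ud: "?N \<inter> fst d = ?N" by blast
  have eb: "smooth_section Y PE ?N (?eb j)" for j
    by (rule sub[OF smooth_map.section_pullback[OF smooth_bundle dbar_hol_smooth[OF e(2)]]]) blast
  have tb: "smooth_section Y PE ?N (?tb j)" for j
    by (rule sub[OF smooth_map.section_pullback[OF smooth_bundle dbar_hol_smooth[OF \<theta>]]]) blast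
  have u: "smooth_fun Y ?N (?u j)" for j by (rule subf[OF smooth_pcoords[OF e(1) t]]) blast
  have du: "smooth_fun Y ?N (d_z d (?u j))" "smooth_fun Y ?N (d_zbar d (?u j))" for j
    using Y.smooth_fun_d[OF u d(1)] Ud by auto
  have J: "holomorphic_fun Y ?N ?J" by (rule Y.hol.R_subset[OF holomorphic_jacobian[OF d(1) c(1)] N(1)]) blast
  note Js = Y.holomorphic_imp_smooth[OF J]
  have PA_t: "fst (PA t d q') = comb ?eb (\<lambda>j q. \<alpha> * d_z d (?u j) q) q' + comb ?tb (\<lambda>j q. ?u j q * ?J q) q'"
    "snd (PA t d q') = comb ?eb (\<lambda>j. d_zbar d (?u j)) q'" if q': "q' \<in> ?N" for q'
  proof -
    have "snd (A (e j) c (f q')) = 0" for j using dbar_hol_zero[OF e(2) c(1)] q' by auto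
    moreover have cU: "f q' \<in> fst c" "f q' \<in> U" "q' \<in> fst d" "q' \<in> V" using q' by auto
    ultimately show "fst (PA t d q') = comb ?eb (\<lambda>j q. \<alpha> * d_z d (?u j) q) q' + comb ?tb (\<lambda>j q. ?u j q * ?J q) q'"
      "snd (PA t d q') = comb ?eb (\<lambda>j. d_zbar d (?u j)) q'"
      by (simp_all add: PA_coords[OF e(1) c(1) cU(1,2) d(1) cU(3) t cU(4) refl] comb_def \<theta>_def sum.distrib)
  qed
  have PA_eb: "fst (PA (?eb j) d q) = ?J q *s \<theta> j (f q)" "snd (PA (?eb j) d q) = 0" for j
    using PA_pullback_section[OF dbar_hol_smooth[OF e(2)] c U d(1) N(3), of j] dbar_hol_zero[OF e(2) c(1) U c(2)]
    by (simp_all add: \<theta>_def)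
  have PA_tb: "snd (PA (?tb j) d q) = 0" for j
    using PA_pullback_section(2)[OF dbar_hol_smooth[OF \<theta>] c _ d(1) N(3)] dbar_hol_zero[OF \<theta> c(1) _ c(2)] U c(2)
    by simp
  have s1: "smooth_section Y PE ?N (comb ?eb (\<lambda>j. d_zbar d (?u j)))"
    and s2: "smooth_section Y PE ?N (comb ?eb (\<lambda>j q. \<alpha> * d_z d (?u j) q))"
    and s3: "smooth_section Y PE ?N (comb ?tb (\<lambda>j q. ?u j q * ?J q))"
    unfolding comb_def[abs_def] using psm.section_dom[OF eb]
    by (intro psm.section_sum psm.section_scale Y.smooth.R_mult Y.smooth.R_const du u Js eb tb N(1); assumption)+
  have "PA (\<lambda>q. snd (PA t d q)) d q = PA (comb ?eb (\<lambda>j. d_zbar d (?u j))) d q"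
    by (rule pop.A_cong[OF sub[OF pop.A_smooth(2)[OF t d(1)]] s1 PA_t(2) d(1) N(2,3)]) blast+
  then have 1: "fst (PA (\<lambda>q. snd (PA t d q)) d q) =
      (\<Sum>j\<in>UNIV. (\<alpha> * d_z d (d_zbar d (?u j)) q) *s ?eb j q + d_zbar d (?u j) q *s (?J q *s \<theta> j (f q)))"
    by (simp add: pop.A_comb(1)[OF N(1) eb du(2) d(1) N(2,3)] PA_eb)
  have "PA (\<lambda>q. fst (PA t d q)) d q =
      PA (\<lambda>q'. comb ?eb (\<lambda>j q. \<alpha> * d_z d (?u j) q) q' + comb ?tb (\<lambda>j q. ?u j q * ?J q) q') d q"
    by (rule pop.A_cong[OF sub[OF pop.A_smooth(1)[OF t d(1)]] psm.section_add[OF s2 s3] PA_t(1) d(1) N(2,3)]) blast+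
  also have "\<dots> = PA (comb ?eb (\<lambda>j q. \<alpha> * d_z d (?u j) q)) d q + PA (comb ?tb (\<lambda>j q. ?u j q * ?J q)) d q"
    by (rule pop.A_add[OF s2 s3 d(1) N(2,3)])
  finally have 2: "snd (PA (\<lambda>q. fst (PA t d q)) d q) =
      (\<Sum>j\<in>UNIV. d_zbar d (\<lambda>q. \<alpha> * d_z d (?u j) q) q *s ?eb j q) + (\<Sum>j\<in>UNIV. d_zbar d (\<lambda>q. ?u j q * ?J q) q *s \<theta> j (f q))"
    using pop.A_comb(2)[OF N(1) eb Y.smooth.R_mult[OF Y.smooth.R_const[OF N(1)] du(1)] d(1) N(2,3)]
      pop.A_comb(2)[OF N(1) tb Y.smooth.R_mult[OF u Js] d(1) N(2,3)]
    by (simp add: PA_eb PA_tb)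
  have qd: "q \<in> ?N \<inter> fst d" using N by blast
  have 3: "d_zbar d (\<lambda>q. \<alpha> * d_z d (?u j) q) q = \<alpha> * d_z d (d_zbar d (?u j)) q" for j
    using Y.d_mult(2)[OF Y.smooth.R_const[OF N(1)] du(1) d(1) qd] Y.d_z_d_zbar_commute[OF u d(1) qd]
    by simp
  have 4: "d_zbar d (\<lambda>q. ?u j q * ?J q) q = d_zbar d (?u j) q * ?J q" for j
    using Y.d_mult(2)[OF u Js d(1) qd] Y.d_holomorphic(1)[OF J d(1) qd] by simp
  show "curvature PA t d q = 0"
    unfolding curvature_def 1 2 3 4 by (simp add: sum.distrib vector_smult_assoc)
qed

end

subsection \<open>The metric\<close>

lemma hermitian_form_sum_left: "hermitian_form h \<Longrightarrow> h (\<Sum>i\<in>I. x i) v = (\<Sum>i\<in>I. h (x i) v)"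
  and hermitian_form_sum_right: "hermitian_form h \<Longrightarrow> h v (\<Sum>i\<in>I. x i) = (\<Sum>i\<in>I. h v (x i))"
  by (induction I rule: infinite_finite_induct) (simp_all add: hermitian_form_simps)

lemma hermitian_metric_iff:
  "hermitian_metric X E K \<longleftrightarrow> (\<forall>p \<in> (\<Union>\<tau>\<in>E. fst \<tau>). hermitian_form (K p)) \<and>
     (\<forall>V u v. smooth_section X E V u \<longrightarrow> smooth_section X E V v \<longrightarrow> smooth_fun X V (\<lambda>p. K p (u p) (v p)))"
  by (simp add: hermitian_metric_def hermitian_form_def)

locale pullback_harmonic_bundle = surface_map Y X f
  for Y :: "('y::t2_space) chart set" and X :: "('x::t2_space) chart set" and f :: "'y \<Rightarrow> 'x" +
  fixes W :: "'x set" and H :: "('x, 'n::finite) harmonic"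
  assumes harmonic: "harmonic_bundle X W H"
begin

abbreviation "VB \<equiv> vbundle H"
abbreviation "Dt \<equiv> D_theta H"
abbreviation "Dn \<equiv> D_nabla H"
abbreviation "K \<equiv> metric H"

lemma harmonicD:
  shows "vector_bundle (smooth_fun X) W VB" "hermitian_metric X VB K"
    "diff_operator derivation_dbar X VB Dt" "diff_operator derivation_d X VB Dn"
proof -
  note hb = harmonic[unfolded harmonic_bundle_def]
  show "vector_bundle (smooth_fun X) W VB" by (rule conjunct1[OF hb])
  show "hermitian_metric X VB K" by (rule conjunct1[OF conjunct2[OF hb]])
  show "diff_operator derivation_dbar X VB Dt" by (rule conjunct1[OF conjunct2[OF conjunct2[OF hb]]])
  show "diff_operator derivation_d X VB Dn"
    by (rule conjunct1[OF conjunct2[OF conjunct2[OF conjunct2[OF conjunct2[OF hb]]]]])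
qed

sublocale T: pullback_operator Y X f 0 W VB Dt
  using harmonicD(1,3) unfolding derivation_dbar_eq by unfold_locales

sublocale N: pullback_operator Y X f 1 W VB Dn
  using harmonicD(1,4) unfolding derivation_d_eq by unfold_locales

abbreviation "PVB \<equiv> pullback_bundle f VB"
abbreviation "PDt \<equiv> pullback_op (scaled_derivation 0) X f VB Dt"
abbreviation "PDn \<equiv> pullback_op (scaled_derivation 1) X f VB Dn"

lemma pullback_harmonic_eq:
  "pullback_harmonic X f H = \<lparr>vbundle = PVB, D_theta = PDt, D_nabla = PDn, metric = K \<circ> f\<rparr>"
  by (simp add: pullback_harmonic_def derivation_dbar_eq derivation_d_eq)

lemma K_form: "p \<in> W \<Longrightarrow> hermitian_form (K p)"
  and K_smooth: "smooth_section X VB V u \<Longrightarrow> smooth_section X VB V v \<Longrightarrow> smooth_fun X V (\<lambda>p. K p (u p) (v p))"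
  using harmonicD(2) unfolding hermitian_metric_iff T.sm.triv_cover by blast+

lemma preserves: "T.preserves_dbar_hol" "N.preserves_dbar_hol"
proof -
  note hb = harmonic[unfolded harmonic_bundle_def]
  show "T.preserves_dbar_hol" unfolding T.preserves_dbar_hol_def
    by (rule conjunct1[OF conjunct2[OF conjunct2[OF conjunct2[OF hb]]]])
  show "N.preserves_dbar_hol" unfolding N.preserves_dbar_hol_def
    by (rule conjunct1[OF conjunct2[OF conjunct2[OF conjunct2[OF conjunct2[OF conjunct2[OF hb]]]]]])
qed

text \<open>The operators P and Q in \<open>harmonic_bundle\<close> occur only existentially, but
  the decomposition of \<open>D_nabla\<close> forces them to be differences of the two given
  operators. In this form the relations can be transported to Y.\<close>

lemma metric_relations:
  assumes "smooth_section X VB V u" "smooth_section X VB V v" "c \<in> X" "p \<in> V" "p \<in> fst c"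
  shows "K p (fst (Dn u c p) - fst (Dt u c p)) (v p) + K p (u p) (snd (Dt v c p)) = d_z c (\<lambda>q. K q (u q) (v q)) p"
    "K p (u p) (fst (Dt v c p)) = K p (snd (Dn u c p) - snd (Dt u c p)) (v p)"
proof -
  obtain P Q where PQ: "\<forall>V u v. smooth_section X VB V u \<longrightarrow> smooth_section X VB V v \<longrightarrow>
          (\<forall>c\<in>X. \<forall>p \<in> V \<inter> fst c.
             K p (P u c p) (v p) + K p (u p) (snd (Dt v c p)) = d_z c (\<lambda>q. K q (u q) (v q)) p \<and>
             K p (u p) (fst (Dt v c p)) = K p (Q u c p) (v p) \<and>
             snd (Dn u c p) = snd (Dt u c p) + Q u c p \<and>
             fst (Dn u c p) = P u c p + fst (Dt u c p))"
    using conjunct1[OF conjunct2[OF conjunct2[OF conjunct2[OF conjunct2[OF conjunct2[OF conjunct2[OF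
      harmonic[unfolded harmonic_bundle_def]]]]]]]] by (elim exE) (rule that)
  have pc: "p \<in> V \<inter> fst c" using assms by blast
  note R = PQ[rule_format, OF assms(1,2,3) pc]
  have "fst (Dn u c p) - fst (Dt u c p) = P u c p" "snd (Dn u c p) - snd (Dt u c p) = Q u c p"
    using R by simp_all
  then show "K p (fst (Dn u c p) - fst (Dt u c p)) (v p) + K p (u p) (snd (Dt v c p)) = d_z c (\<lambda>q. K q (u q) (v q)) p"
    "K p (u p) (fst (Dt v c p)) = K p (snd (Dn u c p) - snd (Dt u c p)) (v p)"
    using R by simp_all
qed

lemma metric_expansion:
  assumes e: "regular_frame (smooth_fun X) VB U e" and q: "f q \<in> U"
  shows "K (f q) (t q) (r q) =
    (\<Sum>i\<in>UNIV. \<Sum>j\<in>UNIV. (T.pcoords e t i q * cnj (T.pcoords e r j q)) * K (f q) (e i (f q)) (e j (f q)))"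
proof -
  have inv: "invertible (frame_matrix (\<lambda>j q. e j (f q)) q)"
    using e q by (simp add: regular_frame_def T.pullback_frame_matrix)
  have "f q \<in> W" using T.sm.section_dom e q unfolding regular_frame_def by blast
  note h = K_form[OF this]
  have "t q = (\<Sum>j\<in>UNIV. T.pcoords e t j q *s e j (f q))" "r q = (\<Sum>j\<in>UNIV. T.pcoords e r j q *s e j (f q))"
    using comb_coords[OF inv, of t] comb_coords[OF inv, of r] by (simp_all add: comb_def)
  then have "K (f q) (t q) (r q) = K (f q) (\<Sum>j\<in>UNIV. T.pcoords e t j q *s e j (f q)) (\<Sum>j\<in>UNIV. T.pcoords e r j q *s e j (f q))"
    by simp
  also have "\<dots> = (\<Sum>i\<in>UNIV. \<Sum>j\<in>UNIV. (T.pcoords e t i q * cnj (T.pcoords e r j q)) * K (f q) (e i (f q)) (e j (f q)))"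
    unfolding hermitian_form_sum(1)[OF h] unfolding hermitian_form_sum(2)[OF h]
    by (simp add: sum_distrib_left mult.assoc)
  finally show ?thesis .
qed

lemma frame_near:
  assumes "smooth_section Y PVB V t" "q \<in> V"
  obtains c U e where "c \<in> X" "f q \<in> fst c" "f q \<in> U" "regular_frame (smooth_fun X) VB U e"
proof -
  obtain c where c: "c \<in> X" "f q \<in> fst c" by (rule X.chart_at)
  have "f q \<in> W" using T.psm.section_dom[OF assms(1)] assms(2) by blast
  then obtain U e where "regular_frame (smooth_fun X) VB U e" "f q \<in> U" by (rule T.sm.frame_at)
  with c show ?thesis by (intro that)
qed

lemma hermitian_metric_pullback: "hermitian_metric Y PVB (K \<circ> f)"
  unfolding hermitian_metric_iff T.psm.triv_cover
proof (intro conjI ballI allI impI)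
  show "hermitian_form ((K \<circ> f) q)" if "q \<in> f -` W" for q using K_form that by simp
  fix V t r assume t: "smooth_section Y PVB V t" and r: "smooth_section Y PVB V r"
  have V: "open V" by (rule T.psm.section_open[OF t])
  have "smooth_fun Y V (\<lambda>q. K (f q) (t q) (r q))"
  proof (rule Y.smooth.R_local)
    fix q assume q: "q \<in> V"
    obtain c U e where c: "c \<in> X" "f q \<in> fst c" "f q \<in> U" and e: "regular_frame (smooth_fun X) VB U e"
      by (rule frame_near[OF t q])
    let ?N = "V \<inter> f -` U"
    have N: "open ?N" using V vimage_open e by (auto simp: regular_frame_def)
    have eU: "smooth_section X VB U (e j)" for j using e by (simp add: regular_frame_def)
    have "smooth_fun Y ?N (\<lambda>q. \<Sum>i\<in>UNIV. \<Sum>j\<in>UNIV. (T.pcoords e t i q * cnj (T.pcoords e r j q)) * K (f q) (e i (f q)) (e j (f q)))"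
      by (intro Y.smooth.R_sum Y.smooth.R_mult Y.smooth_fun_cnj T.smooth_pcoords[OF e] t r N
          Y.smooth.R_subset[OF smooth_fun_pullback[OF K_smooth[OF eU eU]]]) auto
    then have "smooth_fun Y ?N (\<lambda>q. K (f q) (t q) (r q))"
    proof (rule Y.smooth.R_cong)
      fix q assume "q \<in> ?N"
      then have "f q \<in> U" by simp
      then show "(\<Sum>i\<in>UNIV. \<Sum>j\<in>UNIV. (T.pcoords e t i q * cnj (T.pcoords e r j q)) * K (f q) (e i (f q)) (e j (f q))) =
          K (f q) (t q) (r q)"
        by (rule metric_expansion[OF e, of q t r, symmetric])
    qed
    moreover have "q \<in> ?N" "?N \<subseteq> V" using q c(3) by simp_all
    ultimately show "\<exists>N. q \<in> N \<and> N \<subseteq> V \<and> smooth_fun Y N (\<lambda>q. K (f q) (t q) (r q))"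
      by (intro exI[of _ ?N] conjI)
  qed
  then show "smooth_fun Y V (\<lambda>q. (K \<circ> f) q (t q) (r q))" by simp
qed

text \<open>Sesquilinear expansion in a pulled back frame reduces both identities to those for pairs
  of frame vectors on X. The Jacobians match because the metric is conjugate linear in its second
  argument: the conjugate Jacobian carried there by a (0,1) part comes out as the Jacobian
  itself.\<close>

lemma metric_relations_pullback:
  assumes t: "smooth_section Y PVB V t" and r: "smooth_section Y PVB V r" and d: "d \<in> Y" "q \<in> V" "q \<in> fst d"
  shows "K (f q) (fst (PDn t d q) - fst (PDt t d q)) (r q) + K (f q) (t q) (snd (PDt r d q)) =
      d_z d (\<lambda>q. K (f q) (t q) (r q)) q"
    "K (f q) (t q) (fst (PDt r d q)) = K (f q) (snd (PDn t d q) - snd (PDt t d q)) (r q)"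
proof -
  obtain c U e where c: "c \<in> X" "f q \<in> fst c" "f q \<in> U" and e: "regular_frame (smooth_fun X) VB U e"
    by (rule frame_near[OF t d(2)])
  have eU: "smooth_section X VB U (e j)" for j using e by (simp add: regular_frame_def)
  have "f q \<in> W" using T.sm.section_dom[OF eU] c by blast
  note h = K_form[OF this]
  define J where "J = chart_jacobian d c f q"
  define a where "a = T.pcoords e t"
  define b where "b = T.pcoords e r"
  define x where "x = (\<lambda>j. e j (f q))"
  define P where "P = (\<lambda>j. fst (Dn (e j) c (f q)) - fst (Dt (e j) c (f q)))"
  define Q where "Q = (\<lambda>j. snd (Dn (e j) c (f q)) - snd (Dt (e j) c (f q)))"
  define B where "B = (\<lambda>j. snd (Dt (e j) c (f q)))"
  define \<theta> where "\<theta> = (\<lambda>j. fst (Dt (e j) c (f q)))"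
  let ?N = "V \<inter> f -` U"
  have N: "open ?N" using T.psm.section_open[OF t] vimage_open e by (auto simp: regular_frame_def)
  have qN: "q \<in> ?N \<inter> fst d" using d c by blast
  have inv: "invertible (frame_matrix (\<lambda>j q. e j (f q)) q)"
    using e c by (simp add: regular_frame_def T.pullback_frame_matrix)
  have tq: "t q = (\<Sum>j\<in>UNIV. a j q *s x j)" "r q = (\<Sum>j\<in>UNIV. b j q *s x j)"
    using comb_coords[OF inv, of t] comb_coords[OF inv, of r] by (simp_all add: comb_def a_def b_def x_def)
  have ops: "fst (PDn t d q) - fst (PDt t d q) = (\<Sum>i\<in>UNIV. d_z d (a i) q *s x i + (a i q * J) *s P i)"
    "snd (PDn t d q) - snd (PDt t d q) = (\<Sum>i\<in>UNIV. (a i q * cnj J) *s Q i)"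
    "snd (PDt r d q) = (\<Sum>j\<in>UNIV. d_zbar d (b j) q *s x j + (b j q * cnj J) *s B j)"
    "fst (PDt r d q) = (\<Sum>j\<in>UNIV. (b j q * J) *s \<theta> j)"
    unfolding T.PA_coords[OF e c d(1,3) t d(2) refl] N.PA_coords[OF e c d(1,3) t d(2) refl]
      T.PA_coords[OF e c d(1,3) r d(2) refl]
    by (simp_all add: a_def b_def x_def P_def Q_def B_def \<theta>_def J_def sum_subtractf[symmetric]
        vec_eq_iff algebra_simps)
  have sm: "smooth_fun Y ?N (a i)" "smooth_fun Y ?N (\<lambda>q. cnj (b j q))"
    "smooth_fun Y ?N (\<lambda>q. K (f q) (e i (f q)) (e j (f q)))" for i j
    unfolding a_def b_def
    using T.smooth_pcoords[OF e t] Y.smooth_fun_cnj[OF T.smooth_pcoords[OF e r]]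
      Y.smooth.R_subset[OF smooth_fun_pullback[OF K_smooth[OF eU eU]] N] by auto
  \<comment> \<open>The Gram entries of the frame are pulled back functions: the chain rule gives
    the Jacobian, and the relation on X gives their derivative.\<close>
  have dK: "d_z d (\<lambda>q. K (f q) (e i (f q)) (e j (f q))) q = J * (K (f q) (P i) (x j) + K (f q) (x i) (B j))" for i j
    unfolding J_def P_def x_def B_def metric_relations(1)[OF eU eU c(1,3,2)]
    using d_chain(1)[OF K_smooth[OF eU eU] d(1) c(1) d(3) c(2,3)] by simp
  have "d_z d (\<lambda>q. K (f q) (t q) (r q)) q =
      d_z d (\<lambda>q. \<Sum>i\<in>UNIV. \<Sum>j\<in>UNIV. (a i q * cnj (b j q)) * K (f q) (e i (f q)) (e j (f q))) q"
    unfolding a_def b_def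
  proof (rule Y.d_cong[OF d(1) N qN])
    fix q assume "q \<in> ?N"
    then have "f q \<in> U" by simp
    then show "K (f q) (t q) (r q) =
        (\<Sum>i\<in>UNIV. \<Sum>j\<in>UNIV. (T.pcoords e t i q * cnj (T.pcoords e r j q)) * K (f q) (e i (f q)) (e j (f q)))"
      by (rule metric_expansion[OF e])
  qed
  also have "\<dots> = (\<Sum>i\<in>UNIV. \<Sum>j\<in>UNIV. d_z d (\<lambda>q. (a i q * cnj (b j q)) * K (f q) (e i (f q)) (e j (f q))) q)"
  proof -
    note sm' = Y.smooth.R_mult[OF Y.smooth.R_mult[OF sm(1,2)] sm(3)]
    have "d_z d (\<lambda>q. \<Sum>i\<in>UNIV. \<Sum>j\<in>UNIV. (a i q * cnj (b j q)) * K (f q) (e i (f q)) (e j (f q))) q =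
      (\<Sum>i\<in>UNIV. d_z d (\<lambda>q. \<Sum>j\<in>UNIV. (a i q * cnj (b j q)) * K (f q) (e i (f q)) (e j (f q))) q)"
      by (rule conjunct1[OF Y.d_sum[OF N Y.smooth.R_sum[OF N sm'] d(1) qN]])
    also have "\<dots> = (\<Sum>i\<in>UNIV. \<Sum>j\<in>UNIV. d_z d (\<lambda>q. (a i q * cnj (b j q)) * K (f q) (e i (f q)) (e j (f q))) q)"
      by (rule sum.cong[OF refl conjunct1[OF Y.d_sum[OF N sm' d(1) qN]]])
    finally show ?thesis .
  qed
  also have "\<dots> = (\<Sum>i\<in>UNIV. \<Sum>j\<in>UNIV. (a i q * cnj (b j q)) * (J * (K (f q) (P i) (x j) + K (f q) (x i) (B j))) +
      (a i q * cnj (d_zbar d (b j) q) + d_z d (a i) q * cnj (b j q)) * K (f q) (x i) (x j))"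
  proof -
    have "smooth_fun Y ?N (b j)" for j unfolding b_def by (rule T.smooth_pcoords[OF e r])
    then have "d_z d (\<lambda>q. cnj (b j q)) q = cnj (d_zbar d (b j) q)" for j
      using Y.d_cnj(1)[OF _ d(1) qN] by blast
    then show ?thesis
      unfolding Y.d_mult(1)[OF Y.smooth.R_mult[OF sm(1,2)] sm(3) d(1) qN] Y.d_mult(1)[OF sm(1,2) d(1) qN] dK
      by (simp add: x_def)
  qed
  finally have rhs: "d_z d (\<lambda>q. K (f q) (t q) (r q)) q = (\<Sum>i\<in>UNIV. \<Sum>j\<in>UNIV. (a i q * cnj (b j q)) * (J * (K (f q) (P i) (x j) + K (f q) (x i) (B j))) +
      (a i q * cnj (d_zbar d (b j) q) + d_z d (a i) q * cnj (b j q)) * K (f q) (x i) (x j))" .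
  show "K (f q) (fst (PDn t d q) - fst (PDt t d q)) (r q) + K (f q) (t q) (snd (PDt r d q)) =
      d_z d (\<lambda>q. K (f q) (t q) (r q)) q"
    unfolding rhs ops tq hermitian_form_sum_left[OF h]
    unfolding hermitian_form_sum_right[OF h] hermitian_form_simps(1-4)[OF h]
    by (simp add: sum.distrib[symmetric] sum_distrib_left algebra_simps)
  have "K (f q) (x i) (\<theta> j) = K (f q) (Q i) (x j)" for i j
    unfolding x_def \<theta>_def Q_def by (rule metric_relations(2)[OF eU eU c(1,3,2)])
  then show "K (f q) (t q) (fst (PDt r d q)) = K (f q) (snd (PDn t d q) - snd (PDt t d q)) (r q)"
    unfolding ops tq hermitian_form_sum_left[OF h]
    unfolding hermitian_form_sum_right[OF h] hermitian_form_simps(1-4)[OF h]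
    by (simp add: sum_distrib_left algebra_simps)
qed

text \<open>Flatness is obtained independently of the two conditions that the (1,0) parts map
  holomorphic sections to holomorphic ones; on Y these conditions are then derived from it.\<close>

lemma harmonic_bundle_pullback:
  assumes "T.local_hol_frames" "N.local_hol_frames"
  shows "harmonic_bundle Y (f -` W) (pullback_harmonic X f H)"
proof -
  note flat = T.flat_pullback[OF assms(1) preserves(1)] N.flat_pullback[OF assms(2) preserves(2)]
  note pres = T.pop.flat_preserves_dbar_hol[OF flat(1)] N.pop.flat_preserves_dbar_hol[OF flat(2)]
  show ?thesis
    unfolding harmonic_bundle_def pullback_harmonic_eq harmonic.simps derivation_dbar_eq derivation_d_eq
  proof (intro conjI)
    show "\<exists>P Q. \<forall>V u v. smooth_section Y PVB V u \<longrightarrow> smooth_section Y PVB V v \<longrightarrow>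
          (\<forall>c\<in>Y. \<forall>p\<in>V \<inter> fst c.
              (K \<circ> f) p (P u c p) (v p) + (K \<circ> f) p (u p) (snd (PDt v c p)) = d_z c (\<lambda>q. (K \<circ> f) q (u q) (v q)) p \<and>
              (K \<circ> f) p (u p) (fst (PDt v c p)) = (K \<circ> f) p (Q u c p) (v p) \<and>
              snd (PDn u c p) = snd (PDt u c p) + Q u c p \<and> fst (PDn u c p) = P u c p + fst (PDt u c p))"
      by (rule exI[of _ "\<lambda>u c p. fst (PDn u c p) - fst (PDt u c p)"],
          rule exI[of _ "\<lambda>u c p. snd (PDn u c p) - snd (PDt u c p)"])
        (auto simp: metric_relations_pullback)
    show "\<forall>V s. smooth_section Y PVB V s \<longrightarrow>
        (\<forall>c\<in>Y. \<forall>p\<in>V \<inter> fst c. curvature PDt s c p = 0 \<and> curvature PDn s c p = 0)"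
      using flat unfolding T.pop.flat_def N.pop.flat_def by blast
  qed (rule T.pullback_smooth_bundle hermitian_metric_pullback T.diff_operator_pullback N.diff_operator_pullback
      pres[unfolded T.pop.preserves_dbar_hol_def N.pop.preserves_dbar_hol_def])+
qed

end

subsection \<open>The Higgs field and tameness\<close>

context operator
begin

definition higgs_at :: "'x chart \<Rightarrow> 'x \<Rightarrow> complex^'n^'n" where
  "higgs_at c p = (THE M. \<forall>V s. smooth_section X E V s \<longrightarrow> p \<in> V \<longrightarrow> fst (A s c p) = M *v s p)"

text \<open>For \<alpha> = 0 the Leibniz rule has no derivative term in the (1,0) part, so that part
  is linear over functions and acts on each fibre. Uniqueness of the matrix holds since sections
  attain all values at p.\<close>

lemma higgs_at:
  assumes \<alpha>: "\<alpha> = 0" and c: "c \<in> X" "p \<in> fst c" and s: "smooth_section X E V s" "p \<in> V"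
  shows "fst (A s c p) = higgs_at c p *v s p"
proof -
  let ?P = "\<lambda>M. \<forall>V s. smooth_section X E V s \<longrightarrow> p \<in> V \<longrightarrow> fst (A s c p) = M *v s p"
  have pW: "p \<in> W" using sm.section_dom[OF s(1)] s(2) by blast
  then obtain U e where e: "regular_frame (smooth_fun X) E U e" "p \<in> U" by (rule sm.frame_at)
  have inv: "invertible (frame_matrix e p)" using e by (simp add: regular_frame_def)
  \<comment> \<open>The matrix taking each frame vector to its image under the (1,0) part.\<close>
  define M where "M = frame_matrix (\<lambda>j _. fst (A (e j) c p)) p ** matrix_inv (frame_matrix e p)"
  have "fst (A s c p) = M *v s p" if s: "smooth_section X E V s" "p \<in> V" for V s
  proof -
    let ?N = "U \<inter> V"
    have N: "open ?N" "p \<in> ?N" using e sm.section_open[OF s(1)] s(2) by (auto simp: regular_frame_def)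
    have eN: "regular_frame (smooth_fun X) E ?N e" by (rule sm.frame_subset[OF e(1) N(1)]) blast
    have sN: "smooth_section X E ?N s" by (rule sm.section_subset[OF s(1) N(1)]) blast
    have ej: "smooth_section X E ?N (e j)" for j using eN by (simp add: regular_frame_def)
    have u: "smooth_fun X ?N (coords e s j)" for j by (rule sm.R_coords[OF eN sN])
    have "A s c p = A (comb e (coords e s)) c p"
      by (rule A_cong[OF sN sm.section_comb[OF eN u] _ c(1) N(2) c(2)])
        (use eN in \<open>simp add: comb_coords regular_frame_def\<close>)
    then have "fst (A s c p) = (\<Sum>j\<in>UNIV. coords e s j p *s fst (A (e j) c p))"
      using A_comb(1)[OF N(1) ej u c(1) N(2) c(2)] \<alpha> by simp
    also have "\<dots> = M *v s p"
      by (simp add: M_def matrix_vector_mul_assoc[symmetric] frame_matrix_vec coords_def)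
    finally show ?thesis .
  qed
  then have P: "?P M" by blast
  have "higgs_at c p = M"
    unfolding higgs_at_def
  proof (rule the_equality[of ?P, OF P])
    fix M' assume M': "?P M'"
    have "M' *v v = M *v v" for v
    proof -
      obtain V s where vs: "p \<in> V" "smooth_section X E V s" "s p = v"
        using sm.section_constant_coords[OF pW] by blast
      have "M' *v s p = M *v s p"
        using M'[rule_format, OF vs(2,1)] P[rule_format, OF vs(2,1)] by (rule trans[OF sym])
      then show ?thesis using vs(3) by simp
    qed
    then show "M' = M" by (simp add: matrix_eq)
  qed
  then show ?thesis using P s by blast
qed

end

text \<open>It is enough to test on the pullback of a section of X with the prescribed value v at f
  q, where \<open>PA_pullback_section\<close> applies.\<close>

lemma (in pullback_operator) higgs_at_pullback:
  assumes \<alpha>: "\<alpha> = 0" and d: "d \<in> Y" "q \<in> fst d" and c: "c \<in> X" "f q \<in> fst c" and q: "f q \<in> W"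
  shows "pop.higgs_at d q *v v = chart_jacobian d c f q *s (higgs_at c (f q) *v v)"
proof -
  obtain V s where s: "f q \<in> V" "smooth_section X E V s" "s (f q) = v"
    using sm.section_constant_coords[OF q] by blast
  have "smooth_section Y PE (f -` V) (\<lambda>q. s (f q))"
    by (rule smooth_map.section_pullback[OF smooth_bundle s(2)])
  from pop.higgs_at[OF \<alpha> d this] s(1)
  have "fst (PA (\<lambda>q. s (f q)) d q) = pop.higgs_at d q *v s (f q)" by simp
  then show ?thesis
    using PA_pullback_section(1)[OF s(2) c s(1) d] higgs_at[OF \<alpha> c s(2,1)] s(3) by simp
qed

lemma poly_det: "poly (det (A :: complex poly^'n^'n)) z = det (\<chi> i j. poly (A $ i $ j) z)"
  by (simp add: det_def poly_sum poly_prod)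

lemma poly_charpoly_matrix:
  "poly (charpoly_matrix A) z = det ((\<chi> i j. (if i = j then z else 0) - A $ i $ j) :: complex^'n^'n)"
  unfolding charpoly_matrix_def poly_det by (rule arg_cong[where f = det]) (simp add: vec_eq_iff)

lemma det_scale: "det ((\<chi> i j. r * A $ i $ j) :: complex^'n^'n) = r ^ CARD('n) * det A"
  using det_rows_mul[of "\<lambda>_. r" "\<lambda>i. A $ i"] by (simp add: vector_scalar_mult_def)

text \<open>From det(z - r A) = r^n det(z/r - A), with n the rank: the coefficient in degree n - i
  receives the factor r^n r^(i-n) = r^i.\<close>

lemma coeff_charpoly_matrix_scale:
  fixes A :: "complex^'n^'n"
  assumes "r \<noteq> 0" "i \<le> CARD('n)"
  shows "coeff (charpoly_matrix (\<chi> k l. r * A $ k $ l)) (CARD('n) - i) = r ^ i * coeff (charpoly_matrix A) (CARD('n) - i)"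
proof -
  let ?n = "CARD('n)"
  have "poly (charpoly_matrix (\<chi> k l. r * A $ k $ l)) z = poly (smult (r ^ ?n) (pcompose (charpoly_matrix A) [:0, 1 / r:])) z" for z
  proof -
    have "((\<chi> k l. (if k = l then z else 0) - (\<chi> k l. r * A $ k $ l) $ k $ l) :: complex^'n^'n) =
        (\<chi> k l. r * (\<chi> k l. (if k = l then z / r else 0) - A $ k $ l) $ k $ l)"
      using assms(1) by (simp add: vec_eq_iff right_diff_distrib)
    moreover have p: "poly [:0, 1 / r:] z = z / r" by simp
    ultimately show ?thesis
      unfolding poly_charpoly_matrix poly_smult poly_pcompose p
      using det_scale[of r "(\<chi> k l. (if k = l then z / r else 0) - A $ k $ l) :: complex^'n^'n"] by simp
  qed
  then have "charpoly_matrix (\<chi> k l. r * A $ k $ l) = smult (r ^ ?n) (pcompose (charpoly_matrix A) [:0, 1 / r:])"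
    by (simp add: poly_eq_poly_eq_iff[symmetric] fun_eq_iff)
  then have "coeff (charpoly_matrix (\<chi> k l. r * A $ k $ l)) (?n - i) = r ^ ?n * ((1 / r) ^ (?n - i) * coeff (charpoly_matrix A) (?n - i))"
    by (simp add: coeff_pcompose_linear)
  also have "r ^ ?n = r ^ i * r ^ (?n - i)" using assms(2) by (simp add: power_add[symmetric])
  finally show ?thesis using assms(1) by (simp add: power_one_over field_simps)
qed

lemma log_connectionD:
  assumes "log_connection X D E nabla" "hol_section X E V s"
  shows "log_form X D E V (nabla s)"
    "hol_section X E V t \<Longrightarrow> \<forall>p\<in>V. s p = t p \<Longrightarrow> c \<in> X \<Longrightarrow> p \<in> V \<inter> fst c \<Longrightarrow> nabla s c p = nabla t c p"
    "hol_section X E V t \<Longrightarrow> c \<in> X \<Longrightarrow> p \<in> V \<inter> fst c \<Longrightarrow> nabla (\<lambda>q. s q + t q) c p = nabla s c p + nabla t c p"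
    "holomorphic_fun X V g \<Longrightarrow> c \<in> X \<Longrightarrow> p \<in> V \<inter> fst c \<Longrightarrow>
      nabla (\<lambda>q. g q *s s q) c p = g p *s nabla s c p + (if p \<in> D then 0 else d_z c g p) *s s p"
proof -
  note * = assms(1)[unfolded log_connection_def]
  show "log_form X D E V (nabla s)" using *[THEN conjunct1] assms(2) by blast
  show "nabla s c p = nabla t c p"
    if "hol_section X E V t" "\<forall>p\<in>V. s p = t p" "c \<in> X" "p \<in> V \<inter> fst c"
    by (rule *[THEN conjunct2, THEN conjunct1, rule_format, OF assms(2) that(1) _ that(3,4)]) (use that(2) in blast)
  show "nabla (\<lambda>q. s q + t q) c p = nabla s c p + nabla t c p"
    if "hol_section X E V t" "c \<in> X" "p \<in> V \<inter> fst c"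
    by (rule *[THEN conjunct2, THEN conjunct2, THEN conjunct1, rule_format, OF assms(2) that])
  show "nabla (\<lambda>q. g q *s s q) c p = g p *s nabla s c p + (if p \<in> D then 0 else d_z c g p) *s s p"
    if "holomorphic_fun X V g" "c \<in> X" "p \<in> V \<inter> fst c"
    by (rule *[THEN conjunct2, THEN conjunct2, THEN conjunct2, rule_format, OF that(1) assms(2) that(2,3)])
qed

lemma (in surface) log_connection_comb:
  fixes E :: "('x, 'n::finite) trivialisations"
  assumes E: "vector_bundle (holomorphic_fun X) UNIV E" and nabla: "log_connection X D E nabla"
    and V: "open V" and e: "\<And>j. hol_section X E V (e j)" and u: "\<And>j. holomorphic_fun X V (u j)"
    and c: "c \<in> X" "p \<in> V" "p \<in> fst c"
  shows "nabla (comb e u) c p =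
    (\<Sum>j\<in>UNIV. u j p *s nabla (e j) c p + (if p \<in> D then 0 else d_z c (u j) p) *s e j p)"
proof -
  interpret hb: sheaf_bundle "holomorphic_fun X" UNIV E by unfold_locales (rule E)
  have add: "nabla (\<lambda>q. s q + t q) c p = nabla s c p + nabla t c p"
    if "hol_section X E V s" "hol_section X E V t" for s t
    by (rule log_connectionD(3)[OF nabla that c(1)]) (use c in simp)
  have scale: "nabla (\<lambda>q. g q *s s q) c p = g p *s nabla s c p + (if p \<in> D then 0 else d_z c g p) *s s p"
    if "holomorphic_fun X V g" "hol_section X E V s" for g s
    by (rule log_connectionD(4)[OF nabla that(2,1) c(1)]) (use c in simp)
  have "nabla (\<lambda>q. \<Sum>i\<in>I. s i q) c p = (\<Sum>i\<in>I. nabla (s i) c p)"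
    if "finite I" "\<And>i. hol_section X E V (s i)" for I and s :: "'n \<Rightarrow> ('x, 'n) sect"
    using that(1)
  proof induction
    case empty
    show ?case using scale[OF hol.R_const[OF V] hb.section_zero[OF V subset_UNIV], of 0] by simp
  next
    case (insert i I)
    have "hol_section X E V (\<lambda>q. \<Sum>i\<in>I. s i q)" by (rule hb.section_sum[OF V subset_UNIV that(2)])
    then show ?case using add[OF that(2)[of i]] insert by simp
  qed
  from this[of UNIV "\<lambda>j q. u j q *s e j q"] show ?thesis
    using hb.section_scale[OF u e] scale[OF u e] by (simp add: comb_def[abs_def])
qed

locale branched_harmonic = branched_map Y X f + pullback_harmonic_bundle Y X f "- D" H
  for Y :: "('y::t2_space) chart set" and X :: "('x::t2_space) chart set" and f :: "'y \<Rightarrow> 'x"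
    and D :: "'x set" and H :: "('x, 'n::finite) harmonic"
begin

lemma higgs_matrix_eq: "higgs_matrix X H = T.higgs_at"
  "higgs_matrix Y (pullback_harmonic X f H) = T.pop.higgs_at"
  unfolding pullback_harmonic_eq by (simp_all add: fun_eq_iff higgs_matrix_def T.higgs_at_def T.pop.higgs_at_def)

lemma higgs_matrix_pullback:
  assumes "d \<in> Y" "q \<in> fst d" "c \<in> X" "f q \<in> fst c" "f q \<notin> D"
  shows "higgs_matrix Y (pullback_harmonic X f H) d q =
    (\<chi> i j. chart_jacobian d c f q * higgs_matrix X H c (f q) $ i $ j)"
  unfolding matrix_eq
proof
  fix v
  have "higgs_matrix Y (pullback_harmonic X f H) d q *v v = chart_jacobian d c f q *s (higgs_matrix X H c (f q) *v v)"
    unfolding higgs_matrix_eq by (rule T.higgs_at_pullback) (use assms in auto)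
  also have "\<dots> = (\<chi> i j. chart_jacobian d c f q * higgs_matrix X H c (f q) $ i $ j) *v v"
    by (simp add: vec_eq_iff matrix_vector_mult_def sum_distrib_left mult.assoc)
  finally show "higgs_matrix Y (pullback_harmonic X f H) d q *v v =
    (\<chi> i j. chart_jacobian d c f q * higgs_matrix X H c (f q) $ i $ j) *v v" .
qed

text \<open>The Higgs field upstairs is the Jacobian J times the one downstairs, and w J = \<kappa>
  z with w, z the centred coordinates on Y and X. So the i-th coefficient times w^i is \<kappa>^i
  times the pullback of a function that is holomorphic by tameness on X.\<close>

lemma tame_pullback:
  assumes tame: "tame_harmonic_bundle X D H" and frames: "T.local_hol_frames" "N.local_hol_frames"
  shows "tame_harmonic_bundle Y (f -` D) (pullback_harmonic X f H)"
  unfolding tame_harmonic_bundle_def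
proof (intro conjI ballI impI)
  show "harmonic_bundle Y (- (f -` D)) (pullback_harmonic X f H)"
    using harmonic_bundle_pullback[OF frames] by (simp add: vimage_Compl)
  fix y d i assume y: "y \<in> f -` D" and d: "d \<in> Y" "y \<in> fst d" and i: "i \<in> {1..CARD('n)}"
  obtain c where c: "c \<in> X" "f y \<in> fst c" by (rule X.chart_at)
  have "\<exists>N g. f y \<in> N \<and> N \<subseteq> fst c \<and> N \<inter> D = {f y} \<and> holomorphic_fun X N g \<and>
      (\<forall>p\<in>N - {f y}. g p = (snd c p - snd c (f y)) ^ i * coeff (charpoly_matrix (higgs_matrix X H c p)) (CARD('n) - i))"
    using tame y c i unfolding tame_harmonic_bundle_def by simp
  then obtain N g where N: "f y \<in> N" "N \<inter> D = {f y}" "holomorphic_fun X N g"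
    and g: "\<forall>p\<in>N - {f y}. g p = (snd c p - snd c (f y)) ^ i * coeff (charpoly_matrix (higgs_matrix X H c p)) (CARD('n) - i)"
    by (elim exE conjE) (rule that)
  obtain M \<kappa> where M: "open M" "y \<in> M" "M \<subseteq> fst d \<inter> f -` fst c" "holomorphic_fun Y M \<kappa>"
    "\<kappa> y = of_nat (ramification y)" "\<forall>q\<in>M. \<kappa> q \<noteq> 0" "\<forall>q\<in>M - {y}. f q \<noteq> f y"
    "\<forall>q\<in>M. (snd d q - snd d y) * chart_jacobian d c f q = \<kappa> q * (snd c (f q) - snd c (f y))"
    by (rule log_derivative[OF d c])
  let ?M = "M \<inter> f -` N"
  have oM: "open ?M" using M(1) vimage_open[OF X.hol.R_open[OF N(3)]] by blast
  show "\<exists>N g. y \<in> N \<and> N \<subseteq> fst d \<and> N \<inter> f -` D = {y} \<and> holomorphic_fun Y N g \<and>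
      (\<forall>p\<in>N - {y}. g p = (snd d p - snd d y) ^ i *
        coeff (charpoly_matrix (higgs_matrix Y (pullback_harmonic X f H) d p)) (CARD('n) - i))"
  proof (intro exI[of _ ?M] exI[of _ "\<lambda>q. \<kappa> q ^ i * g (f q)"] conjI ballI)
    show "y \<in> ?M" "?M \<subseteq> fst d" using M N by auto
    show "?M \<inter> f -` D = {y}" using M(2,7) N(1,2) y by blast
    show "holomorphic_fun Y ?M (\<lambda>q. \<kappa> q ^ i * g (f q))"
      by (intro Y.hol.R_mult Y.hol.R_power Y.hol.R_subset[OF M(4) oM]
          Y.hol.R_subset[OF holomorphic_fun_pullback[OF N(3)] oM]) auto
    fix q assume q: "q \<in> ?M - {y}"
    let ?J = "chart_jacobian d c f q" and ?C = "\<lambda>A :: complex^'n^'n. coeff (charpoly_matrix A) (CARD('n) - i)"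
    have fq: "f q \<in> N - {f y}" "f q \<notin> D" "f q \<in> fst c" "q \<in> fst d" using q M(3,7) N(2) by auto
    have ne: "snd c (f q) - snd c (f y) \<noteq> 0" using X.chart_inj[OF c(1) fq(3) c(2)] fq(1) by simp
    have rel: "(snd d q - snd d y) * ?J = \<kappa> q * (snd c (f q) - snd c (f y))" using M(8) q by blast
    have "\<kappa> q \<noteq> 0" using M(6) q by blast
    then have "?J \<noteq> 0" using rel ne by auto
    have "\<kappa> q ^ i * g (f q) = (\<kappa> q * (snd c (f q) - snd c (f y))) ^ i * ?C (higgs_matrix X H c (f q))"
      using g fq(1) by (simp add: power_mult_distrib)
    also have "\<dots> = (snd d q - snd d y) ^ i * (?J ^ i * ?C (higgs_matrix X H c (f q)))"
      unfolding rel[symmetric] by (simp add: power_mult_distrib)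
    also have "?J ^ i * ?C (higgs_matrix X H c (f q)) = ?C (\<chi> k l. ?J * higgs_matrix X H c (f q) $ k $ l)"
      using coeff_charpoly_matrix_scale[OF \<open>?J \<noteq> 0\<close>, of i "higgs_matrix X H c (f q)"] i by simp
    also have "(\<chi> k l. ?J * higgs_matrix X H c (f q) $ k $ l) = higgs_matrix Y (pullback_harmonic X f H) d q"
      by (rule higgs_matrix_pullback[OF d(1) fq(4) c(1) fq(3,2), symmetric])
    finally show "\<kappa> q ^ i * g (f q) = (snd d q - snd d y) ^ i * ?C (higgs_matrix Y (pullback_harmonic X f H) d q)" .
  qed
qed

end

section \<open>Induced parabolic structures\<close>

text \<open>Off D a holomorphic frame of T is at the same time a smooth frame of E killed by the
  (0,1) part. In either bundle a section is holomorphic exactly when its coordinates in such a frame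
  are, and pulling the frame back keeps this true on Y.\<close>

lemma (in pullback_operator) dbar_hol_triv:
  assumes T: "vector_bundle (holomorphic_fun X) UNIV T" and W: "W = - D" "open W"
    and rel: "\<And>V s. V \<inter> D = {} \<Longrightarrow> hol_section X T V s = dbar_hol X E A V s"
  shows "local_hol_frames"
    and "V \<inter> f -` D = {} \<Longrightarrow> hol_section Y (pullback_bundle f T) V t = dbar_hol Y PE PA V t"
proof -
  interpret tb: sheaf_bundle "holomorphic_fun X" UNIV T by unfold_locales (rule T)
  have fr: "\<exists>U e. p \<in> U \<and> U \<inter> D = {} \<and> regular_frame (holomorphic_fun X) T U e \<and>
      regular_frame (smooth_fun X) E U e \<and> (\<forall>j. dbar_hol X E A U (e j))" if p: "p \<in> W" for p
  proof -
    obtain U e where e: "regular_frame (holomorphic_fun X) T U e" "p \<in> U" by (rule tb.frame_at[OF UNIV_I])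
    let ?U = "U \<inter> W"
    have U: "open ?U" "?U \<inter> D = {}" using e W by (auto simp: regular_frame_def)
    have eU: "regular_frame (holomorphic_fun X) T ?U e" by (rule tb.frame_subset[OF e(1) U(1)]) blast
    then have d: "dbar_hol X E A ?U (e j)" for j using rel[OF U(2)] by (simp add: regular_frame_def)
    then have "regular_frame (smooth_fun X) E ?U e"
      using eU dbar_hol_smooth[OF d] by (simp add: regular_frame_def)
    then show ?thesis using p e(2) U(2) eU d by (intro exI[of _ ?U] exI[of _ e]) auto
  qed
  show local_hol_frames
    unfolding local_hol_frames_def
  proof
    fix p assume "p \<in> W"
    from fr[OF this] show "\<exists>U e. p \<in> U \<and> regular_frame (smooth_fun X) E U e \<and> (\<forall>j. dbar_hol X E A U (e j))" by blast
  qed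
  interpret ptb: sheaf_bundle "holomorphic_fun Y" UNIV "pullback_bundle f T"
    using hol_map.vector_bundle_pullback[OF T] by unfold_locales simp
  assume V: "V \<inter> f -` D = {}"
  have near: "\<exists>N. open N \<and> q \<in> N \<and> (\<forall>M t. open M \<longrightarrow> M \<subseteq> N \<longrightarrow>
      hol_section Y (pullback_bundle f T) M t = dbar_hol Y PE PA M t)" if q: "q \<in> V" for q
  proof -
    have "f q \<in> W" using q V W by blast
    from fr[OF this] obtain U e where U: "f q \<in> U" and e: "regular_frame (holomorphic_fun X) T U e"
      "regular_frame (smooth_fun X) E U e" "\<And>j. dbar_hol X E A U (e j)" by blast
    have oU: "open (f -` U)" using e(1) vimage_open by (simp add: regular_frame_def)
    have "hol_section Y (pullback_bundle f T) M t = dbar_hol Y PE PA M t" if M: "open M" "M \<subseteq> f -` U" for M t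
      using ptb.section_iff_coords[OF ptb.frame_subset[OF hol_map.frame_pullback[OF T e(1)] M]]
        pop.dbar_hol_coords[OF smooth_map.frame_pullback[OF smooth_bundle e(2)] dbar_hol_pullback[OF e(3)] M]
      by simp
    then show ?thesis using oU U by (intro exI[of _ "f -` U"]) auto
  qed
  show "hol_section Y (pullback_bundle f T) V t = dbar_hol Y PE PA V t"
  proof
    assume t: "hol_section Y (pullback_bundle f T) V t"
    show "dbar_hol Y PE PA V t"
    proof (rule pop.dbar_hol_local)
      fix q assume q: "q \<in> V"
      from near[OF q] obtain N where N: "open N" "q \<in> N" "\<And>M t. open M \<Longrightarrow> M \<subseteq> N \<Longrightarrow>
        hol_section Y (pullback_bundle f T) M t = dbar_hol Y PE PA M t" by blast
      have o: "open (N \<inter> V)" using N(1) ptb.section_open[OF t] by blast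
      have "dbar_hol Y PE PA (N \<inter> V) t"
        using N(3)[OF o Int_lower1] ptb.section_subset[OF t o Int_lower2] by simp
      then show "\<exists>N. q \<in> N \<and> N \<subseteq> V \<and> dbar_hol Y PE PA N t" using N(2) q by blast
    qed
  next
    assume t: "dbar_hol Y PE PA V t"
    show "hol_section Y (pullback_bundle f T) V t"
    proof (rule ptb.section_local)
      fix q assume q: "q \<in> V"
      from near[OF q] obtain N where N: "open N" "q \<in> N" "\<And>M t. open M \<Longrightarrow> M \<subseteq> N \<Longrightarrow>
        hol_section Y (pullback_bundle f T) M t = dbar_hol Y PE PA M t" by blast
      have o: "open (N \<inter> V)" using N(1) psm.section_open[OF pop.dbar_hol_smooth[OF t]] by blast
      have "hol_section Y (pullback_bundle f T) (N \<inter> V) t"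
        using N(3)[OF o Int_lower1] pop.dbar_hol_subset[OF t o Int_lower2] by simp
      then show "\<exists>N. q \<in> N \<and> N \<subseteq> V \<and> hol_section Y (pullback_bundle f T) N t" using N(2) q by blast
    qed
  qed
qed

text \<open>Rids the filtration of the operator: what remains is a holomorphic bundle with a metric,
  and the Higgs and the connection side need no separate growth argument.\<close>

lemma growth_stalk_eq:
  assumes "\<And>V s. V \<inter> D = {} \<Longrightarrow> hol_section X (triv E) V s = dbar_hol X (vbundle H) A V s"
  shows "growth_stalk X D H A x = growth_sections X D (triv E) (metric H) x"
proof -
  have "(open N \<and> N \<inter> D = {x} \<and> dbar_hol X (vbundle H) A (N - {x}) s) \<longleftrightarrow>
      (open N \<and> N \<inter> D = {x} \<and> hol_section X (triv E) (N - {x}) s)" for N s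
    using assms[of "N - {x}" s] by (cases "N \<inter> D = {x}") auto
  then show ?thesis by (simp add: fun_eq_iff growth_stalk_def growth_sections_def)
qed

lemma induced_parabolic_iff:
  "induced_parabolic X D H A E \<longleftrightarrow> parabolic_bundle X D E \<and>
     (\<forall>V s. V \<inter> D = {} \<longrightarrow> hol_section X (triv E) V s = dbar_hol X (vbundle H) A V s) \<and>
     (\<forall>x\<in>D. induced_at X D E x (growth_stalk X D H A x))"
  unfolding induced_parabolic_def induced_at_def by (rule refl)

lemma finite_isolated:
  assumes "finite D" "x \<in> D"
  shows "\<exists>N :: 'x::t2_space set. open N \<and> N \<inter> D = {x}"
proof (intro exI conjI)
  show "open (- (D - {x}))"
    by (rule open_Compl, rule finite_imp_closed, rule finite_Diff[OF assms(1)])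
  show "- (D - {x}) \<inter> D = {x}" using assms(2) by blast
qed

lemma (in branched_map) isolated_preimage:
  assumes "finite D" "y \<in> f -` D"
  shows "\<exists>N. open N \<and> N \<inter> f -` D = {y}"
proof -
  obtain M where M: "open M" "M \<inter> D = {f y}" using finite_isolated[OF assms(1), of "f y"] assms(2) by auto
  obtain d where d: "d \<in> Y" "y \<in> fst d" by (rule Y.chart_at)
  obtain c where c: "c \<in> X" "f y \<in> fst c" by (rule X.chart_at)
  obtain N \<kappa> where N: "open N" "y \<in> N" "N \<subseteq> fst d \<inter> f -` fst c" "holomorphic_fun Y N \<kappa>"
    "\<kappa> y = of_nat (ramification y)" "\<forall>q\<in>N. \<kappa> q \<noteq> 0" "\<forall>q\<in>N - {y}. f q \<noteq> f y"
    "\<forall>q\<in>N. (snd d q - snd d y) * chart_jacobian d c f q = \<kappa> q * (snd c (f q) - snd c (f y))"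
    by (rule log_derivative[OF d c])
  show ?thesis
  proof (intro exI conjI)
    show "open (N \<inter> f -` M)" using N(1) vimage_open[OF M(1)] by blast
    show "N \<inter> f -` M \<inter> f -` D = {y}" using N(2,7) M(2) assms(2) by blast
  qed
qed

text \<open>Uses about F only the local frames that \<open>is_pullback_parabolic\<close> provides,
  so it holds for every representative of the pullback: induced structure on X, growth criterion on
  X, growth criterion on Y, induced structure on Y.\<close>

lemma (in branched_map) induced_parabolic_pullback:
  fixes H :: "('x, 'n::finite) harmonic"
  assumes D: "finite D" and po: "pullback_operator Y X f \<alpha> (- D) (vbundle H) A"
    and herm: "\<And>p. p \<notin> D \<Longrightarrow> hermitian_form (metric H p)"
    and ind: "induced_parabolic X D H A E" and pb: "is_pullback_parabolic Y X D f E F"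
  shows "induced_parabolic Y (f -` D) (pullback_harmonic X f H)
    (pullback_op (scaled_derivation \<alpha>) X f (vbundle H) A) F"
proof -
  interpret po: pullback_operator Y X f \<alpha> "- D" "vbundle H" A by (rule po)
  let ?PH = "pullback_harmonic X f H" and ?PA = "pullback_op (scaled_derivation \<alpha>) X f (vbundle H) A"
  have parE: "parabolic_bundle X D E"
    and rel: "\<And>V s. V \<inter> D = {} \<Longrightarrow> hol_section X (triv E) V s = dbar_hol X (vbundle H) A V s"
    and indE: "\<And>x. x \<in> D \<Longrightarrow> induced_at X D E x (growth_stalk X D H A x)"
    using ind unfolding induced_parabolic_iff by simp_all
  have parF: "parabolic_bundle Y (f -` D) F"
    and relF: "\<And>V s. V \<inter> f -` D = {} \<Longrightarrow> hol_section Y (triv F) V s = hol_section Y (pullback_bundle f (triv E)) V s"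
    using pb unfolding is_pullback_parabolic_def by simp_all
  have local_form: "\<forall>y \<in> f -` D. \<exists>U e a V b. \<exists>d\<in>Y.
        parabolic_splitting X D E (f y) U e a \<and> y \<in> V \<and> V \<subseteq> f -` U \<inter> fst d \<and>
        parabolic_splitting Y (f -` D) F y V b (\<lambda>j. frac (real (ramification y) * a j)) \<and>
        (\<forall>j. \<forall>q \<in> V - {y}.
           b j q = (snd d q - snd d y) powi (- \<lfloor>real (ramification y) * a j\<rfloor>) *s e j (f q))"
    using pb unfolding is_pullback_parabolic_def by (elim conjE)
  have T: "vector_bundle (holomorphic_fun X) UNIV (triv E)" using parE by (simp add: parabolic_bundle_def)
  have oD: "open (- D)" using D by (simp add: finite_imp_closed open_Compl)
  have relY: "hol_section Y (triv F) V s = dbar_hol Y (vbundle ?PH) ?PA V s" if "V \<inter> f -` D = {}" for V s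
    using po.dbar_hol_triv(2)[OF T refl oD rel that] relF[OF that] by (simp add: pullback_harmonic_def)
  have "induced_at Y (f -` D) F y (growth_stalk Y (f -` D) ?PH ?PA y)" if y: "y \<in> f -` D" for y
  proof -
    obtain U e a V b d where d: "d \<in> Y" and sX: "parabolic_splitting X D E (f y) U e a"
      and V: "y \<in> V" "V \<subseteq> f -` U \<inter> fst d"
      and sY: "parabolic_splitting Y (f -` D) F y V b (\<lambda>j. frac (real (ramification y) * a j))"
      and b: "\<forall>j. \<forall>q \<in> V - {y}.
           b j q = (snd d q - snd d y) powi (- \<lfloor>real (ramification y) * a j\<rfloor>) *s e j (f q)"
      using local_form[rule_format, OF y] by (elim exE bexE conjE) (rule that)
    have fy: "f y \<in> D" using y by simp
    have SX: "split_at X D E (metric H) (f y) U e a"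
      using parE herm fy finite_isolated[OF D fy] sX by unfold_locales
    have SY: "split_at Y (f -` D) F (metric H \<circ> f) y V b (\<lambda>j. frac (real (ramification y) * a j))"
      using parF herm y isolated_preimage[OF D y] sY by unfold_locales auto
    have "induced_at X D E (f y) (growth_sections X D (triv E) (metric H) (f y))"
      using indE[OF fy] growth_stalk_eq[of D X E H A, OF rel] by simp
    from split_at.induced_frame_growth[OF SX this]
    have "frame_growth X (f y) (growth_sections X D (triv E) (metric H) (f y)) U e a" .
    from pullback_frame_growth[OF SX SY d V(2) b this]
    have "frame_growth Y y (growth_sections Y (f -` D) (triv F) (metric H \<circ> f) y) V b (\<lambda>j. frac (real (ramification y) * a j))" .
    from split_at.frame_growth_induced[OF SY this]
    have "induced_at Y (f -` D) F y (growth_sections Y (f -` D) (triv F) (metric H \<circ> f) y)" .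
    moreover have "growth_stalk Y (f -` D) ?PH ?PA y = growth_sections Y (f -` D) (triv F) (metric ?PH) y"
      by (rule growth_stalk_eq[OF relY])
    ultimately show ?thesis by (simp add: pullback_harmonic_def)
  qed
  then show ?thesis unfolding induced_parabolic_iff using parF relY by blast
qed

context branched_harmonic
begin

lemma induced_higgs_pullback:
  assumes "finite D" "induced_higgs X D H E \<theta>" "is_pullback_higgs Y X D f E \<theta> F \<phi>"
  shows "induced_higgs Y (f -` D) (pullback_harmonic X f H) F \<phi>"
  unfolding induced_higgs_def
proof (intro conjI ballI)
  show "parabolic_higgs_bundle Y (f -` D) F \<phi>" using assms(3) by (simp add: is_pullback_higgs_def)
  have par: "induced_parabolic X D H Dt E" "is_pullback_parabolic Y X D f E F"
    using assms(2,3) unfolding induced_higgs_def is_pullback_higgs_def by blast+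
  have "induced_parabolic Y (f -` D) (pullback_harmonic X f H) PDt F"
    by (rule induced_parabolic_pullback[OF assms(1) T.pullback_operator_axioms _ par]) (simp add: K_form)
  then show "induced_parabolic Y (f -` D) (pullback_harmonic X f H) (D_theta (pullback_harmonic X f H)) F"
    by (simp add: pullback_harmonic_eq)
  fix d q assume d: "d \<in> Y" "q \<in> fst d - f -` D"
  obtain c where c: "c \<in> X" "f q \<in> fst c" by (rule X.chart_at)
  have "\<phi> d q *v v = chart_jacobian d c f q *s (\<theta> c (f q) *v v)" for v
    using assms(3) d c unfolding is_pullback_higgs_def by simp
  moreover have "\<theta> c (f q) = higgs_matrix X H c (f q)"
    using assms(2) c d unfolding induced_higgs_def by simp
  moreover have "higgs_matrix Y (pullback_harmonic X f H) d q *v v = chart_jacobian d c f q *s (higgs_matrix X H c (f q) *v v)" for v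
    unfolding higgs_matrix_eq by (rule T.higgs_at_pullback) (use c d in auto)
  ultimately show "\<phi> d q = higgs_matrix Y (pullback_harmonic X f H) d q"
    by (simp add: matrix_eq)
qed

text \<open>\<open>is_pullback_connection\<close> prescribes the pulled back connection on pulled
  back sections only. Off B these contain frames, and the Leibniz rule, which both sides satisfy,
  determines the rest.\<close>

lemma induced_connection_pullback:
  assumes "finite D" "induced_connection X D H E nabla" "is_pullback_connection Y X D f E nabla F nabla'"
  shows "induced_connection Y (f -` D) (pullback_harmonic X f H) F nabla'"
  unfolding induced_connection_def
proof (intro conjI allI impI ballI)
  show "parabolic_connection Y (f -` D) F nabla'" using assms(3) by (simp add: is_pullback_connection_def)
  have par: "induced_parabolic X D H Dn E" "is_pullback_parabolic Y X D f E F"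
    using assms(2,3) unfolding induced_connection_def is_pullback_connection_def by blast+
  have "induced_parabolic Y (f -` D) (pullback_harmonic X f H) PDn F"
    by (rule induced_parabolic_pullback[OF assms(1) N.pullback_operator_axioms _ par]) (simp add: K_form)
  then show "induced_parabolic Y (f -` D) (pullback_harmonic X f H) (D_nabla (pullback_harmonic X f H)) F"
    by (simp add: pullback_harmonic_eq)
  fix V s d q assume V: "V \<inter> f -` D = {}" and s: "hol_section Y (triv F) V s"
    and d: "d \<in> Y" and q: "q \<in> V \<inter> fst d"
  have E: "vector_bundle (holomorphic_fun X) UNIV (triv E)" and F: "vector_bundle (holomorphic_fun Y) UNIV (triv F)"
    using par by (simp_all add: induced_parabolic_def is_pullback_parabolic_def parabolic_bundle_def)
  interpret tE: sheaf_bundle "holomorphic_fun X" UNIV "triv E" by unfold_locales (rule E)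
  interpret tF: sheaf_bundle "holomorphic_fun Y" UNIV "triv F" by unfold_locales (rule F)
  interpret ptb: sheaf_bundle "holomorphic_fun Y" UNIV "pullback_bundle f (triv E)"
    using hol_map.vector_bundle_pullback[OF E] by unfold_locales simp
  have rel: "\<And>V s. V \<inter> D = {} \<Longrightarrow> hol_section X (triv E) V s = dbar_hol X VB Dn V s"
    using par(1) by (simp add: induced_parabolic_def)
  have relF: "\<And>V s. V \<inter> f -` D = {} \<Longrightarrow> hol_section Y (triv F) V s = hol_section Y (pullback_bundle f (triv E)) V s"
    using par(2) by (simp add: is_pullback_parabolic_def)
  have oD: "open (- D)" by (rule open_Compl, rule finite_imp_closed, rule assms(1))
  obtain c where c: "c \<in> X" "f q \<in> fst c" by (rule X.chart_at)
  obtain U0 e where e0: "regular_frame (holomorphic_fun X) (triv E) U0 e" "f q \<in> U0"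
    by (rule tE.frame_at[OF UNIV_I])
  define U where "U = U0 - D"
  have U: "open U" "U \<inter> D = {}" "f q \<in> U"
    using e0 oD q V by (auto simp: U_def Diff_eq regular_frame_def)
  have e: "regular_frame (holomorphic_fun X) (triv E) U e"
    by (rule tE.frame_subset[OF e0(1) U(1)]) (auto simp: U_def)
  have eS: "regular_frame (smooth_fun X) VB U e"
    using e rel[OF U(2)] N.dbar_hol_smooth by (simp add: regular_frame_def)
  let ?M = "V \<inter> f -` U" and ?u = "T.pcoords e s"
  have sP: "hol_section Y (pullback_bundle f (triv E)) V s" using relF[OF V] s by simp
  have M: "open ?M" "?M \<subseteq> f -` U" "?M \<subseteq> V" "q \<in> ?M" "?M \<inter> f -` D = {}"
    using tF.section_open[OF s] vimage_open[OF U(1)] q U V by auto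
  have eM: "regular_frame (holomorphic_fun Y) (pullback_bundle f (triv E)) ?M (\<lambda>j q. e j (f q))"
    by (rule ptb.frame_subset[OF hol_map.frame_pullback[OF E e] M(1,2)])
  have u: "holomorphic_fun Y ?M (?u j)" for j
    by (rule ptb.R_coords[OF eM ptb.section_subset[OF sP M(1,3)]])
  have ej: "hol_section Y (triv F) ?M (\<lambda>q. e j (f q))" for j
    using eM relF[OF M(5)] by (simp add: regular_frame_def)
  have sM: "hol_section Y (triv F) ?M s" by (rule tF.section_subset[OF s M(1,3)])
  have comb: "comb (\<lambda>j q. e j (f q)) ?u p = s p" if "p \<in> ?M" for p
    by (rule comb_coords) (use eM that in \<open>simp add: regular_frame_def\<close>)
  have cM: "hol_section Y (triv F) ?M (comb (\<lambda>j q. e j (f q)) ?u)"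
    by (rule tF.section_cong[OF sM]) (simp add: comb)
  have log: "log_connection Y (f -` D) (triv F) nabla'"
    using assms(3) by (simp add: is_pullback_connection_def parabolic_connection_def)
  have "nabla' s d q = nabla' (comb (\<lambda>j q. e j (f q)) ?u) d q"
    by (rule log_connectionD(2)[OF log sM cM _ d]) (use comb q M(4) in auto)
  also have "\<dots> = (\<Sum>j\<in>UNIV. ?u j q *s nabla' (\<lambda>q. e j (f q)) d q + (if q \<in> f -` D then 0 else d_z d (?u j) q) *s e j (f q))"
    by (rule Y.log_connection_comb[OF F log M(1) ej u d M(4)]) (use q in simp)
  also have "\<dots> = (\<Sum>j\<in>UNIV. (1 * d_z d (?u j) q) *s e j (f q) + (?u j q * chart_jacobian d c f q) *s fst (Dn (e j) c (f q)))"
  proof (rule sum.cong[OF refl])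
    fix j
    have ejX: "hol_section X (triv E) U (e j)" using e by (simp add: regular_frame_def)
    have "nabla' (\<lambda>q. e j (f q)) d q = chart_jacobian d c f q *s nabla (e j) c (f q)"
      using assms(3) U ejX d c q unfolding is_pullback_connection_def by simp
    also have "nabla (e j) c (f q) = fst (Dn (e j) c (f q))"
      using assms(2) U ejX c unfolding induced_connection_def by simp
    finally show "?u j q *s nabla' (\<lambda>q. e j (f q)) d q + (if q \<in> f -` D then 0 else d_z d (?u j) q) *s e j (f q) =
      (1 * d_z d (?u j) q) *s e j (f q) + (?u j q * chart_jacobian d c f q) *s fst (Dn (e j) c (f q))"
      using q V by (auto simp: vector_smult_assoc add.commute)
  qed
  also have "\<dots> = fst (PDn s d q)"
  proof (rule N.PA_coords(1)[OF eS c U(3) d _ _ _ refl, symmetric])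
    show "smooth_section Y PVB V s"
      using N.dbar_hol_triv(2)[OF E refl oD rel V, of s] sP N.pop.dbar_hol_smooth by simp
  qed (use q in auto)
  finally show "nabla' s d q = fst (D_nabla (pullback_harmonic X f H) s d q)" by (simp add: pullback_harmonic_eq)
qed

end

section \<open>Existence of pullbacks\<close>

lemma frame_matrix_column: "frame_matrix e p *v axis j 1 = e j p"
  by (simp add: vec_eq_iff frame_matrix_def)

section \<open>Adapted bases and local splittings\<close>

lemma flag_chain:
  fixes L :: "(real \<times> 'a set) list"
  assumes "sorted_wrt (\<lambda>(\<alpha>, F) (\<beta>, G). \<alpha> < \<beta> \<and> G \<subset> F) L" "(\<alpha>, F) \<in> set L" "(\<beta>, G) \<in> set L"
  shows "\<alpha> \<le> \<beta> \<Longrightarrow> G \<subseteq> F" "\<alpha> < \<beta> \<Longrightarrow> G \<subset> F"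
proof -
  obtain i k where i: "i < length L" "L ! i = (\<alpha>, F)" and k: "k < length L" "L ! k = (\<beta>, G)"
    using assms(2,3) by (auto simp: in_set_conv_nth)
  have "i < k \<Longrightarrow> \<alpha> < \<beta> \<and> G \<subset> F" using sorted_wrt_nth_less[OF assms(1), of i k] i k by simp
  moreover have "k < i \<Longrightarrow> \<beta> < \<alpha> \<and> F \<subset> G" using sorted_wrt_nth_less[OF assms(1), of k i] i k by simp
  moreover have "i = k \<Longrightarrow> \<alpha> = \<beta> \<and> F = G" using i k by simp
  ultimately show "\<alpha> \<le> \<beta> \<Longrightarrow> G \<subseteq> F" "\<alpha> < \<beta> \<Longrightarrow> G \<subset> F" by (cases i k rule: linorder_cases; auto)+
qed

text \<open>The list is decreasing, so the induction on it starts with the smallest subspace and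
  extends a basis of it step by step to the larger ones.\<close>

lemma adapted_basis:
  fixes Fs :: "(complex^'n) set list"
  assumes "sorted_wrt (\<lambda>F G. G \<subseteq> F) Fs"
  shows "\<exists>B. vec.independent B \<and> B \<subseteq> \<Union>(set Fs) \<and> (\<forall>F\<in>set Fs. F \<subseteq> vec.span (B \<inter> F))"
  using assms
proof (induction Fs)
  case Nil
  show ?case using vec.independent_empty by auto
next
  case (Cons F Fs)
  then obtain B where B: "vec.independent B" "B \<subseteq> \<Union>(set Fs)" "\<forall>G\<in>set Fs. G \<subseteq> vec.span (B \<inter> G)" by auto
  have "B \<subseteq> F" using B(2) Cons.prems by auto
  from vec.maximal_independent_subset_extend[OF this B(1)]
  obtain B' where B': "B \<subseteq> B'" "B' \<subseteq> F" "vec.independent B'" "F \<subseteq> vec.span B'" by blast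
  have "G \<subseteq> vec.span (B' \<inter> G)" if "G \<in> set Fs" for G
    using B(3) that vec.span_mono[of "B \<inter> G" "B' \<inter> G"] B'(1) by blast
  moreover have "B' \<inter> F = B'" using B'(2) by blast
  ultimately show ?case using B' by (intro exI[of _ B']) auto
qed

text \<open>Each vector of an adapted basis gets the largest weight whose subspace contains it. That
  every weight of the flag is attained is where strictness of the inclusions enters.\<close>

lemma flag_adapted_basis:
  fixes L :: "(real \<times> (complex^'n::finite) set) list"
  assumes L: "L \<noteq> []" "snd (hd L) = UNIV"
    and sorted: "sorted_wrt (\<lambda>(\<alpha>, F) (\<beta>, G). \<alpha> < \<beta> \<and> G \<subset> F) L"
    and subs: "\<forall>F\<in>snd ` set L. vec.subspace F \<and> F \<noteq> {0}"
  shows "\<exists>(e :: 'n \<Rightarrow> complex^'n) a. vec.span (range e) = UNIV \<and> fst ` set L = range a \<and>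
    (\<forall>l. weight_ge L l = vec.span {e j | j. a j \<ge> l})"
proof -
  have sub: "vec.subspace F \<and> F \<noteq> {0}" if "(\<alpha>, F) \<in> set L" for \<alpha> F
    using subs that by (metis image_eqI snd_conv)
  have "sorted_wrt (\<lambda>F G. G \<subseteq> F) (map snd L)"
    unfolding sorted_wrt_map using sorted by (rule sorted_wrt_mono_rel[rotated]) auto
  from adapted_basis[OF this] obtain B where B: "vec.independent B"
    "\<And>\<alpha> F. (\<alpha>, F) \<in> set L \<Longrightarrow> F \<subseteq> vec.span (B \<inter> F)" by force
  have top: "(fst (hd L), UNIV) \<in> set L" using hd_in_set[OF L(1)] unfolding L(2)[symmetric] prod.collapse .
  then have span: "vec.span B = UNIV" using B(2)[OF top] by auto
  have fin: "finite B" by (rule vec.finiteI_independent[OF B(1)])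
  have "card B = vec.dim (UNIV :: (complex^'n) set)"
    by (rule vec.basis_card_eq_dim) (use span B(1) in auto)
  then have "card B = CARD('n)" by (simp only: vec_dim_card)
  then obtain e :: "'n \<Rightarrow> complex^'n" where e: "bij_betw e UNIV B"
    using finite_same_card_bij[of "UNIV :: 'n set" B] fin by auto
  have range: "range e = B" using e by (simp add: bij_betw_def)
  define S where "S j = {\<alpha>. \<exists>F. (\<alpha>, F) \<in> set L \<and> e j \<in> F}" for j
  define a where "a j = Max (S j)" for j
  have finS: "finite (S j)" for j
    by (rule finite_subset[of _ "fst ` set L"]) (force simp: S_def)+
  have "S j \<noteq> {}" for j using top by (auto simp: S_def)
  then have aS: "a j \<in> S j" for j unfolding a_def by (rule Max_in[OF finS])
  have a_ge: "\<alpha> \<le> a j" if "(\<alpha>, F) \<in> set L" "e j \<in> F" for \<alpha> F j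
    unfolding a_def by (rule Max_ge[OF finS]) (use that in \<open>auto simp: S_def\<close>)
  \<comment> \<open>Among the weights satisfying P the least one has the largest subspace. Used for
    the weights above a given \<alpha> and for those at least l.\<close>
  have smallest: "\<exists>\<beta> G. (\<beta>, G) \<in> set L \<and> P \<beta> \<and> (\<forall>\<gamma> F. (\<gamma>, F) \<in> set L \<longrightarrow> P \<gamma> \<longrightarrow> F \<subseteq> G)"
    if P: "(\<alpha>, F) \<in> set L" "P \<alpha>" for P \<alpha> F
  proof -
    let ?T = "{\<beta> \<in> fst ` set L. P \<beta>}"
    have "\<alpha> \<in> fst ` set L" using P(1) by force
    then have T: "finite ?T" "?T \<noteq> {}" using P(2) by auto
    then have "Min ?T \<in> ?T" by (rule Min_in)
    then obtain G where G: "(Min ?T, G) \<in> set L" "P (Min ?T)" by auto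
    have "F' \<subseteq> G" if F': "(\<gamma>, F') \<in> set L" "P \<gamma>" for \<gamma> F'
      by (rule flag_chain(1)[OF sorted G(1) F'(1)]) (rule Min_le[OF T(1)], use F' in force)
    then show ?thesis using G by blast
  qed
  have "fst ` set L = range a"
  proof
    show "range a \<subseteq> fst ` set L" using aS by (force simp: S_def)
    show "fst ` set L \<subseteq> range a"
    proof
      fix \<alpha> assume "\<alpha> \<in> fst ` set L"
      then obtain F where F: "(\<alpha>, F) \<in> set L" by auto
      \<comment> \<open>Otherwise every basis vector in F lies in a member of larger weight, hence
        all lie in the largest such member G. As they span F, this makes F a subspace of G, against
        strictness.\<close>
      have "\<exists>j. e j \<in> F \<and> a j \<le> \<alpha>"
      proof (rule ccontr)
        assume none: "\<not> (\<exists>j. e j \<in> F \<and> a j \<le> \<alpha>)"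
        have bigger: "\<exists>\<beta> G. (\<beta>, G) \<in> set L \<and> \<alpha> < \<beta> \<and> b \<in> G" if b: "b \<in> B \<inter> F" for b
        proof -
          have "b \<in> range e" using b range by blast
          then obtain j where j: "b = e j" by blast
          have "\<not> a j \<le> \<alpha>" using none b j by blast
          then have "\<alpha> < a j" by simp
          then show ?thesis using aS[of j] j by (auto simp: S_def)
        qed
        show False
        proof (cases "B \<inter> F = {}")
          case True
          then show False using B(2)[OF F] sub[OF F] vec.subspace_0[of F] by auto
        next
          case False
          then obtain b where "b \<in> B \<inter> F" by blast
          from bigger[OF this] obtain \<beta> G where "(\<beta>, G) \<in> set L" "\<alpha> < \<beta>" by blast
          from smallest[where P = "\<lambda>\<beta>. \<alpha> < \<beta>", OF this] obtain \<beta> G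
            where G: "(\<beta>, G) \<in> set L" "\<alpha> < \<beta>" "\<And>\<gamma> F. (\<gamma>, F) \<in> set L \<Longrightarrow> \<alpha> < \<gamma> \<Longrightarrow> F \<subseteq> G" by blast
          have "B \<inter> F \<subseteq> G" using bigger G(3) by blast
          then have "vec.span (B \<inter> F) \<subseteq> G" using sub[OF G(1)] by (intro vec.span_minimal) auto
          then show False using B(2)[OF F] flag_chain(2)[OF sorted F G(1,2)] by blast
        qed
      qed
      then obtain j where "e j \<in> F" "a j \<le> \<alpha>" by blast
      then have "\<alpha> = a j" using a_ge[OF F, of j] by simp
      then show "\<alpha> \<in> range a" by blast
    qed
  qed
  moreover have "weight_ge L l = vec.span {e j | j. a j \<ge> l}" for l
  proof
    show "weight_ge L l \<subseteq> vec.span {e j | j. a j \<ge> l}"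
    proof
      fix v assume "v \<in> weight_ge L l"
      then consider "v = 0" | \<alpha> F where "\<alpha> \<ge> l" "(\<alpha>, F) \<in> set L" "v \<in> F" by (auto simp: weight_ge_def)
      then show "v \<in> vec.span {e j | j. a j \<ge> l}"
      proof cases
        case 1 then show ?thesis by (simp add: vec.span_zero)
      next
        case (2 \<alpha> F)
        have "B \<inter> F \<subseteq> {e j | j. a j \<ge> l}"
        proof
          fix b assume b: "b \<in> B \<inter> F"
          then have "b \<in> range e" using range by blast
          then obtain j where j: "b = e j" by blast
          then have "l \<le> a j" using a_ge[OF 2(2), of j] b 2(1) by simp
          then show "b \<in> {e j | j. a j \<ge> l}" using j by blast
        qed
        then show ?thesis using vec.span_mono B(2)[OF 2(2)] 2(3) by blast
      qed
    qed
    show "vec.span {e j | j. a j \<ge> l} \<subseteq> weight_ge L l"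
    proof (cases "\<exists>\<alpha> F. (\<alpha>, F) \<in> set L \<and> l \<le> \<alpha>")
      case True
      then obtain \<alpha> F where "(\<alpha>, F) \<in> set L" "l \<le> \<alpha>" by blast
      from smallest[where P = "\<lambda>\<beta>. l \<le> \<beta>", OF this] obtain \<beta> G
        where G: "(\<beta>, G) \<in> set L" "l \<le> \<beta>" "\<And>\<gamma> F. (\<gamma>, F) \<in> set L \<Longrightarrow> l \<le> \<gamma> \<Longrightarrow> F \<subseteq> G" by blast
      have "{e j | j. a j \<ge> l} \<subseteq> G"
      proof
        fix v assume "v \<in> {e j | j. a j \<ge> l}"
        then obtain j where j: "v = e j" "l \<le> a j" by blast
        obtain F where "(a j, F) \<in> set L" "e j \<in> F" using aS[of j] by (auto simp: S_def)
        then show "v \<in> G" using G(3) j by blast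
      qed
      then have "vec.span {e j | j. a j \<ge> l} \<subseteq> G" using sub[OF G(1)] by (intro vec.span_minimal) auto
      then show ?thesis using G by (auto simp: weight_ge_def)
    next
      case False
      have "{e j | j. a j \<ge> l} = {}"
      proof (rule ccontr)
        assume "{e j | j. a j \<ge> l} \<noteq> {}"
        then obtain j where "l \<le> a j" by blast
        moreover obtain F where "(a j, F) \<in> set L" using aS[of j] by (auto simp: S_def)
        ultimately show False using False by blast
      qed
      then show ?thesis by (simp add: weight_ge_def)
    qed
  qed
  ultimately show ?thesis using span range by blast
qed

text \<open>A basis adapted to the flag at x is extended to nearby points with constant coordinates
  in a local frame h; the change of basis is then a constant invertible matrix, and e is a frame
  wherever h is.\<close>

lemma (in surface) parabolic_splitting_exists:
  fixes E :: "('x, 'n::finite) parabolic"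
  assumes D: "finite D" and E: "parabolic_bundle X D E" and x: "x \<in> D"
  shows "\<exists>U e a. parabolic_splitting X D E x U e a"
proof -
  interpret tE: sheaf_bundle "holomorphic_fun X" UNIV "triv E"
    using E by unfold_locales (simp add: parabolic_bundle_def)
  let ?L = "flag E x"
  have *: "?L \<noteq> [] \<and> snd (hd ?L) = UNIV \<and> sorted_wrt (\<lambda>(\<alpha>, F) (\<beta>, G). \<alpha> < \<beta> \<and> G \<subset> F) ?L \<and>
      (\<forall>(\<alpha>, F) \<in> set ?L. 0 \<le> \<alpha> \<and> \<alpha> < 1 \<and> vec.subspace F \<and> F \<noteq> {0})"
    using E[unfolded parabolic_bundle_def] x by (rule conjunct2[THEN bspec])
  have subs: "\<forall>F\<in>snd ` set ?L. vec.subspace F \<and> F \<noteq> {0}"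
  proof
    fix F assume "F \<in> snd ` set ?L"
    then obtain \<alpha> where "(\<alpha>, F) \<in> set ?L" by (elim imageE) (simp, metis prod.collapse)
    with *[THEN conjunct2, THEN conjunct2, THEN conjunct2] show "vec.subspace F \<and> F \<noteq> {0}" by (rule bspec[THEN revcut_rl]) simp
  qed
  obtain e0 :: "'n \<Rightarrow> complex^'n" and a where e0: "vec.span (range e0) = UNIV" "fst ` set ?L = range a"
    "\<forall>l. weight_ge ?L l = vec.span {e0 j | j. a j \<ge> l}" using flag_adapted_basis[OF *[THEN conjunct1] *[THEN conjunct2, THEN conjunct1]
        *[THEN conjunct2, THEN conjunct2, THEN conjunct1] subs] by blast
  obtain U0 h where h: "regular_frame (holomorphic_fun X) (triv E) U0 h" "x \<in> U0" by (rule tE.frame_at[OF UNIV_I])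
  obtain N where N: "open N" "N \<inter> D = {x}" using finite_isolated[OF D x] by blast
  define U where "U = U0 \<inter> N"
  have U: "open U" "x \<in> U" "U \<inter> D = {x}" using h N by (auto simp: U_def regular_frame_def)
  have hU: "regular_frame (holomorphic_fun X) (triv E) U h" by (rule tE.frame_subset[OF h(1) U(1)]) (simp add: U_def)
  have inv: "\<And>p. p \<in> U \<Longrightarrow> invertible (frame_matrix h p)" using hU by (simp add: regular_frame_def)
  define e where "e j = comb h (\<lambda>k _. coords h (\<lambda>_. e0 j) k x)" for j
  have ex: "e j x = e0 j" for j
    using comb_coords[OF inv[OF U(2)], of "\<lambda>_. e0 j"] by (simp add: e_def comb_def)
  have e_eq: "e j p = frame_matrix h p *v (matrix_inv (frame_matrix h x) *v e0 j)" for j p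
    by (simp add: e_def comb_def coords_def frame_matrix_vec)
  have fm: "frame_matrix e p = frame_matrix h p ** (matrix_inv (frame_matrix h x) ** frame_matrix (\<lambda>j _. e0 j) x)"
    (is "_ = ?A ** (?B ** ?C)") for p
  proof -
    have "(?A ** (?B ** ?C)) $ i $ j = frame_matrix e p $ i $ j" for i j
    proof -
      have "(?A ** (?B ** ?C)) $ i $ j = ((?A ** (?B ** ?C)) *v axis j 1) $ i" by (rule matrix_mult_axis[symmetric])
      also have "\<dots> = (?A *v (?B *v (?C *v axis j 1))) $ i" by (simp only: matrix_vector_mul_assoc)
      also have "\<dots> = frame_matrix e p $ i $ j"
        unfolding frame_matrix_column e_eq[symmetric] by (simp add: frame_matrix_def)
      finally show ?thesis .
    qed
    then show ?thesis by (simp add: vec_eq_iff)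
  qed
  have "columns (frame_matrix (\<lambda>j _. e0 j) x) = range e0"
    by (auto simp: columns_def column_def frame_matrix_def)
  then have "invertible (frame_matrix (\<lambda>j _. e0 j) x)"
    unfolding invertible_right_inverse matrix_right_invertible_span_columns using e0(1) by simp
  then have "invertible (frame_matrix e p)" if "p \<in> U" for p
    unfolding fm by (intro invertible_mult inv[OF that] invertible_matrix_inv inv[OF U(2)])
  moreover have "hol_section X (triv E) U (e j)" for j
    unfolding e_def by (rule tE.section_comb[OF hU hol.R_const[OF U(1)]])
  ultimately have "hol_frame X (triv E) U e" using U(1) by (simp add: hol_frame_regular_frame regular_frame_def)
  then show ?thesis using U e0 ex unfolding parabolic_splitting_def by (intro exI[of _ U] exI[of _ e] exI[of _ a]) simp
qed

section \<open>Model flags and elementary modifications\<close>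

definition weight_flag :: "('n \<Rightarrow> real) \<Rightarrow> (real \<times> (complex^'n::finite) set) list" where
  "weight_flag a = map (\<lambda>l. (l, vec.span {axis j 1 | j. a j \<ge> l})) (sorted_list_of_set (range a))"

lemma span_axis_zero: "v \<in> vec.span {axis j (1::complex) | j. P j} \<Longrightarrow> \<not> P i \<Longrightarrow> v $ i = 0"
proof -
  assume v: "v \<in> vec.span {axis j (1::complex) | j. P j}" "\<not> P i"
  have "vec.span {axis j (1::complex) | j. P j} \<subseteq> {v. v $ i = 0}"
    using v(2) by (intro vec.span_minimal) (auto simp: vec.subspace_def axis_def)
  then show "v $ i = 0" using v(1) by blast
qed

text \<open>The flag given to the new fibre over a point of B: that fibre is identified with the
  standard space so that the new frame becomes the standard basis, and the weights alone determine
  the subspaces.\<close>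

lemma weight_flag:
  fixes a :: "'n::finite \<Rightarrow> real"
  assumes a: "\<And>j. 0 \<le> a j" "\<And>j. a j < 1"
  shows "weight_flag a \<noteq> []" "snd (hd (weight_flag a)) = UNIV"
    "sorted_wrt (\<lambda>(\<alpha>, F) (\<beta>, G). \<alpha> < \<beta> \<and> G \<subset> F) (weight_flag a)"
    "\<forall>(\<alpha>, F) \<in> set (weight_flag a). 0 \<le> \<alpha> \<and> \<alpha> < 1 \<and> vec.subspace F \<and> F \<noteq> {0}"
    "fst ` set (weight_flag a) = range a"
    "weight_ge (weight_flag a) l = vec.span {axis j 1 | j. a j \<ge> l}"
proof -
  let ?F = "\<lambda>l. vec.span {axis j (1::complex) | j. a j \<ge> l}"
  have mono: "?F m \<subseteq> ?F l" if "l \<le> m" for l m by (rule vec.span_mono) (use that in auto)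
  have axis: "axis j 1 \<in> ?F (a j)" for j by (rule vec.span_base) auto
  have set: "set (weight_flag a) = (\<lambda>l. (l, ?F l)) ` range a" by (simp add: weight_flag_def)
  show "weight_flag a \<noteq> []" by (simp add: weight_flag_def)
  have "x \<in> ?F (Min (range a))" for x :: "complex^'n"
  proof -
    have "(\<Sum>i\<in>UNIV. (x $ i) *s axis i 1) \<in> ?F (Min (range a))"
      by (intro vec.span_sum vec.span_scale vec.span_base) auto
    then show ?thesis by (simp add: basis_expansion)
  qed
  then show "snd (hd (weight_flag a)) = UNIV"
    by (auto simp: weight_flag_def sorted_list_of_set_nonempty)
  show "sorted_wrt (\<lambda>(\<alpha>, F) (\<beta>, G). \<alpha> < \<beta> \<and> G \<subset> F) (weight_flag a)"
    unfolding weight_flag_def sorted_wrt_map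
  proof (rule sorted_wrt_mono_rel[OF _ strict_sorted_list_of_set])
    fix l m assume lm: "l \<in> set (sorted_list_of_set (range a))" "l < m"
    then obtain j where j: "l = a j" by auto
    then have "axis j 1 \<notin> ?F m" using span_axis_zero[of "axis j 1" "\<lambda>i. m \<le> a i" j] lm(2) by (auto simp: axis_def)
    then have "?F m \<subset> ?F l" using mono[of l m] lm(2) axis[of j] j by auto
    then show "(case (l, ?F l) of (\<alpha>, F) \<Rightarrow> \<lambda>(\<beta>, G). \<alpha> < \<beta> \<and> G \<subset> F) (m, ?F m)" using lm(2) by simp
  qed
  have "?F (a j) \<noteq> {0}" for j
  proof
    assume "?F (a j) = {0}"
    then have "axis j (1::complex) \<in> {0 :: complex^'n}" using axis[of j] by (simp only:)
    then show False by simp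
  qed
  then show "\<forall>(\<alpha>, F) \<in> set (weight_flag a). 0 \<le> \<alpha> \<and> \<alpha> < 1 \<and> vec.subspace F \<and> F \<noteq> {0}"
    unfolding set using a by auto
  show "fst ` set (weight_flag a) = range a" unfolding set by force
  show "weight_ge (weight_flag a) l = ?F l"
  proof
    show "weight_ge (weight_flag a) l \<subseteq> ?F l"
    proof
      fix v assume "v \<in> weight_ge (weight_flag a) l"
      then consider "v = 0" | j where "l \<le> a j" "v \<in> ?F (a j)" unfolding weight_ge_def set by blast
      then show "v \<in> ?F l" by cases (use mono in \<open>blast intro: vec.span_zero\<close>)+
    qed
    show "?F l \<subseteq> weight_ge (weight_flag a) l"
    proof (cases "\<exists>j. l \<le> a j")
      case True
      let ?T = "{b \<in> range a. l \<le> b}"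
      have T: "finite ?T" "?T \<noteq> {}" using True by auto
      have "Min ?T \<in> ?T" using T by (rule Min_in)
      then obtain j where j: "Min ?T = a j" "l \<le> a j" by auto
      have "Min ?T \<le> a i" if "l \<le> a i" for i by (rule Min_le[OF T(1)]) (use that in auto)
      then have "{axis j (1::complex) | j. l \<le> a j} \<subseteq> {axis i (1::complex) | i. a j \<le> a i}" using j by auto
      then have "?F l \<subseteq> ?F (a j)" by (rule vec.span_mono)
      moreover have "?F (a j) \<subseteq> weight_ge (weight_flag a) l"
      proof -
        have "(a j, ?F (a j)) \<in> set (weight_flag a)" unfolding set by blast
        then show ?thesis using j(2) unfolding weight_ge_def by blast
      qed
      ultimately show ?thesis by (rule subset_trans)
    next
      case False
      then have "{axis j (1::complex) | j. l \<le> a j} = {}" by auto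
      then show ?thesis by (simp add: weight_ge_def)
    qed
  qed
qed

text \<open>An elementary modification along B. Off B the old trivialisations are kept; around each
  y in B one new trivialisation declares \<open>b y\<close>, so far a frame only on a punctured
  neighbourhood, to be a frame across y. The fibre over y may change, as fibres are identified with
  the standard space pointwise.\<close>

definition modify :: "('x, 'n::finite) trivialisations \<Rightarrow> 'x set \<Rightarrow> ('x \<Rightarrow> 'x set) \<Rightarrow> ('x \<Rightarrow> 'n \<Rightarrow> ('x, 'n) sect) \<Rightarrow> ('x, 'n) trivialisations"
where
  "modify T B V b = (\<lambda>y. (V y, \<lambda>q. matrix_inv (frame_matrix (b y) q))) ` B \<union> (\<lambda>\<tau>. (fst \<tau> - B, snd \<tau>)) ` T"

text \<open>Distinct members of the new atlas overlap only off B, where their frames are regular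
  frames of the old bundle; so all transition functions and, off B, all sections are the old
  ones.\<close>

lemma (in function_sheaf) modify:
  fixes T :: "('x, 'n::finite) trivialisations"
  assumes T: "vector_bundle R UNIV T" and B: "closed B"
    and V: "\<And>y. y \<in> B \<Longrightarrow> open (V y)" "\<And>y. y \<in> B \<Longrightarrow> V y \<inter> B = {y}"
    and b: "\<And>y. y \<in> B \<Longrightarrow> regular_frame R T (V y - {y}) (b y)" "\<And>y. y \<in> B \<Longrightarrow> invertible (frame_matrix (b y) y)"
  shows "vector_bundle R UNIV (modify T B V b)"
    and "\<And>M s. M \<inter> B = {} \<Longrightarrow> regular_section R (modify T B V b) M s = regular_section R T M s"
    and "\<And>y. y \<in> B \<Longrightarrow> regular_frame R (modify T B V b) (V y) (b y)"
proof -
  let ?E = "modify T B V b"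
  interpret tT: sheaf_bundle R UNIV T by unfold_locales (rule T)
  define g where "g \<sigma> = (\<lambda>j q. matrix_inv (snd \<sigma> q) *v axis j (1::complex))" for \<sigma> :: "'x set \<times> ('x \<Rightarrow> complex^'n^'n)"
  have invb: "invertible (frame_matrix (b y) q)" if "y \<in> B" "q \<in> V y" for y q
    using b(1)[OF that(1)] b(2)[OF that(1)] that(2) by (cases "q = y") (auto simp: regular_frame_def)
  have cases: thesis
    if "\<sigma> \<in> ?E" "\<And>y. y \<in> B \<Longrightarrow> \<sigma> = (V y, \<lambda>q. matrix_inv (frame_matrix (b y) q)) \<Longrightarrow> thesis"
      "\<And>\<tau>. \<tau> \<in> T \<Longrightarrow> \<sigma> = (fst \<tau> - B, snd \<tau>) \<Longrightarrow> thesis" for \<sigma> thesis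
    using that unfolding modify_def by blast
  have gb: "g (V y, \<lambda>q. matrix_inv (frame_matrix (b y) q)) j q = b y j q" if "y \<in> B" "q \<in> V y" for y q j
    by (simp add: g_def matrix_inv_matrix_inv[OF invb[OF that]] frame_matrix_column)
  have \<sigma>: "open (fst \<sigma>)" "\<forall>q\<in>fst \<sigma>. invertible (snd \<sigma> q)" "regular_frame R T (fst \<sigma> - B) (g \<sigma>)" if "\<sigma> \<in> ?E" for \<sigma>
  proof -
    have "open (fst \<sigma>) \<and> (\<forall>q\<in>fst \<sigma>. invertible (snd \<sigma> q)) \<and> regular_frame R T (fst \<sigma> - B) (g \<sigma>)"
    proof (rule cases[OF that])
      fix y assume y: "y \<in> B" and \<sigma>: "\<sigma> = (V y, \<lambda>q. matrix_inv (frame_matrix (b y) q))"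
      have "V y - B = V y - {y}" using V(2)[OF y] by blast
      moreover have "regular_frame R T (V y - {y}) (g \<sigma>)"
        unfolding regular_frame_def
      proof (intro conjI allI ballI)
        show "open (V y - {y})" using b(1)[OF y] by (simp add: regular_frame_def)
        show "regular_section R T (V y - {y}) (g \<sigma> j)" for j
          by (rule tT.section_cong[of _ "b y j"]) (use b(1)[OF y] gb[OF y] \<sigma> in \<open>auto simp: regular_frame_def\<close>)
        show "invertible (frame_matrix (g \<sigma>) q)" if "q \<in> V y - {y}" for q
          using invb[OF y, of q] gb[OF y, of q] that by (simp add: \<sigma> frame_matrix_def)
      qed
      ultimately show ?thesis using V(1)[OF y] invb[OF y] by (simp add: \<sigma> invertible_matrix_inv)
    next
      fix \<tau> assume \<tau>: "\<tau> \<in> T" "\<sigma> = (fst \<tau> - B, snd \<tau>)"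
      have o: "open (fst \<tau> - B)" using tT.triv_open[OF \<tau>(1)] B by blast
      have "regular_frame R T (fst \<tau> - B - B) (g \<sigma>)"
        using tT.frame_subset[OF tT.frame_triv[OF \<tau>(1)], of "fst \<tau> - B"] o unfolding g_def \<tau>(2) by simp
      then show ?thesis using o tT.triv_invertible[OF \<tau>(1)] by (simp add: \<tau>(2))
    qed
    then show "open (fst \<sigma>)" "\<forall>q\<in>fst \<sigma>. invertible (snd \<sigma> q)" "regular_frame R T (fst \<sigma> - B) (g \<sigma>)" by blast+
  qed
  have disj: "\<sigma> = \<sigma>' \<or> fst \<sigma> \<inter> fst \<sigma>' \<inter> B = {}" if "\<sigma> \<in> ?E" "\<sigma>' \<in> ?E" for \<sigma> \<sigma>'
  proof (rule cases[OF that(1)])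
    fix y assume y: "y \<in> B" "\<sigma> = (V y, \<lambda>q. matrix_inv (frame_matrix (b y) q))"
    show ?thesis
    proof (rule cases[OF that(2)])
      fix y' assume y': "y' \<in> B" "\<sigma>' = (V y', \<lambda>q. matrix_inv (frame_matrix (b y') q))"
      show ?thesis
      proof (cases "y = y'")
        case True then show ?thesis using y y' by simp
      next
        case False then show ?thesis using V(2)[OF y(1)] V(2)[OF y'(1)] y(2) y'(2) by auto
      qed
    qed auto
  qed auto
  show vb: "vector_bundle R UNIV ?E"
    unfolding vector_bundle_def
  proof (intro conjI ballI allI)
    show "(\<Union>\<sigma>\<in>?E. fst \<sigma>) = UNIV"
    proof (intro set_eqI iffI UNIV_I)
      fix q
      show "q \<in> (\<Union>\<sigma>\<in>?E. fst \<sigma>)"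
      proof (cases "q \<in> B")
        case True
        then show ?thesis using V(2)[OF True] by (auto simp: modify_def)
      next
        case False
        obtain \<tau> where "\<tau> \<in> T" "q \<in> fst \<tau>" using tT.triv_at[OF UNIV_I] by blast
        then show ?thesis using False by (auto simp: modify_def)
      qed
    qed
    show "invertible (snd \<sigma> q)" if "\<sigma> \<in> ?E" "q \<in> fst \<sigma>" for \<sigma> q using \<sigma>[OF that(1)] that(2) by blast+
    show "open (fst \<sigma>)" if "\<sigma> \<in> ?E" for \<sigma> by (rule \<sigma>(1)[OF that])
    fix \<sigma> \<sigma>' i j assume m: "\<sigma> \<in> ?E" "\<sigma>' \<in> ?E"
    let ?N = "fst \<sigma> \<inter> fst \<sigma>'"
    have o: "open ?N" using \<sigma>(1)[OF m(1)] \<sigma>(1)[OF m(2)] by blast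
    from disj[OF m] show "R ?N (\<lambda>q. (snd \<sigma>' q ** matrix_inv (snd \<sigma> q)) $ i $ j)"
    proof
      assume eq: "\<sigma> = \<sigma>'"
      have "mat 1 $ i $ j = (snd \<sigma>' q ** matrix_inv (snd \<sigma> q)) $ i $ j" if "q \<in> ?N" for q
        using \<sigma>(2)[OF m(1)] that by (simp add: eq matrix_inv_right_invertible)
      then show ?thesis by (rule R_cong[OF R_const[OF o]])
    next
      assume N: "?N \<inter> B = {}"
      have f: "regular_frame R T ?N (g \<sigma>)" "regular_frame R T ?N (g \<sigma>')"
        using tT.frame_subset[OF \<sigma>(3)[OF m(1)] o] tT.frame_subset[OF \<sigma>(3)[OF m(2)] o] N by blast+
      have "R ?N (coords (g \<sigma>') (g \<sigma> j) i)"
        by (rule tT.R_coords[OF f(2)]) (use f(1) in \<open>simp add: regular_frame_def\<close>)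
      then show ?thesis
      proof (rule R_cong)
        fix q assume q: "q \<in> ?N"
        have fm: "frame_matrix (g \<sigma>') q = matrix_inv (snd \<sigma>' q)" by (simp add: g_def)
        have i2: "matrix_inv (matrix_inv (snd \<sigma>' q)) = snd \<sigma>' q"
          by (rule matrix_inv_matrix_inv) (use \<sigma>(2)[OF m(2)] q in blast)
        have "coords (g \<sigma>') (g \<sigma> j) i q = (snd \<sigma>' q *v (matrix_inv (snd \<sigma> q) *v axis j 1)) $ i"
          unfolding coords_def fm i2 by (simp add: g_def)
        also have "\<dots> = (snd \<sigma>' q ** matrix_inv (snd \<sigma> q)) $ i $ j"
          unfolding matrix_vector_mul_assoc by (rule matrix_mult_axis)
        finally show "coords (g \<sigma>') (g \<sigma> j) i q = (snd \<sigma>' q ** matrix_inv (snd \<sigma> q)) $ i $ j" .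
      qed
    qed
  qed
  interpret tE: sheaf_bundle R UNIV ?E by unfold_locales (rule vb)
  have gE: "regular_frame R ?E (fst \<sigma>) (g \<sigma>)" if "\<sigma> \<in> ?E" for \<sigma>
    unfolding g_def by (rule tE.frame_triv[OF that])
  show "regular_section R ?E M s = regular_section R T M s" if M: "M \<inter> B = {}" for M s
  proof -
    have near: "\<exists>N. q \<in> N \<and> open N \<and> (open M \<longrightarrow> regular_section R ?E (N \<inter> M) s = regular_section R T (N \<inter> M) s)"
      if q: "q \<in> M" for q
    proof -
      obtain \<sigma> where s: "\<sigma> \<in> ?E" "q \<in> fst \<sigma>" using tE.triv_at[OF UNIV_I] by blast
      have "regular_section R ?E (fst \<sigma> \<inter> M) s = regular_section R T (fst \<sigma> \<inter> M) s" if "open M"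
      proof -
        have o: "open (fst \<sigma> \<inter> M)" using that \<sigma>(1)[OF s(1)] by blast
        have "regular_frame R ?E (fst \<sigma> \<inter> M) (g \<sigma>)" "regular_frame R T (fst \<sigma> \<inter> M) (g \<sigma>)"
          using tE.frame_subset[OF gE[OF s(1)] o] tT.frame_subset[OF \<sigma>(3)[OF s(1)] o] M by blast+
        then show ?thesis by (simp only: tE.section_iff_coords tT.section_iff_coords)
      qed
      then show ?thesis using s \<sigma>(1)[OF s(1)] by (intro exI[of _ "fst \<sigma>"]) simp
    qed
    show ?thesis
    proof
      assume s: "regular_section R ?E M s"
      show "regular_section R T M s"
      proof (rule tT.section_local)
        fix q assume q: "q \<in> M"
        from near[OF q] obtain N where N: "q \<in> N" and o: "open N" and
          eq: "open M \<longrightarrow> regular_section R ?E (N \<inter> M) s = regular_section R T (N \<inter> M) s" by blast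
        have "regular_section R ?E (N \<inter> M) s"
          by (rule tE.section_subset[OF s]) (use o tE.section_open[OF s] in auto)
        then have "regular_section R T (N \<inter> M) s" using eq tE.section_open[OF s] by simp
        then show "\<exists>N. q \<in> N \<and> N \<subseteq> M \<and> regular_section R T N s" using N q by blast
      qed
    next
      assume s: "regular_section R T M s"
      show "regular_section R ?E M s"
      proof (rule tE.section_local)
        fix q assume q: "q \<in> M"
        from near[OF q] obtain N where N: "q \<in> N" and o: "open N" and
          eq: "open M \<longrightarrow> regular_section R ?E (N \<inter> M) s = regular_section R T (N \<inter> M) s" by blast
        have "regular_section R T (N \<inter> M) s"
          by (rule tT.section_subset[OF s]) (use o tT.section_open[OF s] in auto)
        then have "regular_section R ?E (N \<inter> M) s" using eq tT.section_open[OF s] by simp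
        then show "\<exists>N. q \<in> N \<and> N \<subseteq> M \<and> regular_section R ?E N s" using N q by blast
      qed
    qed
  qed
  show "regular_frame R ?E (V y) (b y)" if y: "y \<in> B" for y
  proof -
    let ?s = "(V y, \<lambda>q. matrix_inv (frame_matrix (b y) q))"
    have m: "?s \<in> ?E" using y by (auto simp: modify_def)
    have "regular_section R ?E (V y) (b y j)" for j
      by (rule tE.section_cong[of _ "g ?s j"]) (use gE[OF m] gb[OF y] in \<open>auto simp: regular_frame_def\<close>)
    then show ?thesis using V(1)[OF y] invb[OF y] by (simp add: regular_frame_def)
  qed
qed

lemma invertible_scaled_frame:
  assumes e: "invertible (frame_matrix e p)" and g: "\<And>j. g j \<noteq> 0" and e': "\<And>j. e' j q = g j *s e j p"
  shows "invertible (frame_matrix e' q)"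
  unfolding invertible_left_inverse matrix_left_invertible_ker
proof (intro allI impI)
  fix v assume "frame_matrix e' q *v v = 0"
  then have "frame_matrix e p *v (\<chi> j. v $ j * g j) = 0"
    by (simp add: frame_matrix_vec e' vector_smult_assoc)
  then have "matrix_inv (frame_matrix e p) *v (frame_matrix e p *v (\<chi> j. v $ j * g j)) = 0" by simp
  then have "(\<chi> j. v $ j * g j) = 0" unfolding matrix_inv_vec(2)[OF e] .
  then show "v = 0" using g by (simp add: vec_eq_iff)
qed

lemma (in branched_map) pullback_parabolic_exists:
  fixes E :: "('x, 'n::finite) parabolic"
  assumes D: "finite D" and E: "parabolic_bundle X D E"
  shows "\<exists>F. is_pullback_parabolic Y X D f E F"
proof -
  let ?B = "f -` D" and ?T = "pullback_bundle f (triv E)"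
  have vE: "vector_bundle (holomorphic_fun X) UNIV (triv E)" using E by (simp add: parabolic_bundle_def)
  have vT: "vector_bundle (holomorphic_fun Y) UNIV ?T" using hol_map.vector_bundle_pullback[OF vE] by simp
  interpret tT: sheaf_bundle "holomorphic_fun Y" UNIV ?T by unfold_locales (rule vT)
  have "open (f -` (- D))" by (rule vimage_open, rule open_Compl, rule finite_imp_closed, rule D)
  then have B: "closed ?B" by (simp add: closed_def vimage_Compl)
  define P where "P y d U e a V \<longleftrightarrow> d \<in> Y \<and> y \<in> fst d \<and> parabolic_splitting X D E (f y) U e a \<and> open V \<and>
    V \<subseteq> f -` U \<inter> fst d \<and> V \<inter> ?B = {y}" for y d U and e :: "'n \<Rightarrow> ('x, 'n) sect" and a V
  \<comment> \<open>All choices at y are packed into one tuple, so that a single application of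
    choice over B makes them simultaneously.\<close>
  define Q where "Q y t \<longleftrightarrow> P y (fst t) (fst (snd t)) (fst (snd (snd t))) (fst (snd (snd (snd t)))) (snd (snd (snd (snd t))))" for y t
  have "\<forall>y\<in>?B. \<exists>t. Q y t"
  proof
    fix y assume y: "y \<in> ?B"
    have fy: "f y \<in> D" using y by simp
    obtain d where d: "d \<in> Y" "y \<in> fst d" by (rule Y.chart_at)
    obtain U e a where s: "parabolic_splitting X D E (f y) U e a"
      using X.parabolic_splitting_exists[OF D E fy] by blast
    obtain N where N: "open N" "N \<inter> ?B = {y}" using isolated_preimage[OF D y] by blast
    have U: "open U" "f y \<in> U" using s by (auto simp: parabolic_splitting_def hol_frame_regular_frame regular_frame_def)
    have "P y d U e a (N \<inter> f -` U \<inter> fst d)"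
      unfolding P_def using d s U N vimage_open[OF U(1)] Y.open_chart[OF d(1)] by auto
    then show "\<exists>t. Q y t" by (intro exI[of _ "(d, U, e, a, N \<inter> f -` U \<inter> fst d)"]) (simp add: Q_def)
  qed
  from bchoice[OF this] obtain t where t: "\<forall>y\<in>?B. Q y (t y)" ..
  define d U e a V where defs: "d y = fst (t y)" "U y = fst (snd (t y))" "e y = fst (snd (snd (t y)))"
    "a y = fst (snd (snd (snd (t y))))" "V y = snd (snd (snd (snd (t y))))" for y
  have Py: "P y (d y) (U y) (e y) (a y) (V y)" if "y \<in> ?B" for y using t that unfolding Q_def defs by blast
  define k where "k y j = \<lfloor>real (ramification y) * a y j\<rfloor>" for y j
  \<comment> \<open>At y the twisted formula has no meaning, and the fibre of the new bundle over y
    is free to be identified with the standard space; the standard basis is the value that fits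
    \<open>weight_flag\<close>.\<close>
  define b where "b y j q = (if q = y then axis j 1 else (snd (d y) q - snd (d y) y) powi (- k y j) *s e y j (f q))" for y j q
  define w where "w y = (\<lambda>j. frac (real (ramification y) * a y j))" for y
  let ?F = "\<lparr>triv = modify ?T ?B V b, flag = \<lambda>y. weight_flag (w y)\<rparr>"
  have V: "open (V y)" "V y \<inter> ?B = {y}" "V y \<subseteq> f -` U y \<inter> fst (d y)" "d y \<in> Y"
    "parabolic_splitting X D E (f y) (U y) (e y) (a y)" "y \<in> V y" if "y \<in> ?B" for y
    using Py[OF that] unfolding P_def by blast+
  have b1: "regular_frame (holomorphic_fun Y) ?T (V y - {y}) (b y)" if y: "y \<in> ?B" for y
  proof -
    let ?N = "V y - {y}"
    have o: "open ?N" using V(1)[OF y] by blast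
    have "regular_frame (holomorphic_fun X) (triv E) (U y) (e y)"
      using V(5)[OF y] by (simp add: parabolic_splitting_def hol_frame_regular_frame)
    from tT.frame_subset[OF hol_map.frame_pullback[OF vE this] o]
    have e: "regular_frame (holomorphic_fun Y) ?T ?N (\<lambda>j q. e y j (f q))" using V(3)[OF y] by blast
    have ne: "snd (d y) q - snd (d y) y \<noteq> 0" if "q \<in> ?N" for q
      using Y.chart_inj[OF V(4)[OF y], of q y] V(3,6)[OF y] that by auto
    have "holomorphic_fun Y ?N (\<lambda>q. snd (d y) q - snd (d y) y)"
      by (rule Y.hol.R_diff[OF Y.hol.R_subset[OF Y.holomorphic_chart[OF V(4)[OF y]] o] Y.hol.R_const[OF o]]) (use V(3)[OF y] in blast)
    from Y.hol.R_power_int[OF this ne]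
    have g: "holomorphic_fun Y ?N (\<lambda>q. (snd (d y) q - snd (d y) y) powi (- k y j))" for j .
    show ?thesis
      unfolding regular_frame_def
    proof (intro conjI allI ballI o)
      fix j
      have "hol_section Y ?T ?N (\<lambda>q. e y j (f q))" using e by (simp add: regular_frame_def)
      from tT.section_scale[OF g[of j] this] show "hol_section Y ?T ?N (b y j)"
        by (rule tT.section_cong) (simp add: b_def)
    next
      fix q assume q: "q \<in> ?N"
      show "invertible (frame_matrix (b y) q)"
      proof (rule invertible_scaled_frame)
        show "invertible (frame_matrix (\<lambda>j q. e y j (f q)) q)" using e q by (simp add: regular_frame_def)
        show "(snd (d y) q - snd (d y) y) powi (- k y j) \<noteq> 0" for j using ne[OF q] by (simp add: power_int_eq_0_iff)
        show "b y j q = (snd (d y) q - snd (d y) y) powi (- k y j) *s e y j (f q)" for j using q by (simp add: b_def)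
      qed
    qed
  qed
  have b2: "invertible (frame_matrix (b y) y)" for y
  proof -
    have "frame_matrix (b y) y = mat 1" by (simp add: frame_matrix_def b_def mat_def axis_def vec_eq_iff)
    then show ?thesis by (simp add: invertible_def)
  qed
  have md1: "vector_bundle (holomorphic_fun Y) UNIV (modify ?T ?B V b)"
    by (rule Y.hol.modify(1)[OF vT B V(1,2) b1 b2])
  have md2: "hol_section Y (modify ?T ?B V b) M s = hol_section Y ?T M s" if M: "M \<inter> ?B = {}" for M s
    by (rule Y.hol.modify(2)[OF vT B V(1,2) b1 b2 M])
  have md3: "regular_frame (holomorphic_fun Y) (modify ?T ?B V b) (V y) (b y)" if y: "y \<in> ?B" for y
    by (rule Y.hol.modify(3)[OF vT B V(1,2) b1 b2 y])
  have w: "0 \<le> w y j" "w y j < 1" for y j by (simp_all add: w_def frac_lt_1)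
  have parF: "parabolic_bundle Y ?B ?F"
    unfolding parabolic_bundle_def using md1 weight_flag(1-4)[of "w _", OF w] by simp
  have "is_pullback_parabolic Y X D f E ?F"
    unfolding is_pullback_parabolic_def
  proof (intro conjI allI impI ballI)
    show "parabolic_bundle Y ?B ?F" by (rule parF)
    show "hol_section Y (triv ?F) M s = hol_section Y ?T M s" if "M \<inter> ?B = {}" for M s
      using md2[OF that] by simp
    fix y assume y: "y \<in> ?B"
    have "parabolic_splitting Y ?B ?F y (V y) (b y) (w y)"
      unfolding parabolic_splitting_def hol_frame_regular_frame
      using V(2)[OF y] md3[OF y] weight_flag(5,6)[of "w y", OF w] by (simp add: b_def)
    moreover have "\<forall>j. \<forall>q\<in>V y - {y}. b y j q = (snd (d y) q - snd (d y) y) powi (- \<lfloor>real (ramification y) * a y j\<rfloor>) *s e y j (f q)"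
      by (simp add: b_def k_def)
    ultimately show "\<exists>U e a V b. \<exists>d\<in>Y. parabolic_splitting X D E (f y) U e a \<and> y \<in> V \<and> V \<subseteq> f -` U \<inter> fst d \<and>
        parabolic_splitting Y ?B ?F y V b (\<lambda>j. frac (real (ramification y) * a j)) \<and>
        (\<forall>j. \<forall>q\<in>V - {y}. b j q = (snd d q - snd d y) powi (- \<lfloor>real (ramification y) * a j\<rfloor>) *s e j (f q))"
      unfolding w_def
      by (intro exI[of _ "U y"] exI[of _ "e y"] exI[of _ "a y"] exI[of _ "V y"] exI[of _ "b y"] bexI[of _ "d y"] conjI V[OF y])
  qed
  then show ?thesis by blast
qed

subsection \<open>Residues of the pullback\<close>

context surface
begin

text \<open>w d/dw acts on the n-th power of w as multiplication by n. For n = -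
  \<open>k\<^sub>j\<close> this is the shift that twisting a frame vector causes in the residue of a
  connection.\<close>

lemma coordinate_powi_d_z:
  assumes c: "c \<in> X" "x \<in> fst c" "p \<in> fst c" "p \<noteq> x"
  shows "(snd c p - snd c x) * d_z c (\<lambda>q. (snd c q - snd c x) powi n) p = of_int n * (snd c p - snd c x) powi n"
proof -
  let ?g = "\<lambda>q. (snd c q - snd c x) powi n" and ?z = "snd c p"
  have ne: "?z - snd c x \<noteq> 0" using chart_inj[OF c(1,3,2)] c(4) by simp
  have o: "open (fst c - {x})" using open_chart[OF c(1)] by blast
  have "holomorphic_fun X (fst c - {x}) (\<lambda>q. snd c q - snd c x)"
    by (rule hol.R_diff[OF hol.R_subset[OF holomorphic_chart[OF c(1)] o] hol.R_const[OF o]]) blast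
  then have g: "holomorphic_fun X (fst c - {x}) ?g"
    by (rule hol.R_power_int) (use chart_inj[OF c(1) _ c(2)] in auto)
  have "d_z c ?g p = deriv (?g \<circ> chart_inv c) ?z"
    by (rule d_holomorphic(2)[OF g c(1)]) (use c in blast)
  also have "\<dots> = of_int n * (?z - snd c x) powi (n - 1)"
  proof (rule DERIV_imp_deriv, rule has_field_derivative_transform_within_open)
    show "((\<lambda>z. (z - snd c x) powi n) has_field_derivative of_int n * (?z - snd c x) powi (n - 1)) (at ?z)"
      using ne by (auto intro!: derivative_eq_intros)
    show "open (snd c ` fst c)" by (rule open_chart_image'[OF c(1)])
    show "?z \<in> snd c ` fst c" using c(3) by blast
    show "(z - snd c x) powi n = (?g \<circ> chart_inv c) z" if "z \<in> snd c ` fst c" for z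
      using chart_inv_right[OF c(1) that] by simp
  qed
  finally show ?thesis using ne by (simp add: power_int_diff field_simps)
qed

text \<open>Two logarithmic forms dw/w and dw'/w' at y differ by a factor whose value at y is 1;
  this is the reason why a residue does not depend on the chart.\<close>

lemma log_chart_change:
  assumes d: "d \<in> X" "y \<in> fst d" and d': "d' \<in> X" "y \<in> fst d'"
  obtains \<kappa> where "holomorphic_fun X (fst d \<inter> fst d') \<kappa>" "\<kappa> y = 1"
    "\<forall>q\<in>fst d \<inter> fst d'. (snd d' q - snd d' y) * chart_jacobian d' d id q = \<kappa> q * (snd d q - snd d y)"
proof -
  let ?N = "fst d \<inter> fst d'"
  have o: "open ?N" using open_chart d(1) d'(1) by blast
  have g: "holomorphic_fun X ?N (\<lambda>q. snd d' q - snd d' y)"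
    by (rule hol.R_diff[OF hol.R_subset[OF holomorphic_chart[OF d'(1)] o] hol.R_const[OF o]]) blast
  obtain h where h: "holomorphic_fun X ?N h" "\<forall>q\<in>?N. snd d' q - snd d' y = (snd d q - snd d y) * h q"
    by (rule divide_coordinate[OF g d(1) Int_lower1, of y]) (use d d' in auto)
  have "(h \<longlongrightarrow> h y) (at y)" using holomorphic_isCont[OF h(1), of y] d d' by (simp add: isCont_def)
  moreover have "(h \<longlongrightarrow> chart_jacobian d d' id y) (at y)"
  proof (rule Lim_transform_eventually[OF chart_ratio_limit[OF d(1) d'(1) d(2) d'(2)]])
    have yN: "y \<in> ?N" using d d' by blast
    show "\<forall>\<^sub>F p in at y. (snd d' p - snd d' y) / (snd d p - snd d y) = h p"
      using eventually_in_open[OF o yN]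
    proof eventually_elim
      case (elim p)
      then have "snd d p - snd d y \<noteq> 0" using chart_inj[OF d(1) _ d(2)] by auto
      then show ?case using h(2) elim by simp
    qed
  qed
  ultimately have hy: "h y = chart_jacobian d d' id y" by (rule tendsto_unique[OF at_neq_bot])
  have "holomorphic_fun X ?N (chart_jacobian d' d id)"
    by (rule hol.R_subset[OF self.holomorphic_jacobian[OF d'(1) d(1)] o]) auto
  from hol.R_mult[OF h(1) this] show thesis
  proof (rule that)
    show "h y * chart_jacobian d' d id y = 1"
      using self.jacobian_change_source[OF d(1) d'(1) d(1) d(2) d'(2)] d(2) jacobian_self[OF d] by (simp add: hy)
    show "\<forall>q\<in>?N. (snd d' q - snd d' y) * chart_jacobian d' d id q = h q * chart_jacobian d' d id q * (snd d q - snd d y)"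
      using h(2) by (simp add: mult_ac)
  qed
qed

end

text \<open>The common setting for Higgs field (\<alpha> = 0) and connection (\<alpha> = 1). The
  assumption \<open>residue\<close> says that the (1,0) part has at most a simple pole on E with a
  residue preserving the flag; it is phrased through the operator A, and with the value v
  existential, so that both cases are instances of it.\<close>

locale log_pullback = branched_map Y X f + pullback_operator Y X f \<alpha> "- D" VB A
  for Y :: "('y::t2_space) chart set" and X :: "('x::t2_space) chart set" and f :: "'y \<Rightarrow> 'x"
    and \<alpha> :: complex and D :: "'x set" and VB :: "('x, 'n::finite) trivialisations" and A :: "('x, 'n) diffop" +
  fixes K :: "'x \<Rightarrow> complex^'n \<Rightarrow> complex^'n \<Rightarrow> complex" and E :: "('x, 'n) parabolic" and F :: "('y, 'n) parabolic"
  assumes finD: "finite D" and herm: "\<And>p. p \<notin> D \<Longrightarrow> hermitian_form (K p)"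
    and parE: "parabolic_bundle X D E"
    and rel: "\<And>V s. V \<inter> D = {} \<Longrightarrow> hol_section X (triv E) V s = dbar_hol X VB A V s"
    and pop_flat: "pop.flat"
    and residue: "\<And>V s c x. hol_section X (triv E) V s \<Longrightarrow> c \<in> X \<Longrightarrow> x \<in> V \<inter> fst c \<inter> D \<Longrightarrow>
      \<exists>v N. x \<in> N \<and> N \<subseteq> V \<inter> fst c \<and> N \<inter> D = {x} \<and>
        hol_section X (triv E) N (\<lambda>p. if p = x then v else (snd c p - snd c x) *s fst (A s c p)) \<and>
        (\<forall>\<beta> G. (\<beta>, G) \<in> set (flag E x) \<longrightarrow> s x \<in> G \<longrightarrow> v \<in> G)"
    and pull: "is_pullback_parabolic Y X D f E F"
begin

abbreviation "B \<equiv> f -` D"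

sublocale tE: sheaf_bundle "holomorphic_fun X" UNIV "triv E"
  using parE by unfold_locales (simp add: parabolic_bundle_def)

lemma parF: "parabolic_bundle Y B F"
  using pull by (simp add: is_pullback_parabolic_def)

sublocale tF: sheaf_bundle "holomorphic_fun Y" UNIV "triv F"
  using parF by unfold_locales (simp add: parabolic_bundle_def)

lemma open_compl: "open (- D)" "open (- B)"
proof -
  show "open (- D)" by (rule open_Compl, rule finite_imp_closed, rule finD)
  from vimage_open[OF this] show "open (- B)" by (simp add: vimage_Compl)
qed

lemma relY: "V \<inter> B = {} \<Longrightarrow> hol_section Y (triv F) V s = dbar_hol Y PE PA V s"
proof -
  assume V: "V \<inter> B = {}"
  have "hol_section Y (triv F) V s = hol_section Y (pullback_bundle f (triv E)) V s"
    using pull V by (simp add: is_pullback_parabolic_def)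
  also have "\<dots> = dbar_hol Y PE PA V s"
    by (rule dbar_hol_triv(2)[OF tE.is_vector_bundle refl open_compl(1) rel V])
  finally show ?thesis .
qed

lemma smooth_off_B: "hol_section Y (triv F) V s \<Longrightarrow> open M \<Longrightarrow> M \<subseteq> V - B \<Longrightarrow> smooth_section Y PE M s"
proof -
  assume s: "hol_section Y (triv F) V s" and M: "open M" "M \<subseteq> V - B"
  have "hol_section Y (triv F) M s" by (rule tF.section_subset[OF s M(1)]) (use M in blast)
  moreover have "M \<inter> B = {}" using M by blast
  ultimately show ?thesis using relY[of M s] pop.dbar_hol_smooth by simp
qed

text \<open>In the twisted frame the pulled back residue R gets entries
  \<open>w\<^sup>k\<^sup>i\<^sup>-\<^sup>k\<^sup>j f\<^sup>*R\<^sub>i\<^sub>j\<close>. A negative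
  exponent means a i < a j, where R vanishes at x. An off-diagonal entry that is nonzero at y has
  \<open>k\<^sub>i = k\<^sub>j\<close> and a i \<ge> a j, and for equal integer parts the order of
  the weights is that of the fractional parts.\<close>

lemma coefficient_matrix:
  assumes y: "y \<in> B"
  obtains d V b a' V' Nm where "d \<in> Y" "split_at Y B F (K \<circ> f) y V b a'" "open V'" "y \<in> V'" "V' \<subseteq> V \<inter> fst d"
    "\<forall>i j. holomorphic_fun Y V' (Nm i j)"
    "\<forall>j. \<forall>q\<in>V' - {y}. (snd d q - snd d y) *s fst (PA (b j) d q) = comb b (\<lambda>i. Nm i j) q"
    "\<forall>i j. Nm i j y \<noteq> 0 \<longrightarrow> a' j \<le> a' i"
proof -
  have fy: "f y \<in> D" using y by simp
  have "\<forall>y \<in> B. \<exists>U e a V b. \<exists>d\<in>Y.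
        parabolic_splitting X D E (f y) U e a \<and> y \<in> V \<and> V \<subseteq> f -` U \<inter> fst d \<and>
        parabolic_splitting Y B F y V b (\<lambda>j. frac (real (ramification y) * a j)) \<and>
        (\<forall>j. \<forall>q \<in> V - {y}.
           b j q = (snd d q - snd d y) powi (- \<lfloor>real (ramification y) * a j\<rfloor>) *s e j (f q))"
    using pull unfolding is_pullback_parabolic_def by (elim conjE)
  from this[rule_format, OF y] obtain U e a V b d where d: "d \<in> Y"
    and sX: "parabolic_splitting X D E (f y) U e a" and V: "y \<in> V" "V \<subseteq> f -` U \<inter> fst d"
    and sY: "parabolic_splitting Y B F y V b (\<lambda>j. frac (real (ramification y) * a j))"
    and b0: "\<forall>j. \<forall>q \<in> V - {y}.
           b j q = (snd d q - snd d y) powi (- \<lfloor>real (ramification y) * a j\<rfloor>) *s e j (f q)"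
    by (elim exE bexE conjE) (rule that)
  let ?m = "real (ramification y)" and ?x = "f y"
  define k where "k j = \<lfloor>?m * a j\<rfloor>" for j
  define a' where "a' j = frac (?m * a j)" for j
  define w where "w q = snd d q - snd d y" for q
  have b: "b j q = w q powi (- k j) *s e j (f q)" if "q \<in> V - {y}" for j q
    using b0 that by (simp add: w_def k_def)
  interpret SX: split_at X D E K ?x U e a
    using parE herm fy finite_isolated[OF finD fy] sX by unfold_locales
  have SYi: "split_at Y B F (K \<circ> f) y V b a'"
    using parF herm y isolated_preimage[OF finD y] sY unfolding a'_def[abs_def] by unfold_locales auto
  then interpret SY: split_at Y B F "K \<circ> f" y V b a' .
  have m: "1 \<le> ?m" using ramification_pos[of y] by simp
  \<comment> \<open>The upper bound m - 1 comes from a j < 1; it is the margin that keeps the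
    entries with negative exponent of positive order.\<close>
  have k_bounds: "0 \<le> k j" "real_of_int (k j) \<le> ?m - 1" for j
  proof -
    show "0 \<le> k j" unfolding k_def using SX.a_bounds(1)[of j] by simp
    have "?m * a j < ?m" using SX.a_bounds(2)[of j] m by simp
    then have "k j < int (ramification y)" unfolding k_def by (simp add: floor_less_iff)
    then show "real_of_int (k j) \<le> ?m - 1" by linarith
  qed
  have k_mono: "k j \<le> k i" if "a j \<le> a i" for i j
    unfolding k_def using that by (intro floor_mono mult_left_mono) auto
  obtain c where c: "c \<in> X" "?x \<in> fst c" by (rule X.chart_at)
  have dy: "y \<in> fst d" using V by blast
  have "\<forall>j. \<exists>v N. ?x \<in> N \<and> N \<subseteq> U \<inter> fst c \<and> N \<inter> D = {?x} \<and>
        hol_section X (triv E) N (\<lambda>p. if p = ?x then v else (snd c p - snd c ?x) *s fst (A (e j) c p)) \<and>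
        (\<forall>\<beta> G. (\<beta>, G) \<in> set (flag E ?x) \<longrightarrow> e j ?x \<in> G \<longrightarrow> v \<in> G)"
    using residue[OF SX.sectionU c(1), of ?x] c(2) SX.xU fy by blast
  from choice[OF this] obtain v where "\<forall>j. \<exists>N. ?x \<in> N \<and> N \<subseteq> U \<inter> fst c \<and> N \<inter> D = {?x} \<and>
        hol_section X (triv E) N (\<lambda>p. if p = ?x then v j else (snd c p - snd c ?x) *s fst (A (e j) c p)) \<and>
        (\<forall>\<beta> G. (\<beta>, G) \<in> set (flag E ?x) \<longrightarrow> e j ?x \<in> G \<longrightarrow> v j \<in> G)" ..
  from choice[OF this] obtain Nn where Nn: "\<forall>j. ?x \<in> Nn j \<and> Nn j \<subseteq> U \<inter> fst c \<and> Nn j \<inter> D = {?x} \<and>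
        hol_section X (triv E) (Nn j) (\<lambda>p. if p = ?x then v j else (snd c p - snd c ?x) *s fst (A (e j) c p)) \<and>
        (\<forall>\<beta> G. (\<beta>, G) \<in> set (flag E ?x) \<longrightarrow> e j ?x \<in> G \<longrightarrow> v j \<in> G)" ..
  define \<rho> where "\<rho> j p = (if p = ?x then v j else (snd c p - snd c ?x) *s fst (A (e j) c p))" for j p
  have \<rho>: "hol_section X (triv E) (Nn j) (\<rho> j)" for j using Nn unfolding \<rho>_def[abs_def] by blast
  have vflag: "v j \<in> G" if "(\<beta>, G) \<in> set (flag E ?x)" "e j ?x \<in> G" for j \<beta> G using Nn that by blast
  define N0 where "N0 = (\<Inter>j. Nn j)"
  have Nj: "?x \<in> Nn j" "Nn j \<subseteq> U \<inter> fst c" for j using Nn by blast+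
  have N0_sub: "N0 \<subseteq> Nn j" for j unfolding N0_def by blast
  have "open N0" unfolding N0_def by (intro open_INT ballI tE.section_open[OF \<rho>]) simp
  moreover have "?x \<in> N0" unfolding N0_def using Nj(1) by blast
  moreover have "N0 \<subseteq> U \<inter> fst c" using N0_sub Nj(2) by (rule subset_trans)
  ultimately have N0: "open N0" "?x \<in> N0" "N0 \<subseteq> U \<inter> fst c" "\<And>j. N0 \<subseteq> Nn j"
    using N0_sub by blast+
  have eN: "regular_frame (holomorphic_fun X) (triv E) N0 e"
    by (rule tE.frame_subset[OF SX.frameU N0(1)]) (use N0 in blast)
  define Rr where "Rr i j = coords e (\<rho> j) i" for i j
  have Rr: "holomorphic_fun X N0 (Rr i j)" for i j
    unfolding Rr_def by (rule tE.R_coords[OF eN tE.section_subset[OF \<rho> N0(1,4)]])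
  have Rr0: "Rr i j ?x = 0" if "a i < a j" for i j
  proof -
    obtain G where G: "(a j, G) \<in> set (flag E ?x)" by (rule SX.flag_at)
    have Geq: "G = vec.span {e i ?x | i. a i \<ge> a j}"
      using SX.weight_ge_flag[OF G] SX.weight_ge_span[of "a j"] by simp
    have "e j ?x \<in> G" unfolding Geq by (rule vec.span_base) auto
    from vflag[OF G this] have "v j \<in> vec.span {e i ?x | i. a i \<ge> a j}" unfolding Geq .
    then have "coords e (\<lambda>_. v j) i ?x = 0" using that unfolding SX.span_coords by simp
    then show ?thesis by (simp add: Rr_def coords_def \<rho>_def)
  qed
  obtain M \<kappa> where M: "open M" "y \<in> M" "M \<subseteq> fst d \<inter> f -` fst c" "holomorphic_fun Y M \<kappa>"
    "\<kappa> y = of_nat (ramification y)" "\<forall>q\<in>M. \<kappa> q \<noteq> 0" "\<forall>q\<in>M - {y}. f q \<noteq> f y"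
    "\<forall>q\<in>M. (snd d q - snd d y) * chart_jacobian d c f q = \<kappa> q * (snd c (f q) - snd c (f y))"
    by (rule log_derivative[OF d dy c])
  define V' where "V' = V \<inter> M \<inter> f -` N0"
  have V': "open V'" "y \<in> V'" "V' \<subseteq> V" "V' \<subseteq> M" "V' \<subseteq> f -` N0" "V' \<subseteq> fst d" "V' - {y} \<subseteq> - B"
    using SY.openU M vimage_open[OF N0(1)] N0(2) V SY.U_D by (auto simp: V'_def)
  have oP: "open (V' - {y})" using V'(1) by blast
  have w_ne: "w q \<noteq> 0" if "q \<in> V' - {y}" for q
    using Y.chart_inj[OF d _ dy, of q] V'(6) that by (auto simp: w_def)
  have w_hol: "holomorphic_fun Y V' w"
    unfolding w_def[abs_def]
    by (rule Y.hol.R_diff[OF Y.hol.R_subset[OF Y.holomorphic_chart[OF d] V'(1,6)] Y.hol.R_const[OF V'(1)]])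
  have w_powi: "holomorphic_fun Y (V' - {y}) (\<lambda>q. w q powi n)" for n
    by (rule Y.hol.R_power_int[OF Y.hol.R_subset[OF w_hol oP] w_ne]) auto
  have Rf: "holomorphic_fun Y V' (\<lambda>q. Rr i j (f q))" for i j
    by (rule Y.hol.R_subset[OF holomorphic_fun_pullback[OF Rr] V'(1,5)])
  \<comment> \<open>The two cases are the sign of the exponent. With a nonnegative one the entry is
    holomorphic as it stands; with a negative one it is extended by 0.\<close>
  have "\<exists>h. holomorphic_fun Y V' h \<and> (\<forall>q\<in>V' - {y}. h q = Rr i j (f q) * w q powi (k i - k j)) \<and> (h y \<noteq> 0 \<longrightarrow> a' j \<le> a' i)" for i j
  proof (cases "k j \<le> k i")
    case True
    let ?h = "\<lambda>q. Rr i j (f q) * w q ^ nat (k i - k j)"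
    have "holomorphic_fun Y V' ?h" by (rule Y.hol.R_mult[OF Rf Y.hol.R_power[OF w_hol]])
    moreover have "\<forall>q\<in>V' - {y}. ?h q = Rr i j (f q) * w q powi (k i - k j)" using True by (simp add: power_int_def)
    moreover have "a' j \<le> a' i" if "?h y \<noteq> 0"
    proof -
      have "w y = 0" by (simp add: w_def)
      then have "k i = k j" using that True by (cases "nat (k i - k j)") auto
      moreover have "a j \<le> a i" using Rr0[of i j] that by (cases "a i < a j") auto
      then have "?m * a j \<le> ?m * a i" by (intro mult_left_mono) auto
      ultimately show ?thesis by (simp add: a'_def frac_def k_def)
    qed
    ultimately show ?thesis by (intro exI[of _ ?h]) blast
  next
    case False
    then have aa: "a i < a j" using k_mono[of j i] by (cases "a i < a j") auto
    let ?H = "\<lambda>q. Rr i j (f q) * w q powi (k i - k j)"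
    have hol: "holomorphic_fun Y (V' - {y}) ?H"
      by (rule Y.hol.R_mult[OF Y.hol.R_subset[OF Rf oP] w_powi]) auto
    \<comment> \<open>A zero at x of order at least 1 becomes one at y of order at least m. The
      negative power takes away at most m - 1, so the product keeps order at least 1.\<close>
    have "(\<lambda>p. cmod (Rr i j p)) \<in> O[at ?x](\<lambda>p. rad c ?x p powr 1)"
      by (rule X.vanishing_bigo_rad[OF N0(2) c Rr Rr0[OF aa]])
    from landau_o.big.compose[OF this filterlim_at_image]
    have "(\<lambda>q. cmod (Rr i j (f q))) \<in> O[at y](\<lambda>q. rad c ?x (f q) powr 1)" .
    from landau_o.big.trans[OF this bigthetaD1[OF rad_pullback[OF d dy c]]]
    have o1: "(\<lambda>q. cmod (Rr i j (f q))) \<in> O[at y](\<lambda>q. rad d y q powr (?m * 1))" .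
    have o2: "(\<lambda>q. cmod (w q powi (k i - k j))) \<in> O[at y](\<lambda>q. rad d y q powr of_int (k i - k j))"
      unfolding w_def by (rule bigthetaD1[OF Y.coordinate_powi_bigtheta[OF d dy]])
    have "(\<lambda>q. cmod (?H q)) \<in> O[at y](\<lambda>q. rad d y q powr (?m * 1 + of_int (k i - k j)))"
      using Y.rad_powr_mult[OF o1 o2] by (simp add: norm_mult)
    moreover have "(\<lambda>q. rad d y q powr (?m * 1 + of_int (k i - k j))) \<in> O[at y](\<lambda>q. rad d y q powr 1)"
    proof (rule Y.rad_powr_mono[OF d dy])
      show "1 \<le> ?m * 1 + of_int (k i - k j)" using k_bounds(1)[of i] k_bounds(2)[of j] by simp
    qed
    ultimately have "(\<lambda>q. cmod (?H q)) \<in> O[at y](\<lambda>q. rad d y q powr 1)" by (rule landau_o.big.trans)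
    then have "holomorphic_fun Y V' (?H(y := 0))"
      using Y.punctured_bigo_iff(2)[OF V'(1,2) d dy hol, of 1] by simp
    then show ?thesis by (intro exI[of _ "?H(y := 0)"]) simp
  qed
  then have "\<forall>t. \<exists>h. holomorphic_fun Y V' h \<and> (\<forall>q\<in>V' - {y}. h q = Rr (fst t) (snd t) (f q) * w q powi (k (fst t) - k (snd t))) \<and>
    (h y \<noteq> 0 \<longrightarrow> a' (snd t) \<le> a' (fst t))" by blast
  from choice[OF this] obtain h where h: "\<forall>t. holomorphic_fun Y V' (h t) \<and>
    (\<forall>q\<in>V' - {y}. h t q = Rr (fst t) (snd t) (f q) * w q powi (k (fst t) - k (snd t))) \<and>
    (h t y \<noteq> 0 \<longrightarrow> a' (snd t) \<le> a' (fst t))" ..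
  \<comment> \<open>The full matrix of w times the (1,0) part: \<kappa> converts the logarithmic
    form of X into that of Y, and the diagonal term is the derivative of the twisting
    factor.\<close>
  define Nm where "Nm i j q = (if i = j then - (\<alpha> * of_int (k j)) else 0) + \<kappa> q * h (i, j) q" for i j q
  show thesis
  proof (rule that[of d V b a' V' Nm])
    show "V' \<subseteq> V \<inter> fst d" using V' by blast
    show "\<forall>i j. holomorphic_fun Y V' (Nm i j)"
      unfolding Nm_def[abs_def]
      using h by (intro allI Y.hol.R_add Y.hol.R_mult Y.hol.R_const Y.hol.R_subset[OF M(4) V'(1,4)] V'(1)) blast
    show "\<forall>i j. Nm i j y \<noteq> 0 \<longrightarrow> a' j \<le> a' i"
    proof (intro allI impI)
      fix i j assume "Nm i j y \<noteq> 0"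
      then have "i = j \<or> h (i, j) y \<noteq> 0" by (auto simp: Nm_def)
      then show "a' j \<le> a' i" using h[rule_format, of "(i, j)"] by auto
    qed
    show "\<forall>j. \<forall>q\<in>V' - {y}. (snd d q - snd d y) *s fst (PA (b j) d q) = comb b (\<lambda>i. Nm i j) q"
    proof (intro allI ballI)
      fix j q assume q: "q \<in> V' - {y}"
      let ?P = "V' - {y}" and ?g = "\<lambda>q. w q powi (- k j)"
      let ?J = "chart_jacobian d c f q" and ?Ae = "fst (A (e j) c (f q))"
      have fq: "f q \<in> fst c" "f q \<noteq> ?x" "q \<in> fst d" "f q \<in> U - D" "f q \<in> N0" using q V' M(3,7) N0 by auto
      have oU: "open (U - D)" using SX.openU open_compl(1) by (simp add: Diff_eq open_Int)
      have "hol_section X (triv E) (U - D) (e j)" by (rule tE.section_subset[OF SX.sectionU oU]) blast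
      moreover have "(U - D) \<inter> D = {}" by blast
      ultimately have ej: "smooth_section X VB (U - D) (e j)" using rel[of "U - D" "e j"] dbar_hol_smooth by simp
      have efP: "smooth_section Y PE ?P (\<lambda>q. e j (f q))"
        by (rule psm.section_subset[OF smooth_map.section_pullback[OF smooth_bundle ej] oP]) (use V'(5,7) N0(3) in blast)
      have gP: "smooth_fun Y ?P ?g" by (rule Y.holomorphic_imp_smooth[OF w_powi])
      have geP: "smooth_section Y PE ?P (\<lambda>q. ?g q *s e j (f q))" by (rule psm.section_scale[OF gP efP])
      have geb: "?g q *s e j (f q) = b j q" if "q \<in> ?P" for q using b[of q j] that V'(3) by auto
      have bP: "smooth_section Y PE ?P (b j)" by (rule psm.section_cong[OF geP geb])
      have "PA (b j) d q = PA (\<lambda>q. ?g q *s e j (f q)) d q"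
        by (rule pop.A_cong[OF geP bP geb d q fq(3), symmetric])
      then have "fst (PA (b j) d q) = ?g q *s fst (PA (\<lambda>q. e j (f q)) d q) + (\<alpha> * d_z d ?g q) *s e j (f q)"
        using pop.A_scale(1)[OF gP efP d q fq(3)] by simp
      also have "fst (PA (\<lambda>q. e j (f q)) d q) = ?J *s ?Ae"
        by (rule PA_pullback_section(1)[OF ej c(1) fq(1,4) d fq(3)])
      finally have "w q *s fst (PA (b j) d q) = (?g q * (w q * ?J)) *s ?Ae + (\<alpha> * (w q * d_z d ?g q)) *s e j (f q)"
        by (simp add: vector_smult_assoc vector_add_ldistrib mult_ac)
      also have "w q * d_z d ?g q = of_int (- k j) * ?g q"
        unfolding w_def using Y.coordinate_powi_d_z[OF d dy fq(3), of "- k j"] q by blast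
      also have "w q * ?J = \<kappa> q * (snd c (f q) - snd c ?x)" unfolding w_def using M(8) q V'(4) by blast
      also have "(?g q * (\<kappa> q * (snd c (f q) - snd c ?x))) *s ?Ae = (?g q * \<kappa> q) *s \<rho> j (f q)"
        by (simp only: \<rho>_def fq(2) if_False vector_smult_assoc mult.assoc)
      also have "\<rho> j (f q) = comb e (\<lambda>i. Rr i j) (f q)"
        unfolding Rr_def by (rule comb_coords[symmetric], rule SX.invU) (use fq(4) in blast)
      also have "(?g q * \<kappa> q) *s comb e (\<lambda>i. Rr i j) (f q) = (\<Sum>i\<in>UNIV. (\<kappa> q * h (i, j) q) *s b i q)"
        unfolding comb_def vec.scale_sum_right
      proof (rule sum.cong[OF refl])
        fix i
        have bi: "b i q = w q powi (- k i) *s e i (f q)" by (rule b) (use q V'(3) in blast)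
        \<comment> \<open>Splits the twist of the j-th vector into the twist of the i-th vector,
          absorbed in b i, and the exponent difference carried by the matrix entry.\<close>
        have pw: "w q powi (k i - k j) * w q powi (- k i) = w q powi (- k j)"
          using power_int_add[of "w q" "k i - k j" "- k i"] w_ne[OF q] by simp
        have "?g q * \<kappa> q * Rr i j (f q) = \<kappa> q * (Rr i j (f q) * w q powi (k i - k j)) * w q powi (- k i)"
          by (simp only: pw[symmetric] mult_ac)
        moreover have "h (i, j) q = Rr i j (f q) * w q powi (k i - k j)" using h[rule_format, of "(i, j)"] q by simp
        ultimately show "(?g q * \<kappa> q) *s (Rr i j (f q) *s e i (f q)) = (\<kappa> q * h (i, j) q) *s b i q"
          unfolding bi vector_smult_assoc by simp
      qed
      also have "(\<alpha> * (of_int (- k j) * ?g q)) *s e j (f q) = - (\<alpha> * of_int (k j)) *s b j q"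
        unfolding geb[OF q, symmetric] vector_smult_assoc by simp
      also have "\<dots> = (\<Sum>i\<in>UNIV. (if i = j then - (\<alpha> * of_int (k j)) else 0) *s b i q)"
        by (simp add: if_distrib[of "\<lambda>z. z *s b _ q"] if_distribR sum.delta' cong: if_cong)
      also have "(\<Sum>i\<in>UNIV. (\<kappa> q * h (i, j) q) *s b i q) + \<dots> = comb b (\<lambda>i. Nm i j) q"
        by (simp add: comb_def Nm_def vector_sadd_rdistrib sum.distrib)
      finally show "(snd d q - snd d y) *s fst (PA (b j) d q) = comb b (\<lambda>i. Nm i j) q" by (simp add: w_def)
    qed
  qed (use d SYi V' in blast)+
qed

end

context log_pullback
begin

definition residue_matrix :: "'y \<Rightarrow> complex^'n^'n \<Rightarrow> bool" where
  "residue_matrix y R \<longleftrightarrow> (\<forall>(\<beta>, G) \<in> set (flag F y). \<forall>v\<in>G. R *v v \<in> G) \<and>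
     (\<forall>V s d. hol_section Y (triv F) V s \<longrightarrow> d \<in> Y \<longrightarrow> y \<in> V \<inter> fst d \<longrightarrow>
        (\<exists>N. y \<in> N \<and> N \<subseteq> V \<inter> fst d \<and> N \<inter> B = {y} \<and>
           hol_section Y (triv F) N (\<lambda>q. if q = y then R *v s y else (snd d q - snd d y) *s fst (PA s d q))))"

text \<open>By the Leibniz rule, w times the (1,0) part of A s has in the frame b the coordinates w
  \<alpha> du + N u, where u are those of s. At y the first summand disappears, so the value depends
  linearly on s y alone.\<close>

lemma residue_matrix_exists:
  assumes y: "y \<in> B"
  shows "\<exists>R. residue_matrix y R"
proof -
  obtain d V b a V' Nm where d: "d \<in> Y" and S: "split_at Y B F (K \<circ> f) y V b a"
    and V': "open V'" "y \<in> V'" "V' \<subseteq> V \<inter> fst d" and Nm: "\<forall>i j. holomorphic_fun Y V' (Nm i j)"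
    and eq: "\<forall>j. \<forall>q\<in>V' - {y}. (snd d q - snd d y) *s fst (PA (b j) d q) = comb b (\<lambda>i. Nm i j) q"
    and Nm0: "\<forall>i j. Nm i j y \<noteq> 0 \<longrightarrow> a j \<le> a i"
    by (rule coefficient_matrix[OF y])
  interpret S: split_at Y B F "K \<circ> f" y V b a by (rule S)
  let ?b = "frame_matrix b y" and ?N = "(\<chi> i j. Nm i j y) :: complex^'n^'n"
  define R where "R = ?b ** (?N ** matrix_inv ?b)"
  have Rv: "R *v v = ?b *v (?N *v (matrix_inv ?b *v v))" for v by (simp add: R_def matrix_vector_mul_assoc)
  have dy: "y \<in> fst d" using V' by blast
  have VB: "V' \<inter> B = {y}" using V' S.U_D by blast
  have bV': "regular_frame (holomorphic_fun Y) (triv F) V' b"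
    by (rule tF.frame_subset[OF S.frameU V'(1)]) (use V' in blast)
  have "R *v v \<in> G" if G: "(\<beta>, G) \<in> set (flag F y)" and v: "v \<in> G" for \<beta> G v
  proof -
    have Geq: "G = vec.span {b j y | j. \<beta> \<le> a j}" using S.weight_ge_flag[OF G] S.weight_ge_span[of \<beta>] by simp
    have v0: "(matrix_inv ?b *v v) $ j = 0" if "\<not> \<beta> \<le> a j" for j
      using v that unfolding Geq S.span_coords by (simp add: coords_def)
    have "coords b (\<lambda>_. R *v v) i y = 0" if "\<not> \<beta> \<le> a i" for i
    proof -
      have "coords b (\<lambda>_. R *v v) i y = (\<Sum>j\<in>UNIV. Nm i j y * (matrix_inv ?b *v v) $ j)"
        unfolding coords_def Rv matrix_inv_vec(2)[OF S.invU[OF S.xU]] by (simp add: matrix_vector_mult_def)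
      also have "\<dots> = 0"
      proof (rule sum.neutral, rule ballI)
        fix j
        show "Nm i j y * (matrix_inv ?b *v v) $ j = 0"
        proof (cases "\<beta> \<le> a j")
          case True
          \<comment> \<open>A weight a j at least \<beta> and a weight a i below it cannot be linked
            by the matrix, which at y does not lower weights.\<close>
          then have "Nm i j y = 0" using Nm0[rule_format, of i j] that by (cases "Nm i j y = 0") auto
          then show ?thesis by simp
        qed (simp add: v0)
      qed
      finally show ?thesis .
    qed
    then show ?thesis unfolding Geq S.span_coords by blast
  qed
  then have flags: "\<forall>(\<beta>, G) \<in> set (flag F y). \<forall>v\<in>G. R *v v \<in> G" by blast
  have near: "\<exists>N. y \<in> N \<and> N \<subseteq> M0 \<inter> fst d \<and> N \<inter> B = {y} \<and>
      hol_section Y (triv F) N (\<lambda>q. if q = y then R *v s y else (snd d q - snd d y) *s fst (PA s d q))"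
    if s: "hol_section Y (triv F) M0 s" "y \<in> M0" for M0 s
  proof -
    let ?M = "M0 \<inter> V'" and ?u = "coords b s" and ?w = "\<lambda>q. snd d q - snd d y"
    have M: "open ?M" "y \<in> ?M" "?M \<subseteq> fst d" using tF.section_open[OF s(1)] V' s(2) by auto
    have oP: "open (?M - {y})" using M(1) by blast
    have PB: "?M - {y} \<subseteq> - B" using VB by blast
    have bM: "regular_frame (holomorphic_fun Y) (triv F) ?M b" by (rule tF.frame_subset[OF bV' M(1)]) blast
    have sM: "hol_section Y (triv F) ?M s" by (rule tF.section_subset[OF s(1) M(1)]) blast
    have u: "holomorphic_fun Y ?M (?u j)" for j by (rule tF.R_coords[OF bM sM])
    have NmM: "holomorphic_fun Y ?M (Nm i j)" for i j
      by (rule Y.hol.R_subset[OF Nm[rule_format] M(1)]) blast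
    have w: "holomorphic_fun Y ?M ?w"
      by (rule Y.hol.R_diff[OF Y.hol.R_subset[OF Y.holomorphic_chart[OF d] M(1,3)] Y.hol.R_const[OF M(1)]])
    have du: "holomorphic_fun Y ?M (d_z d (?u j))" for j
      using Y.holomorphic_fun_d_z[OF u d] M(3) by (simp add: Int_absorb2)
    \<comment> \<open>The coordinates, in the frame b, of the section across y; being holomorphic at
      y they show at once that the pole is at most simple.\<close>
    define r where "r i q = ?w q * (\<alpha> * d_z d (?u i) q) + (\<Sum>j\<in>UNIV. Nm i j q * ?u j q)" for i q
    have r: "holomorphic_fun Y ?M (r i)" for i
      unfolding r_def[abs_def]
      by (intro Y.hol.R_add Y.hol.R_mult Y.hol.R_sum Y.hol.R_const w du u NmM M(1))
    have "hol_section Y (triv F) ?M (comb b r)" by (rule tF.section_comb[OF bM r])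
    then have "hol_section Y (triv F) ?M (\<lambda>q. if q = y then R *v s y else ?w q *s fst (PA s d q))"
    proof (rule tF.section_cong)
      fix q assume q: "q \<in> ?M"
      show "comb b r q = (if q = y then R *v s y else ?w q *s fst (PA s d q))"
      proof (cases "q = y")
        case True
        have "R *v s y = ?b *v (\<chi> i. r i y)"
          unfolding Rv by (rule arg_cong[where f = "\<lambda>z. ?b *v z"])
            (simp add: vec_eq_iff r_def coords_def matrix_vector_mult_def[of ?N])
        also have "\<dots> = comb b r y" by (simp add: frame_matrix_vec comb_def)
        finally show ?thesis using True by simp
      next
        case False
        let ?P = "?M - {y}"
        have qP: "q \<in> ?P" "q \<in> fst d" using q False M(3) by auto
        have bj: "smooth_section Y PE ?P (b j)" for j
          by (rule smooth_off_B[OF _ oP, of ?M]) (use bM PB in \<open>auto simp: regular_frame_def\<close>)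
        have sP: "smooth_section Y PE ?P s" by (rule smooth_off_B[OF sM oP]) (use PB in blast)
        have uP: "smooth_fun Y ?P (?u j)" for j
          by (rule Y.holomorphic_imp_smooth[OF Y.hol.R_subset[OF u oP]]) blast
        have cs: "s q = comb b ?u q" if "q \<in> ?P" for q
          by (rule comb_coords[symmetric]) (use bM that in \<open>simp add: regular_frame_def\<close>)
        have cP: "smooth_section Y PE ?P (comb b ?u)" by (rule psm.section_cong[OF sP cs])
        have "fst (PA s d q) = (\<Sum>j\<in>UNIV. (\<alpha> * d_z d (?u j) q) *s b j q + ?u j q *s fst (PA (b j) d q))"
          using pop.A_cong[OF sP cP cs d qP] pop.A_comb(1)[OF oP bj uP d qP] by simp
        then have "?w q *s fst (PA s d q) =
            (\<Sum>j\<in>UNIV. (?w q * (\<alpha> * d_z d (?u j) q)) *s b j q + ?u j q *s (?w q *s fst (PA (b j) d q)))"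
          by (simp only: vec.scale_sum_right vector_add_ldistrib vector_smult_assoc mult.commute[of "?w q"])
        also have "\<dots> = (\<Sum>j\<in>UNIV. (?w q * (\<alpha> * d_z d (?u j) q)) *s b j q + ?u j q *s comb b (\<lambda>i. Nm i j) q)"
        proof (rule sum.cong[OF refl])
          fix j
          have "?w q *s fst (PA (b j) d q) = comb b (\<lambda>i. Nm i j) q" using eq qP(1) by blast
          then show "(?w q * (\<alpha> * d_z d (?u j) q)) *s b j q + ?u j q *s (?w q *s fst (PA (b j) d q)) =
            (?w q * (\<alpha> * d_z d (?u j) q)) *s b j q + ?u j q *s comb b (\<lambda>i. Nm i j) q" by simp
        qed
        also have "\<dots> = (\<Sum>j\<in>UNIV. (?w q * (\<alpha> * d_z d (?u j) q)) *s b j q) +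
            (\<Sum>j\<in>UNIV. \<Sum>i\<in>UNIV. (Nm i j q * ?u j q) *s b i q)"
          by (simp add: sum.distrib comb_def vec.scale_sum_right mult.commute)
        also have "(\<Sum>j\<in>UNIV. \<Sum>i\<in>UNIV. (Nm i j q * ?u j q) *s b i q) = (\<Sum>i\<in>UNIV. (\<Sum>j\<in>UNIV. Nm i j q * ?u j q) *s b i q)"
          unfolding vec.scale_sum_left by (rule sum.swap)
        also have "(\<Sum>j\<in>UNIV. (?w q * (\<alpha> * d_z d (?u j) q)) *s b j q) + \<dots> = comb b r q"
          by (simp only: comb_def r_def vector_sadd_rdistrib sum.distrib)
        finally show ?thesis using False by simp
      qed
    qed
    then show ?thesis using M VB by (intro exI[of _ ?M]) auto
  qed
  have "\<exists>N. y \<in> N \<and> N \<subseteq> M0 \<inter> fst d' \<and> N \<inter> B = {y} \<and>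
      hol_section Y (triv F) N (\<lambda>q. if q = y then R *v s y else (snd d' q - snd d' y) *s fst (PA s d' q))"
    if s: "hol_section Y (triv F) M0 s" and d': "d' \<in> Y" "y \<in> M0 \<inter> fst d'" for M0 s d'
  proof -
    let ?\<sigma> = "\<lambda>q. if q = y then R *v s y else (snd d q - snd d y) *s fst (PA s d q)"
    have y': "y \<in> M0" "y \<in> fst d'" using d' by auto
    obtain N where N: "y \<in> N" "N \<subseteq> M0 \<inter> fst d" "N \<inter> B = {y}" "hol_section Y (triv F) N ?\<sigma>"
      using near[OF s y'(1)] by (elim exE conjE) (rule that)
    obtain \<kappa> where \<kappa>: "holomorphic_fun Y (fst d \<inter> fst d') \<kappa>" "\<kappa> y = 1"
      "\<forall>q\<in>fst d \<inter> fst d'. (snd d' q - snd d' y) * chart_jacobian d' d id q = \<kappa> q * (snd d q - snd d y)"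
      by (rule Y.log_chart_change[OF d dy d'(1) y'(2)])
    let ?N = "N \<inter> fst d'"
    have o: "open ?N" using tF.section_open[OF N(4)] Y.open_chart[OF d'(1)] by blast
    have "hol_section Y (triv F) ?N (\<lambda>q. \<kappa> q *s ?\<sigma> q)"
      by (rule tF.section_scale[OF Y.hol.R_subset[OF \<kappa>(1) o] tF.section_subset[OF N(4) o]]) (use N in auto)
    then have "hol_section Y (triv F) ?N (\<lambda>q. if q = y then R *v s y else (snd d' q - snd d' y) *s fst (PA s d' q))"
    proof (rule tF.section_cong)
      fix q assume q: "q \<in> ?N"
      show "\<kappa> q *s ?\<sigma> q = (if q = y then R *v s y else (snd d' q - snd d' y) *s fst (PA s d' q))"
      proof (cases "q = y")
        case True then show ?thesis by (simp add: \<kappa>(2))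
      next
        case False
        have oM: "open (M0 - B)" using tF.section_open[OF s] open_compl(2) by (simp add: Diff_eq open_Int)
        have sS: "smooth_section Y PE (M0 - B) s" by (rule smooth_off_B[OF s oM]) blast
        have qq: "q \<in> M0 - B" "q \<in> fst d" "q \<in> fst d'" using q False N(2,3) by auto
        have PA': "fst (PA s d' q) = chart_jacobian d' d id q *s fst (PA s d q)"
          by (rule pop.A_chart(1)[OF sS d'(1) d qq(1,3,2)])
        have ratio: "(snd d' q - snd d' y) * chart_jacobian d' d id q = \<kappa> q * (snd d q - snd d y)"
          using \<kappa>(3) qq by blast
        show ?thesis by (simp only: False if_False PA' vector_smult_assoc ratio)
      qed
    qed
    then show ?thesis using N y'(2) by (intro exI[of _ ?N]) auto
  qed
  then have "residue_matrix y R" unfolding residue_matrix_def using flags by blast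
  then show ?thesis ..
qed

definition Res :: "'y \<Rightarrow> complex^'n^'n" where "Res y = (SOME R. residue_matrix y R)"

lemma Res: "y \<in> B \<Longrightarrow> residue_matrix y (Res y)"
  unfolding Res_def by (rule someI_ex[OF residue_matrix_exists])

lemma Res_flag: "y \<in> B \<Longrightarrow> \<forall>(\<beta>, G) \<in> set (flag F y). \<forall>v\<in>G. Res y *v v \<in> G"
  using Res[of y] by (simp add: residue_matrix_def)

text \<open>Off B, holomorphy of the coefficients comes from flatness of the pulled back operator;
  at B it comes from the residue. The Higgs field and the connection on Y are both of the form
  \<omega>.\<close>

lemma log_form_extension:
  assumes s: "hol_section Y (triv F) V s"
    and \<omega>: "\<And>d q. d \<in> Y \<Longrightarrow> q \<in> V \<inter> fst d \<Longrightarrow> \<omega> d q = (if q \<in> B then Res q *v s q else fst (PA s d q))"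
  shows "log_form Y B (triv F) V \<omega>"
  unfolding log_form_def
proof (intro conjI ballI)
  show oV: "open V" by (rule tF.section_open[OF s])
  have oP: "open (V - B)" using oV open_compl(2) by (simp add: Diff_eq open_Int)
  have PB: "(V - B) \<inter> B = {}" by blast
  have sP: "hol_section Y (triv F) (V - B) s" by (rule tF.section_subset[OF s oP]) blast
  have sS: "smooth_section Y PE (V - B) s" by (rule smooth_off_B[OF s oP]) blast
  have dS: "dbar_hol Y PE PA (V - B) s" using relY[OF PB, of s] sP by simp
  show "\<omega> d q = (if q \<in> B then 1 else chart_jacobian d d' id q) *s \<omega> d' q"
    if "d \<in> Y" "d' \<in> Y" "q \<in> V \<inter> fst d \<inter> fst d'" for d d' q
  proof (cases "q \<in> B")
    case True then show ?thesis using \<omega>[of d q] \<omega>[of d' q] that by simp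
  next
    case False
    have "fst (PA s d q) = chart_jacobian d d' id q *s fst (PA s d' q)"
      by (rule pop.A_chart(1)[OF sS that(1,2)]) (use that(3) False in auto)
    then show ?thesis using \<omega>[of d q] \<omega>[of d' q] that False by simp
  qed
  show "hol_section Y (triv F) (V \<inter> fst d - B) (\<omega> d)" if d: "d \<in> Y" for d
  proof -
    have "dbar_hol Y PE PA ((V - B) \<inter> fst d) (\<lambda>q. fst (PA s d q))"
      using pop.flat_preserves_dbar_hol[OF pop_flat] dS d unfolding pop.preserves_dbar_hol_def by blast
    moreover have "(V - B) \<inter> fst d = V \<inter> fst d - B" by blast
    ultimately have "hol_section Y (triv F) (V \<inter> fst d - B) (\<lambda>q. fst (PA s d q))"
      using relY[of "V \<inter> fst d - B"] by auto
    then show ?thesis by (rule tF.section_cong) (use \<omega>[OF d] in auto)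
  qed
  show "\<exists>N. y \<in> N \<and> N \<subseteq> V \<inter> fst d \<and> N \<inter> B = {y} \<and>
      hol_section Y (triv F) N (\<lambda>q. if q = y then \<omega> d y else (snd d q - snd d y) *s \<omega> d q)"
    if d: "d \<in> Y" and y: "y \<in> V \<inter> fst d \<inter> B" for d y
  proof -
    have yB: "y \<in> B" and yV: "y \<in> V \<inter> fst d" using y by auto
    from Res[OF yB, unfolded residue_matrix_def, THEN conjunct2, rule_format, OF s d yV]
    obtain N where N: "y \<in> N" "N \<subseteq> V \<inter> fst d" "N \<inter> B = {y}"
      "hol_section Y (triv F) N (\<lambda>q. if q = y then Res y *v s y else (snd d q - snd d y) *s fst (PA s d q))"
      by (elim exE conjE) (rule that)
    have "hol_section Y (triv F) N (\<lambda>q. if q = y then \<omega> d y else (snd d q - snd d y) *s \<omega> d q)"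
    proof (rule tF.section_cong[OF N(4)])
      fix q assume q: "q \<in> N"
      then have "\<omega> d q = (if q \<in> B then Res q *v s q else fst (PA s d q))" by (intro \<omega>[OF d]) (use N(2) in blast)
      moreover have "q \<in> B \<longleftrightarrow> q = y" using N(3) q by blast
      ultimately show "(if q = y then Res y *v s y else (snd d q - snd d y) *s fst (PA s d q)) =
          (if q = y then \<omega> d y else (snd d q - snd d y) *s \<omega> d q)" by auto
    qed
    then show ?thesis using N(1,2,3) by blast
  qed
qed

end

section \<open>The pulled back Higgs field and connection\<close>

context branched_harmonic
begin

text \<open>The residue assumption follows from the logarithmic form of \<theta> applied to s: off D
  the Higgs field \<theta> coincides with the (1,0) part of \<open>D_theta\<close>, and at x the
  value \<theta> c x applied to s x is available as v.\<close>

lemma log_pullback_higgs: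
  assumes D: "finite D" and frames: "T.local_hol_frames" and ind: "induced_higgs X D H E \<theta>"
    and pull: "is_pullback_parabolic Y X D f E F"
  shows "log_pullback Y X f 0 D VB Dt K E F"
proof (unfold_locales)
  have par: "induced_parabolic X D H Dt E" and higgs: "parabolic_higgs_bundle X D E \<theta>"
    and \<theta>: "\<forall>c\<in>X. \<forall>p\<in>fst c - D. \<theta> c p = higgs_matrix X H c p"
    using ind unfolding induced_higgs_def by blast+
  show "finite D" by (rule D)
  show "hermitian_form (K p)" if "p \<notin> D" for p using K_form that by simp
  show "parabolic_bundle X D E" using par by (simp add: induced_parabolic_def)
  show rel: "hol_section X (triv E) V s = dbar_hol X VB Dt V s" if "V \<inter> D = {}" for V s
    using par that by (simp add: induced_parabolic_def)
  show "T.pop.flat" by (rule T.flat_pullback[OF frames preserves(1)])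
  show "is_pullback_parabolic Y X D f E F" by (rule pull)
  interpret tE: sheaf_bundle "holomorphic_fun X" UNIV "triv E"
    using par by unfold_locales (simp add: induced_parabolic_def parabolic_bundle_def)
  fix V s c x assume s: "hol_section X (triv E) V s" and c: "c \<in> X" and x: "x \<in> V \<inter> fst c \<inter> D"
  have "log_form X D (triv E) V (\<lambda>c p. \<theta> c p *v s p)"
    using higgs s unfolding parabolic_higgs_bundle_def by blast
  then have "\<exists>N. x \<in> N \<and> N \<subseteq> V \<inter> fst c \<and> N \<inter> D = {x} \<and>
      hol_section X (triv E) N (\<lambda>p. if p = x then \<theta> c x *v s x else (snd c p - snd c x) *s (\<theta> c p *v s p))"
    using c x unfolding log_form_def by simp
  then obtain N where N: "x \<in> N" "N \<subseteq> V \<inter> fst c" "N \<inter> D = {x}"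
    "hol_section X (triv E) N (\<lambda>p. if p = x then \<theta> c x *v s x else (snd c p - snd c x) *s (\<theta> c p *v s p))"
    by (elim exE conjE) (rule that)
  have "hol_section X (triv E) N (\<lambda>p. if p = x then \<theta> c x *v s x else (snd c p - snd c x) *s fst (Dt s c p))"
  proof (rule tE.section_cong[OF N(4)])
    fix p assume p: "p \<in> N"
    show "(if p = x then \<theta> c x *v s x else (snd c p - snd c x) *s (\<theta> c p *v s p)) =
      (if p = x then \<theta> c x *v s x else (snd c p - snd c x) *s fst (Dt s c p))"
    proof (cases "p = x")
      case False
      have oN: "open (N - {x})" using tE.section_open[OF N(4)] by blast
      have "hol_section X (triv E) (N - {x}) s" by (rule tE.section_subset[OF s oN]) (use N(2) in blast)
      moreover have "(N - {x}) \<inter> D = {}" using N(3) by blast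
      ultimately have sS: "smooth_section X VB (N - {x}) s" using rel[of "N - {x}" s] T.dbar_hol_smooth by simp
      have pp: "p \<in> fst c" "p \<in> N - {x}" "p \<notin> D" using p False N(2,3) by auto
      have "fst (Dt s c p) = T.higgs_at c p *v s p" by (rule T.higgs_at[OF refl c pp(1) sS pp(2)])
      then show ?thesis using \<theta> c pp False by (simp add: higgs_matrix_eq)
    qed simp
  qed
  moreover have "\<theta> c x *v s x \<in> G" if G: "(\<beta>, G) \<in> set (flag E x)" "s x \<in> G" for \<beta> G
  proof -
    have "\<forall>(\<alpha>, F)\<in>set (flag E x). \<forall>v\<in>F. \<theta> c x *v v \<in> F"
      using higgs c x unfolding parabolic_higgs_bundle_def by blast
    from bspec[OF this G(1)] G(2) show ?thesis by simp
  qed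
  ultimately show "\<exists>v N. x \<in> N \<and> N \<subseteq> V \<inter> fst c \<and> N \<inter> D = {x} \<and>
        hol_section X (triv E) N (\<lambda>p. if p = x then v else (snd c p - snd c x) *s fst (Dt s c p)) \<and>
        (\<forall>\<beta> G. (\<beta>, G) \<in> set (flag E x) \<longrightarrow> s x \<in> G \<longrightarrow> v \<in> G)"
    using N(1,2,3) by (intro exI[of _ "\<theta> c x *v s x"] exI[of _ N]) blast
qed

text \<open>As for the Higgs field, with nabla s c x as the value v. The agreement with
  \<open>D_nabla\<close> is known only off D, so s is restricted to the punctured neighbourhood
  before the two are compared.\<close>

lemma log_pullback_connection:
  assumes D: "finite D" and frames: "N.local_hol_frames" and ind: "induced_connection X D H E nabla"
    and pull: "is_pullback_parabolic Y X D f E F"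
  shows "log_pullback Y X f 1 D VB Dn K E F"
proof (unfold_locales)
  have par: "induced_parabolic X D H Dn E" and conn: "parabolic_connection X D E nabla"
    and nabla: "\<And>V s c p. V \<inter> D = {} \<Longrightarrow> hol_section X (triv E) V s \<Longrightarrow> c \<in> X \<Longrightarrow> p \<in> V \<inter> fst c \<Longrightarrow> nabla s c p = fst (Dn s c p)"
    using ind unfolding induced_connection_def by blast+
  show "finite D" by (rule D)
  show "hermitian_form (K p)" if "p \<notin> D" for p using K_form that by simp
  show "parabolic_bundle X D E" using par by (simp add: induced_parabolic_def)
  show rel: "hol_section X (triv E) V s = dbar_hol X VB Dn V s" if "V \<inter> D = {}" for V s
    using par that by (simp add: induced_parabolic_def)
  show "N.pop.flat" by (rule N.flat_pullback[OF frames preserves(2)])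
  show "is_pullback_parabolic Y X D f E F" by (rule pull)
  interpret tE: sheaf_bundle "holomorphic_fun X" UNIV "triv E"
    using par by unfold_locales (simp add: induced_parabolic_def parabolic_bundle_def)
  fix V s c x assume s: "hol_section X (triv E) V s" and c: "c \<in> X" and x: "x \<in> V \<inter> fst c \<inter> D"
  have "log_connection X D (triv E) nabla" using conn by (simp add: parabolic_connection_def)
  from log_connectionD(1)[OF this s] have "\<exists>N. x \<in> N \<and> N \<subseteq> V \<inter> fst c \<and> N \<inter> D = {x} \<and>
      hol_section X (triv E) N (\<lambda>p. if p = x then nabla s c x else (snd c p - snd c x) *s nabla s c p)"
    using c x unfolding log_form_def by simp
  then obtain N where N: "x \<in> N" "N \<subseteq> V \<inter> fst c" "N \<inter> D = {x}"
    "hol_section X (triv E) N (\<lambda>p. if p = x then nabla s c x else (snd c p - snd c x) *s nabla s c p)"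
    by (elim exE conjE) (rule that)
  have "hol_section X (triv E) N (\<lambda>p. if p = x then nabla s c x else (snd c p - snd c x) *s fst (Dn s c p))"
  proof (rule tE.section_cong[OF N(4)])
    fix p assume p: "p \<in> N"
    show "(if p = x then nabla s c x else (snd c p - snd c x) *s nabla s c p) =
      (if p = x then nabla s c x else (snd c p - snd c x) *s fst (Dn s c p))"
    proof (cases "p = x")
      case False
      have oN: "open (N - {x})" using tE.section_open[OF N(4)] by blast
      have sN: "hol_section X (triv E) (N - {x}) s" by (rule tE.section_subset[OF s oN]) (use N(2) in blast)
      have "nabla s c p = fst (Dn s c p)"
        by (rule nabla[OF _ sN c]) (use N(2,3) p False in auto)
      then show ?thesis using False by simp
    qed simp
  qed
  moreover have "nabla s c x \<in> G" if G: "(\<beta>, G) \<in> set (flag E x)" "s x \<in> G" for \<beta> G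
  proof -
    have "\<forall>(\<alpha>, F)\<in>set (flag E x). s x \<in> F \<longrightarrow> nabla s c x \<in> F"
      using conn s c x unfolding parabolic_connection_def by blast
    from bspec[OF this G(1)] G(2) show ?thesis by simp
  qed
  ultimately show "\<exists>v N. x \<in> N \<and> N \<subseteq> V \<inter> fst c \<and> N \<inter> D = {x} \<and>
        hol_section X (triv E) N (\<lambda>p. if p = x then v else (snd c p - snd c x) *s fst (Dn s c p)) \<and>
        (\<forall>\<beta> G. (\<beta>, G) \<in> set (flag E x) \<longrightarrow> s x \<in> G \<longrightarrow> v \<in> G)"
    using N(1,2,3) by (intro exI[of _ "nabla s c x"] exI[of _ N]) blast
qed

lemma pullback_higgs_exists:
  assumes D: "finite D" and frames: "T.local_hol_frames" and ind: "induced_higgs X D H E \<theta>"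
  shows "\<exists>F \<phi>. is_pullback_higgs Y X D f E \<theta> F \<phi>"
proof -
  have "parabolic_bundle X D E" using ind by (simp add: induced_higgs_def induced_parabolic_def)
  from pullback_parabolic_exists[OF D this] obtain F where F: "is_pullback_parabolic Y X D f E F" ..
  interpret L: log_pullback Y X f 0 D VB Dt K E F by (rule log_pullback_higgs[OF D frames ind F])
  \<comment> \<open>By the convention for logarithmic forms, the coefficient at a point of B is the
    residue; elsewhere the pulled back Higgs field is forced.\<close>
  define \<phi> where "\<phi> d q = (if q \<in> f -` D then L.Res q else T.pop.higgs_at d q)" for d q
  have "is_pullback_higgs Y X D f E \<theta> F \<phi>"
    unfolding is_pullback_higgs_def parabolic_higgs_bundle_def
  proof (intro conjI allI impI ballI F L.parF)
    fix V s assume s: "hol_section Y (triv F) V s"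
    have oP: "open (V - f -` D)" using L.tF.section_open[OF s] L.open_compl(2) by (simp add: Diff_eq open_Int)
    have sS: "smooth_section Y PVB (V - f -` D) s" by (rule L.smooth_off_B[OF s oP]) blast
    show "log_form Y (f -` D) (triv F) V (\<lambda>d q. \<phi> d q *v s q)"
    proof (rule L.log_form_extension[OF s])
      fix d q assume d: "d \<in> Y" and q: "q \<in> V \<inter> fst d"
      show "\<phi> d q *v s q = (if q \<in> f -` D then L.Res q *v s q else fst (PDt s d q))"
      proof (cases "q \<in> f -` D")
        case False
        have "fst (PDt s d q) = T.pop.higgs_at d q *v s q"
          by (rule T.pop.higgs_at[OF refl d _ sS]) (use q False in auto)
        then show ?thesis using False by (simp add: \<phi>_def)
      qed (simp add: \<phi>_def)
    qed
  next
    fix d y assume "d \<in> Y" and y: "y \<in> f -` D \<inter> fst d"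
    then have "\<phi> d y = L.Res y" by (simp add: \<phi>_def)
    then show "case z of (\<beta>, G) \<Rightarrow> \<forall>v\<in>G. \<phi> d y *v v \<in> G" if "z \<in> set (flag F y)" for z
      using L.Res_flag[of y] y that by simp
  next
    fix d c q v assume d: "d \<in> Y" and c: "c \<in> X" and q: "q \<in> fst d \<inter> f -` fst c - f -` D"
    have "\<phi> d q *v v = chart_jacobian d c f q *s (T.higgs_at c (f q) *v v)"
      using T.higgs_at_pullback[OF refl d _ c, of q v] q by (simp add: \<phi>_def)
    moreover have "\<theta> c (f q) = T.higgs_at c (f q)"
      using ind c q unfolding induced_higgs_def higgs_matrix_eq by simp
    ultimately show "\<phi> d q *v v = chart_jacobian d c f q *s (\<theta> c (f q) *v v)" by simp
  qed
  then show ?thesis by blast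
qed

lemma pullback_connection_exists:
  assumes D: "finite D" and frames: "N.local_hol_frames" and ind: "induced_connection X D H E nabla"
  shows "\<exists>F nabla'. is_pullback_connection Y X D f E nabla F nabla'"
proof -
  have "parabolic_bundle X D E" using ind by (simp add: induced_connection_def induced_parabolic_def)
  from pullback_parabolic_exists[OF D this] obtain F where F: "is_pullback_parabolic Y X D f E F" ..
  interpret L: log_pullback Y X f 1 D VB Dn K E F by (rule log_pullback_connection[OF D frames ind F])
  \<comment> \<open>Linear over functions at the points of B, in agreement with the convention that
    dg has coefficient 0 there.\<close>
  define nabla' where "nabla' s d q = (if q \<in> f -` D then L.Res q *v s q else fst (PDn s d q))" for s d q
  have oP: "open (V - f -` D)" if "hol_section Y (triv F) V s" for V s
    using L.tF.section_open[OF that] L.open_compl(2) by (simp add: Diff_eq open_Int)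
  have sS: "smooth_section Y PVB (V - f -` D) s" if "hol_section Y (triv F) V s" for V s
    by (rule L.smooth_off_B[OF that oP[OF that]]) blast
  have log: "log_connection Y (f -` D) (triv F) nabla'"
    unfolding log_connection_def
  proof (intro conjI allI impI ballI)
    show "log_form Y (f -` D) (triv F) V (nabla' s)" if "hol_section Y (triv F) V s" for V s
      by (rule L.log_form_extension[OF that]) (simp add: nabla'_def)
  next
    fix V s t d q assume s: "hol_section Y (triv F) V s" and t: "hol_section Y (triv F) V t"
      and eq: "\<forall>p\<in>V. s p = t p" and d: "d \<in> Y" and q: "q \<in> V \<inter> fst d"
    show "nabla' s d q = nabla' t d q"
    proof (cases "q \<in> f -` D")
      case True
      then show ?thesis using eq q by (simp add: nabla'_def)
    next
      case False
      have "PDn s d q = PDn t d q"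
        by (rule N.pop.A_cong[OF sS[OF s] sS[OF t] _ d]) (use eq q False in auto)
      then show ?thesis using False by (simp add: nabla'_def)
    qed
  next
    fix V s t d q assume s: "hol_section Y (triv F) V s" and t: "hol_section Y (triv F) V t"
      and d: "d \<in> Y" and q: "q \<in> V \<inter> fst d"
    show "nabla' (\<lambda>q. s q + t q) d q = nabla' s d q + nabla' t d q"
    proof (cases "q \<in> f -` D")
      case True
      then show ?thesis by (simp add: nabla'_def matrix_vector_right_distrib)
    next
      case False
      have "PDn (\<lambda>q. s q + t q) d q = PDn s d q + PDn t d q"
        by (rule N.pop.A_add[OF sS[OF s] sS[OF t] d]) (use q False in auto)
      then show ?thesis using False by (simp add: nabla'_def)
    qed
  next
    fix V g s d q assume g: "holomorphic_fun Y V g" and s: "hol_section Y (triv F) V s"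
      and d: "d \<in> Y" and q: "q \<in> V \<inter> fst d"
    show "nabla' (\<lambda>q. g q *s s q) d q = g q *s nabla' s d q + (if q \<in> f -` D then 0 else d_z d g q) *s s q"
    proof (cases "q \<in> f -` D")
      case True
      then show ?thesis by (simp add: nabla'_def vector_scalar_commute)
    next
      case False
      have "smooth_fun Y (V - f -` D) g"
        by (rule Y.holomorphic_imp_smooth[OF Y.hol.R_subset[OF g oP[OF s]]]) blast
      from N.pop.A_scale(1)[OF this sS[OF s] d, of q] q False show ?thesis by (simp add: nabla'_def)
    qed
  qed
  have "is_pullback_connection Y X D f E nabla F nabla'"
    unfolding is_pullback_connection_def parabolic_connection_def
  proof (intro conjI allI impI ballI F L.parF log)
    fix V s d y assume "hol_section Y (triv F) V s" "d \<in> Y" and y: "y \<in> V \<inter> fst d \<inter> f -` D"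
    then have "nabla' s d y = L.Res y *v s y" by (simp add: nabla'_def)
    then show "case z of (\<beta>, G) \<Rightarrow> s y \<in> G \<longrightarrow> nabla' s d y \<in> G" if "z \<in> set (flag F y)" for z
      using L.Res_flag[of y] y that by (cases z) auto
  next
    fix V s d c q assume V: "V \<inter> D = {}" and s: "hol_section X (triv E) V s" and d: "d \<in> Y" and c: "c \<in> X"
      and q: "q \<in> fst d \<inter> f -` (V \<inter> fst c)"
    have sX: "smooth_section X VB V s" using L.rel[OF V, of s] s N.dbar_hol_smooth by simp
    have "q \<notin> f -` D" using q V by blast
    then have "nabla' (\<lambda>q. s (f q)) d q = fst (PDn (\<lambda>q. s (f q)) d q)" by (simp add: nabla'_def)
    also have "\<dots> = chart_jacobian d c f q *s fst (Dn s c (f q))"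
      by (rule N.PA_pullback_section(1)[OF sX c _ _ d]) (use q in auto)
    also have "fst (Dn s c (f q)) = nabla s c (f q)"
      using ind V s c q unfolding induced_connection_def by simp
    finally show "nabla' (\<lambda>q. s (f q)) d q = chart_jacobian d c f q *s nabla s c (f q)" .
  qed
  then show ?thesis by blast
qed

end

text \<open>The pullback of a parabolic object is determined only up to an isomorphism that is the
  identity off B, and no representative is preferred. The conclusion therefore pairs the existence
  of a representative with a claim about all of them, so that neither half can hold
  vacuously.\<close>

theorem theorem7p1:
  fixes X :: "('x::t2_space) chart set" and Y :: "('y::t2_space) chart set"
    and D :: "'x set" and f :: "'y \<Rightarrow> 'x"
    and H :: "('x, 'n::finite) harmonic"
    and E E' :: "('x, 'n) parabolic"
    and \<theta> :: "('x, 'n) higgs" and nabla :: "('x, 'n) connection"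
  assumes "compact_connected_riemann_surface X" and "finite D"
    and "compact_connected_riemann_surface Y"
    and "holomorphic_map Y X f" and "\<not> f constant_on UNIV"
    and "tame_harmonic_bundle X D H"
    and "induced_higgs X D H E \<theta>"
    and "induced_connection X D H E' nabla"
  shows "tame_harmonic_bundle Y (f -` D) (pullback_harmonic X f H) \<and>
    (\<exists>F \<phi>. is_pullback_higgs Y X D f E \<theta> F \<phi>) \<and>
    (\<forall>F \<phi>. is_pullback_higgs Y X D f E \<theta> F \<phi> \<longrightarrow>
       induced_higgs Y (f -` D) (pullback_harmonic X f H) F \<phi>) \<and>
    (\<exists>F' nabla'. is_pullback_connection Y X D f E' nabla F' nabla') \<and>
    (\<forall>F' nabla'. is_pullback_connection Y X D f E' nabla F' nabla' \<longrightarrow>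
       induced_connection Y (f -` D) (pullback_harmonic X f H) F' nabla')"
proof -
  interpret branched_harmonic Y X f D H
  proof unfold_locales
    show "riemann_surface Y" "riemann_surface X" "connected (UNIV :: 'y set)"
      using assms(1,3) by (simp_all add: compact_connected_riemann_surface_def)
    show "holomorphic_map Y X f" "\<not> f constant_on UNIV" by (rule assms(4,5))+
    show "harmonic_bundle X (- D) H" using assms(6) by (simp add: tame_harmonic_bundle_def)
  qed
  have oD: "open (- D)" by (rule open_Compl, rule finite_imp_closed, rule assms(2))
  have par: "induced_parabolic X D H Dt E" "induced_parabolic X D H Dn E'"
    using assms(7,8) unfolding induced_higgs_def induced_connection_def by blast+
  \<comment> \<open>Holomorphic frames of the harmonic bundle off D are taken from the parabolic
    Higgs bundle, and likewise for the connection below.\<close>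
  have T: "T.local_hol_frames"
    by (rule T.dbar_hol_triv(1)[of "triv E" D, OF _ refl oD]) (use par(1) in \<open>simp_all add: induced_parabolic_def parabolic_bundle_def\<close>)
  have N: "N.local_hol_frames"
    by (rule N.dbar_hol_triv(1)[of "triv E'" D, OF _ refl oD]) (use par(2) in \<open>simp_all add: induced_parabolic_def parabolic_bundle_def\<close>)
  show ?thesis
    by (intro conjI allI impI tame_pullback[OF assms(6) T N] pullback_higgs_exists[OF assms(2) T assms(7)]
        induced_higgs_pullback[OF assms(2,7)] pullback_connection_exists[OF assms(2) N assms(8)]
        induced_connection_pullback[OF assms(2,8)])
qed

end
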